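(* Let $G_0\in\mathbb{R}$, let $\alpha,\beta\colon[0,\infty)\to\mathbb{R}$ be measurable with $\int_0^t|\alpha_s|\,\mathrm{d}s+\int_0^t\beta_s^2\,\mathrm{d}s<\infty$ for all $t\ge0$ and $\inf_{s\in[0,\infty)}|\beta_s|>0$, and let $G_t=G_0+\int_0^t\alpha_s\,\mathrm{d}s+\int_0^t\beta_s\,\mathrm{d}W_s$, $t\ge 0$. Let $\nu$ be a probability measure on $\mathbb{R}$ and let $g$ and $\delta$ be the functions associated with $(\nu,G_0,\alpha,\beta)$ as defined in the context. Suppose that $g,g',g''$ and $\delta,\delta',\delta''$ are Lipschitz continuous, and that $g$ is increasing (in the weak sense, i.e. non-decreasing) and not constant. Then there exist a bounded $(\mathcal{F}_t)$-stopping time $\tau$ and a constant $c\in\mathbb{R}$ such that $c+G_\tau$ has the law $\nu$.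
   Context: Setting: $(\Omega,\mathcal{F},(\mathcal{F}_t)_{t\in[0,\infty)},\mathbb{P})$ is a filtered probability space carrying a one-dimensional Brownian motion $W$; $(\mathcal{F}_t)$ is generated by $W$ and augmented by the $\mathbb{P}$-null sets. Definition of $g$: let $F(x):=\nu((-\infty,x])$, $F^{-1}(y):=\inf\{x\in\mathbb{R}: F(x)\ge y\}$ for $y\in(0,1)$, let $\Phi$ be the standard normal distribution function, and set $g:=F^{-1}\circ\Phi\colon\mathbb{R}\to\mathbb{R}$. Definition of $\delta$: $H(t):=\int_0^t\beta_s^2\,\mathrm{d}s$ is a strictly increasing bijection of $[0,\infty)$ with inverse $H^{-1}$; put $\hat\delta(t):=G_0+\int_0^t\alpha_s\,\mathrm{d}s$ and $\delta:=\hat\delta\circ H^{-1}\colon[0,\infty)\to\mathbb{R}$. *)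

theory Defs
  imports "HOL-Probability.Probability"
begin

text \<open>
  The process is only considered at times \<open>t \<ge> 0\<close>; the values of \<open>W t\<close> for \<open>t < 0\<close> are irrelevant.
  Paths are continuous almost surely.
\<close>

locale brownian_motion = prob_space M for M :: "'a measure" +
  fixes W :: "real \<Rightarrow> 'a \<Rightarrow> real"
  assumes W_measurable: "\<And>t. 0 \<le> t \<Longrightarrow> W t \<in> borel_measurable M"
    and W_start: "AE \<omega> in M. W 0 \<omega> = 0"
    and W_indep_increments: "\<And>(n::nat) p. 0 \<le> p 0 \<Longrightarrow> (\<And>i. i < n \<Longrightarrow> p i \<le> p (Suc i)) \<Longrightarrow>
          indep_vars (\<lambda>_. borel) (\<lambda>i \<omega>. W (p (Suc i)) \<omega> - W (p i) \<omega>) {..<n}"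
    and W_increments: "\<And>s t. 0 \<le> s \<Longrightarrow> s < t \<Longrightarrow>
          distributed M lborel (\<lambda>\<omega>. W t \<omega> - W s \<omega>) (normal_density 0 (sqrt (t - s)))"
    and W_continuous: "AE \<omega> in M. continuous_on {0..} (\<lambda>t. W t \<omega>)"

text \<open>
  The filtration generated by \<open>W\<close> and augmented by the null sets of \<open>M\<close>. Completeness of \<open>M\<close> is
  not assumed, so that these are the null sets that belong to \<open>M\<close>; if \<open>M\<close> is complete,
  this is the usual augmentation.
\<close>

definition brownian_filtration :: "'a measure \<Rightarrow> (real \<Rightarrow> 'a \<Rightarrow> real) \<Rightarrow> real \<Rightarrow> 'a measure" where
  "brownian_filtration M W t =
     sigma (space M) ({W s -` A \<inter> space M | s A. 0 \<le> s \<and> s \<le> t \<and> A \<in> sets borel} \<union> null_sets M)"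

text \<open>
  The step function with value \<open>c i\<close> on \<open>(p i, p (i + 1)]\<close>, \<open>i < n\<close>, and its stochastic integral.
\<close>

definition step_fun :: "nat \<Rightarrow> (nat \<Rightarrow> real) \<Rightarrow> (nat \<Rightarrow> real) \<Rightarrow> real \<Rightarrow> real" where
  "step_fun n p c s = (\<Sum>i<n. c i * indicator {p i<..p (Suc i)} s)"

definition step_integral ::
    "(real \<Rightarrow> 'a \<Rightarrow> real) \<Rightarrow> nat \<Rightarrow> (nat \<Rightarrow> real) \<Rightarrow> (nat \<Rightarrow> real) \<Rightarrow> 'a \<Rightarrow> real" where
  "step_integral W n p c \<omega> = (\<Sum>i<n. c i * (W (p (Suc i)) \<omega> - W (p i) \<omega>))"

definition partition_upto :: "real \<Rightarrow> nat \<Rightarrow> (nat \<Rightarrow> real) \<Rightarrow> bool" where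
  "partition_upto t n p \<longleftrightarrow> p 0 = 0 \<and> p n = t \<and> (\<forall>i<n. p i \<le> p (Suc i))"

text \<open>
  \<open>I\<close> is a version with almost surely continuous paths of the stochastic integral process
  \<open>\<integral>\<^sub>0\<^sup>t \<beta>\<^sub>s dW\<^sub>s\<close>, \<open>t \<ge> 0\<close>, of a deterministic integrand: for each \<open>t\<close>, \<open>I t\<close> is the limit in \<open>L\<^sup>2(M)\<close> of
  the integrals of step functions which approximate \<open>\<beta>\<close> in \<open>L\<^sup>2([0, t])\<close>.
\<close>

definition stochastic_integral ::
    "'a measure \<Rightarrow> (real \<Rightarrow> 'a \<Rightarrow> real) \<Rightarrow> (real \<Rightarrow> real) \<Rightarrow> (real \<Rightarrow> 'a \<Rightarrow> real) \<Rightarrow> bool" where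
  "stochastic_integral M W \<beta> I \<longleftrightarrow>
     (\<forall>t\<ge>0. I t \<in> borel_measurable M \<and>
       (\<exists>n p c. (\<forall>k::nat. partition_upto t (n k) (p k)) \<and>
         (\<lambda>k. \<integral>\<^sup>+ s \<in> {0..t}. ennreal ((step_fun (n k) (p k) (c k) s - \<beta> s)\<^sup>2) \<partial>lborel)
           \<longlonglongrightarrow> 0 \<and>
         (\<lambda>k. \<integral>\<^sup>+ \<omega>. ennreal ((step_integral W (n k) (p k) (c k) \<omega> - I t \<omega>)\<^sup>2) \<partial>M)
           \<longlonglongrightarrow> 0)) \<and>
     (AE \<omega> in M. continuous_on {0..} (\<lambda>t. I t \<omega>))"

definition quantile :: "real measure \<Rightarrow> real \<Rightarrow> real" where
  "quantile \<nu> y = Inf {x. y \<le> cdf \<nu> x}"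

definition g_fun :: "real measure \<Rightarrow> real \<Rightarrow> real" where
  "g_fun \<nu> = quantile \<nu> \<circ> cdf std_normal_distribution"

definition H_fun :: "(real \<Rightarrow> real) \<Rightarrow> real \<Rightarrow> real" where
  "H_fun \<beta> t = (LBINT s:{0..t}. (\<beta> s)\<^sup>2)"

definition delta_hat :: "real \<Rightarrow> (real \<Rightarrow> real) \<Rightarrow> real \<Rightarrow> real" where
  "delta_hat G0 \<alpha> t = G0 + (LBINT s:{0..t}. \<alpha> s)"

definition delta_fun :: "real \<Rightarrow> (real \<Rightarrow> real) \<Rightarrow> (real \<Rightarrow> real) \<Rightarrow> real \<Rightarrow> real" where
  "delta_fun G0 \<alpha> \<beta> = delta_hat G0 \<alpha> \<circ> inv_into {0..} (H_fun \<beta>)"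

text \<open>
  \<open>f\<close>, \<open>f'\<close> and \<open>f''\<close> exist on \<open>S\<close> and are Lipschitz continuous there. Derivatives are taken within \<open>S\<close>,
  hence they are one-sided at \<open>0\<close> if \<open>S\<close> is \<open>[0, \<infinity>)\<close>.
\<close>

definition lipschitz_upto_second_deriv :: "real set \<Rightarrow> (real \<Rightarrow> real) \<Rightarrow> bool" where
  "lipschitz_upto_second_deriv S f \<longleftrightarrow>
     (\<exists>f' f''.
       (\<forall>x\<in>S. (f has_real_derivative f' x) (at x within S)) \<and>
       (\<forall>x\<in>S. (f' has_real_derivative f'' x) (at x within S)) \<and>
       (\<exists>L. L-lipschitz_on S f) \<and> (\<exists>L. L-lipschitz_on S f') \<and> (\<exists>L. L-lipschitz_on S f''))"

text \<open>
  If a process \<open>G\<close> has continuous paths only almost surely and \<open>M\<close> is not complete, then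
  \<open>G\<^sub>\<tau>\<close> need only be measurable for the completion of \<open>M\<close>; the law is therefore taken
  there. For complete \<open>M\<close> nothing changes. If \<open>X\<close> is not measurable, the left-hand side is the null
  measure, so for a probability measure \<open>\<nu>\<close> measurability of \<open>X\<close> is implied.
\<close>

definition has_law :: "'a measure \<Rightarrow> ('a \<Rightarrow> real) \<Rightarrow> real measure \<Rightarrow> bool" where
  "has_law M X \<nu> \<longleftrightarrow> distr (completion M) borel X = \<nu>"

end

theory Submission
  imports Defs
begin

text \<open>
  The inverse \<open>T\<close> of the quadratic variation \<open>H\<close> turns the stochastic integral into a Brownian motion \<open>B\<close> in its own
  filtration and the drift into \<open>\<delta>\<close>, so that \<open>g(N)\<close>, \<open>N\<close> normal, has to be embedded into \<open>c + \<delta>(s) + B s\<close>. The associated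
  forward-backward equation is replaced by a discrete scheme: its decoupling field stays Lipschitz and
  increasing, and run along \<open>B\<close> it gives bounded times at which the law is attained approximately. No
  convergence of these times is proved. Instead, convex combinations of the indicators of \<open>\<sigma> \<le> q\<close> converge, and
  their limits describe a bounded randomised stopping time that attains the law exactly; the limit law is
  identified by its trigonometric moments. The times of the scheme are bounded away from \<open>0\<close> while the path
  stays small, so the information up to a small time \<open>a\<close> is available for the randomisation: \<open>2 B(a/2) - B(a)\<close> is
  independent of the future after \<open>a\<close>, and its conditional quantile transform realises the limit probabilities.
\<close>

text \<open>In continuous time the scheme is the system \<open>dY = Z\<^sup>2 ds\<close>,
  \<open>u(s, X, Y) = u(0, 0, 0) + \<integral> Z dX\<close>, \<open>Z = u\<^sub>x\<close>, with a
  Brownian motion \<open>X\<close>. The stochastic integral is a Brownian motion run on the clock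
  \<open>Y\<close>, so the terminal condition at \<open>s = 1\<close> reads
  \<open>g(X) = c + \<delta>(Y) + B(Y)\<close>. Differentiating the equation for \<open>u\<close>
  yields linear equations for \<open>u\<^sub>x\<close> and \<open>u\<^sub>y\<close> whose drift in
  \<open>x\<close> is \<open>2 u\<^sub>x u\<^sub>y\<close>; the maximum principle for them is the
  source of all bounds, and \<open>|Z| <= L\<close> keeps the clock below \<open>L\<^sup>2\<close>.
  The obstacle is the passage to the limit: a limit of stopping probabilities is a randomised time,
  whereas the filtration of \<open>W\<close> offers no independent coin. The coin has to be taken
  from a piece of the path that no stopping decision has used yet. Such a piece exists because
  \<open>g' > 0\<close> somewhere: diffusion spreads this slope, so that the field increases
  uniformly in \<open>x\<close> near the origin during the first half of the horizon,
  \<open>Z\<close> is bounded below there, and the clock must run.\<close>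

abbreviation \<N> :: "real measure" where "\<N> \<equiv> std_normal_distribution"

section \<open>Gaussian integrals\<close>

interpretation gauss: prob_space \<N>
 by (rule prob_space_normal_density) simp

lemma integral_gauss_density:
 fixes f :: "real => real"
 assumes [measurable]: "f \<in> borel_measurable borel"
 shows "integral\<^sup>L \<N> f = (LINT x|lborel. std_normal_density x * f x)"
 by (subst integral_density) auto

lemma integrable_gauss_density:
 fixes f :: "real => real"
 assumes [measurable]: "f \<in> borel_measurable borel"
 shows "integrable \<N> f \<longleftrightarrow> integrable lborel (%x. std_normal_density x * f x)"
 by (subst integrable_density) auto

lemma integrable_gauss_power [simp]: "integrable \<N> (%x. x^k)"
 by (subst integrable_gauss_density) (auto intro: integrable_std_normal_moment)

lemma integrable_gauss_abs_power [simp]: "integrable \<N> (%x. \<bar>x\<bar>^k)"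
 by (subst integrable_gauss_density) (auto intro: integrable_std_normal_moment_abs)

lemma integrable_gauss_id [simp]: "integrable \<N> (%x. x)"
 using integrable_gauss_power[of 1] by simp

lemma integrable_gauss_abs [simp]: "integrable \<N> (%x. \<bar>x\<bar>)"
 using integrable_gauss_abs_power[of 1] by simp

lemma gauss_mean [simp]: "(LINT x|\<N>. x) = 0"
 using integral_std_normal_moment_odd[of 0] by (subst integral_gauss_density) auto

lemma gauss_second_moment [simp]: "(LINT x|\<N>. x^2) = 1"
 using integral_std_normal_moment_even[of 1] by (subst integral_gauss_density) (auto simp: fact_numeral)

lemma gauss_fourth_moment: "(LINT x|\<N>. x^4) = 3"
 using integral_std_normal_moment_even[of 2] by (subst integral_gauss_density) (auto simp: fact_numeral)

lemma gauss_abs_moment_le: "(LINT x|\<N>. \<bar>x\<bar>) <= 1"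
proof -
 have "(LINT x|\<N>. \<bar>x\<bar>) <= (LINT x|\<N>. (1 + x^2)/2)"
 proof (intro integral_mono)
  fix x :: real
  have "0 <= (1 - \<bar>x\<bar>)\<^sup>2" by simp
  thus "\<bar>x\<bar> <= (1 + x^2)/2" by (simp add: power2_diff)
 qed auto
 also have "... = 1" using gauss.prob_space by simp
 finally show ?thesis .
qed

text \<open>Cameron-Martin in dimension one: the exponential factor is the density of the translate
  of \<open>\<N>\<close> by \<open>a\<close>. It moves a translation from a merely Lipschitz
  function to a factor that is smooth in \<open>a\<close>.\<close>

lemma gauss_exp_shift_integrable:
 fixes f :: "real => real"
 assumes [measurable]: "f \<in> borel_measurable borel"
 assumes "integrable \<N> (%x. f (x + a))"
 shows "integrable \<N> (%x. f x * exp (a * x - a\<^sup>2/2))"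
  and "(LINT x|\<N>. f x * exp (a * x - a\<^sup>2/2)) = (LINT x|\<N>. f (x + a))"
proof -
 have dens: "std_normal_density (x - a) = std_normal_density x * exp (a * x - a\<^sup>2/2)" for x
  unfolding std_normal_density_def by (simp add: exp_add[symmetric] power2_diff field_simps)
 have "integrable lborel (%x. std_normal_density x * f (x + a))"
  using assms(2) by (subst (asm) integrable_gauss_density) auto
 hence "integrable lborel (%x. std_normal_density (-a + 1 * x) * f ((-a + 1 * x) + a))"
  by (intro lborel_integrable_real_affine[where f="%x. std_normal_density x * f (x + a)"]) auto
 thus "integrable \<N> (%x. f x * exp (a * x - a\<^sup>2/2))"
  by (subst integrable_gauss_density) (auto simp: dens mult_ac)
 have "(LINT x|\<N>. f (x + a)) = (LINT x|lborel. std_normal_density x * f (x + a))"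
  by (subst integral_gauss_density) auto
 also have "... = (LINT x|lborel. std_normal_density (-a + 1 * x) * f ((-a + 1 * x) + a))"
  by (subst lborel_integral_real_affine[where c=1 and t="-a"]) auto
 also have "... = (LINT x|\<N>. f x * exp (a * x - a\<^sup>2/2))"
  by (subst integral_gauss_density) (auto simp: dens mult_ac)
 finally show "(LINT x|\<N>. f x * exp (a * x - a\<^sup>2/2)) = (LINT x|\<N>. f (x + a))"
  by simp
qed

lemma gauss_uminus: "distr \<N> borel uminus = \<N>"
proof -
 have "distr \<N> borel (%x. 0 + -1 * x) = density lborel (normal_density 0 1)"
  using gauss.normal_density_affine[of "%x. x" 0 1 "-1" 0]
  by (auto simp: distributed_def distr_id2 cong: distr_cong)
 thus ?thesis by (simp cong: distr_cong)
qed

lemma gauss_integral_uminus: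
 fixes f :: "real => real"
 assumes [measurable]: "f \<in> borel_measurable borel"
 shows "(LINT x|\<N>. f (- x)) = integral\<^sup>L \<N> f"
proof -
 have "integral\<^sup>L (distr \<N> borel uminus) f = (LINT x|\<N>. f (- x))"
  by (subst integral_distr) auto
 thus ?thesis by (simp add: gauss_uminus)
qed


text \<open>Two shears make up the rotation: first \<open>x\<close> is substituted for fixed
  \<open>y\<close>, which needs \<open>0 < a\<close>, then \<open>y\<close> for fixed new first
  coordinate. The Jacobians \<open>1 / a\<close> and \<open>a\<close> cancel, and the product
  density depends on the radius only.\<close>

lemma gauss_rotation:
 fixes F :: "real \<times> real => ennreal"
 assumes a: "0 < a" and ab: "a\<^sup>2 + b^2 = 1"
 assumes [measurable]: "F \<in> borel_measurable borel"
 shows "(nn_integral \<N> (%x. \<integral>\<^sup>+y. F (a * x + b * y, a * y - b * x) \<partial>\<N>))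
  = (nn_integral \<N> (%x. \<integral>\<^sup>+y. F (x, y) \<partial>\<N>))" (is "?L = ?R")
proof -
 note [measurable] = borel_prod[symmetric]
 have [measurable]: "F \<in> borel_measurable (borel \<Otimes>\<^sub>M borel)" by (simp add: borel_prod)
 let ?n = "%x. ennreal (std_normal_density x)"
 have dens: "?n (a * u - b * v) * ?n (b * u + a * v) = ?n u * ?n v" for u v
 proof -
  have "(a * u - b * v)\<^sup>2 + (b * u + a * v)^2 = (a^2 + b^2) * u^2 + (a^2 + b^2) * v\<^sup>2"
   by (simp add: power2_eq_square algebra_simps)
  hence "(a * u - b * v)\<^sup>2 + (b * u + a * v)^2 = u^2 + v\<^sup>2" by (simp add: ab)
  hence "exp (- (a * u - b * v)\<^sup>2/2) * exp (- (b * u + a * v)\<^sup>2/2) = exp (- u\<^sup>2/2) * exp (- v\<^sup>2/2)"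
   unfolding exp_add[symmetric] by (intro arg_cong[where f=exp]) (simp add: field_simps)
  thus ?thesis
   unfolding std_normal_density_def by (simp add: ennreal_mult'[symmetric])
 qed
 have "?L = (nn_integral lborel (%x. \<integral>\<^sup>+y. ?n x * ?n y * F (a * x + b * y, a * y - b * x) \<partial>lborel))"
  by (simp add: nn_integral_density nn_integral_cmult[symmetric] mult_ac)
 also have "... = (nn_integral lborel (%y. \<integral>\<^sup>+x. ?n x * ?n y * F (a * x + b * y, a * y - b * x) \<partial>lborel))"
  by (rule lborel_pair.Fubini') measurable
 also have "... = (nn_integral lborel (%y. \<integral>\<^sup>+u. ennreal (1/a) * (?n (-b*y/a + 1/a * u) * ?n y *
    F (a * (-b*y/a + 1/a * u) + b * y, a * y - b * (-b*y/a + 1/a * u))) \<partial>lborel))"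
 proof (rule nn_integral_cong)
  fix y :: real
  show "(nn_integral lborel (%x. ?n x * ?n y * F (a * x + b * y, a * y - b * x)))
   = (nn_integral lborel (%u. ennreal (1/a) * (?n (-b*y/a + 1/a * u) * ?n y *
    F (a * (-b*y/a + 1/a * u) + b * y, a * y - b * (-b*y/a + 1/a * u)))))"
   using a by (subst nn_integral_real_affine[where c="1/a" and t="-b*y/a"]) (simp_all add: nn_integral_cmult)
 qed
 also have "... = (nn_integral lborel (%u. \<integral>\<^sup>+y. ennreal (1/a) * (?n (-b*y/a + 1/a * u) * ?n y *
    F (a * (-b*y/a + 1/a * u) + b * y, a * y - b * (-b*y/a + 1/a * u))) \<partial>lborel))"
  by (rule lborel_pair.Fubini'[symmetric]) measurable
 also have "... = (nn_integral lborel (%u. \<integral>\<^sup>+v. ?n u * ?n v * F (u, v) \<partial>lborel))"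
 proof (rule nn_integral_cong)
  fix u :: real
  have 1: "- b * (b * u + a * v)/a + 1/a * u = a * u - b * v" for v
  proof -
   have "- b * (b * u + a * v) + u = (1 - b\<^sup>2) * u - a * b * v" by (simp add: power2_eq_square algebra_simps)
   also have "1 - b\<^sup>2 = a\<^sup>2" using ab by simp
   finally show ?thesis using a by (simp add: field_simps power2_eq_square)
  qed
  have 2: "a * (a * u - b * v) + b * (b * u + a * v) = u" for v
  proof -
   have "a * (a * u - b * v) + b * (b * u + a * v) = (a^2 + b^2) * u" by (simp add: power2_eq_square algebra_simps)
   thus ?thesis by (simp add: ab)
  qed
  have 3: "a * (b * u + a * v) - b * (a * u - b * v) = v" for v
  proof -
   have "a * (b * u + a * v) - b * (a * u - b * v) = (a^2 + b^2) * v" by (simp add: power2_eq_square algebra_simps)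
   thus ?thesis by (simp add: ab)
  qed
  have 4: "ennreal a * (ennreal (1/a) * X) = X" for X
   using a by (simp add: mult.assoc[symmetric] ennreal_mult'[symmetric])
  show "(nn_integral lborel (%y. ennreal (1/a) * (?n (-b*y/a + 1/a * u) * ?n y *
    F (a * (-b*y/a + 1/a * u) + b * y, a * y - b * (-b*y/a + 1/a * u)))))
   = (nn_integral lborel (%v. ?n u * ?n v * F (u, v)))"
  proof -
   let ?G = "%y. ennreal (1/a) * (?n (-b*y/a + 1/a * u) * ?n y *
    F (a * (-b*y/a + 1/a * u) + b * y, a * y - b * (-b*y/a + 1/a * u)))"
   have "ennreal a * ?G (b * u + a * v) = ?n u * ?n v * F (u, v)" for v
    by (simp only: 1 2 3 4 dens)
   moreover have "integral\<^sup>N lborel ?G = ennreal a * (nn_integral lborel (%v. ?G (b * u + a * v)))"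
    using a by (subst nn_integral_real_affine[where c=a and t="b*u"]) auto
   moreover have "... = (nn_integral lborel (%v. ennreal a * ?G (b * u + a * v)))"
    by (rule nn_integral_cmult[symmetric]) measurable
   ultimately show ?thesis by simp
  qed
 qed
 also have "... = ?R"
  by (simp add: nn_integral_density nn_integral_cmult[symmetric] mult_ac)
 finally show ?thesis .
qed

lemma gauss_convolution:
 fixes f :: "real => ennreal"
 assumes [measurable]: "f \<in> borel_measurable borel" and st: "0 <= s" "0 <= t"
 shows "(nn_integral \<N> (%x. \<integral>\<^sup>+y. f (s * x + t * y) \<partial>\<N>))
  = (nn_integral \<N> (%x. f (sqrt (s^2 + t^2) * x)))"
proof (cases "s = 0")
 case True
 thus ?thesis using st gauss.emeasure_space_1 by simp
next
 case False
 note [measurable] = borel_prod[symmetric]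
 define r where "r = sqrt (s^2 + t^2)"
 have r: "0 < r" "r\<^sup>2 = s^2 + t\<^sup>2" using False st by (auto simp: r_def add_pos_nonneg)
 have eq: "r * (s/r * x + t/r * y) = s * x + t * y" for x y
  using r(1) by (simp add: field_simps)
 have "(s/r)\<^sup>2 + (t/r)^2 = (s^2 + t^2)/r\<^sup>2" by (simp add: power_divide add_divide_distrib)
 hence 1: "(s/r)\<^sup>2 + (t/r)^2 = 1" using r by (metis divide_self less_irrefl zero_less_power)
 have [measurable]: "(%w::real\<times>real. f (r * fst w)) \<in> borel_measurable borel"
  by (simp add: borel_prod[symmetric])
 show ?thesis
  using gauss_rotation[of "s/r" "t/r" "%w. f (r * fst w)"] False st r 1 gauss.emeasure_space_1
  by (simp add: eq r_def[symmetric] del: times_divide_eq_left)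
qed

lemma distr_gauss_convolution:
 assumes "0 <= s" "0 <= t"
 shows "distr (\<N> \<Otimes>\<^sub>M \<N>) borel (%(x, y). s * x + t * y)
  = distr \<N> borel (%x. sqrt (s^2 + t^2) * x)"
proof (rule measure_eqI)
 fix A :: "real set" assume "A \<in> sets (distr (\<N> \<Otimes>\<^sub>M \<N>) borel (%(x, y). s * x + t * y))"
 hence [measurable]: "A \<in> sets borel" by simp
 have [measurable_cong]: "sets \<N> = sets borel" by simp
 have "emeasure (distr (\<N> \<Otimes>\<^sub>M \<N>) borel (%(x, y). s * x + t * y)) A
  = (\<integral>\<^sup>+w. indicator A (case w of (x, y) => s * x + t * y) \<partial>(\<N> \<Otimes>\<^sub>M \<N>))"
  by (subst nn_integral_distr[where M'=borel and f="indicator A", symmetric]) (auto simp del: sets_density)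
 also have "... = (nn_integral \<N> (%x. \<integral>\<^sup>+y. indicator A (s * x + t * y) \<partial>\<N>))"
  by (subst gauss.nn_integral_fst[symmetric]) auto
 also have "... = (nn_integral \<N> (%x. indicator A (sqrt (s^2 + t^2) * x)))"
  using assms by (subst gauss_convolution) auto
 also have "... = emeasure (distr \<N> borel (%x. sqrt (s^2 + t^2) * x)) A"
  by (subst nn_integral_distr[where M'=borel and f="indicator A", symmetric]) auto
 finally show "emeasure (distr (\<N> \<Otimes>\<^sub>M \<N>) borel (%(x, y). s * x + t * y)) A
  = emeasure (distr \<N> borel (%x. sqrt (s^2 + t^2) * x)) A" .
qed simp

lemma lipschitz_measurable:
 fixes f :: "real => real"
 assumes f: "!!x y. \<bar>f x - f y\<bar> <= C * \<bar>x - y\<bar>"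
 shows "f \<in> borel_measurable borel"
proof -
 have "0 <= C" using f[of 1 0] by simp
 hence "C-lipschitz_on UNIV f"
  using f by (intro lipschitz_onI) (auto simp: dist_real_def)
 thus ?thesis by (intro borel_measurable_continuous_onI lipschitz_on_continuous_on)
qed

lemma gauss_integrable_lipschitz:
 fixes f :: "real => real"
 assumes f: "!!x y. \<bar>f x - f y\<bar> <= C * \<bar>x - y\<bar>"
 shows "integrable \<N> f"
proof -
 note [measurable] = lipschitz_measurable[OF f]
 show ?thesis
 proof (rule Bochner_Integration.integrable_bound)
  show "integrable \<N> (%x. \<bar>f 0\<bar> + C * \<bar>x\<bar>)" by simp
  show "AE x in \<N>. norm (f x) <= norm (\<bar>f 0\<bar> + C * \<bar>x\<bar>)"
  proof (intro always_eventually allI)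
   fix x show "norm (f x) <= norm (\<bar>f 0\<bar> + C * \<bar>x\<bar>)"
    using f[of x 0] by simp
  qed
 qed simp
qed

lemma gauss_convolution_integral:
 fixes f :: "real => real"
 assumes [measurable]: "f \<in> borel_measurable borel"
  and f: "integrable \<N> (%x. f (sqrt (s^2 + t^2) * x))" and st: "0 <= s" "0 <= t"
 shows "(LINT x|\<N>. \<integral>y. f (s * x + t * y) \<partial>\<N>)
  = (LINT x|\<N>. f (sqrt (s^2 + t^2) * x))"
proof -
 interpret P: pair_prob_space \<N> \<N> ..
 have [measurable_cong]: "sets \<N> = sets borel" by simp
 from f have "integrable (distr \<N> borel (%x. sqrt (s^2 + t^2) * x)) f"
  by (subst integrable_distr_eq) auto
 hence "integrable (distr (\<N> \<Otimes>\<^sub>M \<N>) borel (%(x, y). s * x + t * y)) f"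
  using st by (simp add: distr_gauss_convolution)
 hence int: "integrable (\<N> \<Otimes>\<^sub>M \<N>) (%(x, y). f (s * x + t * y))"
  by (subst (asm) integrable_distr_eq) (auto simp: split_beta')
 have "(LINT x|\<N>. \<integral>y. f (s * x + t * y) \<partial>\<N>)
  = (\<integral>w. f (case w of (x, y) => s * x + t * y) \<partial>(\<N> \<Otimes>\<^sub>M \<N>))"
  using P.integral_fst[OF int] by (simp add: split_beta')
 also have "... = integral\<^sup>L (distr (\<N> \<Otimes>\<^sub>M \<N>) borel (%(x, y). s * x + t * y)) f"
  by (subst integral_distr) auto
 also have "... = integral\<^sup>L (distr \<N> borel (%x. sqrt (s^2 + t^2) * x)) f"
  using st by (simp add: distr_gauss_convolution)
 also have "... = (LINT x|\<N>. f (sqrt (s^2 + t^2) * x))"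
  by (subst integral_distr) auto
 finally show ?thesis .
qed

section \<open>One step of the discrete scheme\<close>

definition clip :: "real => real => real" where "clip c x = max (- c) (min c x)"

lemma clip_measurable [measurable]: "clip c \<in> borel_measurable borel"
 unfolding clip_def by measurable

lemma abs_clip_le: "0 <= c ==> \<bar>clip c x\<bar> <= c" "0 <= c ==> \<bar>clip c x\<bar> <= \<bar>x\<bar>"
 by (auto simp: clip_def)

lemma clip_uminus: "0 <= c ==> clip c (- x) = - clip c x"
 by (auto simp: clip_def max_def min_def)

lemma gauss_integrable_quadratic:
 fixes F :: "real => real"
 assumes "F \<in> borel_measurable borel" "!!x. \<bar>F x\<bar> <= a + b * \<bar>x\<bar> + c * x\<^sup>2"
 shows "integrable \<N> F"
proof (rule Bochner_Integration.integrable_bound)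
 show "integrable \<N> (%x. a + b * \<bar>x\<bar> + c * x^2)" by simp
 show "AE x in \<N>. norm (F x) <= norm (a + b * \<bar>x\<bar> + c * x^2)"
  using order_trans[OF assms(2) abs_ge_self] by (auto intro!: always_eventually)
qed (use assms in simp)

lemma integrable_gauss_clip [simp]: "0 <= c ==> integrable \<N> (clip c)"
 using abs_clip_le[of c] by (intro gauss_integrable_quadratic[where a=c and b=0 and c=0]) auto

lemma gauss_clip_mean: "0 <= c ==> gauss.expectation (clip c) = 0"
 using gauss_integral_uminus[of "clip c"] by (simp add: clip_uminus)

lemma gauss_abs_clip_le:
 assumes "0 <= c"
 shows "gauss.expectation (%x. \<bar>clip c x\<bar>) <= 1"
proof -
 have "gauss.expectation (%x. \<bar>clip c x\<bar>) <= gauss.expectation (%x. \<bar>x\<bar>)"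
  using abs_clip_le assms by (intro integral_mono) auto
 thus ?thesis using gauss_abs_moment_le by linarith
qed

lemma gauss_clip_sq_le:
 assumes "0 <= c"
 shows "gauss.expectation (%x. (clip c x)^2) <= 1"
proof -
 have "gauss.expectation (%x. (clip c x)^2) <= gauss.expectation (%x. x^2)"
 proof (intro integral_mono)
  show "integrable \<N> (%x. (clip c x)^2)"
   using abs_clip_le[OF assms] assms
   by (intro gauss_integrable_quadratic[where a=0 and b=0 and c=1]) (auto simp: abs_le_square_iff)
  show "(clip c x)\<^sup>2 <= x\<^sup>2" for x using abs_clip_le(2)[OF assms] by (simp add: abs_le_square_iff)
 qed simp
 thus ?thesis by simp
qed

lemma gauss_abs_integral_le:
 fixes F :: "real => real"
 assumes "integrable \<N> F" "integrable \<N> G" "!!x. \<bar>F x\<bar> <= G x"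
 shows "\<bar>gauss.expectation F\<bar> <= gauss.expectation G"
proof -
 have "\<bar>gauss.expectation F\<bar> <= gauss.expectation (%x. \<bar>F x\<bar>)" by (rule integral_abs_bound)
 also have "... <= gauss.expectation G" using assms by (intro integral_mono) auto
 finally show ?thesis .
qed

lemma gauss_clip_weighted_le:
 fixes F :: "real => real"
 assumes c: "0 <= c" and F: "F \<in> borel_measurable borel" "!!x. \<bar>F x\<bar> <= K" 
 shows "\<bar>gauss.expectation (%x. clip c x * F x)\<bar> <= K"
proof -
 have K: "0 <= K" using F(2)[of 0] by simp
 have "\<bar>gauss.expectation (%x. clip c x * F x)\<bar> <= gauss.expectation (%x. K * \<bar>clip c x\<bar>)"
 proof (rule gauss_abs_integral_le)
  show *: "\<bar>clip c x * F x\<bar> <= K * \<bar>clip c x\<bar>" for x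
   using mult_right_mono[OF F(2), of "\<bar>clip c x\<bar>" x] by (simp add: abs_mult mult_ac)
  show "integrable \<N> (%x. clip c x * F x)"
  proof (rule gauss_integrable_quadratic[where a="K * c" and b=0 and c=0])
   show "\<bar>clip c x * F x\<bar> <= K * c + 0 * \<bar>x\<bar> + 0 * x\<^sup>2" for x
    using *[of x] mult_left_mono[OF abs_clip_le(1)[OF c] K, of x] by linarith
  qed (use F in measurable)
 qed (use c in simp)
 also have "... <= K * 1" using gauss_abs_clip_le[OF c] K by (simp add: mult_left_le)
 finally show ?thesis by simp
qed

text \<open>\<open>f\<close> is the field one step later. Its Lipschitz constants must come back
  unchanged, since the step is iterated over the whole horizon. The condition \<open>small\<close>
  makes every weight \<open>1 + \<theta> * clip c u\<close> met below at least
  \<open>1/2\<close>.\<close>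

locale gauss_step =
 fixes h c L \<Lambda> :: real and f :: "real => real => real"
 assumes h: "0 < h" and c: "1 <= c" and L: "0 < L" and \<Lambda>: "0 < \<Lambda>"
  and small: "8 * L * \<Lambda> * sqrt h * c <= 1"
  and lipx: "!!x x' y. \<bar>f x y - f x' y\<bar> <= L * \<bar>x - x'\<bar>"
  and lipy: "!!x y y'. \<bar>f x y - f x y'\<bar> <= \<Lambda> * \<bar>y - y'\<bar>"
begin

lemma c0: "0 <= c" using c by simp

lemma small1: "8 * L * \<Lambda> * sqrt h <= 1"
proof -
 have "8 * L * \<Lambda> * sqrt h * 1 <= 8 * L * \<Lambda> * sqrt h * c"
  using c h L \<Lambda> by (intro mult_left_mono) auto
 thus ?thesis using small by simp
qed

lemma sqh: "sqrt h * (sqrt h * x) = h * x"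
 using h by (simp add: mult.assoc[symmetric])

lemma f_measurable [measurable]: "(%u. f (x + s * u) y) \<in> borel_measurable borel"
proof (rule lipschitz_measurable[where C="L * \<bar>s\<bar>"])
 show "\<bar>f (x + s * u) y - f (x + s * \<eta>) y\<bar> <= L * \<bar>s\<bar> * \<bar>u - \<eta>\<bar>" for u \<eta>
  using lipx[of "x + s * u" y "x + s * \<eta>"] by (simp add: right_diff_distrib[symmetric] abs_mult mult.assoc)
qed

lemma f_integrable [simp]: "integrable \<N> (%u. f (x + s * u) y)"
proof (rule gauss_integrable_lipschitz[where C="L * \<bar>s\<bar>"])
 show "\<bar>f (x + s * u) y - f (x + s * \<eta>) y\<bar> <= L * \<bar>s\<bar> * \<bar>u - \<eta>\<bar>" for u \<eta>
  using lipx[of "x + s * u" y "x + s * \<eta>"] by (simp add: right_diff_distrib[symmetric] abs_mult mult.assoc)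
qed

lemma clip_f_integrable [simp]: "integrable \<N> (%u. clip c u * f (x + s * u) y)"
proof (rule Bochner_Integration.integrable_bound)
 show "integrable \<N> (%u. c * f (x + s * u) y)" by simp
 show "AE u in \<N>. norm (clip c u * f (x + s * u) y) <= norm (c * f (x + s * u) y)"
  using abs_clip_le(1)[OF c0] c0 by (auto simp: abs_mult intro!: mult_right_mono always_eventually)
qed simp

text \<open>Correlation of the later field with the truncated noise. Divided by
  \<open>sqrt h\<close> it is a difference quotient that stands for the derivative in
  \<open>x\<close>.\<close>

definition D :: "real => real => real" where
 "D x y = gauss.expectation (%u. clip c u * f (x + sqrt h * u) y)"

lemma D_lipschitz: "\<bar>D x y - D x' y'\<bar> <= L * \<bar>x - x'\<bar> + \<Lambda> * \<bar>y - y'\<bar>"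
proof -
 have "D x y - D x' y' = gauss.expectation (%u. clip c u * (f (x + sqrt h * u) y - f (x' + sqrt h * u) y'))"
  unfolding D_def by (simp add: right_diff_distrib)
 also have "\<bar>...\<bar> <= L * \<bar>x - x'\<bar> + \<Lambda> * \<bar>y - y'\<bar>"
 proof (rule gauss_clip_weighted_le[OF c0])
  fix u
  show "\<bar>f (x + sqrt h * u) y - f (x' + sqrt h * u) y'\<bar> <= L * \<bar>x - x'\<bar> + \<Lambda> * \<bar>y - y'\<bar>"
   using lipx[of "x + sqrt h * u" y "x' + sqrt h * u"] lipy[of "x' + sqrt h * u" y y'] by simp
 qed measurable
 finally show ?thesis .
qed

lemma D_bound: "\<bar>D x y\<bar> <= sqrt h * L"
proof -
 have "D x y = gauss.expectation (%u. clip c u * (f (x + sqrt h * u) y - f x y))"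
  unfolding D_def using gauss_clip_mean[OF c0] c0 by (simp add: right_diff_distrib)
 also have "\<bar>...\<bar> <= gauss.expectation (%u. L * sqrt h * u^2)"
 proof (rule gauss_abs_integral_le)
  show "\<bar>clip c u * (f (x + sqrt h * u) y - f x y)\<bar> <= L * sqrt h * u\<^sup>2" for u
  proof -
   have "\<bar>clip c u\<bar> * \<bar>f (x + sqrt h * u) y - f x y\<bar> <= \<bar>u\<bar> * (L * (sqrt h * \<bar>u\<bar>))"
    using lipx[of "x + sqrt h * u" y x] h abs_clip_le(2)[OF c0, of u]
    by (intro mult_mono) (auto simp: abs_mult)
   thus ?thesis by (simp add: abs_mult power2_eq_square mult_ac)
  qed
  show "integrable \<N> (%u. clip c u * (f (x + sqrt h * u) y - f x y))"
   using c0 by (simp add: right_diff_distrib)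
 qed simp
 also have "... = sqrt h * L" by simp
 finally show ?thesis .
qed

text \<open>The discrete control is determined implicitly, with the time argument already advanced by \<open>h z\<^sup>2\<close>.\<close>

definition z :: "real => real => real" where
 "z x y = (SOME z. \<bar>z\<bar> <= L & sqrt h * z = D x (y + h * z^2))"

definition step :: "real => real => real" where
 "step x y = gauss.expectation (%u. f (x + sqrt h * u) (y + h * (z x y)^2))"

lemma z_ex: "\<exists>z. \<bar>z\<bar> <= L & sqrt h * z = D x (y + h * z^2)"
proof -
 let ?\<phi> = "%z. sqrt h * z - D x (y + h * z^2)"
 have "\<Lambda>-lipschitz_on UNIV (D x)"
  using D_lipschitz[of x _ x] \<Lambda> by (intro lipschitz_onI) (auto simp: dist_real_def)
 hence cD: "continuous_on UNIV (D x)" by (rule lipschitz_on_continuous_on)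
 have "continuous_on {-L..L} ?\<phi>"
  by (intro continuous_intros continuous_on_compose2[OF cD]) auto
 moreover have "?\<phi> (- L) <= 0" "0 <= ?\<phi> L"
  using D_bound[of x "y + h * (-L)\<^sup>2"] D_bound[of x "y + h * L\<^sup>2"] by auto
 ultimately obtain z where "-L <= z" "z <= L" "?\<phi> z = 0"
  using IVT'[of ?\<phi> "-L" 0 L] L by auto
 thus ?thesis by (intro exI[of _ z]) auto
qed

lemma z_bound: "\<bar>z x y\<bar> <= L" and z_eq: "sqrt h * z x y = D x (y + h * (z x y)^2)"
 using someI_ex[OF z_ex[of x y]] unfolding z_def by auto

lemma time_shift_diff:
 "\<bar>h * (z x y)^2 - h * (z x' y')\<^sup>2\<bar> <= 2 * L * h * \<bar>z x y - z x' y'\<bar>"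
proof -
 have "h * (z x y)^2 - h * (z x' y')^2 = h * (z x y + z x' y') * (z x y - z x' y')"
  by (simp add: power2_eq_square algebra_simps)
 also have "\<bar>...\<bar> = h * \<bar>z x y + z x' y'\<bar> * \<bar>z x y - z x' y'\<bar>" using h by (simp add: abs_mult)
 also have "... <= h * (2 * L) * \<bar>z x y - z x' y'\<bar>"
  using z_bound[of x y] z_bound[of x' y'] h by (intro mult_right_mono mult_left_mono) auto
 finally show ?thesis by (simp add: mult_ac)
qed

text \<open>The implicit time argument feeds the difference of the controls back with the factor
  \<open>2 * L * \<Lambda> * sqrt h <= 1/4\<close>, which the left-hand side absorbs. This makes the
  selected root continuous in the state, hence measurable.\<close>

lemma z_lipschitz: "3/4 * (sqrt h * \<bar>z x y - z x' y'\<bar>) <= L * \<bar>x - x'\<bar> + \<Lambda> * \<bar>y - y'\<bar>"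
proof -
 let ?d = "\<bar>z x y - z x' y'\<bar>"
 have "sqrt h * (z x y - z x' y') = D x (y + h * (z x y)^2) - D x' (y' + h * (z x' y')^2)"
  by (simp add: z_eq[symmetric] right_diff_distrib)
 hence "sqrt h * ?d <= L * \<bar>x - x'\<bar> + \<Lambda> * \<bar>(y + h * (z x y)^2) - (y' + h * (z x' y')^2)\<bar>"
  using D_lipschitz[of x "y + h * (z x y)\<^sup>2" x' "y' + h * (z x' y')\<^sup>2"] h by (metis abs_mult abs_of_nonneg real_sqrt_ge_0_iff less_imp_le)
 also have "... <= L * \<bar>x - x'\<bar> + \<Lambda> * (\<bar>y - y'\<bar> + 2 * L * h * ?d)"
  using time_shift_diff[of x y x' y'] \<Lambda> by (intro add_left_mono mult_left_mono) auto
 also have "\<Lambda> * (\<bar>y - y'\<bar> + 2 * L * h * ?d) = \<Lambda> * \<bar>y - y'\<bar> + (2 * L * \<Lambda> * sqrt h) * (sqrt h * ?d)"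
  using h by (simp add: algebra_simps)
 also have "(2 * L * \<Lambda> * sqrt h) * (sqrt h * ?d) <= (1/4) * (sqrt h * ?d)"
  using small1 h by (intro mult_right_mono) auto
 finally show ?thesis by simp
qed

lemma z_measurable [measurable]: "(%p. z (fst p) (snd p)) \<in> borel_measurable borel"
proof -
 let ?K = "4/3 * (L + \<Lambda>)/sqrt h"
 have "?K-lipschitz_on UNIV (%p. z (fst p) (snd p))"
 proof (rule lipschitz_onI)
  fix p q :: "real \<times> real"
  have "L * \<bar>fst p - fst q\<bar> + \<Lambda> * \<bar>snd p - snd q\<bar> <= L * dist p q + \<Lambda> * dist p q"
   using dist_fst_le[of p q] dist_snd_le[of p q] L \<Lambda> by (intro add_mono mult_left_mono) (auto simp: dist_real_def)
  hence "3/4 * (sqrt h * \<bar>z (fst p) (snd p) - z (fst q) (snd q)\<bar>) <= (L + \<Lambda>) * dist p q"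
   using z_lipschitz[of "fst p" "snd p" "fst q" "snd q"] by (simp add: distrib_right)
  thus "dist (z (fst p) (snd p)) (z (fst q) (snd q)) <= ?K * dist p q"
   using h by (simp add: dist_real_def field_simps)
 qed (use h L \<Lambda> in auto)
 thus ?thesis by (intro borel_measurable_continuous_onI lipschitz_on_continuous_on)
qed

text \<open>Differences of \<open>step\<close> in \<open>x\<close> are averages of differences of \<open>f\<close> with respect to positive weights
 of total mass 1; this is the discrete maximum principle. Positivity of the weights is the
 reason for the truncation \<open>clip c\<close>.\<close>

lemma step_diff_x:
 obtains \<theta> where "\<bar>\<theta>\<bar> <= 4 * L * \<Lambda> * sqrt h" "\<bar>\<theta>\<bar> * c <= 1/2"
  "step x y - step x' y = gauss.expectation (%u. (1 + \<theta> * clip c u) *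
   (f (x + sqrt h * u) (y + h * (z x y)^2) - f (x' + sqrt h * u) (y + h * (z x y)^2)))"
proof -
 define Y Y' w where "Y = y + h * (z x y)\<^sup>2" and "Y' = y + h * (z x' y)\<^sup>2" and "w = z x y - z x' y"
 define a where "a u = f (x + sqrt h * u) Y - f (x' + sqrt h * u) Y" for u
 define b where "b u = f (x' + sqrt h * u) Y - f (x' + sqrt h * u) Y'" for u
 let ?E = gauss.expectation
 have [simp]: "integrable \<N> a" "integrable \<N> b"
  "integrable \<N> (%u. clip c u * a u)" "integrable \<N> (%u. clip c u * b u)"
  unfolding a_def b_def by (simp_all add: right_diff_distrib)
 have [measurable]: "a \<in> borel_measurable borel" "b \<in> borel_measurable borel"
  unfolding a_def b_def by measurable
 have bb: "\<bar>b u\<bar> <= \<Lambda> * (2 * L * h * \<bar>w\<bar>)" for u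
 proof -
  have "\<bar>b u\<bar> <= \<Lambda> * \<bar>Y - Y'\<bar>" unfolding b_def by (rule lipy)
  also have "... <= \<Lambda> * (2 * L * h * \<bar>w\<bar>)"
   using time_shift_diff[of x y x' y] \<Lambda> unfolding Y_def Y'_def w_def by (intro mult_left_mono) auto
  finally show ?thesis .
 qed
 have Eb: "\<bar>?E b\<bar> <= \<Lambda> * (2 * L * h * \<bar>w\<bar>)"
  using gauss_abs_integral_le[of b "%_. \<Lambda> * (2 * L * h * \<bar>w\<bar>)"] bb gauss.prob_space by simp
 have Ecb: "\<bar>?E (%u. clip c u * b u)\<bar> <= \<Lambda> * (2 * L * h * \<bar>w\<bar>)"
  by (rule gauss_clip_weighted_le[OF c0 _ bb]) simp
 have weq: "sqrt h * w = ?E (%u. clip c u * a u) + ?E (%u. clip c u * b u)"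
 proof -
  have "sqrt h * w = D x Y - D x' Y'"
   unfolding w_def Y_def Y'_def by (simp add: z_eq[symmetric] right_diff_distrib)
  also have "... = ?E (%u. clip c u * a u + clip c u * b u)"
   unfolding D_def a_def b_def by (simp add: right_diff_distrib)
  finally show ?thesis by simp
 qed
 have seq: "step x y - step x' y = ?E a + ?E b"
 proof -
  have "step x y - step x' y = ?E (%u. a u + b u)"
   unfolding step_def Y_def[symmetric] Y'_def[symmetric] a_def b_def by simp
  thus ?thesis by simp
 qed
 have q: "\<Lambda> * (2 * L * h * \<bar>w\<bar>) = (2 * L * \<Lambda> * sqrt h) * (sqrt h * \<bar>w\<bar>)"
  using h by (simp add: algebra_simps)
 have q1: "(2 * L * \<Lambda> * sqrt h) * (sqrt h * \<bar>w\<bar>) <= (1/4) * (sqrt h * \<bar>w\<bar>)"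
  using small1 h by (intro mult_right_mono) auto
 define A where "A = ?E (%u. clip c u * a u)"
 have Aw: "3/4 * (sqrt h * \<bar>w\<bar>) <= \<bar>A\<bar>"
 proof -
  have "\<bar>sqrt h * w\<bar> = sqrt h * \<bar>w\<bar>" using h by (simp add: abs_mult)
  thus ?thesis using weq Ecb q q1 unfolding A_def[symmetric] by linarith
 qed
 \<comment> \<open>The effect \<open>?E b\<close> of the advanced time is small compared with
   \<open>A\<close>; written as a multiple of \<open>A\<close> it becomes a tilt of the Gaussian
   weight. If \<open>A = 0\<close>, then \<open>w = 0\<close> and \<open>?E b = 0\<close>, and the
   value 0 of the division is the right one.\<close>
 define \<theta> where "\<theta> = ?E b/A"
 have \<theta>A: "?E b = \<theta> * A"
 proof (cases "A = 0")
  case True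
  hence "w = 0" using Aw h by (auto simp: zero_le_mult_iff mult_le_0_iff)
  thus ?thesis using Eb True by simp
 qed (simp add: \<theta>_def)
 have \<theta>: "\<bar>\<theta>\<bar> <= 4 * L * \<Lambda> * sqrt h"
 proof (cases "A = 0")
  case True thus ?thesis using L \<Lambda> h by (simp add: \<theta>_def)
 next
  case False
  have "\<bar>?E b\<bar> <= (2 * L * \<Lambda> * sqrt h) * (sqrt h * \<bar>w\<bar>)" using Eb q by simp
  also have "... <= (2 * L * \<Lambda> * sqrt h) * (2 * \<bar>A\<bar>)"
   using Aw L \<Lambda> h by (intro mult_left_mono) auto
  finally show ?thesis using False by (simp add: \<theta>_def divide_le_eq mult_ac)
 qed
 moreover have "\<bar>\<theta>\<bar> * c <= 1/2"
 proof -
  have "\<bar>\<theta>\<bar> * c <= (4 * L * \<Lambda> * sqrt h) * c" using \<theta> c0 by (rule mult_right_mono)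
  thus ?thesis using small by simp
 qed
 moreover have "step x y - step x' y = ?E (%u. (1 + \<theta> * clip c u) * a u)"
  using seq \<theta>A by (simp add: A_def distrib_right mult.assoc)
 ultimately show ?thesis using that[of \<theta>] unfolding a_def Y_def by simp
qed

lemma tilt_pos:
 assumes "\<bar>\<theta>\<bar> * c <= 1/2"
 shows "1/2 <= 1 + \<theta> * clip c u" "1 + \<theta> * clip c u <= 3/2" "\<bar>\<theta> * clip c u\<bar> <= 1/2"
proof -
 have "\<bar>\<theta> * clip c u\<bar> <= \<bar>\<theta>\<bar> * c"
  unfolding abs_mult using abs_clip_le(1)[OF c0] by (intro mult_left_mono) auto
 thus "\<bar>\<theta> * clip c u\<bar> <= 1/2" using assms by linarith
 thus "1/2 <= 1 + \<theta> * clip c u" "1 + \<theta> * clip c u <= 3/2" by (auto simp: abs_if split: if_splits)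
qed

lemma tilt_mass: "gauss.expectation (%u. r + \<theta> * clip c u) = r"
 using c0 gauss_clip_mean[OF c0] gauss.prob_space by simp

lemma step_lipschitz_x: "\<bar>step x y - step x' y\<bar> <= L * \<bar>x - x'\<bar>"
proof -
 obtain \<theta> where \<theta>: "\<bar>\<theta>\<bar> * c <= 1/2"
  "step x y - step x' y = gauss.expectation (%u. (1 + \<theta> * clip c u) *
   (f (x + sqrt h * u) (y + h * (z x y)^2) - f (x' + sqrt h * u) (y + h * (z x y)^2)))"
  using step_diff_x[of x y x'] by blast
 have "\<bar>step x y - step x' y\<bar> <= gauss.expectation (%u. L * \<bar>x - x'\<bar> * (1 + \<theta> * clip c u))"
  unfolding \<theta>(2)
 proof (rule gauss_abs_integral_le)
  fix u
  show "\<bar>(1 + \<theta> * clip c u) * (f (x + sqrt h * u) (y + h * (z x y)^2) - f (x' + sqrt h * u) (y + h * (z x y)^2))\<bar>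
   <= L * \<bar>x - x'\<bar> * (1 + \<theta> * clip c u)"
   using lipx[of "x + sqrt h * u" "y + h * (z x y)\<^sup>2" "x' + sqrt h * u"] tilt_pos(1)[OF \<theta>(1), of u]
   by (simp add: abs_mult mult_ac mult_left_mono)
 qed (simp_all add: right_diff_distrib distrib_right mult.assoc c0)
 also have "... = L * \<bar>x - x'\<bar>" using tilt_mass by simp
 finally show ?thesis .
qed

text \<open>The advanced times differ by \<open>d\<close>, which contains the unknown difference of
  the controls. Estimating \<open>|d|\<close> separately would enlarge the constant in every step.
  Instead \<open>?E b\<close> and the control term are bounded together by one tilted weight of mass
  1; then \<open>\<Lambda> * |d|\<close> cancels and exactly \<open>\<Lambda>\<close>
  remains.\<close>

lemma step_lipschitz_y: "\<bar>step x y - step x y'\<bar> <= \<Lambda> * \<bar>y - y'\<bar>"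
proof -
 define Y Y' where "Y = y + h * (z x y)\<^sup>2" and "Y' = y' + h * (z x y')\<^sup>2"
 define d \<tau> where "d = Y - Y'" and "\<tau> = sqrt h * (z x y + z x y')"
 define b where "b u = f (x + sqrt h * u) Y - f (x + sqrt h * u) Y'" for u
 let ?E = gauss.expectation
 have [simp]: "integrable \<N> b" "integrable \<N> (%u. clip c u * b u)"
  unfolding b_def by (simp_all add: right_diff_distrib)
 have bb: "\<bar>b u\<bar> <= \<Lambda> * \<bar>d\<bar>" for u unfolding b_def d_def by (rule lipy)
 have seq: "step x y - step x y' = ?E b"
  unfolding step_def Y_def[symmetric] Y'_def[symmetric] b_def by simp
 have "sqrt h * (z x y - z x y') = ?E (%u. clip c u * b u)"
 proof -
  have "sqrt h * (z x y - z x y') = D x Y - D x Y'"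
   unfolding Y_def Y'_def by (simp add: z_eq[symmetric] right_diff_distrib)
  thus ?thesis unfolding D_def b_def by (simp add: right_diff_distrib)
 qed
 moreover have "d = (y - y') + \<tau> * (sqrt h * (z x y - z x y'))"
  unfolding d_def Y_def Y'_def \<tau>_def by (simp add: power2_eq_square algebra_simps sqh)
 ultimately have deq: "d = (y - y') + \<tau> * ?E (%u. clip c u * b u)" by simp
 have main: "\<bar>?E (%u. (s + t * clip c u) * b u)\<bar> <= \<Lambda> * \<bar>d\<bar>"
  if s: "\<bar>s\<bar> = 1" and t: "\<bar>t\<bar> <= \<Lambda> * \<bar>\<tau>\<bar>" for s t
 proof -
  have "\<bar>\<tau>\<bar> <= sqrt h * (2 * L)"
   unfolding \<tau>_def abs_mult using h z_bound[of x y] z_bound[of x y'] by (intro mult_mono) auto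
  hence "\<bar>t\<bar> <= \<Lambda> * (sqrt h * (2 * L))" using t \<Lambda> by (meson mult_left_mono order_trans less_imp_le)
  hence "\<bar>t\<bar> * c <= (\<Lambda> * (sqrt h * (2 * L))) * c" using c0 by (rule mult_right_mono)
  also have "... <= 1/4" using small by (simp add: mult_ac)
  finally have "\<bar>s * t\<bar> * c <= 1/2" using s by (simp add: abs_mult)
  from tilt_pos(1)[OF this] have pos: "0 <= 1 + s * t * clip c u" for u by (meson order_trans zero_le_divide_1_iff zero_le_numeral)
  have ss: "s * s = 1" using s by (metis abs_mult_self_eq mult_1)
  have "s + t * clip c u = s * (1 + s * t * clip c u)" for u
   using ss by (simp add: distrib_left mult.assoc[symmetric])
  hence ab: "\<bar>s + t * clip c u\<bar> = 1 + s * t * clip c u" for u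
   using pos s by (simp add: abs_mult)
  have "\<bar>?E (%u. (s + t * clip c u) * b u)\<bar> <= ?E (%u. \<Lambda> * \<bar>d\<bar> * (1 + (s * t) * clip c u))"
  proof (rule gauss_abs_integral_le)
   show "\<bar>(s + t * clip c u) * b u\<bar> <= \<Lambda> * \<bar>d\<bar> * (1 + (s * t) * clip c u)" for u
    using mult_right_mono[OF bb pos, of u u] by (simp add: abs_mult ab mult_ac)
  qed (simp_all add: distrib_right distrib_left mult.assoc c0)
  also have "... = \<Lambda> * \<bar>d\<bar>" using tilt_mass by simp
  finally show ?thesis .
 qed
 have "\<bar>?E b\<bar> + \<Lambda> * sgn d * \<tau> * ?E (%u. clip c u * b u) <= \<Lambda> * \<bar>d\<bar>"
 proof -
  define s :: real where "s = (if ?E b \<ge> 0 then 1 else -1)"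
  have "\<bar>\<Lambda> * sgn d * \<tau>\<bar> <= \<Lambda> * \<bar>\<tau>\<bar>" using \<Lambda> by (simp add: abs_mult sgn_if)
  from main[of s, OF _ this] have "?E (%u. (s + \<Lambda> * sgn d * \<tau> * clip c u) * b u) <= \<Lambda> * \<bar>d\<bar>"
   by (auto simp: s_def abs_if split: if_splits)
  also have "?E (%u. (s + \<Lambda> * sgn d * \<tau> * clip c u) * b u) = s * ?E b + \<Lambda> * sgn d * \<tau> * ?E (%u. clip c u * b u)"
   by (simp add: distrib_right mult.assoc)
  finally show ?thesis by (simp add: s_def split: if_splits)
 qed
 moreover have "\<Lambda> * sgn d * \<tau> * ?E (%u. clip c u * b u) = \<Lambda> * \<bar>d\<bar> - \<Lambda> * (sgn d * (y - y'))"
 proof -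
  have "\<tau> * ?E (%u. clip c u * b u) = d - (y - y')" using deq by simp
  hence "\<Lambda> * sgn d * \<tau> * ?E (%u. clip c u * b u) = \<Lambda> * sgn d * (d - (y - y'))" by (simp add: mult.assoc)
  also have "... = \<Lambda> * \<bar>d\<bar> - \<Lambda> * (sgn d * (y - y'))"
   by (simp add: right_diff_distrib mult.assoc linordered_idom_class.abs_sgn mult.commute[of d])
  finally show ?thesis .
 qed
 moreover have "\<Lambda> * (sgn d * (y - y')) <= \<Lambda> * \<bar>y - y'\<bar>"
  using \<Lambda> by (intro mult_left_mono) (auto simp: sgn_if)
 ultimately show ?thesis using seq by linarith
qed

lemma step_mono:
 assumes "!!x x' y. x <= x' ==> f x y <= f x' y" "x <= x'"
 shows "step x y <= step x' y"
proof -
 obtain \<theta> where \<theta>: "\<bar>\<theta>\<bar> * c <= 1/2"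
  "step x' y - step x y = gauss.expectation (%u. (1 + \<theta> * clip c u) *
   (f (x' + sqrt h * u) (y + h * (z x' y)^2) - f (x + sqrt h * u) (y + h * (z x' y)^2)))"
  using step_diff_x[of x' y x] by blast
 have "0 <= (1 + \<theta> * clip c u) * (f (x' + sqrt h * u) (y + h * (z x' y)^2) - f (x + sqrt h * u) (y + h * (z x' y)^2))" for u
  using tilt_pos(1)[OF \<theta>(1), of u] assms by (intro mult_nonneg_nonneg) auto
 hence "0 <= step x' y - step x y" unfolding \<theta>(2) by (intro integral_nonneg_AE always_eventually allI)
 thus ?thesis by simp
qed

end

section \<open>Gaussian inequalities: mass of intervals, regression, weighted squares\<close>

lemma gauss_interval_ge:
 assumes "a <= b" "\<bar>a\<bar> <= R" "\<bar>b\<bar> <= R"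
 shows "(b - a) * std_normal_density R <= measure \<N> {a..b}"
proof -
 have "ennreal ((b - a) * std_normal_density R) = (nn_integral lborel (%x. ennreal (std_normal_density R) * indicator {a..b} x))"
  using assms by (simp add: nn_integral_cmult_indicator ennreal_mult'[symmetric] mult.commute)
 also have "... <= (nn_integral lborel (%x. ennreal (std_normal_density x) * indicator {a..b} x))"
 proof (rule nn_integral_mono)
  fix x :: real
  have "std_normal_density R <= std_normal_density x" if "x \<in> {a..b}"
  proof -
   have "\<bar>x\<bar> <= \<bar>R\<bar>" using that assms by auto
   hence "x\<^sup>2 <= R\<^sup>2" by (simp add: abs_le_square_iff)
   thus ?thesis by (simp add: std_normal_density_def divide_right_mono)
  qed
  thus "ennreal (std_normal_density R) * indicator {a..b} x <= ennreal (std_normal_density x) * indicator {a..b} x"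
   by (auto simp: indicator_def ennreal_leI)
 qed
 also have "... = emeasure \<N> {a..b}"
  by (subst emeasure_density) auto
 finally show ?thesis
  by (simp add: gauss.emeasure_eq_measure)
qed

text \<open>The share of the unit variance carried by noise of size at most 1. Such noise moves
  \<open>x\<close> by at most \<open>sqrt h\<close>, so a slope known only near \<open>x\<close>
  still bounds the control from below.\<close>

definition inner_variance :: real where
 "inner_variance = gauss.expectation (%u. indicator {-1..1} u * u^2)"

lemma inner_variance_integrable [simp]:
 "integrable \<N> (%u. indicator {-1..1} u * u^2)"
 by (rule gauss_integrable_quadratic[where a=0 and b=0 and c=1]) (auto simp: indicator_def)

lemma inner_variance_pos: "0 < inner_variance"
proof -
 have "0 < 1/4 * ((1 - 1/2) * std_normal_density 1)" by (simp add: normal_density_pos)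
 also have "... <= 1/4 * measure \<N> {1/2..1}"
  using gauss_interval_ge[of "1/2" 1 1] by simp
 also have "... = gauss.expectation (%u. 1/4 * indicator {1/2..1} u)" by simp
 also have "... <= inner_variance"
  unfolding inner_variance_def
 proof (intro integral_mono)
  fix u :: real
  have "1/4 <= u\<^sup>2" if "1/2 <= u" using power_mono[OF that, of 2] by (simp add: power2_eq_square)
  thus "1/4 * indicator {1/2..1} u <= indicator {-1..1} u * u\<^sup>2" by (auto simp: indicator_def)
  show "integrable \<N> (%u. 1/4 * indicator {1/2..1} u :: real)"
   by (rule gauss_integrable_quadratic[where a=1 and b=0 and c=0]) (auto simp: indicator_def)
 qed simp
 finally show ?thesis .
qed

text \<open>Mean and correlation with \<open>u\<close> are the least squares coefficients, and by
  orthogonality another slope \<open>s\<close> costs exactly the square of its distance from the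
  optimum. Hence any affine approximation, however obtained, controls the error of the
  regression.\<close>

lemma gauss_regression:
 fixes F :: "real => real"
 assumes [measurable]: "F \<in> borel_measurable borel" and F: "!!x. \<bar>F x\<bar> <= a + b * \<bar>x\<bar>"
 shows "gauss.expectation (%u. (F u - gauss.expectation F - s * u)^2)
  <= gauss.expectation (%u. (F u - A - B * u)^2) + (gauss.expectation (%u. u * F u) - s)\<^sup>2"
proof -
 let ?E = gauss.expectation
 define m v where "m = ?E F" and "v = ?E (%u. u * F u)"
 have ab: "0 <= a" "0 <= a + b" using F[of 0] F[of 1] by auto
 have sq: "(F x)\<^sup>2 <= 2 * a^2 + 2 * b^2 * x\<^sup>2" for x
 proof -
  have "(F x)\<^sup>2 <= (a + b * \<bar>x\<bar>)\<^sup>2" using F[of x] by (metis abs_ge_zero power2_abs power_mono)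
  also have "... <= 2 * a^2 + 2 * b^2 * x\<^sup>2"
   using sum_squares_ge_zero[of "a - b * \<bar>x\<bar>" 0] by (simp add: power2_eq_square algebra_simps)
  finally show ?thesis .
 qed
 have [simp]: "integrable \<N> F"
  using F by (intro gauss_integrable_quadratic[where a=a and b=b and c=0]) auto
 have [simp]: "integrable \<N> (%u. u * F u)"
 proof (rule gauss_integrable_quadratic[where a=0 and b=a and c=b])
  show "\<bar>x * F x\<bar> <= 0 + a * \<bar>x\<bar> + b * x\<^sup>2" for x
   using mult_left_mono[OF F, of "\<bar>x\<bar>" x] by (simp add: abs_mult power2_eq_square algebra_simps)
 qed simp
 have [simp]: "integrable \<N> (%u. (F u)^2)"
  using sq by (intro gauss_integrable_quadratic[where a="2 * a\<^sup>2" and b=0 and c="2 * b\<^sup>2"]) auto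
 have expand: "?E (%u. (F u - p - q * u)^2) = ?E (%u. (F u)^2) - m\<^sup>2 - v\<^sup>2 + (m - p)^2 + (v - q)\<^sup>2" for p q
 proof -
  have "?E (%u. (F u - p - q * u)^2) =
   ?E (%u. (F u)^2 + p^2 + q^2 * u^2 - 2 * p * F u - 2 * q * (u * F u) + 2 * p * q * u)"
   by (intro Bochner_Integration.integral_cong) (auto simp: power2_eq_square algebra_simps)
  also have "... = ?E (%u. (F u)^2) + p^2 + q^2 - 2 * p * m - 2 * q * v"
   using gauss.prob_space by (simp add: m_def v_def)
  finally show ?thesis by (simp add: power2_eq_square algebra_simps)
 qed
 show ?thesis
  unfolding m_def[symmetric] v_def[symmetric] expand by simp
qed

text \<open>Cauchy-Schwarz for the product of \<open>sqrt W * p\<close> and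
  \<open>1 / sqrt W\<close>, by completing the square with the multiplier \<open>?E p / K\<close>.
  It exchanges the tilted average for the plain one at the price of squaring
  \<open>p\<close>.\<close>

lemma gauss_weighted_square_ge:
 fixes p W :: "real => real"
 assumes [measurable]: "p \<in> borel_measurable borel" "W \<in> borel_measurable borel"
  and p: "!!u. 0 <= p u" "!!u. p u <= 1" and W: "!!u. 1/2 <= W u" "!!u. W u <= 2"
  and K: "gauss.expectation (%u. 1/W u) <= K"
 shows "(gauss.expectation p)\<^sup>2/K <= gauss.expectation (%u. W u * (p u)^2)"
proof -
 let ?E = gauss.expectation
 have W0: "0 < W u" for u using W(1)[of u] by linarith
 have iW: "1/2 <= 1/W u" "1/W u <= 2" for u
  using W[of u] W0[of u] by (auto simp: field_simps)
 have [simp]: "integrable \<N> p"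
  using p by (intro gauss_integrable_quadratic[where a=1 and b=0 and c=0]) auto
 have [simp]: "integrable \<N> (%u. 1/W u)"
  using iW W0 by (intro gauss_integrable_quadratic[where a=2 and b=0 and c=0]) (auto simp: less_imp_le)
 have [simp]: "integrable \<N> (%u. W u * (p u)^2)"
 proof (rule gauss_integrable_quadratic[where a=2 and b=0 and c=0])
  show "\<bar>W u * (p u)\<^sup>2\<bar> <= 2 + 0 * \<bar>u\<bar> + 0 * u\<^sup>2" for u
   using mult_mono[OF W(2)[of u] power_le_one[OF p(1)[of u] p(2)[of u], of 2]] W0[of u] by simp
 qed simp
 have "1/2 <= ?E (%u. 1/W u)"
  using integral_mono[of \<N> "%_. 1/2" "%u. 1/W u"] iW gauss.prob_space by simp
 hence K0: "0 < K" using K by linarith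
 define l where "l = ?E p/K"
 have "2 * l * ?E p - l\<^sup>2 * K <= 2 * l * ?E p - l\<^sup>2 * ?E (%u. 1/W u)"
  using K by (simp add: mult_left_mono)
 also have "... = ?E (%u. 2 * l * p u - l\<^sup>2 * (1/W u))"
  by (subst Bochner_Integration.integral_diff) (auto simp del: mult_divide_mult_cancel_left_if times_divide_eq_right)
 also have "... <= ?E (%u. W u * (p u)^2)"
 proof (intro integral_mono)
  fix u
  have "0 <= (p u * W u - l)^2/W u" using W0[of u] by simp
  also have "... = W u * (p u)^2 - 2 * l * p u + l^2 * (1/W u)"
   using W0[of u] by (simp add: power2_eq_square field_simps)
  finally show "2 * l * p u - l\<^sup>2 * (1/W u) <= W u * (p u)\<^sup>2" by simp
 qed (auto simp del: mult_divide_mult_cancel_left_if times_divide_eq_right)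
 also have "2 * l * ?E p - l\<^sup>2 * K = (?E p)^2/K"
  using K0 by (simp add: l_def power2_eq_square field_simps)
 finally show ?thesis .
qed

lemma clip_error:
 assumes c: "0 < c"
 shows "\<bar>x - clip c x\<bar> * \<bar>x\<bar> <= x^4/c\<^sup>2"
proof (cases "\<bar>x\<bar> <= c")
 case True
 hence "clip c x = x" by (simp add: clip_def abs_le_iff)
 thus ?thesis by simp
next
 case False
 have 1: "\<bar>x - clip c x\<bar> <= \<bar>x\<bar>" using c by (auto simp: clip_def)
 have 2: "c\<^sup>2 <= x\<^sup>2" using False c abs_le_square_iff[of c x] by simp
 have "\<bar>x - clip c x\<bar> * \<bar>x\<bar> <= \<bar>x\<bar> * \<bar>x\<bar>" using 1 by (rule mult_right_mono) simp
 also have "... = x\<^sup>2" by (simp add: power2_eq_square)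
 also have "... <= x^4/c\<^sup>2"
  using mult_left_mono[OF 2, of "x\<^sup>2"] c by (simp add: pos_le_divide_eq power4_eq_xxxx power2_eq_square mult.assoc)
 finally show ?thesis .
qed

section \<open>Propagation of slopes, lower bound for the control, cost of the truncation\<close>

context gauss_step
begin

text \<open>The first order term of \<open>1 / (1 + \<theta> * clip c u)\<close> averages to zero,
  so only \<open>2 * \<theta>\<^sup>2 <= 32 * L\<^sup>2 * \<Lambda>\<^sup>2 * h\<close> is lost. A
  loss of order \<open>h\<close> per step stays bounded over the horizon.\<close>

lemma tilted_square_ge:
 assumes [measurable]: "p \<in> borel_measurable borel" and p: "!!u. 0 <= p u" "!!u. p u <= 1"
  and \<theta>: "\<bar>\<theta>\<bar> <= 4 * L * \<Lambda> * sqrt h" "\<bar>\<theta>\<bar> * c <= 1/2"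
 shows "(gauss.expectation p)\<^sup>2/(1 + 32 * L^2 * \<Lambda>\<^sup>2 * h) <= gauss.expectation (%u. (1 + \<theta> * clip c u) * (p u)^2)"
proof (rule gauss_weighted_square_ge)
 note t = tilt_pos[OF \<theta>(2)]
 let ?E = gauss.expectation
 have csq: "integrable \<N> (%x. (clip c x)^2)"
  using abs_clip_le(2)[OF c0] by (intro gauss_integrable_quadratic[where a=0 and b=0 and c=1]) (auto simp: abs_le_square_iff)
 have inv: "1/(1 + \<theta> * clip c u) <= 1 - \<theta> * clip c u + 2 * \<theta>^2 * (clip c u)\<^sup>2" for u
 proof -
  define v where "v = \<theta> * clip c u"
  have v: "\<bar>v\<bar> <= 1/2" using t(3)[of u] by (simp add: v_def)
  hence "0 <= v^2 * (1 + 2 * v)" by (auto simp: abs_if split: if_splits)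
  hence "1 <= (1 - v + 2 * v^2) * (1 + v)" by (simp add: power2_eq_square algebra_simps)
  hence "1/(1 + v) <= 1 - v + 2 * v\<^sup>2" using v by (auto simp: divide_le_eq abs_if split: if_splits)
  thus ?thesis by (simp add: v_def power_mult_distrib)
 qed
 have "?E (%u. 1/(1 + \<theta> * clip c u)) <= ?E (%u. (1 - \<theta> * clip c u) + 2 * \<theta>^2 * (clip c u)^2)"
 proof (intro integral_mono inv)
  show "integrable \<N> (%u. 1/(1 + \<theta> * clip c u))"
  proof (rule gauss_integrable_quadratic[where a=2 and b=0 and c=0])
   show "\<bar>1/(1 + \<theta> * clip c u)\<bar> <= 2 + 0 * \<bar>u\<bar> + 0 * u\<^sup>2" for u
    using t(1)[of u] by (auto simp: divide_le_eq)
  qed simp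
 qed (use csq c0 in simp_all)
 also have "... = 1 + 2 * \<theta>^2 * ?E (%u. (clip c u)^2)"
  using csq c0 gauss_clip_mean[OF c0] gauss.prob_space by simp
 also have "... <= 1 + 2 * \<theta>^2 * 1"
  using gauss_clip_sq_le[OF c0] by (intro add_left_mono mult_left_mono) auto
 also have "\<theta>\<^sup>2 <= (4 * L * \<Lambda> * sqrt h)\<^sup>2"
  using \<theta>(1) by (metis abs_ge_zero power2_abs power_mono)
 also have "(4 * L * \<Lambda> * sqrt h)\<^sup>2 = 16 * L^2 * \<Lambda>\<^sup>2 * h" using h by (simp add: power_mult_distrib)
 finally show "?E (%u. 1/(1 + \<theta> * clip c u)) <= 1 + 32 * L^2 * \<Lambda>\<^sup>2 * h" by simp
 show "1 + \<theta> * clip c u <= 2" for u using t(2)[of u] by linarith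
qed (use p tilt_pos[OF \<theta>(2)] in auto)

text \<open>Slopes are encoded by a density whose integrals bound the increments from below, so no
  derivative of the field is needed and the averaging of \<open>step_diff_x\<close> acts on the
  density by Fubini. The tilt depends on the two points compared, hence the condition on
  \<open>w'\<close> for all admissible \<theta>.\<close>

lemma step_slope:
 fixes w w' :: "real => real"
 assumes [measurable]: "w \<in> borel_measurable borel" "w' \<in> borel_measurable borel"
  and w: "!!t. 0 <= w t"
  and f: "!!x x' y. x <= x' ==> (\<integral>\<^sup>+t\<in>{x..x'}. ennreal (w t) \<partial>lborel) <= ennreal (f x' y - f x y)"
  and mono: "!!x x' y. x <= x' ==> f x y <= f x' y"
  and w': "!!\<theta> t. \<bar>\<theta>\<bar> <= 4 * L * \<Lambda> * sqrt h ==> \<bar>\<theta>\<bar> * c <= 1/2 ==>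
   ennreal (w' t) <= (nn_integral \<N> (%u. ennreal ((1 + \<theta> * clip c u) * w (t + sqrt h * u))))"
  and "x <= x'"
 shows "(\<integral>\<^sup>+t\<in>{x..x'}. ennreal (w' t) \<partial>lborel) <= ennreal (step x' y - step x y)"
proof -
 interpret PS: pair_sigma_finite \<N> lborel ..
 have [measurable_cong]: "sets \<N> = sets borel" by simp
 obtain \<theta> where \<theta>: "\<bar>\<theta>\<bar> <= 4 * L * \<Lambda> * sqrt h" "\<bar>\<theta>\<bar> * c <= 1/2"
  "step x' y - step x y = gauss.expectation (%u. (1 + \<theta> * clip c u) *
   (f (x' + sqrt h * u) (y + h * (z x' y)^2) - f (x + sqrt h * u) (y + h * (z x' y)^2)))"
  using step_diff_x[of x' y x] by blast
 define Y where "Y = y + h * (z x' y)\<^sup>2"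
 let ?W = "%u. 1 + \<theta> * clip c u"
 have W0: "0 <= ?W u" for u using tilt_pos(1)[OF \<theta>(2), of u] by linarith
 have "(\<integral>\<^sup>+t\<in>{x..x'}. ennreal (w' t) \<partial>lborel)
  <= (\<integral>\<^sup>+t\<in>{x..x'}. (nn_integral \<N> (%u. ennreal (?W u * w (t + sqrt h * u)))) \<partial>lborel)"
  by (intro nn_integral_mono mult_right_mono w' \<theta>) auto
 also have "... = (nn_integral lborel (%t. (nn_integral \<N> (%u. ennreal (?W u * w (t + sqrt h * u)) * indicator {x..x'} t))))"
  by (intro nn_integral_cong nn_integral_multc[symmetric]) simp
 also have "... = (nn_integral \<N> (%u. (nn_integral lborel (%t. ennreal (?W u * w (t + sqrt h * u)) * indicator {x..x'} t))))"
  by (rule PS.Fubini') (simp add: split_beta')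
 also have "... = (nn_integral \<N> (%u. ennreal (?W u) * (\<integral>\<^sup>+t\<in>{x + sqrt h * u..x' + sqrt h * u}. ennreal (w t) \<partial>lborel)))"
 proof (rule nn_integral_cong)
  fix u :: real
  have "(\<integral>\<^sup>+t\<in>{x + sqrt h * u..x' + sqrt h * u}. ennreal (w t) \<partial>lborel)
   = (nn_integral lborel (%t. ennreal (w (t + sqrt h * u)) * indicator {x..x'} t))"
  proof (subst nn_integral_real_affine[where c=1 and t="sqrt h * u"])
   have "indicator {x + sqrt h * u..x' + sqrt h * u} (sqrt h * u + 1 * t) = (indicator {x..x'} t :: ennreal)" for t
    by (auto simp: indicator_def)
   thus "ennreal \<bar>1\<bar> * (nn_integral lborel (%t. ennreal (w (sqrt h * u + 1 * t)) * indicator {x + sqrt h * u..x' + sqrt h * u} (sqrt h * u + 1 * t)))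
    = (nn_integral lborel (%t. ennreal (w (t + sqrt h * u)) * indicator {x..x'} t))"
    by (simp add: add.commute)
  qed auto
  thus "(nn_integral lborel (%t. ennreal (?W u * w (t + sqrt h * u)) * indicator {x..x'} t))
   = ennreal (?W u) * (\<integral>\<^sup>+t\<in>{x + sqrt h * u..x' + sqrt h * u}. ennreal (w t) \<partial>lborel)"
   using W0[of u] w by (simp add: ennreal_mult nn_integral_cmult mult.assoc)
 qed
 also have "... <= (nn_integral \<N> (%u. ennreal (?W u) * ennreal (f (x' + sqrt h * u) Y - f (x + sqrt h * u) Y)))"
  using f \<open>x <= x'\<close> by (intro nn_integral_mono mult_left_mono) auto
 also have "... = (nn_integral \<N> (%u. ennreal (?W u * (f (x' + sqrt h * u) Y - f (x + sqrt h * u) Y))))"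
  using W0 mono \<open>x <= x'\<close> by (intro nn_integral_cong) (simp add: ennreal_mult)
 also have "... = ennreal (gauss.expectation (%u. ?W u * (f (x' + sqrt h * u) Y - f (x + sqrt h * u) Y)))"
 proof (rule nn_integral_eq_integral)
  show "AE u in \<N>. 0 <= ?W u * (f (x' + sqrt h * u) Y - f (x + sqrt h * u) Y)"
   using W0 mono \<open>x <= x'\<close> by (intro always_eventually allI mult_nonneg_nonneg) auto
 qed (simp add: distrib_right right_diff_distrib mult.assoc)
 finally show ?thesis unfolding \<theta>(3) Y_def .
qed

text \<open>Pairing \<open>u\<close> with \<open>- u\<close> turns \<open>D\<close> into an average
  of increments of \<open>f\<close>. For \<open>|u| <= 1\<close> they obey the slope bound, for
  larger noise they are nonnegative by monotonicity.\<close>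

lemma z_ge:
 assumes mono: "!!x x' y. x <= x' ==> f x y <= f x' y" and \<kappa>: "0 <= \<kappa>"
  and slope: "!!s t y. x - sqrt h <= s ==> s <= t ==> t <= x + sqrt h ==> \<kappa> * (t - s) <= f t y - f s y"
 shows "\<kappa> * inner_variance <= z x y"
proof -
 define Y where "Y = y + h * (z x y)\<^sup>2"
 let ?E = gauss.expectation
 have D1: "D x Y = - ?E (%u. clip c u * f (x + sqrt h * (- u)) Y)"
  unfolding D_def using gauss_integral_uminus[of "%u. clip c u * f (x + sqrt h * u) Y"] c0
  by (simp add: clip_uminus)
 have i: "integrable \<N> (%u. clip c u * f (x + sqrt h * (- u)) Y)"
  using clip_f_integrable[of x "- sqrt h" Y] by simp
 have "\<kappa> * sqrt h * inner_variance = ?E (%u. \<kappa> * sqrt h * (indicator {-1..1} u * u^2))"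
  by (simp add: inner_variance_def)
 also have "... <= ?E (%u. 1/2 * (clip c u * f (x + sqrt h * u) Y - clip c u * f (x + sqrt h * (- u)) Y))"
 proof (intro integral_mono)
  have pos: "\<kappa> * sqrt h * (indicator {-1..1} u * u^2)
   <= 1/2 * (clip c u * f (x + sqrt h * u) Y - clip c u * f (x + sqrt h * (- u)) Y)" if "0 <= u" for u
  proof (cases "u <= 1")
   case True
   have cl: "clip c u = u" using True that c by (simp add: clip_def)
   have "\<kappa> * ((x + sqrt h * u) - (x + sqrt h * (- u))) <= f (x + sqrt h * u) Y - f (x + sqrt h * (- u)) Y"
    using that True h by (intro slope) (auto simp: mult_left_le)
   from mult_left_mono[OF this that]
   show ?thesis using cl that True by (simp add: power2_eq_square algebra_simps)
  next
   case False
   have "0 <= clip c u" using that c by (simp add: clip_def)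
   hence "clip c u * f (x + sqrt h * (- u)) Y <= clip c u * f (x + sqrt h * u) Y"
    using that h by (intro mult_left_mono mono) auto
   thus ?thesis using False by (auto simp: indicator_def)
  qed
  show "\<kappa> * sqrt h * (indicator {-1..1} u * u^2)
   <= 1/2 * (clip c u * f (x + sqrt h * u) Y - clip c u * f (x + sqrt h * (- u)) Y)" for u
  proof (cases "0 <= u")
   case False
   thus ?thesis using pos[of "- u"] c0 by (auto simp: clip_uminus indicator_def)
  qed (rule pos)
 qed (use i in simp_all)
 also have "... = D x Y" using D1 i by (simp add: D_def)
 also have "... = sqrt h * z x y" by (simp add: z_eq Y_def)
 finally show ?thesis using h by (simp add: mult.assoc mult.left_commute)
qed

text \<open>The price for using the truncated noise in \<open>D\<close>; the 3 is the fourth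
  Gaussian moment from \<open>clip_error\<close>. Relative to \<open>sqrt h\<close> the error is of
  order \<open>1 / c\<^sup>2\<close>, uniformly in the step length.\<close>

lemma correlation_close:
 "\<bar>gauss.expectation (%u. u * f (x + sqrt h * u) (y + h * (z x y)^2)) - sqrt h * z x y\<bar> <= 3 * L * sqrt h/c\<^sup>2"
proof -
 define Y where "Y = y + h * (z x y)\<^sup>2"
 define F where "F u = f (x + sqrt h * u) Y - f x Y" for u
 let ?E = gauss.expectation
 have [measurable]: "F \<in> borel_measurable borel" unfolding F_def by measurable
 have F: "\<bar>F u\<bar> <= L * sqrt h * \<bar>u\<bar>" for u
  using lipx[of "x + sqrt h * u" Y x] h by (simp add: F_def abs_mult mult.assoc)
 have i: "integrable \<N> (%u. u * F u)"
 proof (rule gauss_integrable_quadratic[where a=0 and b=0 and c="L * sqrt h"])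
  show "\<bar>u * F u\<bar> <= 0 + 0 * \<bar>u\<bar> + L * sqrt h * u\<^sup>2" for u
   using mult_left_mono[OF F, of "\<bar>u\<bar>" u] by (simp add: abs_mult power2_eq_square mult.left_commute)
 qed simp
 have ci: "integrable \<N> (%u. clip c u * F u)"
  unfolding F_def right_diff_distrib using c0 by (intro Bochner_Integration.integrable_diff integrable_mult_left) auto
 have feq: "f (x + sqrt h * u) Y = F u + f x Y" for u by (simp add: F_def)
 have "?E (%u. u * f (x + sqrt h * u) Y) = ?E (%u. u * F u)"
  using i by (simp add: feq distrib_left)
 moreover have "sqrt h * z x y = ?E (%u. clip c u * F u)"
  unfolding z_eq D_def Y_def[symmetric] using ci c0 gauss_clip_mean[OF c0] by (simp add: feq distrib_left)
 ultimately have "?E (%u. u * f (x + sqrt h * u) Y) - sqrt h * z x y = ?E (%u. u * F u - clip c u * F u)"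
  using i ci by simp
 also have "\<bar>...\<bar> <= ?E (%u. L * sqrt h/c^2 * u^4)"
 proof (rule gauss_abs_integral_le)
  fix u :: real
  have "\<bar>u * F u - clip c u * F u\<bar> = \<bar>u - clip c u\<bar> * \<bar>F u\<bar>"
   unfolding left_diff_distrib[symmetric] by (rule abs_mult)
  also have "... <= \<bar>u - clip c u\<bar> * (L * sqrt h * \<bar>u\<bar>)" by (rule mult_left_mono[OF F]) simp
  also have "... = (L * sqrt h) * (\<bar>u - clip c u\<bar> * \<bar>u\<bar>)" by (simp only: mult_ac)
  also have "... <= (L * sqrt h) * (u^4/c^2)"
   using c L h by (intro mult_left_mono clip_error) auto
  finally show "\<bar>u * F u - clip c u * F u\<bar> <= L * sqrt h/c^2 * u^4" by simp
 qed (use i ci in simp_all)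
 also have "... = 3 * L * sqrt h/c\<^sup>2" by (simp add: gauss_fourth_moment)
 finally show ?thesis unfolding Y_def .
qed

end

section \<open>The heat semigroup\<close>

definition heat :: "real => (real => real) => real => real" where
 "heat t F x = gauss.expectation (%\<xi>. F (x + sqrt t * \<xi>))"

lemma heat_measurable [measurable]:
 assumes [measurable]: "F \<in> borel_measurable borel"
 shows "heat t F \<in> borel_measurable borel"
proof -
 have [measurable_cong]: "sets \<N> = sets borel" by simp
 show ?thesis unfolding heat_def by measurable
qed

lemma heat_semigroup:
 assumes [measurable]: "F \<in> borel_measurable borel"
  and "integrable \<N> (%\<xi>. F (x + sqrt (s + t) * \<xi>))" and st: "0 <= s" "0 <= t"
 shows "heat s (heat t F) x = heat (s + t) F x"
 using gauss_convolution_integral[of "%u. F (x + u)" "sqrt s" "sqrt t"] assms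
 by (simp add: heat_def add.assoc)

lemma heat_zero [simp]: "heat 0 F = F"
 using gauss.prob_space by (simp add: heat_def fun_eq_iff)

lemma lipschitz_affine:
 fixes F :: "real => real"
 assumes F: "!!x y. \<bar>F x - F y\<bar> <= L * \<bar>x - y\<bar>"
 shows "integrable \<N> (%\<xi>. F (x + s * \<xi>))"
proof (rule gauss_integrable_lipschitz)
 show "\<bar>F (x + s * \<xi>) - F (x + s * \<eta>)\<bar> <= (L * \<bar>s\<bar>) * \<bar>\<xi> - \<eta>\<bar>" for \<xi> \<eta>
  using F[of "x + s * \<xi>" "x + s * \<eta>"] by (simp add: right_diff_distrib[symmetric] abs_mult mult.assoc)
qed

lemma heat_close:
 assumes F: "!!x y. \<bar>F x - F y\<bar> <= L * \<bar>x - y\<bar>" and t: "0 <= t"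
 shows "\<bar>heat t F x - F x\<bar> <= L * sqrt t"
proof -
 have L: "0 <= L" using F[of 1 0] by simp
 have "heat t F x - F x = gauss.expectation (%\<xi>. F (x + sqrt t * \<xi>) - F x)"
  using lipschitz_affine[OF F] gauss.prob_space by (simp add: heat_def)
 also have "\<bar>...\<bar> <= gauss.expectation (%\<xi>. L * sqrt t * \<bar>\<xi>\<bar>)"
  using F[of "x + sqrt t * _" x] lipschitz_affine[OF F] t
  by (intro gauss_abs_integral_le) (auto simp: abs_mult mult.assoc)
 also have "... <= L * sqrt t * 1"
  using gauss_abs_moment_le L t by (simp add: mult_left_le)
 finally show ?thesis by simp
qed

text \<open>For \<open>m >= 8\<close> it dominates the second moment of
  \<open>\<xi>\<^sup>2 * exp (\<xi>\<^sup>2 / m)\<close>, the shape of the error of the affine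
  approximation below; the exponent \<open>1/4\<close> stays under the Gaussian
  \<open>1/2\<close>.\<close>

definition gauss_exp_moment :: real where
 "gauss_exp_moment = gauss.expectation (%\<xi>. \<xi>^4 * exp (\<xi>^2/4))"

lemma gauss_exp_moment_integrable:
 "integrable \<N> (%\<xi>. \<xi>^4 * exp (\<xi>^2/4))"
proof -
 have eq: "std_normal_density \<xi> * (\<xi>^4 * exp (\<xi>^2/4)) = sqrt 2 * (normal_density 0 (sqrt 2) \<xi> * (\<xi> - 0)^4)" for \<xi>
 proof -
  have "exp (- \<xi>\<^sup>2/2) * exp (\<xi>^2/4) = exp (- \<xi>\<^sup>2/4)" by (simp add: exp_add[symmetric])
  moreover have "sqrt (2 * pi * 2) = sqrt (2 * pi) * sqrt 2" by (simp add: real_sqrt_mult)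
  ultimately show ?thesis by (simp add: normal_density_def field_simps)
 qed
 show ?thesis
  using integrable_normal_moment[of "sqrt 2" 0 4] by (subst integrable_gauss_density) (auto simp: eq)
qed

text \<open>The heat semigroup turns a Lipschitz function into one that is close to affine on the scale of a single
 step. The Gaussian shift is written as the density \<open>exp (\<rho> v - \<rho>\<^sup>2 / 2)\<close>, and this density is compared with its linear part in \<open>\<rho>\<close>.\<close>

lemma heat_affine_approx:
 assumes F: "!!x y. \<bar>F x - F y\<bar> <= L * \<bar>x - y\<bar>" and h: "0 < h" and m: "0 < m"
 obtains A B where "!!\<xi>. \<bar>heat (m * h) F (x + sqrt h * \<xi>) - A - B * \<xi>\<bar> <= L * sqrt (h/m) * (\<xi>^2 * exp (\<xi>^2/m))"
proof -
 note [measurable] = lipschitz_measurable[OF F]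
 have L: "0 <= L" using F[of 1 0] by simp
 let ?E = gauss.expectation
 define s where "s = sqrt (m * h)"
 have s: "0 < s" using h m by (simp add: s_def)
 define G where "G v = F (x + s * v) - F x" for v
 have [measurable]: "G \<in> borel_measurable borel" unfolding G_def by measurable
 have G: "\<bar>G v\<bar> <= L * s * \<bar>v\<bar>" for v
  using F[of "x + s * v" x] s by (simp add: G_def abs_mult mult.assoc)
 have Gi: "integrable \<N> (%v. G (v + r))" for r
  using lipschitz_affine[OF F, of "x + s * r" s] by (simp add: G_def algebra_simps)
 have Gvi: "integrable \<N> (%v. G v * v)"
 proof (rule gauss_integrable_quadratic[where a=0 and b=0 and c="L * s"])
  show "\<bar>G v * v\<bar> <= 0 + 0 * \<bar>v\<bar> + L * s * v\<^sup>2" for v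
   using mult_right_mono[OF G, of "\<bar>v\<bar>" v] by (simp add: abs_mult power2_eq_square mult_ac)
 qed simp
 \<comment> \<open>\<open>A\<close> is the smoothed function at \<open>x\<close> and
   \<open>B\<close> its derivative with respect to \<xi>, expressed without derivatives of
   \<open>F\<close> by Gaussian integration by parts.\<close>
 define A B where "A = F x + ?E G" and "B = ?E (%v. G v * v)/sqrt m"
 have "\<bar>heat (m * h) F (x + sqrt h * \<xi>) - A - B * \<xi>\<bar> <= L * sqrt (h/m) * (\<xi>^2 * exp (\<xi>^2/m))" for \<xi>
 proof -
  define \<rho> where "\<rho> = \<xi>/sqrt m"
  have \<rho>s: "s * \<rho> = sqrt h * \<xi>" using m by (simp add: \<rho>_def s_def real_sqrt_mult)
  have \<rho>2: "\<rho>\<^sup>2 = \<xi>^2/m" using m by (simp add: \<rho>_def power_divide)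
  define Y where "Y v = exp (\<rho> * v - \<rho>\<^sup>2/2)" for v
  have [measurable]: "Y \<in> borel_measurable borel" unfolding Y_def by measurable
  note sh = gauss_exp_shift_integrable[where a=\<rho>, folded Y_def]
  have Y1: "integrable \<N> Y" "?E Y = 1"
   using sh[of "%_. 1"] gauss.prob_space by simp_all
  have Yv: "integrable \<N> (%v. v * Y v)" "?E (%v. v * Y v) = \<rho>"
   using sh[of "%v. v"] gauss.prob_space by simp_all
  have Y2: "integrable \<N> (%v. (Y v)^2)" "?E (%v. (Y v)^2) = exp (\<rho>^2)"
  proof -
   have "(Y v)\<^sup>2 = exp (\<rho>^2) * exp ((2 * \<rho>) * v - (2 * \<rho>)\<^sup>2/2)" for v
    by (simp add: Y_def exp_double[symmetric] exp_add[symmetric] power2_eq_square algebra_simps)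
   moreover note gauss_exp_shift_integrable[where a="2 * \<rho>" and f="%_. 1"]
   ultimately show "integrable \<N> (%v. (Y v)^2)" "?E (%v. (Y v)^2) = exp (\<rho>^2)"
    using gauss.prob_space by simp_all
  qed
  define K where "K v = Y v - 1 - \<rho> * v" for v
  have [measurable]: "K \<in> borel_measurable borel" unfolding K_def by measurable
  have Ksq: "(K v)\<^sup>2 = (Y v)^2 + 1 + \<rho>^2 * v^2 - 2 * Y v - 2 * \<rho> * (v * Y v) + 2 * \<rho> * v" for v
   by (simp add: K_def power2_eq_square algebra_simps)
  have K2: "integrable \<N> (%v. (K v)^2)" "?E (%v. (K v)^2) = exp (\<rho>^2) - 1 - \<rho>\<^sup>2"
   unfolding Ksq using Y1 Yv Y2 gauss.prob_space by (simp_all, simp add: power2_eq_square)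
  have "exp (\<rho>^2) - 1 - \<rho>\<^sup>2 <= (\<rho>^2)^2 * exp (\<rho>^2)"
  proof -
   have "1 - \<rho>\<^sup>2 <= exp (- \<rho>\<^sup>2)" using exp_ge_add_one_self[of "- \<rho>\<^sup>2"] by simp
   hence "(1 - \<rho>\<^sup>2) * exp (\<rho>^2) <= exp (- \<rho>\<^sup>2) * exp (\<rho>^2)" by (rule mult_right_mono) simp
   hence 1: "exp (\<rho>^2) - 1 <= \<rho>^2 * exp (\<rho>^2)" by (simp add: exp_add[symmetric] algebra_simps)
   from mult_left_mono[OF this, of "\<rho>\<^sup>2"] 1 show ?thesis by (simp add: power2_eq_square algebra_simps)
  qed
  hence EK: "?E (%v. (K v)^2) <= (\<rho>^2)^2 * exp (\<rho>^2)" by (simp add: K2)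
  have GY: "integrable \<N> (%v. G v * Y v)" "?E (%v. G v * Y v) = ?E (%v. G (v + \<rho>))"
   using sh[of G] Gi by simp_all
  have "heat (m * h) F (x + sqrt h * \<xi>) = ?E (%v. F x + G (v + \<rho>))"
   unfolding heat_def s_def[symmetric] G_def \<rho>s[symmetric] by (simp add: algebra_simps)
  also have "... = F x + ?E (%v. G v * Y v)" using Gi gauss.prob_space by (simp add: GY)
  finally have "heat (m * h) F (x + sqrt h * \<xi>) - A - B * \<xi>
    = ?E (%v. G v * Y v) - ?E G - \<rho> * ?E (%v. G v * v)"
   by (simp add: A_def B_def \<rho>_def)
  also have "... = ?E (%v. G v * Y v - G v - \<rho> * (G v * v))"
   using GY(1) Gi[of 0] Gvi by simp
  also have "... = ?E (%v. G v * K v)"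
   by (simp add: K_def right_diff_distrib mult.left_commute)
  finally have "heat (m * h) F (x + sqrt h * \<xi>) - A - B * \<xi> = ?E (%v. G v * K v)" .
  moreover have "\<bar>?E (%v. G v * K v)\<bar> <= L * s * (\<rho>^2 * exp (\<rho>^2))"
  proof (cases "\<rho> = 0")
   case True thus ?thesis by (simp add: K_def Y_def)
  next
   case False
   hence r: "0 < \<rho>\<^sup>2" by simp
   \<comment> \<open>Young's inequality in place of Cauchy-Schwarz. The weight
     \<open>\<rho>\<^sup>2\<close> balances the two terms, because \<open>v\<close> has second
     moment 1 and \<open>K\<close> has second moment at most
     \<open>(\<rho>\<^sup>2)\<^sup>2 * exp (\<rho>\<^sup>2)\<close>.\<close>
   have "\<bar>?E (%v. G v * K v)\<bar> <= ?E (%v. L * s * (1/2) * (\<rho>^2 * v^2 + (K v)^2 / \<rho>^2))"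
   proof (rule gauss_abs_integral_le)
    show "integrable \<N> (%v. G v * K v)"
     unfolding K_def using GY(1) Gi[of 0] Gvi by (simp add: right_diff_distrib mult.left_commute)
    show "integrable \<N> (%v. L * s * (1/2) * (\<rho>^2 * v^2 + (K v)^2 / \<rho>^2))"
     using K2 by simp
    fix v
    have "0 <= (\<rho>^2 * \<bar>v\<bar> - \<bar>K v\<bar>)^2 / \<rho>\<^sup>2" by simp
    also have "... = \<rho>^2 * v^2 + (K v)^2 / \<rho>^2 - 2 * (\<bar>v\<bar> * \<bar>K v\<bar>)"
    proof -
     have "(r * a - b)\<^sup>2/r = r * a^2 + b^2/r - 2 * (a * b)" if "0 < r" for a b r :: real
      using that by (simp add: power2_eq_square field_simps)
     from this[OF r, of "\<bar>v\<bar>" "\<bar>K v\<bar>"] show ?thesis by simp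
    qed
    finally have "\<bar>v\<bar> * \<bar>K v\<bar> <= 1/2 * (\<rho>^2 * v^2 + (K v)^2 / \<rho>^2)" by simp
    hence "(L * s) * (\<bar>v\<bar> * \<bar>K v\<bar>) <= (L * s) * (1/2 * (\<rho>^2 * v^2 + (K v)^2 / \<rho>^2))"
     using L s by (intro mult_left_mono) auto
    moreover have "\<bar>G v * K v\<bar> <= (L * s) * (\<bar>v\<bar> * \<bar>K v\<bar>)"
     using mult_right_mono[OF G, of "\<bar>K v\<bar>" v] by (simp add: abs_mult mult.assoc)
    ultimately show "\<bar>G v * K v\<bar> <= L * s * (1/2) * (\<rho>^2 * v^2 + (K v)^2 / \<rho>^2)" by (simp add: mult.assoc)
   qed
   also have "... = L * s * (1/2) * (\<rho>^2 + ?E (%v. (K v)^2) / \<rho>^2)"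
    using K2(1) by simp
   also have "... <= L * s * (1/2) * (\<rho>^2 * exp (\<rho>^2) + \<rho>^2 * exp (\<rho>^2))"
   proof (intro mult_left_mono add_mono)
    show "\<rho>\<^sup>2 <= \<rho>^2 * exp (\<rho>^2)" by (simp add: mult_le_cancel_left1)
    show "?E (%v. (K v)^2) / \<rho>^2 <= \<rho>^2 * exp (\<rho>^2)"
     using EK r by (simp add: divide_le_eq power2_eq_square mult_ac)
   qed (use L s in simp)
   finally show ?thesis by simp
  qed
  moreover have "L * s * (\<rho>^2 * exp (\<rho>^2)) = L * sqrt (h/m) * (\<xi>^2 * exp (\<xi>^2/m))"
  proof -
   have "s/m = sqrt (h/m)"
    using m h by (simp add: s_def real_sqrt_mult real_sqrt_divide field_simps)
   moreover have "L * s * (\<xi>^2/m * e) = L * (s/m) * (\<xi>^2 * e)" for e by simp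
   ultimately show ?thesis unfolding \<rho>2 by simp
  qed
  ultimately show ?thesis by simp
 qed
 thus ?thesis by (rule that)
qed

section \<open>The discrete decoupling field\<close>

text \<open>\<open>U j\<close> is the discrete decoupling field with \<open>j\<close> steps of length \<open>h\<close> remaining: an approximation of the solution of
 \<open>u\<^sub>s + u\<^sub>x\<^sub>x / 2 + (u\<^sub>x)\<^sup>2 u\<^sub>y = 0\<close>, \<open>u(1, x, y) = g x - \<delta> y\<close>.\<close>

locale scheme =
 fixes h c L \<Lambda> :: real and g \<delta> :: "real => real"
 assumes h: "0 < h" and c: "1 <= c" and L: "0 < L" and \<Lambda>: "0 < \<Lambda>"
  and small: "8 * L * \<Lambda> * sqrt h * c <= 1"
  and g_lipschitz: "!!x x'. \<bar>g x - g x'\<bar> <= L * \<bar>x - x'\<bar>"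
  and \<delta>_lipschitz: "!!y y'. \<bar>\<delta> y - \<delta> y'\<bar> <= \<Lambda> * \<bar>y - y'\<bar>"
  and g_mono: "mono g"
begin

primrec U :: "nat => real => real => real" where
 "U 0 = (%x y. g x - \<delta> y)"
| "U (Suc j) = gauss_step.step h c L (U j)"

definition Z :: "nat => real => real => real" where
 "Z j = gauss_step.z h c L (U j)"

lemma U_step_mono: "gauss_step h c L \<Lambda> (U j) & (\<forall>x x' y. x <= x' --> U j x y <= U j x' y)"
proof (induction j)
 case 0
 show ?case
  using g_lipschitz \<delta>_lipschitz g_mono h c L \<Lambda> small
  by (auto simp: gauss_step_def mono_def abs_minus_commute)
next
 case (Suc j)
 interpret S: gauss_step h c L \<Lambda> "U j" using Suc by simp
 have "gauss_step h c L \<Lambda> (U (Suc j))"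
  using h c L \<Lambda> small S.step_lipschitz_x S.step_lipschitz_y by (simp add: gauss_step_def)
 thus ?case using Suc S.step_mono by simp
qed

lemma gauss_step_U: "gauss_step h c L \<Lambda> (U j)"
 using U_step_mono by simp

lemma U_mono: "x <= x' ==> U j x y <= U j x' y"
 using U_step_mono[of j] by blast

lemmas U_lipschitz_x = gauss_step.lipx[OF gauss_step_U]
lemmas U_lipschitz_y = gauss_step.lipy[OF gauss_step_U]
lemmas Z_bound = gauss_step.z_bound[OF gauss_step_U, folded Z_def]
lemmas Z_measurable [measurable] = gauss_step.z_measurable[OF gauss_step_U, folded Z_def]
lemmas U_Suc = gauss_step.step_def[OF gauss_step_U, folded Z_def U.simps(2)]

lemma U_lipschitz: "\<bar>U j x y - U j x' y'\<bar> <= L * \<bar>x - x'\<bar> + \<Lambda> * \<bar>y - y'\<bar>"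
 using U_lipschitz_x[of j x y x'] U_lipschitz_y[of j x' y y'] by linarith

lemma U_measurable [measurable]: "(%p. U j (fst p) (snd p)) \<in> borel_measurable borel"
proof -
 have "(L + \<Lambda>)-lipschitz_on UNIV (%p. U j (fst p) (snd p))"
 proof (rule lipschitz_onI)
  fix p q :: "real \<times> real"
  have "L * \<bar>fst p - fst q\<bar> + \<Lambda> * \<bar>snd p - snd q\<bar> <= L * dist p q + \<Lambda> * dist p q"
   using dist_fst_le[of p q] dist_snd_le[of p q] L \<Lambda> by (intro add_mono mult_left_mono) (auto simp: dist_real_def)
  thus "dist (U j (fst p) (snd p)) (U j (fst q) (snd q)) <= (L + \<Lambda>) * dist p q"
   using U_lipschitz[of j "fst p" "snd p" "fst q" "snd q"] by (simp add: dist_real_def distrib_right)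
 qed (use L \<Lambda> in simp)
 thus ?thesis by (intro borel_measurable_continuous_onI lipschitz_on_continuous_on)
qed

lemma U_section_measurable [measurable]: "(%x. U j x y) \<in> borel_measurable borel"
 by (rule lipschitz_measurable[OF U_lipschitz_x])

lemma Z_sq_bound: "(Z j x y)\<^sup>2 <= L\<^sup>2"
 using Z_bound[of j x y] L by (simp add: abs_le_square_iff[symmetric])

lemma U_integrable [simp]: "integrable \<N> (%v. U j (x + s * v) y)"
 by (rule gauss_step.f_integrable[OF gauss_step_U])

text \<open>A step of the field is a heat step of length \<open>h\<close> with the time argument
  advanced by at most \<open>h * L\<^sup>2\<close>. The field is \<Lambda>-Lipschitz in
  \<open>y\<close> at every level, so the deviations simply add up.\<close>

lemma U_heat_close: "\<bar>U (j + m) x y - heat (m * h) (%x. U j x y) x\<bar> <= m * h * (\<Lambda> * L^2)"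
proof (induction m arbitrary: x)
 case (Suc m)
 let ?E = gauss.expectation and ?F = "%x. U j x y"
 define Y where "Y = y + h * (Z (j + m) x y)\<^sup>2"
 have lip: "\<bar>heat (m * h) ?F x - heat (m * h) ?F x'\<bar> <= L * \<bar>x - x'\<bar>" for x x'
 proof -
  have eq: "heat (m * h) ?F x - heat (m * h) ?F x' = ?E (%v. U j (x + sqrt (m * h) * v) y - U j (x' + sqrt (m * h) * v) y)"
   by (simp add: heat_def)
  have "\<bar>?E (%v. U j (x + sqrt (m * h) * v) y - U j (x' + sqrt (m * h) * v) y)\<bar> <= ?E (%v. L * \<bar>x - x'\<bar>)"
  proof (rule gauss_abs_integral_le)
   show "\<bar>U j (x + sqrt (m * h) * v) y - U j (x' + sqrt (m * h) * v) y\<bar> <= L * \<bar>x - x'\<bar>" for v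
    using U_lipschitz_x[of j "x + sqrt (m * h) * v" y "x' + sqrt (m * h) * v"] by simp
  qed (rule Bochner_Integration.integrable_diff U_integrable gauss.integrable_const)+
  thus ?thesis using gauss.prob_space unfolding eq by simp
 qed
 have hi: "integrable \<N> (%v. heat (m * h) ?F (x + sqrt h * v))"
  by (rule lipschitz_affine[OF lip])
 have "heat h (heat (m * h) ?F) x = heat (h + m * h) ?F x"
  using h by (intro heat_semigroup) auto
 moreover have "h + m * h = Suc m * h" by (simp add: distrib_right)
 ultimately have "heat (Suc m * h) ?F x = ?E (%v. heat (m * h) ?F (x + sqrt h * v))"
  by (metis heat_def)
 moreover have "U (j + Suc m) x y = ?E (%v. U (j + m) (x + sqrt h * v) Y)"
  unfolding Y_def add_Suc_right by (rule U_Suc)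
 ultimately have eq: "U (j + Suc m) x y - heat (Suc m * h) ?F x
   = ?E (%v. U (j + m) (x + sqrt h * v) Y - heat (m * h) ?F (x + sqrt h * v))"
  using hi by (simp del: U.simps)
 have "\<bar>?E (%v. U (j + m) (x + sqrt h * v) Y - heat (m * h) ?F (x + sqrt h * v))\<bar> <= ?E (%v. Suc m * h * (\<Lambda> * L^2))"
 proof (rule gauss_abs_integral_le)
  fix v
  have "\<Lambda> * \<bar>Y - y\<bar> <= \<Lambda> * (h * L^2)"
   using Z_sq_bound[of "j + m" x y] h \<Lambda> by (simp add: Y_def mult_left_mono)
  moreover have "Suc m * h * (\<Lambda> * L^2) = m * h * (\<Lambda> * L^2) + \<Lambda> * (h * L^2)" by (simp add: algebra_simps)
  ultimately show "\<bar>U (j + m) (x + sqrt h * v) Y - heat (m * h) ?F (x + sqrt h * v)\<bar> <= Suc m * h * (\<Lambda> * L^2)"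
   using U_lipschitz_y[of "j + m" "x + sqrt h * v" Y y] Suc.IH[of "x + sqrt h * v"] by linarith
 qed (use hi in simp_all)
 thus ?case using gauss.prob_space unfolding eq by simp
qed simp

text \<open>Mean square error of one step of the embedding: \<open>s * v\<close> is the Brownian
  increment obtained for the clock time \<open>s\<^sup>2\<close>, and it has to match the increment
  of the field.\<close>

definition residual :: "nat => real => real => real => real" where
 "residual j x y s = gauss.expectation (%v.
   (U j (x + sqrt h * v) (y + h * (Z j x y)^2) - U (Suc j) x y - s * v)\<^sup>2)"

text \<open>The slope \<open>s\<close> is compared with the optimal one through
  \<open>sqrt h * Z\<close>. The truncation error contributes the square
  \<open>9 * L\<^sup>2 * h / c^4\<close>, doubled to 18 when the two deviations are
  separated.\<close>

lemma residual_le: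
 "residual j x y s <= gauss.expectation (%v. (U j (x + sqrt h * v) (y + h * (Z j x y)^2) - A - B * v)^2)
  + 18 * L^2 * h/c^4 + 2 * (sqrt h * Z j x y - s)\<^sup>2"
proof -
 define Y where "Y = y + h * (Z j x y)\<^sup>2"
 let ?E = gauss.expectation and ?F = "%v. U j (x + sqrt h * v) Y"
 have "residual j x y s = ?E (%v. (?F v - ?E ?F - s * v)^2)"
  by (simp add: residual_def Y_def U_Suc del: U.simps)
 also have "... <= ?E (%v. (?F v - A - B * v)^2) + (?E (%v. v * ?F v) - s)\<^sup>2"
 proof (rule gauss_regression)
  show "\<bar>?F v\<bar> <= \<bar>U j x Y\<bar> + (L * sqrt h) * \<bar>v\<bar>" for v
   using U_lipschitz_x[of j "x + sqrt h * v" Y x] h by (simp add: abs_mult mult.assoc)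
 qed simp
 also have "(?E (%v. v * ?F v) - s)\<^sup>2 <= 18 * L^2 * h/c^4 + 2 * (sqrt h * Z j x y - s)\<^sup>2"
 proof -
  define a b where "a = ?E (%v. v * ?F v) - sqrt h * Z j x y" and "b = sqrt h * Z j x y - s"
  have "\<bar>a\<bar> <= 3 * L * sqrt h/c\<^sup>2"
   using gauss_step.correlation_close[OF gauss_step_U[of j], of x y] by (simp add: a_def Y_def Z_def)
  hence "a\<^sup>2 <= (3 * L * sqrt h/c^2)\<^sup>2" by (metis abs_ge_zero power2_abs power_mono)
  also have "... = 9 * L^2 * h/c^4" using h by (simp add: power_divide power_mult_distrib flip: power_mult)
  finally have "a\<^sup>2 <= 9 * L^2 * h/c^4" .
  moreover have "(a + b)\<^sup>2 <= 2 * a^2 + 2 * b\<^sup>2"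
   using zero_le_power2[of "a - b"] by (simp add: power2_eq_square algebra_simps)
  ultimately have "(a + b)\<^sup>2 <= 18 * L^2 * h/c^4 + 2 * b\<^sup>2" by simp
  thus ?thesis by (simp add: a_def b_def)
 qed
 finally show ?thesis by (simp add: Y_def)
qed

text \<open>Comparison with a constant. It serves for the levels with fewer than \<open>m\<close>
  steps remaining, where the field has not been smoothed enough.\<close>

lemma residual_crude:
 "residual j x y s <= L^2 * h + 18 * L^2 * h/c^4 + 2 * (sqrt h * Z j x y - s)\<^sup>2"
proof -
 define Y where "Y = y + h * (Z j x y)\<^sup>2"
 let ?E = gauss.expectation and ?F = "%v. U j (x + sqrt h * v) Y"
 have le: "(?F v - U j x Y - 0 * v)\<^sup>2 <= L^2 * h * v\<^sup>2" for v
 proof -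
  have "\<bar>?F v - U j x Y\<bar> <= \<bar>L * sqrt h * v\<bar>"
   using U_lipschitz_x[of j "x + sqrt h * v" Y x] h L by (simp add: abs_mult mult.assoc)
  hence "(?F v - U j x Y)\<^sup>2 <= (L * sqrt h * v)\<^sup>2" by (simp only: abs_le_square_iff)
  thus ?thesis using h by (simp add: power_mult_distrib)
 qed
 have "?E (%v. (?F v - U j x Y - 0 * v)^2) <= ?E (%v. L^2 * h * v^2)"
 proof (intro integral_mono le)
  show "integrable \<N> (%v. (?F v - U j x Y - 0 * v)^2)"
   by (rule gauss_integrable_quadratic[where a=0 and b=0 and c="L\<^sup>2 * h"]) (use le in auto)
 qed simp
 also have "... = L^2 * h" by simp
 finally show ?thesis
  using residual_le[of j x y s "U j x Y" 0] by (simp add: Y_def)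
qed

text \<open>With \<open>m\<close> steps still to come the field is close to a heat flow over time
  \<open>m * h\<close>, which is affine on the scale \<open>sqrt h\<close>. The two squared errors
  are of order \<open>m\<^sup>2 * h\<^sup>2\<close> and \<open>h / m\<close>; summed over
  \<open>1 / h\<close> steps they vanish if \<open>m\<close> is taken large first and
  \<open>h\<close> small afterwards.\<close>

lemma residual_fine:
 fixes m j :: nat
 assumes "8 <= m" "m <= j"
 shows "residual j x y s <= 2 * (m * h * (\<Lambda> * L^2))^2 + 2 * L^2 * (h/m) * gauss_exp_moment
  + 18 * L^2 * h/c^4 + 2 * (sqrt h * Z j x y - s)\<^sup>2"
proof -
 define Y where "Y = y + h * (Z j x y)\<^sup>2"
 let ?E = gauss.expectation and ?F = "%v. U j (x + sqrt h * v) Y"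
 have m: "0 < real m" using assms by simp
 obtain A B where AB: "!!v. \<bar>heat (m * h) (%x. U (j - m) x Y) (x + sqrt h * v) - A - B * v\<bar>
   <= L * sqrt (h/m) * (v^2 * exp (v^2/m))"
  using heat_affine_approx[of "%x. U (j - m) x Y" L h "real m" x, OF U_lipschitz_x h m] by metis
 have le: "(?F v - A - B * v)\<^sup>2 <= 2 * (m * h * (\<Lambda> * L^2))^2 + 2 * L^2 * (h/m) * (v^4 * exp (v^2/4))" for v
 proof -
  define a b where "a = ?F v - heat (m * h) (%x. U (j - m) x Y) (x + sqrt h * v)"
   and "b = heat (m * h) (%x. U (j - m) x Y) (x + sqrt h * v) - A - B * v"
  have "\<bar>a\<bar> <= m * h * (\<Lambda> * L^2)"
   using U_heat_close[of "j - m" m "x + sqrt h * v" Y] assms by (simp add: a_def)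
  hence a: "a\<^sup>2 <= (m * h * (\<Lambda> * L^2))\<^sup>2" by (metis abs_ge_zero power2_abs power_mono)
  have "b\<^sup>2 <= (L * sqrt (h/m) * (v^2 * exp (v^2/m)))\<^sup>2"
   using AB[of v] unfolding b_def by (metis abs_ge_zero power2_abs power_mono)
  also have "... = L^2 * (h/m) * (v^4 * exp (2 * v^2/m))"
  proof -
   have "(L * sqrt (h/m))\<^sup>2 = L^2 * (h/m)" using h by (simp add: power_mult_distrib)
   moreover have "(v^2 * exp (v^2/m))\<^sup>2 = v^4 * exp (2 * v^2/m)"
    using exp_double[of "v\<^sup>2/m"] by (simp add: power_mult_distrib flip: power_mult)
   ultimately show ?thesis by (simp only: power_mult_distrib[of "L * sqrt (h/m)"])
  qed
  also have "... <= L^2 * (h/m) * (v^4 * exp (v^2/4))"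
  proof (intro mult_left_mono)
   have "2 * v^2/m <= 2 * v^2/8" using assms by (intro divide_left_mono) auto
   thus "exp (2 * v^2/m) <= exp (v^2/4)" by simp
  qed (use h in auto)
  finally have "2 * b^2 <= 2 * L^2 * (h/m) * (v^4 * exp (v^2/4))" by simp
  moreover have "(a + b)\<^sup>2 <= 2 * a^2 + 2 * b\<^sup>2"
   using zero_le_power2[of "a - b"] by (simp add: power2_eq_square algebra_simps)
  moreover have "a + b = ?F v - A - B * v" by (simp add: a_def b_def)
  ultimately show ?thesis using a by simp
 qed
 let ?G = "%v. 2 * (m * h * (\<Lambda> * L^2))^2 + 2 * L^2 * (h/m) * (v^4 * exp (v^2/4))"
 note Gi = integrable_mult_right[OF gauss_exp_moment_integrable]
 have "?E (%v. (?F v - A - B * v)^2) <= ?E ?G"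
 proof (rule integral_mono')
  show "integrable \<N> ?G"
   by (intro Bochner_Integration.integrable_add Gi) simp
 qed (use le order_trans[OF zero_le_power2 le] in blast)+
 also have "?E ?G = ?E (%_. 2 * (m * h * (\<Lambda> * L^2))^2) + ?E (%v. 2 * L^2 * (h/m) * (v^4 * exp (v^2/4)))"
  by (intro Bochner_Integration.integral_add Gi) simp
 also have "?E (%v. 2 * L^2 * (h/m) * (v^4 * exp (v^2/4))) = 2 * L^2 * (h/m) * gauss_exp_moment"
  unfolding gauss_exp_moment_def by (rule integral_mult_right_zero)
 also have "?E (%_. 2 * (m * h * (\<Lambda> * L^2))^2) = 2 * (m * h * (\<Lambda> * L^2))\<^sup>2"
  using gauss.prob_space by simp
 finally show ?thesis
  using residual_le[of j x y s A B] by (simp add: Y_def)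
qed

end

text \<open>A bound for the propagated slope valid for \<open>|x| <= 2\<close> and remaining time in
  \<open>[1/2, 1]\<close>: the exponential collects the Cauchy-Schwarz losses of all steps, the
  squared factor is a lower bound for the heat flow started from the indicator of
  \<open>[a, b]\<close>.\<close>

definition slope_bound :: "real => real => real => real => real => real" where
 "slope_bound L \<Lambda> \<kappa> a b =
   \<kappa> * exp (- 32 * L^2 * \<Lambda>\<^sup>2) * ((b - a) * std_normal_density (2 * (max \<bar>a\<bar> \<bar>b\<bar> + 2)))\<^sup>2"

lemma slope_bound_pos: "0 < \<kappa> ==> a < b ==> 0 < slope_bound L \<Lambda> \<kappa> a b"
 unfolding slope_bound_def by (intro mult_pos_pos zero_less_power normal_density_pos) auto

lemma heat_indicator_bounds:
 "0 <= heat t (indicator {a..b}) x" "heat t (indicator {a..b}) x <= 1"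
proof -
 have i: "integrable \<N> (%u. indicator {a..b} (x + sqrt t * u) :: real)"
  by (rule gauss_integrable_quadratic[where a=1 and b=0 and c=0]) (auto simp: indicator_def)
 show "0 <= heat t (indicator {a..b}) x" unfolding heat_def by simp
 have "heat t (indicator {a..b}) x <= gauss.expectation (%_. 1)"
  unfolding heat_def by (intro integral_mono i) (auto simp: indicator_def)
 thus "heat t (indicator {a..b}) x <= 1" using gauss.prob_space by simp
qed

text \<open>Since \<open>1/2 <= sqrt t <= 1\<close>, in the standardised variable the interval
  becomes no shorter and stays within the radius \<open>2 * (max |a| |b| + 2)\<close>, where the
  density is smallest at the edge.\<close>

lemma heat_indicator_ge:
 assumes "a <= b" "\<bar>x\<bar> <= 2" "1/2 <= t" "t <= 1"
 shows "(b - a) * std_normal_density (2 * (max \<bar>a\<bar> \<bar>b\<bar> + 2)) <= heat t (indicator {a..b}) x"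
proof -
 define s where "s = sqrt t"
 have "1/4 <= t" using assms by simp
 hence s: "1/2 <= s" "s <= 1" using assms real_le_rsqrt[of "1/2" t] by (auto simp: s_def power2_eq_square)
 have eq: "indicator {a..b} (x + s * u) = (indicator {(a - x)/s..(b - x)/s} u :: real)" for u
  using s by (auto simp: indicator_def divide_le_eq le_divide_eq algebra_simps)
 have bd: "\<bar>(v - x)/s\<bar> <= 2 * (max \<bar>a\<bar> \<bar>b\<bar> + 2)" if "v = a \<or> v = b" for v
 proof -
  have "\<bar>v - x\<bar> <= max \<bar>a\<bar> \<bar>b\<bar> + 2" using that assms by auto
  also have "... <= (2 * (max \<bar>a\<bar> \<bar>b\<bar> + 2)) * s"
   using mult_left_mono[OF s(1), of "2 * (max \<bar>a\<bar> \<bar>b\<bar> + 2)"] by simp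
  finally show ?thesis using s by (simp add: abs_divide pos_divide_le_eq)
 qed
 have "(b - a) * s <= (b - a) * 1" using s assms by (intro mult_left_mono) auto
 hence "b - a <= (b - a)/s" using s by (simp add: pos_le_divide_eq)
 hence "(b - a) * std_normal_density (2 * (max \<bar>a\<bar> \<bar>b\<bar> + 2))
   <= ((b - x)/s - (a - x)/s) * std_normal_density (2 * (max \<bar>a\<bar> \<bar>b\<bar> + 2))"
  by (intro mult_right_mono) (auto simp: diff_divide_distrib[symmetric])
 also have "... <= measure \<N> {(a - x)/s..(b - x)/s}"
  using s assms bd[of a] bd[of b] by (intro gauss_interval_ge) (auto simp: divide_right_mono)
 also have "... = heat t (indicator {a..b}) x" unfolding heat_def s_def[symmetric] eq by simp
 finally show ?thesis .
qed

context scheme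
begin

lemma Z_nonneg: "0 <= Z j x y"
 using gauss_step.z_ge[OF gauss_step_U[of j], of 0 x y] U_mono[of _ _ j] by (simp add: Z_def)

text \<open>Squares of heat solutions are stable under tilted averages: Cauchy-Schwarz returns the
  square of the averaged solution with one more factor in the denominator. An indicator is its own
  square, so the recursion starts from \<kappa> on \<open>[a, b]\<close>.\<close>

definition slope_density :: "real => real => real => nat => real => real" where
 "slope_density \<kappa> a b j t = \<kappa> * (heat (j * h) (indicator {a..b}) t)^2/(1 + 32 * L^2 * \<Lambda>\<^sup>2 * h)^j"

lemma slope_density_measurable [measurable]: "slope_density \<kappa> a b j \<in> borel_measurable borel"
 unfolding slope_density_def by measurable

lemma heat_indicator_Suc:
 "gauss.expectation (%u. heat (j * h) (indicator {a..b}) (t + sqrt h * u)) = heat (Suc j * h) (indicator {a..b}) t"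
proof -
 have "heat h (heat (j * h) (indicator {a..b})) t = heat (h + j * h) (indicator {a..b}) t"
 proof (rule heat_semigroup)
  show "integrable \<N> (%u. indicator {a..b} (t + sqrt (h + j * h) * u) :: real)"
   by (rule gauss_integrable_quadratic[where a=1 and b=0 and c=0]) (auto simp: indicator_def)
 qed (use h in auto)
 moreover have "h + j * h = Suc j * h" by (simp add: distrib_right)
 ultimately show ?thesis by (metis heat_def)
qed

lemma slope_density_step:
 assumes \<kappa>: "0 < \<kappa>" and \<theta>: "\<bar>\<theta>\<bar> <= 4 * L * \<Lambda> * sqrt h" "\<bar>\<theta>\<bar> * c <= 1/2"
 shows "ennreal (slope_density \<kappa> a b (Suc j) t)
  <= (nn_integral \<N> (%u. ennreal ((1 + \<theta> * clip c u) * slope_density \<kappa> a b j (t + sqrt h * u))))"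
proof -
 interpret S: gauss_step h c L \<Lambda> "U j" by (rule gauss_step_U)
 let ?E = gauss.expectation
 define p where "p u = heat (j * h) (indicator {a..b}) (t + sqrt h * u)" for u
 define q where "q = 1 + 32 * L^2 * \<Lambda>\<^sup>2 * h"
 have q: "0 < q" using h by (simp add: q_def add_pos_nonneg)
 have [measurable]: "p \<in> borel_measurable borel" unfolding p_def by measurable
 have p: "0 <= p u" "p u <= 1" for u unfolding p_def by (rule heat_indicator_bounds)+
 note W = S.tilt_pos[OF \<theta>(2)]
 have W0: "0 <= 1 + \<theta> * clip c u" for u using W(1)[of u] by linarith
 have int: "integrable \<N> (%u. (1 + \<theta> * clip c u) * (p u)^2)"
 proof (rule gauss_integrable_quadratic[where a=2 and b=0 and c=0])
  fix u
  have "(1 + \<theta> * clip c u) * (p u)^2 <= 2 * 1"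
   using W(2)[of u] p[of u] by (intro mult_mono power_le_one) auto
  thus "\<bar>(1 + \<theta> * clip c u) * (p u)\<^sup>2\<bar> <= 2 + 0 * \<bar>u\<bar> + 0 * u\<^sup>2" using W0[of u] by simp
 qed simp
 have "(?E p)\<^sup>2/q <= ?E (%u. (1 + \<theta> * clip c u) * (p u)^2)"
  unfolding q_def by (rule S.tilted_square_ge[OF _ p \<theta>]) simp
 hence "\<kappa>/q^j * ((?E p)^2/q) <= \<kappa>/q^j * ?E (%u. (1 + \<theta> * clip c u) * (p u)^2)"
  using \<kappa> q by (intro mult_left_mono) auto
 hence "slope_density \<kappa> a b (Suc j) t <= ?E (%u. \<kappa>/q^j * ((1 + \<theta> * clip c u) * (p u)^2))"
  unfolding slope_density_def heat_indicator_Suc[symmetric] p_def[symmetric] q_def[symmetric] using q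
  by (simp add: mult.commute)
 hence "ennreal (slope_density \<kappa> a b (Suc j) t) <= ennreal (?E (%u. \<kappa>/q^j * ((1 + \<theta> * clip c u) * (p u)^2)))"
  by (rule ennreal_leI)
 also have "... = (nn_integral \<N> (%u. ennreal (\<kappa>/q^j * ((1 + \<theta> * clip c u) * (p u)^2))))"
  using int \<kappa> q W0 by (intro nn_integral_eq_integral[symmetric] integrable_mult_right always_eventually allI mult_nonneg_nonneg) auto
 also have "... = (nn_integral \<N> (%u. ennreal ((1 + \<theta> * clip c u) * slope_density \<kappa> a b j (t + sqrt h * u))))"
  unfolding slope_density_def p_def q_def by (intro nn_integral_cong arg_cong[where f=ennreal]) simp
 finally show ?thesis .
qed

lemma U_slope_integral:
 assumes \<kappa>: "0 < \<kappa>"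
  and g_slope: "!!x x'. x <= x' ==> (\<integral>\<^sup>+t\<in>{x..x'}. ennreal (\<kappa> * indicator {a..b} t) \<partial>lborel) <= ennreal (g x' - g x)"
 shows "x <= x' ==> (\<integral>\<^sup>+t\<in>{x..x'}. ennreal (slope_density \<kappa> a b j t) \<partial>lborel) <= ennreal (U j x' y - U j x y)"
proof (induction j arbitrary: x x' y)
 case 0
 have "(indicator {a..b} t)\<^sup>2 = (indicator {a..b} t :: real)" for t by (simp add: indicator_def)
 thus ?case using g_slope[OF 0] by (simp add: slope_density_def)
next
 case (Suc j)
 interpret S: gauss_step h c L \<Lambda> "U j" by (rule gauss_step_U)
 have nn: "0 <= slope_density \<kappa> a b j t" for t
  using \<kappa> h by (simp add: slope_density_def)
 show ?case unfolding U.simps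
  by (rule S.step_slope[OF slope_density_measurable slope_density_measurable nn Suc.IH U_mono slope_density_step[OF \<kappa>] Suc.prems])
qed

lemma U_slope:
 assumes \<kappa>: "0 < \<kappa>" and "a < b"
  and g_slope: "!!x x'. x <= x' ==> (\<integral>\<^sup>+t\<in>{x..x'}. ennreal (\<kappa> * indicator {a..b} t) \<partial>lborel) <= ennreal (g x' - g x)"
  and j: "1/2 <= j * h" "j * h <= 1" and x: "-2 <= x" "x <= x'" "x' <= 2"
 shows "slope_bound L \<Lambda> \<kappa> a b * (x' - x) <= U j x' y - U j x y"
proof -
 define q where "q = 1 + 32 * L^2 * \<Lambda>\<^sup>2 * h"
 have q: "0 < q" using h by (simp add: q_def add_pos_nonneg)
 have "q^j <= exp (32 * L^2 * \<Lambda>\<^sup>2 * h)^j"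
  using q unfolding q_def by (intro power_mono exp_ge_add_one_self) auto
 also have "... = exp (32 * L^2 * \<Lambda>\<^sup>2 * (j * h))" by (simp add: exp_of_nat_mult[symmetric] mult_ac)
 also have "... <= exp (32 * L^2 * \<Lambda>\<^sup>2)" using j by (simp add: mult_left_le)
 finally have qj: "1/exp (32 * L^2 * \<Lambda>\<^sup>2) <= 1/q^j" using q by (intro divide_left_mono) auto
 have sd: "slope_bound L \<Lambda> \<kappa> a b <= slope_density \<kappa> a b j t" if "t \<in> {x..x'}" for t
 proof -
  let ?r = "(b - a) * std_normal_density (2 * (max \<bar>a\<bar> \<bar>b\<bar> + 2))"
  have "?r\<^sup>2 <= (heat (j * h) (indicator {a..b}) t)\<^sup>2"
   using heat_indicator_ge[of a b t "j * h"] that x j \<open>a < b\<close> by (intro power_mono) auto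
  hence "\<kappa> * ?r\<^sup>2 * (1/exp (32 * L^2 * \<Lambda>\<^sup>2)) <= \<kappa> * (heat (j * h) (indicator {a..b}) t)^2 * (1/q^j)"
   using \<kappa> qj by (intro mult_mono) auto
  thus ?thesis
   unfolding slope_bound_def slope_density_def q_def[symmetric] by (simp add: exp_minus inverse_eq_divide)
 qed
 have "ennreal (slope_bound L \<Lambda> \<kappa> a b * (x' - x)) = (\<integral>\<^sup>+t\<in>{x..x'}. ennreal (slope_bound L \<Lambda> \<kappa> a b) \<partial>lborel)"
  using x slope_bound_pos[OF \<kappa> \<open>a < b\<close>, of L \<Lambda>] by (simp add: nn_integral_cmult_indicator ennreal_mult)
 also have "... <= (\<integral>\<^sup>+t\<in>{x..x'}. ennreal (slope_density \<kappa> a b j t) \<partial>lborel)"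
  by (intro nn_integral_mono) (auto simp: indicator_def intro!: ennreal_leI sd)
 also have "... <= ennreal (U j x' y - U j x y)"
  using U_slope_integral[OF \<kappa> g_slope] x by simp
 finally show ?thesis using U_mono[OF x(2), of j y] by simp
qed

lemma Z_ge:
 assumes \<kappa>: "0 < \<kappa>" and "a < b"
  and g_slope: "!!x x'. x <= x' ==> (\<integral>\<^sup>+t\<in>{x..x'}. ennreal (\<kappa> * indicator {a..b} t) \<partial>lborel) <= ennreal (g x' - g x)"
  and j: "1/2 <= j * h" "j * h <= 1" and "h <= 1" "\<bar>x\<bar> <= 1"
 shows "slope_bound L \<Lambda> \<kappa> a b * inner_variance <= Z j x y"
proof -
 have "sqrt h <= 1" using \<open>h <= 1\<close> by simp
 hence "-2 <= x - sqrt h" "x + sqrt h <= 2" using \<open>\<bar>x\<bar> <= 1\<close> by linarith+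
 thus ?thesis unfolding Z_def
  using slope_bound_pos[OF \<kappa> \<open>a < b\<close>, of L \<Lambda>] U_mono[of _ _ j] \<open>\<bar>x\<bar> <= 1\<close>
  by (intro gauss_step.z_ge[OF gauss_step_U] U_slope[OF \<kappa> \<open>a < b\<close> g_slope j]) auto
qed

end

section \<open>Filtered Brownian motion\<close>

text \<open>Instances are \<open>W\<close> and the time-changed integral. The law of an increment is
  given as a scaling of \<open>\<N>\<close>, jointly with its independence of the past; the null
  sets belong to every \<open>F t\<close>, so almost sure modifications remain adapted.\<close>

locale filtered_bm = prob_space M for M :: "'a measure" +
 fixes F :: "real => 'a measure" and B :: "real => 'a => real"
 assumes subalgebra_F: "!!t. 0 <= t ==> subalgebra M (F t)"
  and F_mono: "!!s t. 0 <= s ==> s <= t ==> sets (F s) \<subseteq> sets (F t)"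
  and null_F: "!!t. 0 <= t ==> null_sets M \<subseteq> sets (F t)"
  and adapted: "!!t. 0 <= t ==> B t \<in> borel_measurable (F t)"
  and increment: "!!s t A C. 0 <= s ==> s < t ==> A \<in> sets (F s) ==> C \<in> sets borel ==>
    prob (A \<inter> {w\<in>space M. B t w - B s w \<in> C})
    = prob A * measure \<N> {x. sqrt (t - s) * x \<in> C}"
  and start: "AE w in M. B 0 w = 0"
  and continuous_paths: "AE w in M. continuous_on {0..} (%t. B t w)"
begin

lemma space_F: "0 <= t ==> space (F t) = space M"
 using subalgebra_F by (simp add: subalgebra_def)

lemma sets_F: "0 <= t ==> A \<in> sets (F t) ==> A \<in> sets M"
 using subalgebra_F by (auto simp: subalgebra_def)

lemma measurable_F: "0 <= t ==> f \<in> measurable (F t) N ==> f \<in> measurable M N"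
 using subalgebra_F measurable_from_subalg by blast

lemma measurable_F_mono: "0 <= s ==> s <= t ==> f \<in> measurable (F s) N ==> f \<in> measurable (F t) N"
 using F_mono[of s t] space_F[of s] space_F[of t] by (auto simp: measurable_def)

lemma B_measurable: "0 <= t ==> B t \<in> borel_measurable M"
 using measurable_F adapted by blast

lemma space_in_F: "0 <= t ==> space M \<in> sets (F t)"
 using space_F sets.top[of "F t"] by simp

text \<open>\<open>distr M (F s) (%w. w)\<close> is the restriction of the probability to
  \<open>F s\<close>. The product form turns the freezing of everything known at time
  \<open>s\<close> into an instance of Fubini.\<close>

lemma distr_increment:
 assumes "0 <= s" "s < t"
 defines "\<eta> \<equiv> %w. (B t w - B s w)/sqrt (t - s)"
 shows "distr M (F s) (%w. w) \<Otimes>\<^sub>M \<N> = distr M (F s \<Otimes>\<^sub>M borel) (%w. (w, \<eta> w))"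
proof -
 have t: "0 <= t" using assms by simp
 have [measurable]: "B t \<in> borel_measurable M" "B s \<in> borel_measurable M"
  using assms by (auto intro: B_measurable)
 have \<eta>[measurable]: "\<eta> \<in> borel_measurable M" unfolding \<eta>_def by measurable
 have r: "0 < sqrt (t - s)" using assms by simp
 have key: "prob (A \<inter> (\<eta> -` C \<inter> space M)) = prob A * measure \<N> C"
  if "A \<in> sets (F s)" "C \<in> sets borel" for A C
 proof -
  have [measurable]: "C \<in> sets borel" by fact
  have C': "{x. x/sqrt (t - s) \<in> C} \<in> sets borel" by measurable
  have "A \<inter> (\<eta> -` C \<inter> space M) = A \<inter> {w\<in>space M. B t w - B s w \<in> {x. x/sqrt (t - s) \<in> C}}"
   by (auto simp: \<eta>_def)
  thus ?thesis
   using increment[OF assms(1,2) that(1) C'] r by simp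
 qed
 have [measurable]: "(%w. w) \<in> measurable M (F s)"
  using subalgebra_F[OF assms(1)] by (auto simp: measurable_def subalgebra_def)
 interpret D: prob_space "distr M (F s) (%w. w)" by (rule prob_space_distr) simp
 show ?thesis
 proof (rule pair_measure_eqI)
  fix A C assume A: "A \<in> sets (distr M (F s) (%w. w))" and C: "C \<in> sets \<N>"
  hence [measurable]: "A \<in> sets (F s)" "C \<in> sets borel" by auto
  have A': "A \<subseteq> space M" using sets.sets_into_space[of A "F s"] space_F[OF assms(1)] by simp
  have "(%w. (w, \<eta> w)) -` (A \<times> C) \<inter> space M = A \<inter> (\<eta> -` C \<inter> space M)" by auto
  thus "emeasure (distr M (F s) (%w. w)) A * emeasure \<N> C
   = emeasure (distr M (F s \<Otimes>\<^sub>M borel) (%w. (w, \<eta> w))) (A \<times> C)"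
   using key[of A C] A'
   by (simp add: emeasure_distr emeasure_eq_measure gauss.emeasure_eq_measure ennreal_mult' Int_absorb2)
 next
  show "sets (distr M (F s) (%w. w) \<Otimes>\<^sub>M \<N>) = sets (distr M (F s \<Otimes>\<^sub>M borel) (%w. (w, \<eta> w)))"
   by (simp only: sets_distr) (intro sets_pair_measure_cong, simp_all)
 qed (rule D.sigma_finite_measure_axioms gauss.sigma_finite_measure_axioms)+
qed

lemma nn_integral_increment:
 assumes "0 <= s" "s < t" and [measurable]: "\<Psi> \<in> borel_measurable (F s \<Otimes>\<^sub>M borel)"
 shows "(nn_integral M (%w. \<Psi> (w, (B t w - B s w)/sqrt (t - s))))
  = (nn_integral M (%w. (nn_integral \<N> (%x. \<Psi> (w, x)))))"
proof -
 let ?\<eta> = "%w. (B t w - B s w)/sqrt (t - s)"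
 have [measurable]: "B t \<in> borel_measurable M" "B s \<in> borel_measurable M"
  using assms(1,2) by (auto intro: B_measurable)
 have [measurable]: "(%w. w) \<in> measurable M (F s)"
  using subalgebra_F[OF assms(1)] by (auto simp: measurable_def subalgebra_def)
 interpret D: prob_space "distr M (F s) (%w. w)" by (rule prob_space_distr) simp
 have [measurable_cong]: "sets \<N> = sets borel" by simp
 have eq: "distr M (F s) (%w. w) \<Otimes>\<^sub>M \<N> = distr M (F s \<Otimes>\<^sub>M borel) (%w. (w, ?\<eta> w))"
  by (rule distr_increment[OF assms(1,2)])
 have "(nn_integral M (%w. \<Psi> (w, ?\<eta> w))) = integral\<^sup>N (distr M (F s \<Otimes>\<^sub>M borel) (%w. (w, ?\<eta> w))) \<Psi>"
  by (subst nn_integral_distr) auto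
 also have "... = (\<integral>\<^sup>+w. (nn_integral \<N> (%x. \<Psi> (w, x))) \<partial>distr M (F s) (%w. w))"
  unfolding eq[symmetric] by (subst gauss.nn_integral_fst) auto
 also have "... = (nn_integral M (%w. (nn_integral \<N> (%x. \<Psi> (w, x)))))"
  by (subst nn_integral_distr) auto
 finally show ?thesis .
qed

text \<open>A state \<open>S\<close> at a random index \<open>J\<close> of the mesh of width \<open>1 / p\<close> that is known at the time \<open>J / p\<close>.\<close>

definition adapted_state :: "nat => ('a => nat) => ('a => 's::topological_space) => bool" where
 "adapted_state p J S \<longleftrightarrow> (\<forall>j::nat. \<forall>A\<in>sets borel. {w\<in>space M. J w = j & S w \<in> A} \<in> sets (F (j/p)))"

lemma adapted_state_J:
 fixes j :: nat
 assumes "adapted_state p J S"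
 shows "{w\<in>space M. J w = j} \<in> sets (F (j/p))"
proof -
 have "\<forall>A\<in>sets borel. {w\<in>space M. J w = j & S w \<in> A} \<in> sets (F (j/p))"
  using assms unfolding adapted_state_def by (rule spec)
 from bspec[OF this, of UNIV] show ?thesis by simp
qed

lemma adapted_state_measurable:
 assumes "adapted_state p J S"
 shows "S \<in> borel_measurable M" "J \<in> measurable M (count_space UNIV)"
proof -
 show "S \<in> borel_measurable M"
 proof (rule measurableI)
  fix A :: "'b set" assume A: "A \<in> sets borel"
  have "S -` A \<inter> space M = (\<Union>j. {w\<in>space M. J w = j & S w \<in> A})" by auto
  also have "... \<in> sets M"
  proof (intro sets.countable_UN subsetI, elim imageE)
   fix X and j :: nat assume X: "X = {w\<in>space M. J w = j & S w \<in> A}"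
   show "X \<in> sets M"
    unfolding X using assms A unfolding adapted_state_def by (intro sets_F[of "j/p"]) (simp, blast)
  qed
  finally show "S -` A \<inter> space M \<in> sets M" .
 qed simp
 show "J \<in> measurable M (count_space UNIV)"
 proof (rule measurable_count_space_eq_countable[THEN iffD2])
  show "J \<in> space M \<rightarrow> UNIV & (\<forall>a\<in>UNIV. J -` {a} \<inter> space M \<in> events)"
  proof (intro conjI ballI)
   fix j :: nat
   have eq: "J -` {j} \<inter> space M = {w\<in>space M. J w = j}" by auto
   show "J -` {j} \<inter> space M \<in> events"
    unfolding eq by (rule sets_F[OF _ adapted_state_J[OF assms]]) simp
  qed simp
 qed simp
qed

text \<open>The state is known at \<open>j / p\<close> only where the index equals \<open>j\<close>.
  Off \<open>D\<close> it is replaced by a constant, whose value is irrelevant, and what results is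
  measurable at that deterministic time.\<close>

lemma adapted_state_on:
 fixes i j :: nat
 assumes S: "adapted_state p J S" and [measurable]: "m \<in> measurable borel (count_space UNIV)"
  and D_def: "D = {w\<in>space M. J w = j & m (S w) = i}"
 shows "D \<in> sets (F (j/p))" "(%w. if w \<in> D then S w else undefined) \<in> borel_measurable (F (j/p))"
proof -
 have jp: "0 <= real j/real p" by simp
 have [measurable]: "m -` {i} \<in> sets borel" using measurable_sets[OF assms(2), of "{i}"] by simp
 have "D = {w\<in>space M. J w = j & S w \<in> m -` {i}}" by (auto simp: D_def)
 also have "... \<in> sets (F (j/p))" using S \<open>m -` {i} \<in> sets borel\<close> unfolding adapted_state_def by blast
 finally show D: "D \<in> sets (F (j/p))" .
 show "(%w. if w \<in> D then S w else undefined) \<in> borel_measurable (F (j/p))"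
 proof (rule measurableI)
  fix A :: "'b set" assume A: "A \<in> sets borel"
  have 1: "{w\<in>space M. J w = j & S w \<in> A} \<inter> D \<in> sets (F (j/p))"
   using S A D unfolding adapted_state_def by auto
  have 2: "space (F (j/p)) - D \<in> sets (F (j/p))" using D by auto
  have "(%w. if w \<in> D then S w else undefined) -` A \<inter> space (F (j/p))
   = ({w\<in>space M. J w = j & S w \<in> A} \<inter> D) \<union> (if undefined \<in> A then space (F (j/p)) - D else {})"
   using space_F[OF jp] by (auto simp: D_def split: if_splits)
  thus "(%w. if w \<in> D then S w else undefined) -` A \<inter> space (F (j/p)) \<in> sets (F (j/p))"
   using 1 2 by (auto simp del: Diff_iff)
 qed simp
qed

text \<open>The Brownian increment over the next \<open>m\<close> mesh intervals, normalised so that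
  it is standard normal given the state whatever duration the state prescribes.\<close>

definition next_noise :: "nat => ('a => nat) => ('a => nat) => 'a => real" where
 "next_noise p J m w = (B ((J w + m w)/p) w - B (J w/p) w)/sqrt (m w/p)"

lemma nn_integral_partition_nat:
 assumes [measurable]: "c \<in> measurable M (count_space UNIV)" "f \<in> borel_measurable M"
 shows "(nn_integral M (%w. f w)) = (\<Sum>n::nat. \<integral>\<^sup>+w. f w * indicator {w. c w = n} w \<partial>M)"
proof -
 have "f w = (\<Sum>n. f w * indicator {w. c w = n} w)" for w
 proof -
  have "(%n. f w * indicator {w. c w = n} w) = (%n. if n = c w then f w else 0)"
   by (auto simp: fun_eq_iff indicator_def)
  thus ?thesis using sums_unique[OF sums_single[of "c w" "%_. f w"]] by simp
 qed
 hence "(nn_integral M (%w. f w)) = (nn_integral M (%w. (\<Sum>n. f w * indicator {w. c w = n} w)))" by simp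
 also have "... = (\<Sum>n. \<integral>\<^sup>+w. f w * indicator {w. c w = n} w \<partial>M)"
  by (rule nn_integral_suminf) measurable
 finally show ?thesis .
qed

text \<open>The strong Markov property at a mesh time: on each of the countably many events that fix
  index and duration, coded by \<open>prod_encode\<close>, the increment has deterministic end
  points.\<close>

lemma nn_integral_next_noise:
 fixes S :: "'a => 's::second_countable_topology"
 assumes S: "adapted_state p J S" and m[measurable]: "m \<in> measurable borel (count_space UNIV)"
  and m1: "!!s. 1 <= m s" and p: "0 < p"
  and [measurable]: "\<Phi> \<in> borel_measurable (borel \<Otimes>\<^sub>M borel)"
 shows "(nn_integral M (%w. \<Phi> (S w, next_noise p J (%w. m (S w)) w)))
  = (nn_integral M (%w. (nn_integral \<N> (%x. \<Phi> (S w, x)))))" (is "?L = ?R")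
  and "next_noise p J (%w. m (S w)) \<in> borel_measurable M"
proof -
 note [measurable] = adapted_state_measurable[OF S]
 have [measurable_cong]: "sets \<N> = sets borel" by simp
 have Bp[measurable]: "B (real j/real p) \<in> borel_measurable M" for j by (rule B_measurable) simp
 have m'[measurable]: "(%w. m (S w)) \<in> measurable M (count_space UNIV)" by measurable
 define c where "c w = prod_encode (J w, m (S w))" for w
 have [measurable]: "c \<in> measurable M (count_space UNIV)" unfolding c_def by measurable
 define \<eta> where "\<eta> j i w = (B ((j + i)/p) w - B (j/p) w)/sqrt ((j + i)/p - j/p)" for j i :: nat and w
 let ?nn = "next_noise p J (%w. m (S w))"
 have nn_eq: "?nn w = \<eta> j i w" if "J w = j" "m (S w) = i" for w j i
  using that by (simp add: next_noise_def \<eta>_def add_divide_distrib)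
 show nn[measurable]: "?nn \<in> borel_measurable M"
 proof -
  have "(%w. (%(n::nat) w. B (real n/real p) w) (J w + m (S w)) w) \<in> borel_measurable M"
   by (rule measurable_compose_countable[where g="%w. J w + m (S w)"]) measurable
  moreover have "(%w. (%(n::nat) w. B (real n/real p) w) (J w) w) \<in> borel_measurable M"
   by (rule measurable_compose_countable[where g=J]) measurable
  ultimately show ?thesis unfolding next_noise_def by simp
 qed
 have part: "(nn_integral M (%w. \<Phi> (S w, ?nn w) * indicator {w. c w = n} w))
  = (nn_integral M (%w. (nn_integral \<N> (%x. \<Phi> (S w, x))) * indicator {w. c w = n} w))" for n
 proof -
  obtain j i where ji: "prod_decode n = (j, i)" by force
  hence n: "n = prod_encode (j, i)" by (metis prod_decode_inverse)
  define D where "D = {w\<in>space M. J w = j & m (S w) = i}"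
  have cD: "indicator {w. c w = n} w = (indicator D w :: ennreal)" if "w \<in> space M" for w
   using that by (auto simp: c_def n D_def indicator_def)
  define S' where "S' w = (if w \<in> D then S w else undefined)" for w
  note DS = adapted_state_on[OF S m D_def, folded S'_def]
  show ?thesis
  proof (cases "i = 0")
   case True
   have "m (S w) \<noteq> 0" for w using m1[of "S w"] by simp
   hence "D = {}" using True by (simp add: D_def)
   thus ?thesis using cD by (simp cong: nn_integral_cong)
  next
   case False
   have [measurable]: "D \<in> sets (F (j/p))" "S' \<in> borel_measurable (F (j/p))"
    using DS by (auto simp: S'_def[abs_def])
   have lt: "real j/real p < real (j + i)/real p" using p False by (simp add: divide_strict_right_mono)
   have "(nn_integral M (%w. \<Phi> (S w, ?nn w) * indicator {w. c w = n} w))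
    = (nn_integral M (%w. \<Phi> (S' w, \<eta> j i w) * indicator D w))"
   proof (rule nn_integral_cong)
    fix w assume w: "w \<in> space M"
    show "\<Phi> (S w, ?nn w) * indicator {w. c w = n} w = \<Phi> (S' w, \<eta> j i w) * indicator D w"
     unfolding cD[OF w] by (cases "w \<in> D") (simp_all add: S'_def D_def nn_eq)
   qed
   also have "... = (nn_integral M (%w. (nn_integral \<N> (%x. \<Phi> (S' w, x) * indicator D w))))"
    unfolding \<eta>_def
    using nn_integral_increment[OF _ lt, of "%wt. \<Phi> (S' (fst wt), snd wt) * indicator D (fst wt)"] by simp
   also have "... = (nn_integral M (%w. (nn_integral \<N> (%x. \<Phi> (S' w, x))) * indicator D w))"
    by (intro nn_integral_cong nn_integral_multc) simp
   also have "... = (nn_integral M (%w. (nn_integral \<N> (%x. \<Phi> (S w, x))) * indicator {w. c w = n} w))"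
   proof (rule nn_integral_cong)
    fix w assume w: "w \<in> space M"
    show "(nn_integral \<N> (%x. \<Phi> (S' w, x))) * indicator D w
     = (nn_integral \<N> (%x. \<Phi> (S w, x))) * indicator {w. c w = n} w"
     unfolding cD[OF w] by (cases "w \<in> D") (simp_all add: S'_def)
   qed
   finally show ?thesis .
  qed
 qed
 show "?L = ?R"
  by (subst (1 2) nn_integral_partition_nat[where c=c]) (simp_all add: part)
qed

lemma adapted_state_next:
 fixes S :: "'a => 's::second_countable_topology"
 assumes S: "adapted_state p J S" and m[measurable]: "m \<in> measurable borel (count_space UNIV)"
  and m1: "!!s. 1 <= m s" and p: "0 < p"
  and [measurable]: "T \<in> measurable (borel \<Otimes>\<^sub>M borel) borel"
 shows "adapted_state p (%w. J w + m (S w)) (%w. T (S w, next_noise p J (%w. m (S w)) w))"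
 unfolding adapted_state_def
proof (intro allI ballI)
 fix n :: nat and A :: "'b set" assume [measurable]: "A \<in> sets borel"
 let ?nn = "next_noise p J (%w. m (S w))"
 define X where "X j = {w\<in>space M. J w = j & m (S w) = n - j & T (S w, ?nn w) \<in> A}" for j
 have X: "X j \<in> sets (F (n/p))" if "j <= n" for j
 proof -
  define i where "i = n - j"
  define D where "D = {w\<in>space M. J w = j & m (S w) = i}"
  define S' where "S' w = (if w \<in> D then S w else undefined)" for w
  define \<eta> where "\<eta> w = (B (n/p) w - B (j/p) w)/sqrt (i/p)" for w
  have jn: "0 <= real j/p" "real j/p <= real n/p" using that by (auto simp: divide_right_mono)
  note DS = adapted_state_on[OF S m D_def, folded S'_def]
  have D[measurable]: "D \<in> sets (F (n/p))" using DS(1) F_mono[OF jn] by auto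
  have [measurable]: "S' \<in> borel_measurable (F (n/p))"
   using DS(2) measurable_F_mono[OF jn] by (simp add: S'_def[abs_def])
  have [measurable]: "B (n/p) \<in> borel_measurable (F (n/p))" by (rule adapted) simp
  have [measurable]: "B (j/p) \<in> borel_measurable (F (n/p))" by (rule measurable_F_mono[OF jn adapted]) simp
  have [measurable]: "\<eta> \<in> borel_measurable (F (n/p))" unfolding \<eta>_def by measurable
  have "X j = D \<inter> {w\<in>space (F (n/p)). T (S' w, \<eta> w) \<in> A}"
   using that space_F[of "n/p"]
   by (auto simp: X_def D_def S'_def i_def \<eta>_def next_noise_def)
  also have "... \<in> sets (F (n/p))" by measurable
  finally show ?thesis .
 qed
 have "{w\<in>space M. J w + m (S w) = n & T (S w, ?nn w) \<in> A} = (\<Union>j\<in>{..n}. X j)"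
  by (auto simp: X_def)
 also have "... \<in> sets (F (n/p))" using X by (intro sets.finite_UN) auto
 finally show "{w\<in>space M. J w + m (S w) = n & T (S w, ?nn w) \<in> A} \<in> sets (F (n/p))" .
qed

end

section \<open>The scheme along a Brownian path\<close>

text \<open>\<open>n\<close> counts the steps of the auxiliary time, whose horizon is 1;
  \<open>1 / p\<close> is the mesh of the Brownian clock and later much finer than
  \<open>1 / n\<close>. A clock on a mesh keeps all stopping times rational and the Markov property
  elementary.\<close>

locale scheme_bm = filtered_bm M F B + scheme h c L \<Lambda> g \<delta>
 for M :: "'a measure" and F B h c L \<Lambda> g \<delta> +
 fixes n p :: nat
 assumes n: "0 < n" and hn: "h = 1/n" and p: "0 < p"
begin

text \<open>\<open>Suc\<close> rounds the duration up and makes it positive even where the control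
  vanishes, so there is always an increment to normalise; the excess is at most
  \<open>1 / p\<close>.\<close>

definition steps :: "nat => real \<times> real \<times> real => nat" where
 "steps j s = Suc (nat \<lfloor>p * (h * (Z j (fst s) (fst (snd s)))^2)\<rfloor>)"

text \<open>The coordinates are the Gaussian walk, the ideal clock without rounding, and the
  Brownian path at the rounded clock. Walk and path share the noise, with standard deviations
  \<open>sqrt h\<close> and \<open>sqrt (steps / p)\<close>.\<close>

definition trans :: "nat => (real \<times> real \<times> real) \<times> real => real \<times> real \<times> real" where
 "trans j wt = (case wt of (s, \<xi>) => (fst s + sqrt h * \<xi>, fst (snd s) + h * (Z j (fst s) (fst (snd s)))^2,
   snd (snd s) + sqrt (steps j s/p) * \<xi>))"

text \<open>After \<open>k\<close> steps \<open>n - k\<close> remain; the next step averages the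
  field with \<open>n - Suc k\<close> steps remaining, and its control is the one to apply.\<close>

primrec chain :: "nat => ('a => nat) \<times> ('a => real \<times> real \<times> real)" where
 "chain 0 = (%w. 0, %w. (0, 0, 0))"
| "chain (Suc k) = (%w. fst (chain k) w + steps (n - Suc k) (snd (chain k) w),
   %w. trans (n - Suc k) (snd (chain k) w,
    next_noise p (fst (chain k)) (%w. steps (n - Suc k) (snd (chain k) w)) w))"

abbreviation "J k \<equiv> fst (chain k)"
abbreviation "S k \<equiv> snd (chain k)"
abbreviation "noise k \<equiv> next_noise p (J k) (%w. steps (n - Suc k) (S k w))"
abbreviation "X k w \<equiv> fst (S k w)"
abbreviation "Y k w \<equiv> fst (snd (S k w))"
abbreviation "b k w \<equiv> snd (snd (S k w))"

lemma Z_pair_measurable [measurable]: "(%s. Z j (fst s) (fst (snd s))) \<in> borel_measurable (borel :: (real \<times> real \<times> real) measure)"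
proof -
 have "(%s :: real \<times> real \<times> real. (fst s, fst (snd s))) \<in> borel_measurable borel"
  by (intro borel_measurable_continuous_onI continuous_intros)
 from measurable_compose[OF this Z_measurable, of j] show ?thesis by simp
qed

lemma coordinate_measurable [measurable]:
 "(fst :: real \<times> real \<times> real => real) \<in> borel_measurable borel"
 "(%s :: real \<times> real \<times> real. fst (snd s)) \<in> borel_measurable borel"
 "(%s :: real \<times> real \<times> real. snd (snd s)) \<in> borel_measurable borel"
 by (intro borel_measurable_continuous_onI continuous_intros)+

lemma steps_measurable [measurable]: "steps j \<in> measurable borel (count_space UNIV)"
 unfolding steps_def by measurable

lemma trans_measurable [measurable]: "trans j \<in> measurable (borel \<Otimes>\<^sub>M borel) borel"
proof -
 have "trans j \<in> measurable (borel \<Otimes>\<^sub>M borel) (borel \<Otimes>\<^sub>M (borel \<Otimes>\<^sub>M borel))"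
  unfolding trans_def split_beta' by (intro measurable_Pair) measurable
 thus ?thesis by (simp add: borel_prod)
qed

lemma steps_pos: "1 <= steps j s"
 by (simp add: steps_def)

lemma chain_adapted: "adapted_state p (J k) (S k)"
proof (induction k)
 case 0
 show ?case unfolding adapted_state_def
 proof (intro allI ballI)
  fix j :: nat and A :: "(real \<times> real \<times> real) set"
  have "{w\<in>space M. J 0 w = j & S 0 w \<in> A} = (if j = 0 & (0, 0, 0) \<in> A then space M else {})" by auto
  thus "{w\<in>space M. J 0 w = j & S 0 w \<in> A} \<in> sets (F (j/p))"
   using space_in_F[of "j/p"] space_in_F[of 0] by (auto simp del: chain.simps)
 qed
next
 case (Suc k)
 show ?case
  using adapted_state_next[OF Suc steps_measurable steps_pos p trans_measurable, of "n - Suc k" "n - Suc k"]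
  by simp
qed

lemma S_measurable [measurable]: "S k \<in> borel_measurable M" and J_measurable [measurable]: "J k \<in> measurable M (count_space UNIV)"
 by (rule adapted_state_measurable[OF chain_adapted])+

lemma noise_measurable [measurable]: "noise k \<in> borel_measurable M"
 using nn_integral_next_noise(2)[OF chain_adapted steps_measurable steps_pos p borel_measurable_const] .

lemma nn_integral_noise:
 assumes "\<Phi> \<in> borel_measurable (borel \<Otimes>\<^sub>M borel)"
 shows "(nn_integral M (%w. \<Phi> (S k w, noise k w))) = (nn_integral M (%w. (nn_integral \<N> (%x. \<Phi> (S k w, x)))))"
 by (rule nn_integral_next_noise(1)[OF chain_adapted steps_measurable steps_pos p assms])

lemma X_Suc: "X (Suc k) w = X k w + sqrt h * noise k w"
 and Y_Suc: "Y (Suc k) w = Y k w + h * (Z (n - Suc k) (X k w) (Y k w))\<^sup>2"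
 and b_Suc: "b (Suc k) w = b k w + sqrt (steps (n - Suc k) (S k w)/p) * noise k w"
 and J_Suc: "J (Suc k) w = J k w + steps (n - Suc k) (S k w)"
 by (simp_all add: trans_def)

text \<open>The random durations leave no trace in the law of the walk, because every normalised
  noise is standard normal given the state; Gaussian convolution adds the variances.\<close>

lemma nn_integral_X:
 assumes [measurable]: "f \<in> borel_measurable borel"
 shows "(nn_integral M (%w. f (X k w))) = (nn_integral \<N> (%x. f (sqrt (k * h) * x)))"
 using assms
proof (induction k arbitrary: f)
 case 0
 show ?case using emeasure_space_1 gauss.emeasure_space_1 by simp
next
 case (Suc k)
 note [measurable] = Suc.prems
 have [measurable_cong]: "sets \<N> = sets borel" by simp
 have "(nn_integral M (%w. f (X (Suc k) w))) = (nn_integral M (%w. (%wt. f (fst (fst wt) + sqrt h * snd wt)) (S k w, noise k w)))"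
  unfolding X_Suc by simp
 also have "... = (nn_integral M (%w. (nn_integral \<N> (%x. f (X k w + sqrt h * x)))))"
  by (subst nn_integral_noise) simp_all
 also have "... = (nn_integral \<N> (%v. (nn_integral \<N> (%x. f (sqrt (k * h) * v + sqrt h * x)))))"
  by (rule Suc.IH) simp
 also have "... = (nn_integral \<N> (%x. f (sqrt ((sqrt (k * h))^2 + (sqrt h)^2) * x)))"
  using h by (intro gauss_convolution) auto
 also have "(sqrt (k * h))\<^sup>2 + (sqrt h)^2 = Suc k * h" using h by (simp add: distrib_right)
 finally show ?case .
qed

lemma distr_X: "distr M borel (X n) = \<N>"
proof (rule measure_eqI)
 fix A assume "A \<in> sets (distr M borel (X n))"
 hence [measurable]: "A \<in> sets borel" by simp
 have "emeasure (distr M borel (X n)) A = (nn_integral M (%w. indicator A (X n w)))"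
  by (subst emeasure_distr) (auto simp: nn_integral_indicator[symmetric] indicator_def intro!: nn_integral_cong simp del: nn_integral_indicator)
 also have "... = (nn_integral \<N> (%x. indicator A (sqrt (n * h) * x)))"
  by (rule nn_integral_X) simp
 also have "... = emeasure \<N> A" using n by (simp add: hn)
 finally show "emeasure (distr M borel (X n)) A = emeasure \<N> A" .
qed simp

lemma b_eq: "b k w = B (J k w/p) w - B 0 w"
proof (induction k)
 case (Suc k)
 let ?m = "steps (n - Suc k) (S k w)"
 have "0 < ?m" using steps_pos[of "n - Suc k" "S k w"] by linarith
 hence "sqrt (?m/p) * noise k w = B (J (Suc k) w/p) w - B (J k w/p) w"
  using p unfolding next_noise_def J_Suc by simp
 thus ?case using Suc b_Suc by (simp del: chain.simps)
qed simp

lemma steps_bounds: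
 "h * (Z j (fst s) (fst (snd s)))^2 <= steps j s/p"
 "steps j s/p <= h * (Z j (fst s) (fst (snd s)))^2 + 1/p"
proof -
 let ?v = "h * (Z j (fst s) (fst (snd s)))\<^sup>2"
 have "0 <= p * ?v" using h by simp
 hence "p * ?v <= steps j s" "steps j s <= p * ?v + 1" unfolding steps_def by linarith+
 thus "?v <= steps j s/p" "steps j s/p <= ?v + 1/p" using p by (auto simp: field_simps)
qed

lemma time_bounds: "Y k w <= J k w/p" "J k w/p <= Y k w + k/p" "Y k w <= k * h * L\<^sup>2" "0 <= Y k w"
proof (induction k)
 case (Suc k)
 let ?m = "steps (n - Suc k) (S k w)"
 have eq: "J (Suc k) w/p = J k w/p + ?m/p" unfolding J_Suc by (simp add: add_divide_distrib)
 note sb = steps_bounds[of "n - Suc k" "S k w"]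
 have l: "h * (Z (n - Suc k) (X k w) (Y k w))^2 <= h * L\<^sup>2" "0 <= h * (Z (n - Suc k) (X k w) (Y k w))\<^sup>2"
  using h Z_sq_bound by (auto intro: mult_left_mono)
 show "Y (Suc k) w <= J (Suc k) w/p" unfolding eq Y_Suc using Suc(1) sb(1) by linarith
 have "real (Suc k)/p = k/p + 1/p" by (simp add: add_divide_distrib)
 thus "J (Suc k) w/p <= Y (Suc k) w + Suc k/p" unfolding eq Y_Suc using Suc(2) sb(2) by linarith
 have "real (Suc k) * h * L^2 = k * h * L^2 + h * L\<^sup>2" by (simp add: algebra_simps)
 thus "Y (Suc k) w <= Suc k * h * L\<^sup>2" unfolding Y_Suc using Suc(3) l by linarith
 show "0 <= Y (Suc k) w" unfolding Y_Suc using Suc(4) l by linarith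
qed simp_all

lemma J_mono: "k <= l ==> J k w <= J l w" and Y_mono: "k <= l ==> Y k w <= Y l w"
proof -
 show "k <= l ==> J k w <= J l w"
  by (rule lift_Suc_mono_le[of "%k. J k w"]) (auto simp: J_Suc simp del: chain.simps)
 show "k <= l ==> Y k w <= Y l w"
  by (rule lift_Suc_mono_le[of "%k. Y k w"]) (use h in \<open>auto simp: Y_Suc simp del: chain.simps\<close>)
qed

lemma J_pos: "0 < J n w"
proof -
 obtain k where "n = Suc k" using n gr0_conv_Suc by blast
 thus ?thesis using J_Suc[of k w] steps_pos[of "n - Suc k" "S k w"] by (simp del: chain.simps)
qed

text \<open>The accumulated defect between field and path. It vanishes at the start, and after
  \<open>n\<close> steps it is the error of the embedding up to sign and up to the rounding of the
  clock inside \<delta>.\<close>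

definition q :: "nat => 'a => real" where
 "q k w = U (n - k) (X k w) (Y k w) - U n 0 0 - b k w"

lemma U_state_measurable [measurable]: "(%s. U j (fst s) (fst (snd s))) \<in> borel_measurable (borel :: (real \<times> real \<times> real) measure)"
proof -
 have "(%s :: real \<times> real \<times> real. (fst s, fst (snd s))) \<in> borel_measurable borel"
  by (intro borel_measurable_continuous_onI continuous_intros)
 from measurable_compose[OF this U_measurable, of j] show ?thesis by simp
qed

lemma q_measurable [measurable]: "q k \<in> borel_measurable M"
 unfolding q_def by measurable

text \<open>The increments of \<open>q\<close> are martingale differences, hence their variances add up.\<close>

lemma q_step:
 assumes "k < n" and rb: "!!x y s. s^2 = steps (n - Suc k) (x, y, 0)/p ==> 0 <= s ==> residual (n - Suc k) x y s <= rb"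
 shows "(nn_integral M (%w. ennreal ((q (Suc k) w)^2))) <= (nn_integral M (%w. ennreal ((q k w)^2))) + ennreal rb"
proof -
 define j where "j = n - Suc k"
 have j: "Suc j = n - k" using assms by (simp add: j_def)
 have [measurable_cong]: "sets \<N> = sets borel" by simp
 define Q where "Q s = U j (fst s) (fst (snd s)) - U n 0 0 - snd (snd s)" for s
 have [measurable]: "Q \<in> borel_measurable borel" unfolding Q_def by measurable
 have "(nn_integral M (%w. ennreal ((q (Suc k) w)^2))) = (nn_integral M (%w. (%wt. ennreal ((Q (trans j wt))^2)) (S k w, noise k w)))"
  by (simp add: q_def Q_def j_def)
 also have "... = (nn_integral M (%w. (nn_integral \<N> (%x. ennreal ((Q (trans j (S k w, x)))^2)))))"
  by (subst nn_integral_noise) simp_all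
 also have "... <= (nn_integral M (%w. ennreal ((q k w)^2) + ennreal rb))"
 proof (rule nn_integral_mono)
  fix w
  let ?E = gauss.expectation
  define s where "s = sqrt (steps j (S k w)/p)"
  define V where "V = Y k w + h * (Z j (X k w) (Y k w))\<^sup>2"
  define R where "R x = U j (X k w + sqrt h * x) V - U (Suc j) (X k w) (Y k w) - s * x" for x
  have [measurable]: "R \<in> borel_measurable borel" unfolding R_def by measurable
  have Qeq: "Q (trans j (S k w, x)) = q k w + R x" for x
   by (simp add: Q_def trans_def q_def R_def V_def s_def j del: chain.simps U.simps)
  have Ri: "integrable \<N> R" unfolding R_def by simp
  have ER: "?E R = 0"
   unfolding R_def using gauss.prob_space by (simp add: U_Suc V_def del: U.simps)
  obtain B1 where B1: "!!x. \<bar>R x\<bar> <= B1 + (L * sqrt h + s) * \<bar>x\<bar>" "0 <= B1"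
  proof
   fix x
   have "\<bar>U j (X k w + sqrt h * x) V - U j (X k w) V\<bar> <= L * sqrt h * \<bar>x\<bar>"
    using U_lipschitz_x[of j "X k w + sqrt h * x" V "X k w"] h by (simp add: abs_mult)
   moreover have "\<bar>s * x\<bar> = s * \<bar>x\<bar>" by (simp add: abs_mult s_def)
   ultimately show "\<bar>R x\<bar> <= \<bar>U j (X k w) V - U (Suc j) (X k w) (Y k w)\<bar> + (L * sqrt h + s) * \<bar>x\<bar>"
    unfolding R_def by (simp add: distrib_right del: U.simps)
  qed simp
  have R2i: "integrable \<N> (%x. (R x)^2)"
  proof (rule gauss_integrable_quadratic[where a="2 * B1\<^sup>2" and b=0 and c="2 * (L * sqrt h + s)\<^sup>2"])
   fix x
   let ?l = "L * sqrt h + s"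
   have "(R x)\<^sup>2 <= (B1 + ?l * \<bar>x\<bar>)\<^sup>2" using B1(1)[of x] by (metis abs_ge_zero power2_abs power_mono)
   also have "... <= 2 * B1\<^sup>2 + 2 * (?l * \<bar>x\<bar>)\<^sup>2"
    using zero_le_power2[of "B1 - ?l * \<bar>x\<bar>"] by (simp add: power2_sum power2_diff)
   finally show "\<bar>(R x)\<^sup>2\<bar> <= 2 * B1\<^sup>2 + 0 * \<bar>x\<bar> + 2 * ?l\<^sup>2 * x\<^sup>2" by (simp add: power_mult_distrib)
  qed simp
  have nonneg: "0 <= (q k w)^2 + 2 * q k w * R x + (R x)\<^sup>2" for x
   using zero_le_power2[of "q k w + R x"] by (simp add: power2_sum)
  have eq: "(Q (trans j (S k w, x)))\<^sup>2 = (q k w)^2 + 2 * q k w * R x + (R x)\<^sup>2" for x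
   unfolding Qeq by (simp add: power2_sum)
  have 1: "(nn_integral \<N> (%x. ennreal ((Q (trans j (S k w, x)))^2)))
   = ennreal (?E (%x. (q k w)^2 + 2 * q k w * R x + (R x)^2))"
   unfolding eq using Ri R2i nonneg by (intro nn_integral_eq_integral) simp_all
  have 2: "?E (%x. (q k w)^2 + 2 * q k w * R x + (R x)^2) = (q k w)^2 + ?E (%x. (R x)^2)"
   using Ri R2i ER gauss.prob_space by simp
  have 3: "?E (%x. (R x)^2) = residual j (X k w) (Y k w) s"
   by (simp add: residual_def R_def V_def del: U.simps)
  have "steps j (X k w, Y k w, 0) = steps j (S k w)" by (simp add: steps_def)
  hence 4: "residual j (X k w) (Y k w) s <= rb"
   using rb[of s "X k w" "Y k w"] by (simp add: s_def j_def)
  have "(nn_integral \<N> (%x. ennreal ((Q (trans j (S k w, x)))^2))) <= ennreal ((q k w)^2 + rb)"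
   unfolding 1 2 3 using 4 by (intro ennreal_leI) simp
  moreover have "0 <= rb" using 4 unfolding 3[symmetric] by (rule order_trans[rotated]) simp
  ultimately show "(nn_integral \<N> (%x. ennreal ((Q (trans j (S k w, x)))^2))) <= ennreal ((q k w)^2) + ennreal rb"
   by simp
 qed
 also have "... = (nn_integral M (%w. ennreal ((q k w)^2))) + ennreal rb"
  using emeasure_space_1 by (subst nn_integral_add) auto
 finally show ?thesis .
qed

end

context scheme_bm
begin

lemma q_0: "q 0 w = 0"
 by (simp add: q_def)

lemma q_sum:
 assumes rb: "!!j x y s. j < n ==> s\<^sup>2 = steps j (x, y, 0)/p ==> 0 <= s ==> residual j x y s <= rb j"
  and rb0: "!!j. 0 <= rb j" and k: "k <= n"
 shows "(nn_integral M (%w. ennreal ((q k w)^2))) <= ennreal (\<Sum>j<n. rb j)"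
proof -
 have "(nn_integral M (%w. ennreal ((q k w)^2))) <= ennreal (\<Sum>i<k. rb (n - Suc i))"
  using k
 proof (induction k)
  case (Suc k)
  have "(nn_integral M (%w. ennreal ((q (Suc k) w)^2))) <= (nn_integral M (%w. ennreal ((q k w)^2))) + ennreal (rb (n - Suc k))"
   using Suc.prems by (intro q_step rb) auto
  also have "... <= ennreal (\<Sum>i<k. rb (n - Suc i)) + ennreal (rb (n - Suc k))"
   using Suc by (intro add_right_mono) auto
  also have "... = ennreal (\<Sum>i<Suc k. rb (n - Suc i))"
   using rb0 by (simp add: sum_nonneg)
  finally show ?case .
 qed (simp add: q_0)
 also have "(\<Sum>i<k. rb (n - Suc i)) <= (\<Sum>i<n. rb (n - Suc i))"
  using k rb0 by (intro sum_mono2) auto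
 also have "(\<Sum>i<n. rb (n - Suc i)) = (\<Sum>j<n. rb j)"
  by (rule sum.nat_diff_reindex)
 finally show ?thesis using ennreal_leI by (meson order_trans)
qed

text \<open>In this order: the last \<open>m\<close> steps estimated crudely, the deviation from the
  heat flow, the affine approximation, the truncation of the noise, the rounding of the clock. The
  terms become small by choosing \<open>c\<close> and \<open>m\<close>, then \<open>n\<close>, then
  \<open>p\<close>.\<close>

definition total_error :: "nat => real" where
 "total_error m = m * L^2/n + 2 * m^2 * (\<Lambda> * L^2)^2/n + 2 * L^2/m * gauss_exp_moment
   + 18 * L^2/c^4 + 2 * n/p"

lemma gauss_exp_moment_nonneg: "0 <= gauss_exp_moment"
 unfolding gauss_exp_moment_def by simp

lemma total_error_nonneg: "0 <= total_error m"
 unfolding total_error_def using gauss_exp_moment_nonneg by (intro add_nonneg_nonneg) auto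

lemma q_bound:
 assumes m: "8 <= m" and k: "k <= n"
 shows "(nn_integral M (%w. ennreal ((q k w)^2))) <= ennreal (total_error m)"
proof -
 define e where "e = 18 * L^2 * h/c^4 + 2/p"
 define f where "f = 2 * (m * h * (\<Lambda> * L^2))^2 + 2 * L^2 * (h/m) * gauss_exp_moment"
 define rb where "rb j = (if j < m then L\<^sup>2 * h else 0) + f + e" for j
 have f0: "0 <= f" unfolding f_def using h gauss_exp_moment_nonneg by (intro add_nonneg_nonneg) auto
 have e0: "0 <= e" unfolding e_def using h by (intro add_nonneg_nonneg) auto
 have "(nn_integral M (%w. ennreal ((q k w)^2))) <= ennreal (\<Sum>j<n. rb j)"
 proof (rule q_sum[OF _ _ k])
  show "0 <= rb j" for j using f0 e0 h by (simp add: rb_def)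
  fix j x y and s :: real
  assume s: "s\<^sup>2 = steps j (x, y, 0)/p" "0 <= s"
  define z where "z = sqrt h * Z j x y"
  have z: "0 <= z" "z\<^sup>2 = h * (Z j x y)\<^sup>2" using h Z_nonneg by (auto simp: z_def power_mult_distrib)
  have zs: "z\<^sup>2 <= s\<^sup>2" "s\<^sup>2 <= z^2 + 1/p"
   using steps_bounds[of j "(x, y, 0)"] unfolding s z by simp_all
  hence "z <= s" using s(2) power2_le_imp_le by blast
  \<comment> \<open>For \<open>0 <= z <= s\<close> the squared difference of the standard deviations
    is at most the difference of the variances, so rounding costs \<open>1 / p\<close> and not its
    square root.\<close>
  hence "(s - z) * (s - z) <= (s - z) * (s + z)" using z by (intro mult_left_mono) auto
  hence "(z - s)\<^sup>2 <= s^2 - z\<^sup>2" by (simp add: power2_eq_square algebra_simps)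
  hence zz: "2 * (z - s)^2 <= 2/p" using zs by simp
  show "residual j x y s <= rb j"
  proof (cases "j < m")
   case True
   thus ?thesis
    using residual_crude[of j x y s] zz f0 unfolding rb_def e_def z_def by simp
  next
   case False
   thus ?thesis
    using residual_fine[of m j x y s] m zz unfolding rb_def e_def f_def z_def by simp
  qed
 qed
 also have "(\<Sum>j<n. rb j) <= total_error m"
 proof -
  have "(\<Sum>j<n. if j < m then L\<^sup>2 * h else 0) = (\<Sum>j\<in>{..<n} \<inter> {..<m}. L^2 * h)"
   by (simp add: sum.If_cases lessThan_def)
  also have "... <= (\<Sum>j<m. L^2 * h)" using h by (intro sum_mono2) auto
  finally have 1: "(\<Sum>j<n. if j < m then L\<^sup>2 * h else 0) <= m * L^2/n" by (simp add: hn)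
  have 2: "n * f = 2 * m^2 * (\<Lambda> * L^2)^2/n + 2 * L^2/m * gauss_exp_moment"
   using n m by (simp add: f_def hn power_mult_distrib power_divide distrib_left) (simp add: power2_eq_square)
  have 3: "n * e = 18 * L^2/c^4 + 2 * n/p"
   using n by (simp add: e_def hn distrib_left)
  have "(\<Sum>j<n. rb j) = (\<Sum>j<n. if j < m then L\<^sup>2 * h else 0) + n * f + n * e"
   by (simp add: rb_def sum.distrib)
  thus ?thesis using 1 2 3 by (simp add: total_error_def)
 qed
 finally show ?thesis using ennreal_leI by (meson order_trans)
qed

lemma final_error:
 assumes m: "8 <= m" and \<eta>: "0 < \<eta>" "total_error m <= \<eta>\<^sup>2"
 shows "(nn_integral M (%w. ennreal \<bar>U n 0 0 + \<delta> (J n w/p) + B (J n w/p) w - g (X n w)\<bar>)) <= ennreal (\<eta> + \<Lambda> * n/p)"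
proof -
 have "(nn_integral M (%w. ennreal \<bar>U n 0 0 + \<delta> (J n w/p) + B (J n w/p) w - g (X n w)\<bar>))
  <= (nn_integral M (%w. ennreal (\<eta>/2 + \<Lambda> * n/p) + ennreal (1/(2 * \<eta>)) * ennreal ((q n w)^2)))"
 proof (rule nn_integral_mono_AE)
  show "AE w in M. ennreal \<bar>U n 0 0 + \<delta> (J n w/p) + B (J n w/p) w - g (X n w)\<bar>
   <= ennreal (\<eta>/2 + \<Lambda> * n/p) + ennreal (1/(2 * \<eta>)) * ennreal ((q n w)^2)"
   using start
  proof eventually_elim
   case (elim w)
   have "U n 0 0 + \<delta> (J n w/p) + B (J n w/p) w - g (X n w) = \<delta> (J n w/p) - \<delta> (Y n w) - q n w"
    using b_eq[of n w] elim by (simp add: q_def del: chain.simps)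
   moreover have "\<bar>\<delta> (J n w/p) - \<delta> (Y n w)\<bar> <= \<Lambda> * (n/p)"
   proof -
    have "\<bar>\<delta> (J n w/p) - \<delta> (Y n w)\<bar> <= \<Lambda> * \<bar>J n w/p - Y n w\<bar>" by (rule \<delta>_lipschitz)
    also have "... <= \<Lambda> * (n/p)" using time_bounds(1,2)[where k=n and w=w] \<Lambda> by (intro mult_left_mono) linarith+
    finally show ?thesis .
   qed
   moreover have "\<bar>q n w\<bar> <= \<eta>/2 + 1/(2 * \<eta>) * (q n w)\<^sup>2"
   proof -
    have "0 <= (\<eta> - \<bar>q n w\<bar>)^2/(2 * \<eta>)" using \<eta> by simp
    also have "(\<eta> - \<bar>q n w\<bar>)\<^sup>2/(2 * \<eta>) = \<eta>/2 + 1/(2 * \<eta>) * (q n w)^2 - \<bar>q n w\<bar>"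
     using \<eta> by (simp add: power2_diff add_divide_distrib diff_divide_distrib) (simp add: power2_eq_square)
    finally show ?thesis by simp
   qed
   ultimately have "\<bar>U n 0 0 + \<delta> (J n w/p) + B (J n w/p) w - g (X n w)\<bar>
    <= (\<eta>/2 + \<Lambda> * n/p) + 1/(2 * \<eta>) * (q n w)\<^sup>2" by simp
   hence "ennreal \<bar>U n 0 0 + \<delta> (J n w/p) + B (J n w/p) w - g (X n w)\<bar>
    <= ennreal ((\<eta>/2 + \<Lambda> * n/p) + 1/(2 * \<eta>) * (q n w)^2)" by (rule ennreal_leI)
   thus ?case using \<eta> \<Lambda> by (simp add: ennreal_plus[symmetric] ennreal_mult'[symmetric] del: ennreal_plus)
  qed
 qed
 also have "... = ennreal (\<eta>/2 + \<Lambda> * n/p) + ennreal (1/(2 * \<eta>)) * (nn_integral M (%w. ennreal ((q n w)^2)))"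
  using emeasure_space_1 by (simp add: nn_integral_add nn_integral_cmult)
 also have "... <= ennreal (\<eta>/2 + \<Lambda> * n/p) + ennreal (1/(2 * \<eta>)) * ennreal (\<eta>^2)"
  using q_bound[OF m, of n] \<eta>(2) by (intro add_left_mono mult_left_mono) (auto intro: order_trans ennreal_leI)
 also have "... = ennreal (\<eta>/2 + \<Lambda> * n/p + 1/(2 * \<eta>) * \<eta>^2)"
  using \<eta> \<Lambda> by (simp add: ennreal_plus[symmetric] ennreal_mult'[symmetric] del: ennreal_plus)
 also have "\<eta>/2 + \<Lambda> * n/p + 1/(2 * \<eta>) * \<eta>^2 = \<eta> + \<Lambda> * n/p"
  using \<eta> by (simp add: power2_eq_square)
 finally show ?thesis .
qed

text \<open>The start value is close to the heat flow, over \<open>k\<close> steps, of the later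
  field, and that flow moves an \<open>L\<close>-Lipschitz function by at most
  \<open>L * sqrt (k * h)\<close>.\<close>

lemma U_origin_bound: "\<bar>U n 0 0 - U (n - k) 0 y\<bar> <= k * h * (\<Lambda> * L^2) + L * sqrt (k * h) + \<Lambda> * \<bar>y\<bar>" if "k <= n"
proof -
 have "\<bar>U n 0 0 - heat (k * h) (%x. U (n - k) x 0) 0\<bar> <= k * h * (\<Lambda> * L^2)"
  using U_heat_close[of "n - k" k 0 0] that by simp
 moreover have "\<bar>heat (k * h) (%x. U (n - k) x 0) 0 - U (n - k) 0 0\<bar> <= L * sqrt (k * h)"
  using h by (intro heat_close[of "%x. U (n - k) x 0"] U_lipschitz_x) simp
 moreover have "\<bar>U (n - k) 0 0 - U (n - k) 0 y\<bar> <= \<Lambda> * \<bar>y\<bar>"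
  using U_lipschitz_y[of "n - k" 0 0 y] by simp
 ultimately show ?thesis by linarith
qed

text \<open>As long as the Brownian path stays near \<open>0\<close>, most of the first \<open>s\<^sub>0 n\<close> states stay in \<open>[-1, 1]\<close>, where the field is uniformly
 increasing in \<open>x\<close>; hence the elapsed time cannot be small.\<close>

lemma many_errors:
 fixes \<kappa> r t s0 :: real and k0 :: nat
 assumes \<kappa>: "0 < \<kappa>"
  and slope: "!!j x x' y. 1/2 <= j * h ==> j <= n ==> -1 <= x ==> x <= x' ==> x' <= 1 ==> \<kappa> * (x' - x) <= U j x' y - U j x y"
  and Zge: "!!j x y. 1/2 <= j * h ==> j <= n ==> \<bar>x\<bar> <= 1 ==> \<zeta> <= Z j x y" and \<zeta>: "0 < \<zeta>"
  and k0: "k0 + 1 <= n/2" "k0 * h <= s0" "s0 * (\<Lambda> * L^2) + L * sqrt s0 <= \<kappa>/4"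
  and t: "\<Lambda> * t <= \<kappa>/8" "t < k0 * h * \<zeta>^2/2"
  and w: "B 0 w = 0" "J n w/p <= t" "!!k. k <= n ==> \<bar>B (J k w/p) w\<bar> <= \<kappa>/8"
 shows "k0/2 <= card {k. k < k0 & \<kappa>/8 < \<bar>q k w\<bar>}"
proof (rule ccontr)
 assume "\<not> ?thesis"
 hence few: "card {k. k < k0 & \<kappa>/8 < \<bar>q k w\<bar>} < k0/2" by simp
 have k0n: "k0 <= n" using k0(1) by simp
 have half: "1/2 <= real j * h" if "n - Suc k0 <= j" for j
 proof -
  have "real n/2 <= j" using that k0(1) by linarith
  thus ?thesis using n by (simp add: hn field_simps)
 qed
 \<comment> \<open>The field at the state equals start value plus path plus defect. The shift of the
   start value costs \<open>3/8\<close> of \<kappa>, path and defect \<open>1/8\<close> each; thus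
   the field differs from its value at \<open>x = 0\<close> by less than \<kappa>, and the uniform
   slope confines \<open>X\<close> to \<open>[-1, 1]\<close>, where the control is at least
   \<zeta>.\<close>
 have good: "\<zeta>\<^sup>2 <= (Z (n - Suc k) (X k w) (Y k w))\<^sup>2" if k: "k < k0" and qk: "\<bar>q k w\<bar> <= \<kappa>/8" for k
 proof -
  have kn: "k <= n" using k k0n by simp
  have Y: "0 <= Y k w" "Y k w <= t"
   using time_bounds(4)[of k w] time_bounds(1)[of n w] Y_mono[OF kn, of w] w(2) by linarith+
  have kh: "k * h <= s0" using k k0(2) h by (meson less_imp_le mult_right_mono of_nat_mono order_trans)
  have "\<bar>U n 0 0 - U (n - k) 0 (Y k w)\<bar> <= k * h * (\<Lambda> * L^2) + L * sqrt (k * h) + \<Lambda> * \<bar>Y k w\<bar>"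
   by (rule U_origin_bound[OF kn])
  also have "... <= s0 * (\<Lambda> * L^2) + L * sqrt s0 + \<Lambda> * t"
   using kh Y \<Lambda> L by (intro add_mono mult_right_mono mult_left_mono) auto
  also have "... <= \<kappa>/4 + \<kappa>/8" using k0(3) t(1) by linarith
  finally have 1: "\<bar>U n 0 0 - U (n - k) 0 (Y k w)\<bar> <= 3/8 * \<kappa>" by simp
  have 2: "\<bar>b k w\<bar> <= \<kappa>/8" using w(3)[OF kn] b_eq[of k w] w(1) by simp
  have "U (n - k) (X k w) (Y k w) - U (n - k) 0 (Y k w) = q k w + b k w + (U n 0 0 - U (n - k) 0 (Y k w))"
   by (simp add: q_def)
  hence 3: "\<bar>U (n - k) (X k w) (Y k w) - U (n - k) 0 (Y k w)\<bar> < \<kappa>" using 1 2 qk \<kappa> by linarith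
  have nk: "1/2 <= real (n - k) * h" using k by (intro half) simp
  have "\<bar>X k w\<bar> <= 1"
  proof (rule ccontr)
   assume "\<not> \<bar>X k w\<bar> <= 1"
   then consider "1 <= X k w" | "X k w <= -1" by linarith
   thus False
   proof cases
    case 1
    have "\<kappa> * (1 - 0) <= U (n - k) 1 (Y k w) - U (n - k) 0 (Y k w)" by (rule slope[OF nk]) auto
    moreover have "U (n - k) 1 (Y k w) <= U (n - k) (X k w) (Y k w)" using 1 by (rule U_mono)
    ultimately show False using 3 by simp
   next
    case 2
    have "\<kappa> * (0 - -1) <= U (n - k) 0 (Y k w) - U (n - k) (-1) (Y k w)" by (rule slope[OF nk]) auto
    moreover have "U (n - k) (X k w) (Y k w) <= U (n - k) (-1) (Y k w)" using 2 by (rule U_mono)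
    ultimately show False using 3 by simp
   qed
  qed
  hence "\<zeta> <= Z (n - Suc k) (X k w) (Y k w)" using k by (intro Zge half) auto
  thus ?thesis using \<zeta> by (intro power_mono) auto
 qed
 \<comment> \<open>Every good step advances the ideal clock by at least
   \<open>h * \<zeta>\<^sup>2\<close>; good steps in at least half of the first \<open>k0\<close>
   places would exceed the time \<open>t\<close>.\<close>
 have count: "h * \<zeta>^2 * card {i. i < k & \<bar>q i w\<bar> <= \<kappa>/8} <= Y k w" if "k <= k0" for k
  using that
 proof (induction k)
  case (Suc k)
  have IH: "h * \<zeta>^2 * card {i. i < k & \<bar>q i w\<bar> <= \<kappa>/8} <= Y k w" using Suc by simp
  show ?case
  proof (cases "\<bar>q k w\<bar> <= \<kappa>/8")
   case True
   hence "{i. i < Suc k & \<bar>q i w\<bar> <= \<kappa>/8} = insert k {i. i < k & \<bar>q i w\<bar> <= \<kappa>/8}"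
    by (auto simp: less_Suc_eq)
   hence "real (card {i. i < Suc k & \<bar>q i w\<bar> <= \<kappa>/8}) = 1 + card {i. i < k & \<bar>q i w\<bar> <= \<kappa>/8}" by simp
   moreover have "h * \<zeta>^2 <= h * (Z (n - Suc k) (X k w) (Y k w))\<^sup>2"
    using good[OF _ True] Suc.prems h by (intro mult_left_mono) auto
   ultimately show ?thesis using IH unfolding Y_Suc by (simp add: distrib_left)
  next
   case False
   hence "{i. i < Suc k & \<bar>q i w\<bar> <= \<kappa>/8} = {i. i < k & \<bar>q i w\<bar> <= \<kappa>/8}"
    by (auto simp: less_Suc_eq)
   thus ?thesis using IH Y_mono[of k "Suc k" w] by simp
  qed
 qed simp
 have "{i. i < k0 & \<bar>q i w\<bar> <= \<kappa>/8} \<union> {k. k < k0 & \<kappa>/8 < \<bar>q k w\<bar>} = {..<k0}" by auto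
 moreover have "card ({i. i < k0 & \<bar>q i w\<bar> <= \<kappa>/8} \<union> {k. k < k0 & \<kappa>/8 < \<bar>q k w\<bar>})
  = card {i. i < k0 & \<bar>q i w\<bar> <= \<kappa>/8} + card {k. k < k0 & \<kappa>/8 < \<bar>q k w\<bar>}"
  by (intro card_Un_disjoint) auto
 ultimately have "k0/2 <= card {i. i < k0 & \<bar>q i w\<bar> <= \<kappa>/8}" using few by simp
 hence "h * \<zeta>^2 * (k0/2) <= h * \<zeta>^2 * card {i. i < k0 & \<bar>q i w\<bar> <= \<kappa>/8}"
  using h by (intro mult_left_mono) auto
 also have "... <= Y k0 w" by (rule count) simp
 also have "... <= t" using Y_mono[OF k0n, of w] time_bounds(1)[of n w] w(2) by linarith
 finally show False using t(2) by (simp add: mult_ac)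
qed

text \<open>On \<open>A\<close> at least \<open>k0 / 2\<close> of the first \<open>k0\<close>
  defects exceed \<open>\<kappa> / 8\<close>. Integrating their number bounds the probability by an
  average of second moments; Chebyshev gives \<open>64 / \<kappa>\<^sup>2\<close>, and the
  guaranteed half doubles it.\<close>

lemma early_stop_unlikely:
 fixes \<kappa> t s0 :: real and k0 :: nat
 assumes \<kappa>: "0 < \<kappa>"
  and slope: "!!j x x' y. 1/2 <= j * h ==> j <= n ==> -1 <= x ==> x <= x' ==> x' <= 1 ==> \<kappa> * (x' - x) <= U j x' y - U j x y"
  and Zge: "!!j x y. 1/2 <= j * h ==> j <= n ==> \<bar>x\<bar> <= 1 ==> \<zeta> <= Z j x y" and \<zeta>: "0 < \<zeta>"
  and k0: "0 < k0" "k0 + 1 <= n/2" "k0 * h <= s0" "s0 * (\<Lambda> * L^2) + L * sqrt s0 <= \<kappa>/4"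
  and t: "\<Lambda> * t <= \<kappa>/8" "t < k0 * h * \<zeta>^2/2" and m: "8 <= m"
  and A: "A \<in> sets M" "!!w. w \<in> A ==> J n w/p <= t" "!!w s. w \<in> A ==> s \<in> \<rat> ==> 0 <= s ==> s <= t ==> \<bar>B s w\<bar> <= \<kappa>/8"
 shows "prob A <= 128 / \<kappa>^2 * total_error m"
proof -
 note [measurable] = A(1)
 have "ennreal (k0/2) * emeasure M A = (nn_integral M (%w. ennreal (k0/2) * indicator A w))"
  by (simp add: nn_integral_cmult_indicator)
 also have "... <= (nn_integral M (%w. (\<Sum>k<k0. ennreal (64 / \<kappa>^2) * ennreal ((q k w)^2))))"
 proof (rule nn_integral_mono_AE)
  show "AE w in M. ennreal (k0/2) * indicator A w <= (\<Sum>k<k0. ennreal (64 / \<kappa>^2) * ennreal ((q k w)^2))"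
   using start
  proof eventually_elim
   case (elim w)
   show ?case
   proof (cases "w \<in> A")
    case True
    have J: "\<bar>B (J k w/p) w\<bar> <= \<kappa>/8" if "k <= n" for k
    proof (rule A(3)[OF True])
     have "J k w/p <= J n w/p" using J_mono[OF that, of w] by (simp add: divide_right_mono)
     thus "J k w/p <= t" using A(2)[OF True] by linarith
    qed auto
    have "k0/2 <= real (card {k. k < k0 & \<kappa>/8 < \<bar>q k w\<bar>})"
     by (rule many_errors[OF \<kappa> slope Zge \<zeta> k0(2-4) t elim A(2)[OF True] J])
    also have "... = (\<Sum>k\<in>{k. k < k0 & \<kappa>/8 < \<bar>q k w\<bar>}. 1)" by simp
    also have "... <= (\<Sum>k\<in>{k. k < k0 & \<kappa>/8 < \<bar>q k w\<bar>}. 64 / \<kappa>^2 * (q k w)^2)"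
    proof (rule sum_mono)
     fix k assume "k \<in> {k. k < k0 & \<kappa>/8 < \<bar>q k w\<bar>}"
     hence "(\<kappa>/8)\<^sup>2 <= \<bar>q k w\<bar>\<^sup>2" using \<kappa> by (intro power_mono) auto
     thus "1 <= 64 / \<kappa>^2 * (q k w)\<^sup>2" using \<kappa> by (simp add: power_divide field_simps)
    qed
    also have "... <= (\<Sum>k<k0. 64 / \<kappa>^2 * (q k w)^2)" by (intro sum_mono2) auto
    finally have "ennreal (k0/2) <= ennreal (\<Sum>k<k0. 64 / \<kappa>^2 * (q k w)^2)" by (rule ennreal_leI)
    also have "ennreal (\<Sum>k<k0. 64 / \<kappa>^2 * (q k w)^2) = (\<Sum>k<k0. ennreal (64 / \<kappa>^2 * (q k w)^2))"
     by (rule sum_ennreal[symmetric]) simp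
    also have "... = (\<Sum>k<k0. ennreal (64 / \<kappa>^2) * ennreal ((q k w)^2))"
     by (intro sum.cong refl ennreal_mult) auto
    finally show ?thesis using True by simp
   qed simp
  qed
 qed
 also have "... = (\<Sum>k<k0. ennreal (64 / \<kappa>^2) * (nn_integral M (%w. ennreal ((q k w)^2))))"
  by (subst nn_integral_sum) (auto simp: nn_integral_cmult)
 also have "... <= (\<Sum>k<k0. ennreal (64 / \<kappa>^2) * ennreal (total_error m))"
  using k0(2) by (intro sum_mono mult_left_mono q_bound[OF m]) auto
 also have "... = ennreal (k0 * (64 / \<kappa>^2 * total_error m))"
  using total_error_nonneg by (simp add: ennreal_mult'[symmetric] ennreal_of_nat_eq_real_of_nat)
 finally have "ennreal (k0/2 * prob A) <= ennreal (k0 * (64 / \<kappa>^2 * total_error m))"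
  unfolding emeasure_eq_measure by (subst ennreal_mult) auto
 hence "k0/2 * prob A <= k0 * (64 / \<kappa>^2 * total_error m)"
  using total_error_nonneg[of m] by (simp add: ennreal_le_iff)
 hence "k0 * (prob A/2) <= k0 * (64 / \<kappa>^2 * total_error m)" by simp
 thus ?thesis using k0(1) by (simp only: mult_le_cancel_left_pos of_nat_0_less_iff)
qed

end

section \<open>Approximate embedding: choice of the parameters\<close>

context filtered_bm
begin

text \<open>\<open>\<eta>\<close> is the accuracy; \<open>K\<close>, \<open>C\<close>,
  \<open>r\<close>, \<open>t0\<close> are meant to be independent of it. The normal variable behind
  the target is existentially quantified because only its law survives the limit. The last clause
  excludes early stopping on calm paths; restricting to rational times makes calmness a countable
  condition.\<close>

definition approximates :: "real => real => real => real => (real => real) => (real => real) => real => ('a => real) => real => bool" where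
 "approximates K C r t0 g \<delta> \<eta> \<sigma> a \<longleftrightarrow>
  (\<forall>t\<ge>0. {w\<in>space M. \<sigma> w <= t} \<in> sets (F t)) &
  (\<forall>w\<in>space M. \<sigma> w \<in> \<rat> & 0 < \<sigma> w & \<sigma> w <= K) &
  (%w. B (\<sigma> w) w) \<in> borel_measurable M & \<bar>a\<bar> <= C &
  (\<exists>X. distr M borel X = \<N> & X \<in> borel_measurable M &
   (nn_integral M (%w. ennreal \<bar>a + \<delta> (\<sigma> w) + B (\<sigma> w) w - g (X w)\<bar>)) <= ennreal \<eta>) &
  (\<forall>A\<in>sets M. \<forall>t\<le>t0. (\<forall>w\<in>A. \<sigma> w <= t & (\<forall>s\<in>\<rat>. 0 <= s --> s <= t --> \<bar>B s w\<bar> <= r)) --> prob A <= \<eta>)"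

theorem approximate_embedding:
 assumes L: "0 < L" and \<Lambda>: "0 < \<Lambda>"
  and g_lipschitz: "!!x x'. \<bar>g x - g x'\<bar> <= L * \<bar>x - x'\<bar>"
  and \<delta>_lipschitz: "!!y y'. \<bar>\<delta> y - \<delta> y'\<bar> <= \<Lambda> * \<bar>y - y'\<bar>"
  and g_mono: "mono g"
  and \<kappa>0: "0 < \<kappa>0" and ab: "u < v"
  and g_slope: "!!x x'. x <= x' ==> (\<integral>\<^sup>+t\<in>{x..x'}. ennreal (\<kappa>0 * indicator {u..v} t) \<partial>lborel) <= ennreal (g x' - g x)"
 obtains C r t0 where "0 < r" "0 < t0"
  "!!\<eta>. 0 < \<eta> ==> \<exists>\<sigma> a. approximates (L^2 + 1) C r t0 g \<delta> \<eta> \<sigma> a"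
proof -
 define \<kappa> where "\<kappa> = slope_bound L \<Lambda> \<kappa>0 u v"
 have \<kappa>: "0 < \<kappa>" unfolding \<kappa>_def by (rule slope_bound_pos[OF \<kappa>0 ab])
 define \<zeta> where "\<zeta> = \<kappa> * inner_variance"
 have \<zeta>: "0 < \<zeta>" using \<kappa> inner_variance_pos by (simp add: \<zeta>_def)
 \<comment> \<open>The first \<open>s0\<close> of the horizon is where the clock is observed:
   \<open>1/4\<close> leaves more than half of the horizon, so the slope bounds apply, and each of
   the other two bounds limits one term of the drift of the start value to
   \<open>\<kappa> / 8\<close>.\<close>
 define s0 where "s0 = min (1/4) (min (\<kappa>/(8 * \<Lambda> * L^2)) ((\<kappa>/(8 * L))^2))"
 have s0: "0 < s0" "s0 <= 1/4" "s0 <= \<kappa>/(8 * \<Lambda> * L^2)" "s0 <= (\<kappa>/(8 * L))\<^sup>2"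
  using \<kappa> L \<Lambda> by (auto simp: s0_def)
 have s0': "s0 * (\<Lambda> * L^2) + L * sqrt s0 <= \<kappa>/4"
 proof -
  have "s0 * (\<Lambda> * L^2) <= \<kappa>/(8 * \<Lambda> * L^2) * (\<Lambda> * L^2)" using s0(3) \<Lambda> by (intro mult_right_mono) auto
  also have "... = \<kappa>/8" using L \<Lambda> by simp
  finally have 1: "s0 * (\<Lambda> * L^2) <= \<kappa>/8" .
  have "sqrt s0 <= \<kappa>/(8 * L)" using s0(4) \<kappa> L by (intro real_le_lsqrt) auto
  hence "L * sqrt s0 <= L * (\<kappa>/(8 * L))" using L by (intro mult_left_mono) auto
  also have "... = \<kappa>/8" using L by simp
  finally show ?thesis using 1 by simp
 qed
 \<comment> \<open>The elapsed time may move the field by at most \<open>\<kappa> / 8\<close>, and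
   it must stay below \<open>k0 * h * \<zeta>\<^sup>2 / 2\<close>; as
   \<open>k0 * h >= s0 / 2\<close>, the divisor 8 leaves a factor 2 to spare.\<close>
 define t0 where "t0 = min (\<kappa>/(8 * \<Lambda>)) (s0 * \<zeta>^2/8)"
 have t0: "0 < t0" "\<Lambda> * t0 <= \<kappa>/8" "t0 <= s0 * \<zeta>^2/8"
 proof -
  show "0 < t0" "t0 <= s0 * \<zeta>^2/8" using \<kappa> \<Lambda> s0 \<zeta> by (auto simp: t0_def)
  have "\<Lambda> * t0 <= \<Lambda> * (\<kappa>/(8 * \<Lambda>))" using \<Lambda> by (intro mult_left_mono) (auto simp: t0_def)
  thus "\<Lambda> * t0 <= \<kappa>/8" using \<Lambda> by simp
 qed
 \<comment> \<open>With \<open>n * h = 1\<close>, \<open>U_heat_close\<close> places the start value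
   within \<open>\<Lambda> * L\<^sup>2\<close> of the heat flow of the terminal condition, uniformly
   in \<open>n\<close>.\<close>
 define C where "C = \<bar>heat 1 (%x. g x - \<delta> 0) 0\<bar> + \<Lambda> * L\<^sup>2"
 have "\<exists>\<sigma> a. approximates (L^2 + 1) C (\<kappa>/8) t0 g \<delta> \<eta> \<sigma> a" if \<eta>: "0 < \<eta>" for \<eta>
 proof -
  \<comment> \<open>The admissible total error: the first bound serves the accuracy of the
    embedding, the second the early stopping estimate. Each of the five summands gets
    \<open>e / 5\<close>, whence the factors 5, 10 and 90 below.\<close>
  define e where "e = min ((\<eta>/2)^2) (\<eta> * \<kappa>^2/128)"
  have e: "0 < e" "e <= (\<eta>/2)\<^sup>2" "128 / \<kappa>^2 * e <= \<eta>"
  proof -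
   show "0 < e" "e <= (\<eta>/2)\<^sup>2" using \<eta> \<kappa> by (auto simp: e_def)
   have "128 / \<kappa>^2 * e <= 128 / \<kappa>^2 * (\<eta> * \<kappa>^2/128)" by (intro mult_left_mono) (auto simp: e_def)
   thus "128 / \<kappa>^2 * e <= \<eta>" using \<kappa> by simp
  qed
  define c where "c = max 1 (90 * L^2/e)"
  have c: "1 <= c" "90 * L^2 <= c * e"
   using e(1) by (auto simp: c_def max_def field_simps)
  have c4: "18 * L^2/c^4 <= e/5"
  proof -
   have "c <= c^4" using c(1) power_increasing[of 1 4 c] by simp
   hence "c * e <= c^4 * e" using e(1) by (intro mult_right_mono) auto
   hence "90 * L^2 <= c^4 * e" using c(2) by linarith
   thus ?thesis using c(1) by (simp add: field_simps)
  qed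
  have G: "0 <= gauss_exp_moment" unfolding gauss_exp_moment_def by simp
  obtain m :: nat where m: "8 + 10 * L^2 * gauss_exp_moment/e <= m" using real_arch_simple by blast
  have "0 <= 10 * L^2 * gauss_exp_moment/e" using G e(1) by simp
  hence m8: "8 <= m" and m': "10 * L^2 * gauss_exp_moment/e <= m" using m by linarith+
  have em: "2 * L^2/m * gauss_exp_moment <= e/5"
   using m8 m' e(1) by (simp add: field_simps)
  define N1 N2 N3 where "N1 = 5 * m * L^2/e" and "N2 = 10 * (real m)^2 * (\<Lambda> * L^2)^2/e" and "N3 = (8 * L * \<Lambda> * c)\<^sup>2"
  have N0: "0 <= N1" "0 <= N2" "0 <= N3" "0 <= 2/s0" using e(1) s0(1) by (auto simp: N1_def N2_def N3_def)
  obtain n :: nat where "N1 + N2 + N3 + 2/s0 + 4 <= n" using real_arch_simple by blast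
  hence n: "N1 <= n" "N2 <= n" "N3 <= n" "2/s0 <= n" "4 <= real n" using N0 by linarith+
  have n0: "0 < n" using n(5) by linarith
  have en1: "m * L^2/n <= e/5" using n(1) n0 e(1) by (simp add: N1_def field_simps)
  have en2: "2 * (real m)^2 * (\<Lambda> * L^2)^2/n <= e/5" using n(2) n0 e(1) by (simp add: N2_def field_simps)
  define h where "h = 1/real n"
  have h: "0 < h" "h <= 1" using n0 by (auto simp: h_def)
  have small: "8 * L * \<Lambda> * sqrt h * c <= 1"
  proof -
   have "8 * L * \<Lambda> * c <= sqrt n" using n(3) by (intro real_le_rsqrt) (simp add: N3_def)
   thus ?thesis using n0 by (simp add: h_def real_sqrt_divide field_simps)
  qed
  obtain p :: nat where "n + 10 * n/e + 2 * \<Lambda> * n / \<eta> <= p" using real_arch_simple by blast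
  moreover have "0 <= 10 * n/e" "0 <= 2 * \<Lambda> * n / \<eta>" using e(1) \<eta> \<Lambda> by auto
  ultimately have p: "n <= p" "10 * n/e <= p" "2 * \<Lambda> * n / \<eta> <= p" by linarith+
  have p0: "0 < p" using p(1) n0 by simp
  have ep: "2 * n/p <= e/5" using p(2) p0 e(1) by (simp add: field_simps)
  have ep2: "\<Lambda> * n/p <= \<eta>/2" using p(3) p0 \<eta> by (simp add: field_simps)
  have ep3: "n/p <= (1 :: real)" using p(1) p0 by simp
  interpret S: scheme_bm M F B h c L \<Lambda> g \<delta> n p
   using h(1) c(1) L \<Lambda> small g_lipschitz \<delta>_lipschitz g_mono n0 p0
   by unfold_locales (auto simp: h_def)
  have te: "S.total_error m <= e"
   using en1 en2 em c4 ep unfolding S.total_error_def by linarith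
  define k0 where "k0 = nat \<lfloor>s0 * n\<rfloor>"
  have sn: "2 <= s0 * n" using n(4) s0(1) by (simp add: field_simps)
  hence k0r: "real k0 <= s0 * n" "s0 * n - 1 <= real k0" unfolding k0_def by linarith+
  have k0: "0 < k0" "real (k0 + 1) <= n/2" "k0 * h <= s0" "s0/2 <= k0 * h"
  proof -
   have "0 < real k0" using k0r sn by linarith
   thus "0 < k0" by simp
   have "s0 * n <= 1/4 * n" using s0(2) by (intro mult_right_mono) auto
   hence "real k0 + 1 <= n/2" using k0r n(5) by linarith
   thus "real (k0 + 1) <= n/2" by (simp only: of_nat_add of_nat_1)
   show "k0 * h <= s0" using k0r(1) n0 by (simp add: h_def field_simps)
   have "s0 * n/2 <= real k0" using k0r sn by linarith
   thus "s0/2 <= k0 * h" using n0 by (simp add: h_def field_simps)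
  qed
  define \<sigma> where "\<sigma> w = fst (S.chain n) w/p" for w
  have jh: "j * h <= 1" if "j <= n" for j using that n0 by (simp add: h_def)
  have slope: "\<kappa> * (x' - x) <= S.U j x' y - S.U j x y"
   if "1/2 <= j * h" "j <= n" "-1 <= x" "x <= x'" "x' <= 1" for j x x' y
   unfolding \<kappa>_def using that jh by (intro S.U_slope[OF \<kappa>0 ab g_slope]) auto
  have Zge: "\<zeta> <= S.Z j x y" if "1/2 <= j * h" "j <= n" "\<bar>x\<bar> <= 1" for j x y
   unfolding \<zeta>_def \<kappa>_def using that jh h by (intro S.Z_ge[OF \<kappa>0 ab g_slope]) auto
  have "approximates (L^2 + 1) C (\<kappa>/8) t0 g \<delta> \<eta> \<sigma> (S.U n 0 0)"
   unfolding approximates_def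
  proof (intro conjI ballI allI impI)
   fix t :: real assume t: "0 <= t"
   have "{w\<in>space M. \<sigma> w <= t} = (\<Union>j\<in>{j. real j/p <= t}. {w\<in>space M. fst (S.chain n) w = j})"
    by (auto simp: \<sigma>_def)
   also have "... \<in> sets (F t)"
   proof (rule sets.countable_UN'')
    fix j assume "j \<in> {j. real j/p <= t}"
    thus "{w\<in>space M. fst (S.chain n) w = j} \<in> sets (F t)"
     using adapted_state_J[OF S.chain_adapted, of n j] F_mono[of "j/p" t] by auto
   qed simp
   finally show "{w\<in>space M. \<sigma> w <= t} \<in> sets (F t)" .
  next
   fix w assume "w \<in> space M"
   show "\<sigma> w \<in> \<rat>" "0 < \<sigma> w" using S.J_pos[of w] p0 by (auto simp: \<sigma>_def)
   have "\<sigma> w <= n * h * L^2 + n/p"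
    using S.time_bounds(2,3)[where k=n and w=w] unfolding \<sigma>_def by linarith
   moreover have "n * h = 1" using n0 by (simp add: h_def)
   ultimately show "\<sigma> w <= L^2 + 1" using ep3 by simp
  next
   show "(%w. B (\<sigma> w) w) \<in> borel_measurable M"
   proof -
    have [measurable]: "B (real j/real p) \<in> borel_measurable M" for j by (rule B_measurable) simp
    have "(%w. (%(j::nat) w. B (real j/real p) w) (fst (S.chain n) w) w) \<in> borel_measurable M"
     by (rule measurable_compose_countable[OF _ S.J_measurable]) measurable
    thus ?thesis by (simp add: \<sigma>_def)
   qed
  next
   have "S.U 0 = (%x y. g x - \<delta> y)" by simp
   hence "\<bar>S.U n 0 0 - heat (n * h) (%x. g x - \<delta> 0) 0\<bar> <= n * h * (\<Lambda> * L^2)"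
    using S.U_heat_close[of 0 n 0 0] by simp
   moreover have "n * h = 1" using n0 by (simp add: h_def)
   ultimately have "\<bar>S.U n 0 0 - heat 1 (%x. g x - \<delta> 0) 0\<bar> <= \<Lambda> * L\<^sup>2" by simp
   thus "\<bar>S.U n 0 0\<bar> <= C" unfolding C_def by linarith
  next
   have "(nn_integral M (%w. ennreal \<bar>S.U n 0 0 + \<delta> (\<sigma> w) + B (\<sigma> w) w - g (fst (snd (S.chain n) w))\<bar>)) <= ennreal (\<eta>/2 + \<Lambda> * n/p)"
    unfolding \<sigma>_def using m8 \<eta> te e(2) by (intro S.final_error[of m]) auto
   also have "... <= ennreal \<eta>" using ep2 by (intro ennreal_leI) linarith
   finally show "\<exists>X. distr M borel X = \<N> & X \<in> borel_measurable M &
     (nn_integral M (%w. ennreal \<bar>S.U n 0 0 + \<delta> (\<sigma> w) + B (\<sigma> w) w - g (X w)\<bar>)) <= ennreal \<eta>"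
    using S.distr_X by (intro exI[of _ "%w. fst (snd (S.chain n) w)"]) auto
  next
   fix A t
   assume A: "A \<in> sets M" and t: "t <= t0"
    and AA: "\<forall>w\<in>A. \<sigma> w <= t & (\<forall>s\<in>\<rat>. 0 <= s --> s <= t --> \<bar>B s w\<bar> <= \<kappa>/8)"
   have t1: "\<Lambda> * t <= \<kappa>/8" using t0(2) t \<Lambda> by (meson mult_left_mono order_trans less_imp_le)
   have "s0/2 * (\<zeta>^2/2) <= k0 * h * (\<zeta>^2/2)" using k0(4) by (intro mult_right_mono) auto
   moreover have "t < s0/2 * (\<zeta>^2/2)"
   proof -
    have "0 < s0 * \<zeta>\<^sup>2" using s0 \<zeta> by simp
    moreover have "s0/2 * (\<zeta>^2/2) = s0 * \<zeta>^2/4" by simp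
    ultimately show ?thesis using t t0(3) by linarith
   qed
   ultimately have t2: "t < k0 * h * \<zeta>^2/2" by simp
   have "prob A <= 128 / \<kappa>^2 * S.total_error m"
    by (rule S.early_stop_unlikely[OF \<kappa> slope Zge \<zeta> k0(1-3) s0' t1 t2 m8 A]) (use AA in \<open>auto simp: \<sigma>_def\<close>)
   also have "... <= 128 / \<kappa>^2 * e" using te by (intro mult_left_mono) auto
   also have "... <= \<eta>" by (rule e(3))
   finally show "prob A <= \<eta>" .
  qed
  thus ?thesis by blast
 qed
 thus ?thesis using that[of "\<kappa>/8" t0 C] \<kappa> t0(1) by simp
qed

end

section \<open>Convergent convex combinations\<close>

text \<open>Tail convex combinations of a uniformly bounded sequence can be chosen to converge: combinations of almost
 minimal norm form a Cauchy sequence in \<open>L\<^sup>2\<close> by the parallelogram law.\<close>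

definition tail_weights :: "nat => (nat => real) => bool" where
 "tail_weights k w \<longleftrightarrow> (\<forall>m. 0 <= w m) & (\<forall>m<k. w m = 0) & finite {m. w m \<noteq> 0} & (\<Sum>m | w m \<noteq> 0. w m) = 1"

definition mix :: "(nat => real) => (nat => real) => real" where
 "mix w a = (\<Sum>m | w m \<noteq> 0. w m * a m)"

lemma mix_eq:
 assumes "finite I" "{m. w m \<noteq> 0} \<subseteq> I"
 shows "mix w a = (\<Sum>m\<in>I. w m * a m)"
 unfolding mix_def using assms by (intro sum.mono_neutral_left) auto

lemma tail_weights_average:
 assumes "tail_weights k w" "tail_weights k v"
 shows "tail_weights k (%m. (w m + v m)/2)"
  and "mix (%m. (w m + v m)/2) a = (mix w a + mix v a)/2"
proof -
 let ?I = "{m. w m \<noteq> 0} \<union> {m. v m \<noteq> 0}"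
 have I: "finite ?I" using assms by (auto simp: tail_weights_def)
 have sub: "{m. (w m + v m)/2 \<noteq> 0} \<subseteq> ?I" by auto
 have m1: "mix u (%_. 1) = (\<Sum>m | u m \<noteq> 0. u m)" for u by (simp add: mix_def)
 show mix: "mix (%m. (w m + v m)/2) a = (mix w a + mix v a)/2" for a
 proof -
  have "mix (%m. (w m + v m)/2) a = (\<Sum>m\<in>?I. (w m + v m)/2 * a m)" by (rule mix_eq[OF I sub])
  moreover have "mix w a = (\<Sum>m\<in>?I. w m * a m)" "mix v a = (\<Sum>m\<in>?I. v m * a m)"
   by (rule mix_eq[OF I], blast)+
  ultimately show ?thesis
   by (simp add: sum.distrib[symmetric] sum_divide_distrib add_divide_distrib distrib_right)
 qed
 have "(\<Sum>m | (w m + v m)/2 \<noteq> 0. (w m + v m)/2) = 1"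
  using mix[of "%_. 1"] assms unfolding m1 by (simp add: tail_weights_def)
 thus "tail_weights k (%m. (w m + v m)/2)"
  using assms finite_subset[OF sub I] unfolding tail_weights_def by auto
qed

lemma tail_weights_mono: "k <= l ==> tail_weights l w ==> tail_weights k w"
 unfolding tail_weights_def by auto

lemma tail_weights_single: "tail_weights k (%m. if m = k then 1 else 0)"
proof -
 have "{m. (if m = k then 1 else 0 :: real) \<noteq> 0} = {k}" by auto
 thus ?thesis unfolding tail_weights_def by simp
qed

lemma mix_mono:
 assumes "tail_weights k w" "!!m. k <= m ==> a m <= a' m"
 shows "mix w a <= mix w a'"
 unfolding mix_def
proof (rule sum_mono)
 fix m assume "m \<in> {m. w m \<noteq> 0}"
 hence "k <= m" using assms(1) unfolding tail_weights_def by (meson mem_Collect_eq not_le)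
 thus "w m * a m <= w m * a' m" using assms unfolding tail_weights_def by (intro mult_left_mono) auto
qed

lemma mix_const: "tail_weights k w ==> mix w (%_. r) = r"
 unfolding mix_def tail_weights_def by (simp add: sum_distrib_right[symmetric])

lemma mix_bounds:
 assumes "tail_weights k w" "!!m. k <= m ==> 0 <= a m" "!!m. k <= m ==> a m <= 1"
 shows "0 <= mix w a" "mix w a <= 1"
 using mix_mono[OF assms(1), of "%_. 0" a] mix_mono[OF assms(1), of a "%_. 1"] assms mix_const[OF assms(1)] by auto

lemma (in finite_measure) convex_combinations_converge:
 fixes f :: "nat => 'a => real"
 assumes [measurable]: "!!m. f m \<in> borel_measurable M" and f: "!!m x. x \<in> space M ==> 0 <= f m x" "!!m x. x \<in> space M ==> f m x <= 1"
 obtains w where "!!k. tail_weights k (w k)" "AE x in M. convergent (%k. mix (w k) (%m. f m x))"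
proof -
 define G where "G w x = mix w (%m. f m x)" for w x
 have [measurable]: "G w \<in> borel_measurable M" for w unfolding G_def mix_def by measurable
 have G01: "0 <= G w x" "G w x <= 1" if "tail_weights k w" "x \<in> space M" for w k x
  unfolding G_def using mix_bounds[OF that(1)] f[OF that(2)] by auto
 have Gsq: "integrable M (%x. (G w x)^2)" if "tail_weights k w" for w k
 proof (rule integrable_const_bound[where B=1])
  show "AE x in M. norm ((G w x)^2) <= 1"
   using G01[OF that] by (intro AE_I2) (simp add: power_le_one)
 qed simp
 define N where "N w = (LINT x|M. (G w x)^2)" for w
 define d where "d k = Inf (N ` Collect (tail_weights k))" for k
 have ne: "N ` Collect (tail_weights k) \<noteq> {}" for k using tail_weights_single by auto
 have bb: "bdd_below (N ` Collect (tail_weights k))" for k by (auto simp: N_def intro!: bdd_belowI[where m=0])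
 have d_le: "d k <= N w" if "tail_weights k w" for k w
  unfolding d_def using that by (intro cInf_lower bb) auto
 have N_le: "N w <= measure M (space M)" if "tail_weights k w" for k w
 proof -
  have "N w <= (LINT x|M. 1)" unfolding N_def
   using Gsq[OF that] G01[OF that] by (intro integral_mono) (auto simp: power_le_one)
  thus ?thesis by simp
 qed
 have d_mono: "d k <= d l" if "k <= l" for k l
  unfolding d_def using tail_weights_mono[OF that] by (intro cInf_superset_mono ne bb) auto
 have d_bound: "d k <= measure M (space M)" for k
  using d_le[OF tail_weights_single] N_le[OF tail_weights_single] order_trans by blast
 obtain D where D: "d \<longlonglongrightarrow> D" and dD: "!!k. d k <= D"
  using incseq_convergent[of d "measure M (space M)"] d_mono d_bound by (auto simp: incseq_def)
 have "\<exists>w. tail_weights k w & N w < d k + inverse (real (Suc k))" for k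
  using cInf_lessD[OF ne, of k "d k + inverse (real (Suc k))"] unfolding d_def by auto
 then obtain w where w: "!!k. tail_weights k (w k)" "!!k. N (w k) < d k + inverse (real (Suc k))" by metis
 have close: "(LINT x|M. (G (w i) x - G (w j) x)^2) <= 4 * (D - d k) + 4 * inverse (real (Suc k))" if "k <= i" "k <= j" for i j k
 proof -
  let ?u = "%m. (w i m + w j m)/2"
  have tk: "tail_weights k (w i)" "tail_weights k (w j)" using w(1) tail_weights_mono that by blast+
  note u = tail_weights_average[OF tk]
  \<comment> \<open>In the parallelogram identity the average is again an admissible combination, so
    its norm is at least \<open>d k\<close>, while both given norms are at most \<open>D\<close>
    plus the slack; only a small difference remains.\<close>
  have "(LINT x|M. (G (w i) x - G (w j) x)^2) = (LINT x|M. 2 * (G (w i) x)^2 + 2 * (G (w j) x)^2 - 4 * (G ?u x)^2)"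
   unfolding G_def u(2) by (intro Bochner_Integration.integral_cong) (auto simp: power2_eq_square field_simps)
  also have "... = 2 * N (w i) + 2 * N (w j) - 4 * N ?u"
   using Gsq[OF tk(1)] Gsq[OF tk(2)] Gsq[OF u(1)] unfolding N_def by simp
  also have "... <= 4 * (D - d k) + 4 * inverse (real (Suc k))"
  proof -
   have 1: "N (w l) <= D + inverse (real (Suc k))" if "k <= l" for l
   proof -
    have "inverse (real (Suc l)) <= inverse (real (Suc k))" using that by (intro le_imp_inverse_le) auto
    hence "d l + inverse (real (Suc l)) <= D + inverse (real (Suc k))" by (rule add_mono[OF dD])
    thus ?thesis using w(2)[of l] by (meson less_imp_le order_trans)
   qed
   have "2 * a + 2 * b - 4 * c <= 4 * (D - d k) + 4 * v"
    if "a <= D + v" "b <= D + v" "d k <= c" for a b c v :: real using that by argo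
   thus ?thesis using 1[OF that(1)] 1[OF that(2)] d_le[OF u(1)] by blast
  qed
  finally show ?thesis .
 qed
 define r where "r k = 4 * (D - d k) + 4 * inverse (real (Suc k))" for k
 have "r \<longlonglongrightarrow> 4 * (D - D) + 4 * 0"
  unfolding r_def by (intro tendsto_intros D LIMSEQ_inverse_real_of_nat)
 hence r0: "r \<longlonglongrightarrow> 0" by simp
 have Gi: "integrable M (G (w i))" for i
  using G01[OF w(1)] by (intro integrable_const_bound[where B=1]) (auto intro!: AE_I2)
 have L1: "(LINT x|M. norm (G (w i) x - G (w j) x)) <= \<epsilon> * measure M (space M) + r k / \<epsilon>" if "k <= i" "k <= j" "0 < \<epsilon>" for i j k \<epsilon>
 proof -
  have i2: "integrable M (%x. (G (w i) x - G (w j) x)^2)"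
  proof (rule integrable_const_bound[where B=1])
   show "AE x in M. norm ((G (w i) x - G (w j) x)^2) <= 1"
   proof (rule AE_I2)
    fix x assume "x \<in> space M"
    hence "\<bar>G (w i) x - G (w j) x\<bar> <= 1" using G01[OF w(1)[of i]] G01[OF w(1)[of j]] by (smt (verit))
    thus "norm ((G (w i) x - G (w j) x)^2) <= 1" by (simp add: abs_square_le_1)
   qed
  qed simp
  have "(LINT x|M. norm (G (w i) x - G (w j) x)) <= (LINT x|M. \<epsilon> + (G (w i) x - G (w j) x)^2 / \<epsilon>)"
  proof (intro integral_mono)
   fix x
   let ?t = "\<bar>G (w i) x - G (w j) x\<bar>"
   have "0 <= (\<epsilon> - ?t)^2 + \<epsilon> * ?t" using that by simp
   also have "... <= \<epsilon>^2 + ?t\<^sup>2 - \<epsilon> * ?t" by (simp add: power2_diff)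
   finally have "?t * \<epsilon> <= \<epsilon> * \<epsilon> + ?t\<^sup>2" by (simp add: power2_eq_square mult.commute)
   hence "?t <= (\<epsilon> * \<epsilon> + ?t\<^sup>2) / \<epsilon>" using that by (simp add: pos_le_divide_eq)
   thus "norm (G (w i) x - G (w j) x) <= \<epsilon> + (G (w i) x - G (w j) x)^2 / \<epsilon>"
    using that by (simp add: add_divide_distrib)
  qed (use Gi i2 in simp_all)
  also have "... = \<epsilon> * measure M (space M) + (LINT x|M. (G (w i) x - G (w j) x)^2) / \<epsilon>"
   using i2 by simp
  also have "... <= \<epsilon> * measure M (space M) + r k / \<epsilon>"
   using close[OF that(1,2)] that(3) unfolding r_def by (intro add_left_mono divide_right_mono) auto
  finally show ?thesis .
 qed
 have "\<exists>s. strict_mono s & (AE x in M. Cauchy (%i. G (w (s i)) x))"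
 proof (rule cauchy_L1_AE_cauchy_subseq[where s="%i. G (w i)"])
  show "integrable M (G (w i))" for i by (rule Gi)
  fix e :: real assume e: "0 < e"
  define \<epsilon> where "\<epsilon> = e/(2 * (measure M (space M) + 1))"
  have \<epsilon>: "0 < \<epsilon>" using e by (simp add: \<epsilon>_def add_nonneg_pos)
  have "\<epsilon> * measure M (space M) <= \<epsilon> * (measure M (space M) + 1)" using \<epsilon> by simp
  also have "... = e/2"
  proof -
   have "measure M (space M) + 1 \<noteq> 0" using measure_nonneg[of M "space M"] by linarith
   moreover have "a/(2 * b) * b = a/2" if "b \<noteq> 0" for a b :: real using that by simp
   ultimately show ?thesis unfolding \<epsilon>_def by blast
  qed
  finally have 1: "\<epsilon> * measure M (space M) <= e/2" .
  have "eventually (%k. r k < \<epsilon> * e/2) sequentially"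
   using r0 e \<epsilon> by (intro order_tendstoD) auto
  then obtain k where k: "r k < \<epsilon> * e/2" by (auto simp: eventually_sequentially)
  hence "r k / \<epsilon> < e/2" using \<epsilon> by (simp add: pos_divide_less_eq mult.commute)
  hence "(LINT x|M. norm (G (w i) x - G (w j) x)) < e" if "k <= i" "k <= j" for i j
   using L1[OF that \<epsilon>] 1 by linarith
  thus "\<exists>N. \<forall>i\<ge>N. \<forall>j\<ge>N. (LINT x|M. norm (G (w i) x - G (w j) x)) < e" by blast
 qed blast
 then obtain s where s: "strict_mono s" "AE x in M. Cauchy (%i. G (w (s i)) x)" by blast
 show ?thesis
 proof (rule that[of "%i. w (s i)"])
  show "tail_weights k (w (s k))" for k using w(1)[of "s k"] tail_weights_mono seq_suble[OF s(1)] by blast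
  show "AE x in M. convergent (%k. mix (w (s k)) (%m. f m x))"
   using s(2) by (simp add: G_def Cauchy_convergent_iff)
 qed
qed

section \<open>Conditional quantiles\<close>

text \<open>A conditional version of the quantile transform: if \<open>D\<close> has no atoms given \<open>C\<close>, then the conditional distribution function
 of \<open>D\<close> on \<open>E\<close>, evaluated at \<open>D\<close>, is a randomisation variable that realises every \<open>C\<close>-measurable
 conditional probability below that of \<open>E\<close>.\<close>

locale cond_quantile = prob_space M for M :: "'a measure" +
 fixes C :: "'a measure" and E :: "'a set" and D :: "'a => real"
 assumes subalgebra_C: "subalgebra M C" and E_sets [measurable]: "E \<in> sets M"
  and D_measurable [measurable]: "D \<in> borel_measurable M"
  and D_range: "!!w. w \<in> space M ==> 0 < D w" "!!w. w \<in> space M ==> D w < 1"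
  and D_no_atoms: "!!\<zeta>. \<zeta> \<in> borel_measurable C ==> AE w in M. D w \<noteq> \<zeta> w"
begin

sublocale finite_measure_subalgebra M C
 by unfold_locales (rule subalgebra_C)

lemma measurable_C: "f \<in> measurable C N ==> f \<in> measurable M N"
 using subalgebra_C measurable_from_subalg by blast

lemma sets_C: "A \<in> sets C ==> A \<in> sets M"
 using subalgebra_C by (auto simp: subalgebra_def)

lemma space_C: "space C = space M"
 using subalgebra_C by (simp add: subalgebra_def)

definition cond_cdf :: "real => 'a => real" where
 "cond_cdf q = real_cond_exp M C (indicator (E \<inter> {w\<in>space M. D w <= q}))"

text \<open>Clipping alters the conditional distribution function only on a null set and bounds the
  supremum in \<open>threshold\<close> at every point.\<close>

definition clipped_cdf :: "real => 'a => real" where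
 "clipped_cdf q w = max 0 (min 1 (cond_cdf q w))"

text \<open>The left limit at \<open>D w\<close> of the conditional distribution function, along
  rationals so that only countably many versions are combined. The value 0 for the remaining
  \<open>q\<close> cannot raise a supremum of nonnegative numbers.\<close>

definition threshold :: "'a => real" where
 "threshold w = (SUP q\<in>\<rat> \<inter> {0..1}. if q < D w then clipped_cdf q w else 0)"

lemma cond_cdf_measurable [measurable]: "cond_cdf q \<in> borel_measurable C" "cond_cdf q \<in> borel_measurable M"
 unfolding cond_cdf_def by measurable

lemma clipped_cdf_measurable [measurable]: "clipped_cdf q \<in> borel_measurable C" "clipped_cdf q \<in> borel_measurable M"
 unfolding clipped_cdf_def by measurable

lemma countable_index: "countable (\<rat> \<inter> {0..1 :: real})" "\<rat> \<inter> {0..1 :: real} \<noteq> {}"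
 by (auto intro: countable_subset[OF _ countable_rat])

lemma clipped_cdf_bounds: "0 <= clipped_cdf q w" "clipped_cdf q w <= 1"
 by (auto simp: clipped_cdf_def)

lemma threshold_bdd: "bdd_above ((%q. if q < D w then clipped_cdf q w else 0) ` (\<rat> \<inter> {0..1}))"
 using clipped_cdf_bounds by (intro bdd_aboveI[where M=1]) auto

lemma threshold_measurable:
 assumes "!!q. clipped_cdf q \<in> borel_measurable G" "D \<in> borel_measurable G"
 shows "threshold \<in> borel_measurable G"
proof -
 note [measurable] = assms
 have "(%w. SUP q\<in>\<rat> \<inter> {0..1}. if q < D w then clipped_cdf q w else 0) \<in> borel_measurable G"
 proof (rule borel_measurable_cSUP[OF countable_index(1)])
  fix w show "bdd_above ((%q. if q < D w then clipped_cdf q w else 0) ` (\<rat> \<inter> {0..1}))" by (rule threshold_bdd)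
 qed measurable
 thus ?thesis by (simp add: threshold_def[abs_def])
qed

lemma indicator_integrable: "A \<in> sets M ==> integrable M (indicator A :: 'a => real)"
 by (simp add: emeasure_eq_measure)

lemma cdf_facts:
 "AE w in M. (\<forall>q\<in>\<rat>. cond_cdf q w = clipped_cdf q w) & (\<forall>q\<in>\<rat>. \<forall>r\<in>\<rat>. q <= r --> clipped_cdf q w <= clipped_cdf r w)
  & (\<forall>q\<in>\<rat>. 1 <= q --> clipped_cdf q w = real_cond_exp M C (indicator E) w)"
proof -
 let ?I = "%q. indicator (E \<inter> {w\<in>space M. D w <= q}) :: 'a => real"
 have int: "integrable M (?I q)" for q by (rule indicator_integrable) measurable
 have 1: "AE w in M. cond_cdf q w = clipped_cdf q w" for q
 proof -
  have "AE w in M. cond_cdf q w \<ge> 0" "AE w in M. cond_cdf q w <= 1"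
   unfolding cond_cdf_def by (auto intro!: real_cond_exp_ge_c real_cond_exp_le_c int simp: indicator_def)
  thus ?thesis by eventually_elim (simp add: clipped_cdf_def)
 qed
 have 2: "AE w in M. q <= r --> cond_cdf q w <= cond_cdf r w" for q r
 proof (cases "q <= r")
  case True
  have "AE w in M. cond_cdf q w <= cond_cdf r w"
   unfolding cond_cdf_def by (rule real_cond_exp_mono) (use True in \<open>auto simp: indicator_def int\<close>)
  thus ?thesis by simp
 qed simp
 have 3: "1 <= q ==> cond_cdf q = real_cond_exp M C (indicator E)" for q
 proof -
  assume "1 <= q"
  hence "E \<inter> {w\<in>space M. D w <= q} = E"
   using D_range(2) sets.sets_into_space[OF E_sets] by (auto intro: less_imp_le less_le_trans)
  thus ?thesis by (simp add: cond_cdf_def)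
 qed
 have "AE w in M. \<forall>q\<in>\<rat>. cond_cdf q w = clipped_cdf q w"
  using 1 by (subst AE_ball_countable) (auto intro: countable_rat)
 moreover have "AE w in M. \<forall>q\<in>\<rat>. \<forall>r\<in>\<rat>. q <= r --> cond_cdf q w <= cond_cdf r w"
 proof -
  have "AE w in M. \<forall>r\<in>\<rat>. q <= r --> cond_cdf q w <= cond_cdf r w" for q
   using 2 by (subst AE_ball_countable) (auto intro: countable_rat)
  thus ?thesis by (subst AE_ball_countable) (auto intro: countable_rat)
 qed
 ultimately show ?thesis by eventually_elim (auto simp: 3)
qed

text \<open>The defining property of the conditional distribution function at a
  \<open>C\<close>-measurable random level: finitely many values split it into cases of constant
  level, and grid approximations then reach every level.\<close>

lemma freeze:
 assumes \<kappa>[measurable]: "\<kappa> \<in> measurable C (count_space UNIV)" and fin: "finite J" "!!w. w \<in> space M ==> \<kappa> w \<in> J"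
  and [measurable]: "S \<in> sets C" and n: "n \<noteq> (0 :: nat)"
 shows "prob (S \<inter> E \<inter> {w\<in>space M. D w <= real_of_int (\<kappa> w)/n}) = (LINT w:S|M. clipped_cdf (real_of_int (\<kappa> w)/n) w)"
proof -
 let ?c = "%w. clipped_cdf (real_of_int (\<kappa> w)/n) w"
  and ?A = "%j. E \<inter> {w\<in>space M. D w <= real_of_int j/n}"
 have [measurable]: "S \<in> sets M" "\<kappa> \<in> measurable M (count_space UNIV)" by (auto intro: sets_C measurable_C)
 define P where "P j = {w\<in>space M. \<kappa> w = j}" for j
 have P[measurable]: "P j \<in> sets C" "P j \<in> sets M" for j
 proof -
  have "P j = \<kappa> -` {j} \<inter> space C" by (auto simp: P_def space_C)
  thus "P j \<in> sets C" by simp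
  thus "P j \<in> sets M" by (rule sets_C)
 qed
 let ?I = "%q. indicator (E \<inter> {w\<in>space M. D w <= q}) :: 'a => real"
 have int: "integrable M (?I q)" for q by (rule indicator_integrable) measurable
 have s0: "S \<inter> E \<inter> {w\<in>space M. D w <= real_of_int (\<kappa> w)/n}
  = (\<Union>j\<in>J. S \<inter> P j \<inter> ?A j)"
  using fin(2) by (auto simp: P_def)
 have s1: "prob (\<Union>j\<in>J. S \<inter> P j \<inter> ?A j) = (\<Sum>j\<in>J. prob (S \<inter> P j \<inter> ?A j))"
  using fin(1) by (intro finite_measure_finite_Union) (auto simp: disjoint_family_on_def P_def)
 have s2: "(\<Sum>j\<in>J. prob (S \<inter> P j \<inter> ?A j)) = (\<Sum>j\<in>J. (LINT w:S|M. ?c w * indicator (P j) w))"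
 proof (rule sum.cong[OF refl])
  fix j
  have "prob (S \<inter> P j \<inter> ?A j) = (LINT w|M. indicator (S \<inter> P j) w * indicator (?A j) w)"
   by (simp add: indicator_inter_arith[symmetric])
  also have "... = (\<integral>w\<in>S \<inter> P j. ?I (real_of_int j/n) w \<partial>M)"
   by (simp add: set_lebesgue_integral_def)
  also have "... = (\<integral>w\<in>S \<inter> P j. cond_cdf (real_of_int j/n) w \<partial>M)"
   unfolding cond_cdf_def by (intro real_cond_exp_intA int) measurable
  also have "... = (LINT w:S|M. ?c w * indicator (P j) w)"
   unfolding set_lebesgue_integral_def
  proof (rule integral_cong_AE)
   show "AE w in M. indicat_real (S \<inter> P j) w *\<^sub>R cond_cdf (real_of_int j/n) w
    = indicat_real S w *\<^sub>R (?c w * indicator (P j) w)"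
    using cdf_facts by eventually_elim (auto simp: indicator_def P_def)
   have "(%w. ?c w) \<in> borel_measurable M"
    by (rule measurable_compose_countable[where g=\<kappa>]) measurable
   thus "(%w. indicat_real S w *\<^sub>R (?c w * indicator (P j) w)) \<in> borel_measurable M"
    by measurable
  qed measurable
  finally show "prob (S \<inter> P j \<inter> ?A j) = (LINT w:S|M. ?c w * indicator (P j) w)" .
 qed
 have s3: "(\<Sum>j\<in>J. (LINT w:S|M. ?c w * indicator (P j) w)) = (LINT w|M. (\<Sum>j\<in>J. indicator S w *\<^sub>R (?c w * indicator (P j) w)))"
  unfolding set_lebesgue_integral_def
 proof (rule Bochner_Integration.integral_sum[symmetric])
  fix j
  have "(%w. ?c w) \<in> borel_measurable M"
   by (rule measurable_compose_countable[where g=\<kappa>]) measurable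
  thus "integrable M (%w. indicator S w *\<^sub>R (?c w * indicator (P j) w))"
   using clipped_cdf_bounds by (intro integrable_const_bound[where B=1]) (auto simp: indicator_def)
 qed
 have s4: "(LINT w|M. (\<Sum>j\<in>J. indicator S w *\<^sub>R (?c w * indicator (P j) w))) = (LINT w:S|M. ?c w)"
  unfolding set_lebesgue_integral_def
 proof (rule Bochner_Integration.integral_cong[OF refl])
  fix w assume w: "w \<in> space M"
  have "(\<Sum>j\<in>J. indicator (P j) w) = (\<Sum>j\<in>J. if j = \<kappa> w then 1 else (0::real))"
   using w by (intro sum.cong) (auto simp: P_def indicator_def)
  hence "(\<Sum>j\<in>J. indicator (P j) w) = (1::real)" using fin w by simp
  thus "(\<Sum>j\<in>J. indicator S w *\<^sub>R (?c w * indicator (P j) w))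
   = indicator S w *\<^sub>R ?c w"
   by (simp only: real_scaleR_def sum_distrib_left[symmetric] mult_1_right)
 qed
 show ?thesis unfolding s0 s1 s2 s3 s4 by (rule refl)
qed

text \<open>With the conditional quantile \<zeta> at level \<open>N\<close>, the condition
  \<open>threshold w <= N w\<close> is almost surely \<open>D w <= \<zeta> w\<close>. Grid levels
  just above and just below \<zeta> give probabilities on both sides of that of \<open>N\<close>,
  and since \<open>D\<close> does not hit \<zeta> they have the same limit.\<close>

theorem cond_exp_threshold:
 assumes N[measurable]: "N \<in> borel_measurable C"
  and N_bounds: "AE w in M. 0 <= N w & N w <= real_cond_exp M C (indicator E) w"
 shows "AE w in M. real_cond_exp M C (indicator (E \<inter> {w\<in>space M. threshold w <= N w})) w = N w"
proof -
 have [measurable]: "N \<in> borel_measurable M" "threshold \<in> borel_measurable M"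
  by (auto intro: measurable_C threshold_measurable)
 define \<zeta> where "\<zeta> w = (SUP q\<in>\<rat> \<inter> {0..1}. if clipped_cdf q w <= N w then q else 0)" for w
 have \<zeta>_bdd: "bdd_above ((%q. if clipped_cdf q w <= N w then q else 0) ` (\<rat> \<inter> {0..1}))" for w
  by (intro bdd_aboveI[where M=1]) auto
 have \<zeta>C[measurable]: "\<zeta> \<in> borel_measurable C"
 proof -
  have "(%w. SUP q\<in>\<rat> \<inter> {0..1}. if clipped_cdf q w <= N w then q else 0) \<in> borel_measurable C"
  proof (rule borel_measurable_cSUP[OF countable_index(1)])
   fix w show "bdd_above ((%q. if clipped_cdf q w <= N w then q else 0) ` (\<rat> \<inter> {0..1}))" by (rule \<zeta>_bdd)
  qed measurable
  thus ?thesis by (simp add: \<zeta>_def[abs_def])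
 qed
 have [measurable]: "\<zeta> \<in> borel_measurable M" by (rule measurable_C) simp
 have \<zeta>01: "0 <= \<zeta> w" "\<zeta> w <= 1" for w
 proof -
  have "(if clipped_cdf 0 w <= N w then 0 else 0) <= \<zeta> w"
   unfolding \<zeta>_def by (rule cSUP_upper[OF _ \<zeta>_bdd]) simp
  thus "0 <= \<zeta> w" by simp
  show "\<zeta> w <= 1" unfolding \<zeta>_def by (rule cSUP_least[OF countable_index(2)]) auto
 qed
 have \<zeta>_upper: "N w < clipped_cdf q w" if "q \<in> \<rat>" "q <= 1" "\<zeta> w < q" for q w
 proof (rule ccontr)
  assume "\<not> ?thesis"
  moreover have "(if clipped_cdf q w <= N w then q else 0) <= \<zeta> w"
   unfolding \<zeta>_def using that \<zeta>01(1)[of w] by (intro cSUP_upper[OF _ \<zeta>_bdd]) auto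
  ultimately show False using that by simp
 qed
 have \<zeta>_lower: "\<exists>q\<in>\<rat>. r < q & clipped_cdf q w <= N w" if r: "0 <= r" "r < \<zeta> w" for r w
 proof -
  have "\<exists>q\<in>\<rat> \<inter> {0..1}. r < (if clipped_cdf q w <= N w then q else 0)"
   using r(2) unfolding \<zeta>_def by (rule less_cSUP_iff[OF countable_index(2) \<zeta>_bdd, THEN iffD1])
  then obtain q where q: "q \<in> \<rat> \<inter> {0..1}" "r < (if clipped_cdf q w <= N w then q else 0)" ..
  have "clipped_cdf q w <= N w" using q(2) r(1) by (cases "clipped_cdf q w <= N w") simp_all
  moreover from this have "r < q" using q(2) by simp
  ultimately show ?thesis by (rule_tac x=q in bexI) (use q(1) in simp_all)
 qed
 have no_atoms: "AE w in M. D w \<noteq> \<zeta> w" by (rule D_no_atoms[OF \<zeta>C])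
 have eq: "AE w in M. threshold w <= N w \<longleftrightarrow> D w <= \<zeta> w"
  using cdf_facts N_bounds no_atoms AE_space[of M]
 proof eventually_elim
  case (elim w)
  show ?case
  proof
   assume le: "threshold w <= N w"
   show "D w <= \<zeta> w"
   proof (rule ccontr)
    assume "\<not> D w <= \<zeta> w"
    then obtain q where q: "q \<in> \<rat>" "\<zeta> w < q" "q < D w" using Rats_dense_in_real[of "\<zeta> w" "D w"] by (meson not_le)
    hence "q <= 1" "0 <= q" using D_range(2)[of w] \<zeta>01(1)[of w] elim by auto
    hence "N w < clipped_cdf q w" using \<zeta>_upper q by blast
    also have "... = (if q < D w then clipped_cdf q w else 0)" using q by simp
    also have "... <= threshold w"
     unfolding threshold_def using q \<open>q <= 1\<close> \<open>0 <= q\<close> by (intro cSUP_upper[OF _ threshold_bdd]) auto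
    finally show False using le by simp
   qed
  next
   assume "D w <= \<zeta> w"
   hence "D w < \<zeta> w" using elim by simp
   then obtain q where q: "q \<in> \<rat>" "D w < q" "clipped_cdf q w <= N w"
    using \<zeta>_lower[of "D w" w] D_range(1)[of w] elim by auto
   show "threshold w <= N w"
    unfolding threshold_def
   proof (rule cSUP_least[OF countable_index(2)])
    fix r :: real assume "r \<in> \<rat> \<inter> {0..1}"
    hence r: "r \<in> \<rat>" by simp
    have "clipped_cdf r w <= N w" if "r < D w"
    proof -
     have "clipped_cdf r w <= clipped_cdf q w" using elim(1) r q(1,2) that by (meson less_imp_le less_trans)
     thus ?thesis using q(3) by simp
    qed
    thus "(if r < D w then clipped_cdf r w else 0) <= N w"
     using elim(2) by simp
   qed
  qed
 qed
 have Nint: "integrable M N"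
 proof (rule integrable_const_bound[where B=1])
  show "AE w in M. norm (N w) <= 1"
   using N_bounds cdf_facts
  proof eventually_elim
   case (elim w)
   hence "N w <= clipped_cdf 1 w" by simp
   thus ?case using clipped_cdf_bounds(2)[of 1 w] elim by auto
  qed
 qed simp
 have main: "prob (S \<inter> E \<inter> {w\<in>space M. D w <= \<zeta> w}) = (LINT w:S|M. N w)" if S[measurable]: "S \<in> sets C" for S
 proof -
  have [measurable]: "S \<in> sets M" by (rule sets_C) simp
  have Ni: "integrable M (%w. indicator S w *\<^sub>R N w)"
   by (rule integrable_mult_indicator[OF _ Nint]) simp
  have ci: "integrable M (%w. indicator S w *\<^sub>R clipped_cdf (real_of_int (\<kappa> w)/n) w)"
   if [measurable]: "\<kappa> \<in> measurable M (count_space UNIV)" for \<kappa> :: "'a => int" and n :: nat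
  proof -
   have "(%w. clipped_cdf (real_of_int (\<kappa> w)/n) w) \<in> borel_measurable M"
    by (rule measurable_compose_countable[where g=\<kappa>]) measurable
   thus ?thesis
    using clipped_cdf_bounds by (intro integrable_const_bound[where B=1]) (auto simp: indicator_def)
  qed
  \<comment> \<open>The two grid levels are strictly above and strictly below \<zeta> even if
    \<open>n * \<zeta>\<close> is an integer; \<open>\<zeta>_upper\<close> and
    \<open>\<zeta>_lower\<close> need strictness.\<close>
  define up where "up n w = \<lfloor>real n * \<zeta> w\<rfloor> + 1" for n w
  define lo where "lo n w = \<lceil>real n * \<zeta> w\<rceil> - 1" for n w
  have upC[measurable]: "up n \<in> measurable C (count_space UNIV)" and loC[measurable]: "lo n \<in> measurable C (count_space UNIV)" for n
   unfolding up_def lo_def by measurable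
  have upM[measurable]: "up n \<in> measurable M (count_space UNIV)" and loM[measurable]: "lo n \<in> measurable M (count_space UNIV)" for n
   by (rule measurable_C, simp)+
  have n\<zeta>: "0 <= real n * \<zeta> w" "real n * \<zeta> w <= real n" for n w
   using \<zeta>01[of w] by (auto simp: mult_left_le)
  have uprange: "up n w \<in> {-1..int n + 1}" "lo n w \<in> {-1..int n + 1}" for n w
  proof -
   have "\<lfloor>0::real\<rfloor> <= \<lfloor>real n * \<zeta> w\<rfloor>" "\<lfloor>real n * \<zeta> w\<rfloor> <= \<lfloor>real n\<rfloor>" "\<lceil>0::real\<rceil> <= \<lceil>real n * \<zeta> w\<rceil>" "\<lceil>real n * \<zeta> w\<rceil> <= \<lceil>real n\<rceil>"
    using n\<zeta>[of n w] by (intro floor_mono ceiling_mono; simp)+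
   thus "up n w \<in> {-1..int n + 1}" "lo n w \<in> {-1..int n + 1}" unfolding up_def lo_def atLeastAtMost_iff floor_zero ceiling_zero floor_of_nat ceiling_of_nat by presburger+
  qed
  have upb: "\<zeta> w < up n w/n" "up n w/n <= \<zeta> w + 1/n" if "0 < n" for n w
  proof -
   have "real n * \<zeta> w < up n w" "up n w <= real n * \<zeta> w + 1" unfolding up_def by linarith+
   thus "\<zeta> w < up n w/n" "up n w/n <= \<zeta> w + 1/n" using that by (auto simp: field_simps)
  qed
  have lob: "lo n w/n < \<zeta> w" "\<zeta> w - 1/n <= lo n w/n" if "0 < n" for n w
  proof -
   have "lo n w < real n * \<zeta> w" "real n * \<zeta> w - 1 <= lo n w" unfolding lo_def by linarith+
   moreover have "\<zeta> w - 1/n = (real n * \<zeta> w - 1)/n" using that by (simp add: diff_divide_distrib)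
   ultimately show "lo n w/n < \<zeta> w" "\<zeta> w - 1/n <= lo n w/n"
    using that by (auto simp: divide_less_eq mult.commute intro: divide_right_mono)
  qed
  let ?Z = "S \<inter> E \<inter> {w\<in>space M. D w <= \<zeta> w}"
  let ?A = "%\<kappa> n. S \<inter> E \<inter> {w\<in>space M. D w <= real_of_int (\<kappa> (Suc n) w)/Suc n}"
  have lim: "(%n. prob (?A \<kappa> n)) \<longlonglongrightarrow> prob ?Z"
   if [measurable]: "!!n. \<kappa> n \<in> measurable M (count_space UNIV)"
    and near: "!!n w. \<bar>\<kappa> (Suc n) w/Suc n - \<zeta> w\<bar> <= 1/Suc n" for \<kappa> :: "nat => 'a => int"
  proof -
   have "(%n. \<integral>w. indicator (?A \<kappa> n) w \<partial>M) \<longlonglongrightarrow> (\<integral>w. indicator ?Z w \<partial>M :: real)"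
   proof (rule integral_dominated_convergence[where w="%_. 1"])
    show "AE w in M. (%n. indicat_real (?A \<kappa> n) w) \<longlonglongrightarrow> indicator ?Z w"
     using no_atoms
    proof eventually_elim
     case (elim w)
     hence "eventually (%n. 1/real (Suc n) < \<bar>D w - \<zeta> w\<bar>) sequentially"
      by (intro order_tendstoD[OF LIMSEQ_Suc[OF lim_1_over_n]]) auto
     hence "eventually (%n. indicat_real (?A \<kappa> n) w = indicator ?Z w) sequentially"
     proof eventually_elim
      case (elim n)
      hence "D w <= \<kappa> (Suc n) w/Suc n \<longleftrightarrow> D w <= \<zeta> w" using near[of n w] by linarith
      thus ?case by (simp add: indicator_def)
     qed
     thus ?case by (rule tendsto_eventually)
    qed
   qed (auto simp: indicator_def)
   thus ?thesis by simp
  qed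
  have "(LINT w:S|M. N w) <= prob (?A up n)" for n
  proof -
   have "(LINT w:S|M. N w) <= (LINT w:S|M. clipped_cdf (real_of_int (up (Suc n) w)/Suc n) w)"
    unfolding set_lebesgue_integral_def
   proof (rule integral_mono_AE[OF Ni ci[OF upM]])
    show "AE w in M. indicator S w *\<^sub>R N w <= indicator S w *\<^sub>R clipped_cdf (real_of_int (up (Suc n) w)/Suc n) w"
     using cdf_facts N_bounds
    proof eventually_elim
     case (elim w)
     have "N w <= clipped_cdf (up (Suc n) w/Suc n) w"
     proof (cases "real_of_int (up (Suc n) w)/Suc n <= 1")
      case True
      thus ?thesis using \<zeta>_upper[OF _ True upb(1)] by (simp add: less_imp_le)
     next
      case False
      thus ?thesis using elim by simp
     qed
     thus ?case by (simp add: indicator_def)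
    qed
   qed
   also have "... = prob (?A up n)"
    by (rule freeze[symmetric, OF upC finite_atLeastAtMost_int uprange(1) S]) simp
   finally show ?thesis .
  qed
  moreover have "\<bar>up (Suc n) w/Suc n - \<zeta> w\<bar> <= 1/Suc n" for n w
   using upb[of "Suc n" w] by (intro abs_leI) linarith+
  hence "(%n. prob (?A up n)) \<longlonglongrightarrow> prob ?Z" by (intro lim) simp_all
  ultimately have 1: "(LINT w:S|M. N w) <= prob (?Z)"
   by (intro LIMSEQ_le_const) auto
  have "prob (?A lo n) <= (LINT w:S|M. N w)" for n
  proof -
   have "prob (?A lo n) = (LINT w:S|M. clipped_cdf (real_of_int (lo (Suc n) w)/Suc n) w)"
    by (rule freeze[OF loC finite_atLeastAtMost_int uprange(2) S]) simp
   also have "... <= (LINT w:S|M. N w)"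
    unfolding set_lebesgue_integral_def
   proof (rule integral_mono_AE[OF ci[OF loM] Ni])
    \<comment> \<open>Where \<zeta> is 0 the lower grid level is negative, and the conditional
      distribution function vanishes there because \<open>D\<close> is positive.\<close>
    have neg: "AE w in M. \<forall>q\<in>\<rat>. q < 0 --> clipped_cdf q w = 0"
    proof (subst AE_ball_countable[OF countable_rat], intro ballI)
     fix q :: real
     show "AE w in M. q < 0 --> clipped_cdf q w = 0"
     proof (cases "q < 0")
      case True
      hence "E \<inter> {w\<in>space M. D w <= q} = {}" using D_range(1) by force
      hence "cond_cdf q = real_cond_exp M C (%_. 0)" by (simp add: cond_cdf_def indicator_def[abs_def])
      moreover have "AE w in M. real_cond_exp M C (%_. 0) w = 0" by (rule real_cond_exp_F_meas) auto
      hence "AE w in M. q < 0 --> max 0 (min 1 (real_cond_exp M C (%_. 0) w)) = 0"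
       by eventually_elim simp
      ultimately show ?thesis by (simp add: clipped_cdf_def)
     qed simp
    qed
    show "AE w in M. indicator S w *\<^sub>R clipped_cdf (real_of_int (lo (Suc n) w)/Suc n) w <= indicator S w *\<^sub>R N w"
     using cdf_facts N_bounds neg
    proof eventually_elim
     case (elim w)
     let ?r = "real_of_int (lo (Suc n) w)/Suc n"
     have r: "?r \<in> \<rat>" by simp
     have "clipped_cdf ?r w <= N w"
     proof (cases "0 <= ?r")
      case True
      then obtain q where "q \<in> \<rat>" "?r < q" "clipped_cdf q w <= N w"
       using \<zeta>_lower[OF True lob(1)] by auto
      moreover from this have "clipped_cdf ?r w <= clipped_cdf q w" using elim(1) r by (meson less_imp_le)
      ultimately show ?thesis by (blast intro: order_trans)
     next
      case False
      thus ?thesis using elim r by (metis not_le)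
     qed
     thus ?case by (simp add: indicator_def)
    qed
   qed
   finally show ?thesis .
  qed
  moreover have "\<bar>lo (Suc n) w/Suc n - \<zeta> w\<bar> <= 1/Suc n" for n w
   using lob[of "Suc n" w] by (intro abs_leI) linarith+
  hence "(%n. prob (?A lo n)) \<longlonglongrightarrow> prob ?Z" by (intro lim) simp_all
  ultimately have "prob (?Z) <= (LINT w:S|M. N w)"
   by (intro LIMSEQ_le_const2) auto
  thus ?thesis using 1 by simp
 qed
 show ?thesis
 proof (rule real_cond_exp_charact)
  show "integrable M (indicator (E \<inter> {w\<in>space M. threshold w <= N w}) :: 'a => real)"
   by (rule indicator_integrable) measurable
  show "integrable M N" by (rule Nint)
  fix S assume S: "S \<in> sets C"
  hence [measurable]: "S \<in> sets M" by (rule sets_C)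
  have "(LINT w:S|M. indicat_real (E \<inter> {w\<in>space M. threshold w <= N w}) w)
   = (LINT w|M. indicat_real (S \<inter> E \<inter> {w\<in>space M. D w <= \<zeta> w}) w)"
   unfolding set_lebesgue_integral_def
  proof (rule integral_cong_AE)
   show "AE w in M. indicat_real S w *\<^sub>R indicat_real (E \<inter> {w\<in>space M. threshold w <= N w}) w
    = indicat_real (S \<inter> E \<inter> {w\<in>space M. D w <= \<zeta> w}) w"
    using eq by eventually_elim (auto simp: indicator_def)
  qed measurable
  thus "(LINT w:S|M. indicat_real (E \<inter> {w\<in>space M. threshold w <= N w}) w) = (LINT w:S|M. N w)"
   using main[OF S] by simp
 qed measurable
qed

end

section \<open>Independence of the future\<close>

definition generated :: "'a measure => (real => 'a => real) => real set => 'a measure" where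
 "generated M X S = sigma (space M) {X s -` A \<inter> space M | s A. s \<in> S & A \<in> sets borel}"

lemma space_generated [simp]: "space (generated M X S) = space M"
 unfolding generated_def by (rule space_measure_of) auto

lemma sets_generated:
 "sets (generated M X S) = sigma_sets (space M) {X s -` A \<inter> space M | s A. s \<in> S & A \<in> sets borel}"
 unfolding generated_def by (rule sets_measure_of) auto

lemma measurable_generated: "s \<in> S ==> X s \<in> borel_measurable (generated M X S)"
 by (rule measurableI) (auto simp: sets_generated)

lemma sets_generated_le:
 assumes "space G = space M" "!!s. s \<in> S ==> X s \<in> borel_measurable G"
 shows "sets (generated M X S) \<subseteq> sets G"
proof -
 have "sigma_sets (space G) {X s -` A \<inter> space M | s A. s \<in> S & A \<in> sets borel} \<subseteq> sets G"
 proof (rule sets.sigma_sets_subset, clarify)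
  fix s and A :: "real set" assume "s \<in> S" "A \<in> sets borel"
  thus "X s -` A \<inter> space M \<in> sets G" using measurable_sets[OF assms(2)] assms(1) by simp
 qed
 thus ?thesis using assms(1) by (simp add: sets_generated)
qed

lemma subalgebra_generated: "(!!s. s \<in> S ==> X s \<in> borel_measurable M) ==> subalgebra M (generated M X S)"
 unfolding subalgebra_def by (simp add: sets_generated_le)

context filtered_bm
begin

abbreviation "future a \<equiv> generated M B {a..}"

lemma subalgebra_future: "0 <= a ==> subalgebra M (future a)"
 by (rule subalgebra_generated) (simp add: B_measurable)

lemma sets_F_AE:
 assumes t: "0 <= t" and A: "A \<in> sets (F t)" and A': "A' \<in> sets M" and eq: "AE w in M. w \<in> A \<longleftrightarrow> w \<in> A'"
 shows "A' \<in> sets (F t)"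
proof -
 have AM: "A \<in> sets M" by (rule sets_F[OF t A])
 have "AE w in M. w \<notin> A - A'" "AE w in M. w \<notin> A' - A" using eq by (eventually_elim, simp)+
 hence "A - A' \<in> null_sets M" "A' - A \<in> null_sets M"
  using AM A' by (simp_all add: AE_iff_null_sets)
 hence d: "A - A' \<in> sets (F t)" "A' - A \<in> sets (F t)" using null_F[OF t] by auto
 have "(A - (A - A')) \<union> (A' - A) \<in> sets (F t)" by (rule sets.Un[OF sets.Diff[OF A d(1)] d(2)])
 moreover have "(A - (A - A')) \<union> (A' - A) = A'" by auto
 ultimately show ?thesis by simp
qed

lemma measurable_F_AE:
 fixes f g :: "'a => real"
 assumes t: "0 <= t" and f: "f \<in> borel_measurable (F t)" and g: "g \<in> borel_measurable M" and eq: "AE w in M. f w = g w"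
 shows "g \<in> borel_measurable (F t)"
proof (rule measurableI)
 fix A :: "real set" assume A: "A \<in> sets borel"
 have "g -` A \<inter> space M \<in> sets (F t)"
 proof (rule sets_F_AE[OF t])
  show "f -` A \<inter> space M \<in> sets (F t)" using measurable_sets[OF f A] by (simp add: space_F[OF t])
  show "g -` A \<inter> space M \<in> sets M" using measurable_sets[OF g A] .
  show "AE w in M. w \<in> f -` A \<inter> space M \<longleftrightarrow> w \<in> g -` A \<inter> space M" using eq by eventually_elim simp
 qed
 thus "g -` A \<inter> space (F t) \<in> sets (F t)" by (simp add: space_F[OF t])
qed simp

text \<open>Induction on the largest time: given \<open>F u\<close> with \<open>u = Max T\<close>,
  the increment after \<open>u\<close> averages out to a function of \<open>B u - B t\<close>, which
  is absorbed into the factor at \<open>u\<close>. The constant is left unspecified to keep the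
  induction simple; the whole space as \<open>A\<close> identifies it afterwards.\<close>

lemma increments_factor:
 fixes f :: "real => real => ennreal"
 assumes t: "0 <= t" and "finite T" "T \<subseteq> {t<..}" "!!v. f v \<in> borel_measurable borel"
 shows "\<exists>c. \<forall>A\<in>sets (F t). (nn_integral M (%w. (\<Prod>v\<in>T. f v (B v w - B t w)) * indicator A w)) = c * emeasure M A"
 using assms(2-)
proof (induction T arbitrary: f rule: finite_linorder_max_induct)
 case empty
 show ?case by (intro exI[of _ 1] ballI) (simp add: sets_F[OF t])
next
 case (insert m T)
 note f[measurable] = insert.prems(2)
 have tm: "t < m" and T: "T \<subseteq> {t<..}" using insert.prems by auto
 have B[measurable]: "B v \<in> borel_measurable M" if "t <= v" for v using B_measurable that t by simp
 have mT: "m \<notin> T" using insert.hyps by auto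
 show ?case
 proof (cases "T = {}")
  case True
  have "(nn_integral M (%w. f m (B m w - B t w) * indicator A w))
   = (nn_integral \<N> (%x. f m (sqrt (m - t) * x))) * emeasure M A" if A: "A \<in> sets (F t)" for A
  proof -
   have [measurable]: "A \<in> sets (F t)" "A \<in> sets M" using A sets_F[OF t A] by auto
   have "(nn_integral M (%w. f m (B m w - B t w) * indicator A w))
    = (nn_integral M (%w. (%(w, x). f m (sqrt (m - t) * x) * indicator A w) (w, (B m w - B t w)/sqrt (m - t))))"
    using tm by simp
   also have "... = (nn_integral M (%w. (nn_integral \<N> (%x. (%(w, x). f m (sqrt (m - t) * x) * indicator A w) (w, x)))))"
    by (rule nn_integral_increment[OF t tm]) measurable
   also have "... = (nn_integral M (%w. (nn_integral \<N> (%x. f m (sqrt (m - t) * x))) * indicator A w))"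
    by (intro nn_integral_cong) (simp add: nn_integral_multc)
   also have "... = (nn_integral \<N> (%x. f m (sqrt (m - t) * x))) * emeasure M A"
    by (simp add: nn_integral_cmult)
   finally show ?thesis .
  qed
  thus ?thesis using True by auto
 next
  case False
  define u where "u = Max T"
  have uT: "u \<in> T" unfolding u_def using False insert.hyps(1) by simp
  have um: "u < m" and tu: "t < u" using uT insert.hyps(2) T by auto
  have u0: "0 <= u" using t tu by simp
  define \<kappa> where "\<kappa> y = (nn_integral \<N> (%x. f m (y + sqrt (m - u) * x)))" for y
  have \<kappa>[measurable]: "\<kappa> \<in> borel_measurable borel"
   unfolding \<kappa>_def[abs_def] by (rule gauss.borel_measurable_nn_integral) measurable
  define f' where "f' v y = (if v = u then f v y * \<kappa> y else f v y)" for v y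
  have f': "f' v \<in> borel_measurable borel" for v unfolding f'_def by measurable
  obtain c where c: "!!A. A \<in> sets (F t) ==> (nn_integral M (%w. (\<Prod>v\<in>T. f' v (B v w - B t w)) * indicator A w)) = c * emeasure M A"
   using insert.IH[of f', OF T f'] by blast
  have "(nn_integral M (%w. (\<Prod>v\<in>insert m T. f v (B v w - B t w)) * indicator A w)) = c * emeasure M A" if A: "A \<in> sets (F t)" for A
  proof -
   have AFu[measurable]: "A \<in> sets (F u)" using F_mono[of t u] t tu A by auto
   have [measurable]: "B t \<in> borel_measurable (F u)"
    by (rule measurable_F_mono[OF t _ adapted[OF t]]) (use tu in simp)
   have Bv: "B v \<in> borel_measurable (F u)" if "v \<in> T" for v
   proof -
    have "v <= u" "0 <= v" using that insert.hyps(1) T t by (auto simp: u_def)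
    thus ?thesis using measurable_F_mono[of v u] adapted[of v] by simp
   qed
   have [measurable]: "B u \<in> borel_measurable (F u)" by (rule adapted[OF u0])
   define P where "P w = (\<Prod>v\<in>T. f v (B v w - B t w)) * indicator A w" for w
   have [measurable]: "P \<in> borel_measurable (F u)"
    unfolding P_def using Bv by measurable
   define \<Psi> where "\<Psi> z = P (fst z) * f m ((B u (fst z) - B t (fst z)) + sqrt (m - u) * snd z)" for z :: "'a \<times> real"
   have \<Psi>: "\<Psi> \<in> borel_measurable (F u \<Otimes>\<^sub>M borel)" unfolding \<Psi>_def by measurable
   have 1: "(\<Prod>v\<in>insert m T. f v (B v w - B t w)) * indicator A w = \<Psi> (w, (B m w - B u w)/sqrt (m - u))" for w
    using mT insert.hyps(1) um by (simp add: \<Psi>_def P_def mult_ac)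
   have 2: "(nn_integral \<N> (%x. \<Psi> (w, x))) = (\<Prod>v\<in>T. f' v (B v w - B t w)) * indicator A w" for w
   proof -
    have "(\<Prod>v\<in>T. f' v (B v w - B t w)) = (\<Prod>v\<in>T. f v (B v w - B t w)) * \<kappa> (B u w - B t w)"
    proof -
     have "(\<Prod>v\<in>T - {u}. f' v (B v w - B t w)) = (\<Prod>v\<in>T - {u}. f v (B v w - B t w))"
      by (rule prod.cong) (auto simp: f'_def)
     thus ?thesis
      using prod.remove[OF insert.hyps(1) uT, of "%v. f' v (B v w - B t w)"] prod.remove[OF insert.hyps(1) uT, of "%v. f v (B v w - B t w)"]
      by (simp add: f'_def mult_ac)
    qed
    moreover have "(nn_integral \<N> (%x. \<Psi> (w, x))) = P w * \<kappa> (B u w - B t w)"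
     unfolding \<Psi>_def \<kappa>_def fst_conv snd_conv by (rule nn_integral_cmult) measurable
    ultimately show ?thesis by (simp add: P_def mult_ac)
   qed
   show ?thesis
    unfolding 1 nn_integral_increment[OF u0 um \<Psi>] 2 by (rule c[OF A])
  qed
  thus ?thesis by blast
 qed
qed

lemma increments_indep:
 fixes b :: "real => real"
 assumes t: "0 <= t" and T: "finite T" "T \<subseteq> {t<..}" and U: "integrable M U" "U \<in> borel_measurable (F t)"
  and S_def: "S = {w\<in>space M. \<forall>v\<in>T. B v w - B t w <= b v}"
 shows "(LINT w|M. U w * indicator S w) = prob S * (LINT w|M. U w)"
proof -
 interpret Ft: finite_measure_subalgebra M "F t" by unfold_locales (rule subalgebra_F[OF t])
 have B[measurable]: "B v \<in> borel_measurable M" if "v \<in> T" for v using B_measurable that t T by auto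
 have [measurable]: "B t \<in> borel_measurable M" by (rule B_measurable[OF t])
 have S[measurable]: "S \<in> sets M" unfolding S_def using T(1) by measurable
 let ?f = "%v y. indicator {..b v} y :: ennreal"
 obtain c where c: "!!A. A \<in> sets (F t) ==> (nn_integral M (%w. (\<Prod>v\<in>T. ?f v (B v w - B t w)) * indicator A w)) = c * emeasure M A"
  using increments_factor[OF t T, of ?f] by auto
 have ind: "(\<Prod>v\<in>T. ?f v (B v w - B t w)) = indicator S w" if w: "w \<in> space M" for w
 proof (cases "w \<in> S")
  case True
  thus ?thesis by (auto simp: S_def intro!: prod.neutral)
 next
  case False
  then obtain v where "v \<in> T" "\<not> B v w - B t w <= b v" using w False unfolding S_def by blast
  thus ?thesis using T(1) False by (auto intro!: prod_zero bexI[of _ v])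
 qed
 have cA: "emeasure M (S \<inter> A) = c * emeasure M A" if "A \<in> sets (F t)" for A
 proof -
  have [measurable]: "A \<in> sets M" by (rule sets_F[OF t that])
  have "emeasure M (S \<inter> A) = (nn_integral M (%w. indicator S w * indicator A w))"
   by (simp add: indicator_inter_arith[symmetric])
  also have "... = (nn_integral M (%w. (\<Prod>v\<in>T. ?f v (B v w - B t w)) * indicator A w))"
   by (intro nn_integral_cong) (simp add: ind)
  finally show ?thesis using c[OF that] by simp
 qed
 have "S \<inter> space M = S" using sets.sets_into_space[OF S] by auto
 hence c': "c = emeasure M S" using cA[OF space_in_F[OF t]] by (simp add: emeasure_space_1)
 have pA: "prob (S \<inter> A) = prob S * prob A" if "A \<in> sets (F t)" for A
  using cA[OF that] unfolding c' by (simp add: emeasure_eq_measure ennreal_mult'[symmetric])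
 have "AE w in M. real_cond_exp M (F t) (indicator S) w = prob S"
 proof (rule Ft.real_cond_exp_charact)
  fix A assume A: "A \<in> sets (F t)"
  have [measurable]: "A \<in> sets M" by (rule sets_F[OF t A])
  have "(LINT w:A|M. indicat_real S w) = prob (S \<inter> A)"
   unfolding set_lebesgue_integral_def by (simp add: indicator_inter_arith[symmetric] Int_commute)
  thus "(LINT w:A|M. indicat_real S w) = (LINT w:A|M. prob S)"
   using pA[OF A] by (simp add: set_lebesgue_integral_def)
 qed (auto simp: emeasure_eq_measure)
 hence "(LINT w|M. U w * real_cond_exp M (F t) (indicator S) w) = (LINT w|M. U w * prob S)"
  using U(1) by (intro integral_cong_AE) (auto elim: eventually_mono)
 moreover have "(LINT w|M. U w * real_cond_exp M (F t) (indicator S) w) = (LINT w|M. U w * indicator S w)"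
 proof (rule Ft.real_cond_exp_intg(2))
  show "integrable M (%w. U w * indicator S w)" using integrable_real_mult_indicator[OF S U(1)] by simp
 qed (use U(2) in simp_all)
 ultimately show ?thesis by (simp add: mult.commute)
qed

lemma increment_no_atom:
 assumes "0 <= t" "t < v"
 shows "AE w in M. B v w - B t w \<noteq> b"
proof -
 have [measurable]: "B v \<in> borel_measurable M" "B t \<in> borel_measurable M" using assms by (auto intro: B_measurable)
 have "{x. sqrt (v - t) * x \<in> {b}} = {b/sqrt (v - t)}" using assms by (auto simp: field_simps)
 hence "measure \<N> {x. sqrt (v - t) * x \<in> {b}} = 0"
  using prob_space_normal_density by (simp add: measure_def emeasure_density)
 hence "prob (space M \<inter> {w\<in>space M. B v w - B t w \<in> {b}}) = 0"
  using increment[OF assms space_in_F[OF assms(1)], of "{b}"] by simp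
 hence p: "prob {w\<in>space M. B v w - B t w = b} = 0" by (simp add: Int_absorb1)
 have "{w\<in>space M. B v w - B t w = b} \<in> null_sets M"
  by (rule null_setsI) (simp_all add: p emeasure_eq_measure)
 thus ?thesis by (rule AE_I') auto
qed

text \<open>\<open>U\<close> is known only immediately after \<open>t\<close>, so the increments are
  first started at times decreasing to \<open>t\<close>. By continuity of the paths the events
  converge, except where an increment equals its bound, which has probability zero.\<close>

lemma increments_indep_right:
 fixes b :: "real => real"
 assumes t: "0 <= t" and T: "finite T" "T \<subseteq> {t<..}" and U: "integrable M U" "!!q. t < q ==> U \<in> borel_measurable (F q)"
  and S_def: "S = {w\<in>space M. \<forall>v\<in>T. B v w - B t w <= b v}"
 shows "(LINT w|M. U w * indicator S w) = prob S * (LINT w|M. U w)"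
proof -
 define s where "s n = t + 1/real (Suc n)" for n
 have s: "t < s n" "0 <= s n" for n using t by (auto simp: s_def)
 have st: "s \<longlonglongrightarrow> t"
  unfolding s_def[abs_def] using tendsto_add[OF tendsto_const LIMSEQ_Suc[OF lim_1_over_n], of t] by simp
 define R where "R n = {w\<in>space M. \<forall>v\<in>T. B v w - B (s n) w <= b v}" for n
 have [measurable]: "B v \<in> borel_measurable M" if "v \<in> T" for v using B_measurable that t T by auto
 have [measurable]: "B t \<in> borel_measurable M" "B (s n) \<in> borel_measurable M" for n by (rule B_measurable, use t s in simp)+
 have [measurable]: "S \<in> sets M" "R n \<in> sets M" for n unfolding S_def R_def using T(1) by measurable
 have [measurable]: "U \<in> borel_measurable M" using U(1) by simp
 have "AE w in M. B v w - B t w \<noteq> b v" if "v \<in> T" for v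
  using that T t by (intro increment_no_atom) auto
 hence "AE w in M. \<forall>v\<in>T. B v w - B t w \<noteq> b v" by (simp add: AE_finite_all T(1))
 hence conv: "AE w in M. (%n. indicat_real (R n) w) \<longlonglongrightarrow> indicator S w"
  using continuous_paths
 proof eventually_elim
  case (elim w)
  have c: "(%n. B v w - B (s n) w) \<longlonglongrightarrow> B v w - B t w" for v
  proof (intro tendsto_diff tendsto_const)
   show "(%n. B (s n) w) \<longlonglongrightarrow> B t w"
    using elim(2) st t s(2) by (auto simp: continuous_on_sequentially comp_def)
  qed
  have "eventually (%n. B v w - B (s n) w <= b v \<longleftrightarrow> B v w - B t w <= b v) sequentially" if v: "v \<in> T" for v
  proof (cases "B v w - B t w < b v")
   case True
   thus ?thesis using order_tendstoD(2)[OF c True] by (auto elim: eventually_mono)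
  next
   case False
   hence gt: "b v < B v w - B t w" using elim(1) v by force
   show ?thesis using order_tendstoD(1)[OF c gt] gt by (auto elim!: eventually_mono)
  qed
  hence "eventually (%n. \<forall>v\<in>T. B v w - B (s n) w <= b v \<longleftrightarrow> B v w - B t w <= b v) sequentially"
   using T(1) by (simp add: eventually_ball_finite)
  hence "eventually (%n. indicat_real (R n) w = indicator S w) sequentially"
   by eventually_elim (simp add: R_def S_def indicator_def)
  thus ?case by (rule tendsto_eventually)
 qed
 have lim: "(%n. \<integral>w. V w * indicator (R n) w \<partial>M) \<longlonglongrightarrow> (LINT w|M. V w * indicator S w)" if V: "integrable M V" for V :: "'a => real"
 proof (rule integral_dominated_convergence[where w="%w. \<bar>V w\<bar>"])
  have [measurable]: "V \<in> borel_measurable M" using V by simp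
  show "(%w. V w * indicator S w) \<in> borel_measurable M" "(%w. V w * indicator (R n) w) \<in> borel_measurable M" for n by measurable
  show "integrable M (%w. \<bar>V w\<bar>)" using V by simp
  show "AE w in M. (%n. V w * indicator (R n) w) \<longlonglongrightarrow> V w * indicator S w"
   using conv by eventually_elim (intro tendsto_mult tendsto_const)
  show "AE w in M. norm (V w * indicator (R n) w) <= \<bar>V w\<bar>" for n
   by (intro AE_I2) (simp add: indicator_def)
 qed
 have "(%n. prob (R n)) \<longlonglongrightarrow> prob S" using lim[of "%_. 1"] by simp
 hence 1: "(%n. prob (R n) * (LINT w|M. U w)) \<longlonglongrightarrow> prob S * (LINT w|M. U w)" by (intro tendsto_mult tendsto_const)
 have "eventually (%n. s n < v) sequentially" if "v \<in> T" for v
  using order_tendstoD(2)[OF st, of v] T that by auto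
 hence "eventually (%n. \<forall>v\<in>T. s n < v) sequentially" using T(1) by (simp add: eventually_ball_finite)
 hence "eventually (%n. prob (R n) * (LINT w|M. U w) = (LINT w|M. U w * indicator (R n) w)) sequentially"
 proof eventually_elim
  case (elim n)
  hence "T \<subseteq> {s n<..}" by auto
  thus ?case by (rule increments_indep[OF s(2) T(1) _ U(1) U(2)[OF s(1)] R_def, symmetric])
 qed
 hence "(%n. \<integral>w. U w * indicator (R n) w \<partial>M) \<longlonglongrightarrow> prob S * (LINT w|M. U w)" by (rule Lim_transform_eventually[OF 1])
 thus ?thesis using lim[OF U(1)] by (rule LIMSEQ_unique[rotated])
qed

text \<open>The future after \<open>a\<close> is generated by the path on \<open>[a, t]\<close> and
  by the increments after \<open>t\<close>. Intersections of events of both kinds form an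
  intersection stable generator, and on it the integral factorises with a vanishing factor.\<close>

lemma future_zero:
 fixes U :: "'a => real"
 assumes a: "0 <= a" "a <= t" and U: "integrable M U" "!!q. t < q ==> U \<in> borel_measurable (F q)"
  and zero: "!!S. S \<in> sets (generated M B {a..t}) ==> (LINT w:S|M. U w) = 0" and S: "S \<in> sets (future a)"
 shows "(LINT w:S|M. U w) = 0"
proof -
 have t: "0 <= t" using a by simp
 let ?mid = "generated M B {a..t}"
 define inc where "inc T b = {w\<in>space M. \<forall>v\<in>T. B v w - B t w <= b v}" for T and b :: "real => real"
 define \<C> where "\<C> = {S \<inter> inc T b | S T b. S \<in> sets ?mid & finite T & T \<subseteq> {t<..}}"
 have midF: "sets ?mid \<subseteq> sets (F q)" if "t <= q" for q
 proof (rule sets_generated_le)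
  show "space (F q) = space M" using that t by (simp add: space_F)
  show "B s \<in> borel_measurable (F q)" if "s \<in> {a..t}" for s
   using that \<open>t <= q\<close> a by (intro measurable_F_mono[of s q] adapted) auto
 qed
 have BM[measurable]: "B v \<in> borel_measurable M" if "a <= v" for v using that a by (intro B_measurable) simp
 have inc_sets: "inc T b \<in> sets M" if "finite T" "T \<subseteq> {t<..}" for T b
 proof -
  have [measurable]: "B v \<in> borel_measurable M" if "v \<in> T" for v using that \<open>T \<subseteq> {t<..}\<close> a by (intro BM) auto
  have [measurable]: "B t \<in> borel_measurable M" by (rule BM[OF a(2)])
  show ?thesis unfolding inc_def using that(1) by measurable
 qed
 have mid_M: "X \<in> sets M" if "X \<in> sets ?mid" for X using midF[of t] that t by (auto intro: sets_F)
 have \<C>_M: "\<C> \<subseteq> sets M" unfolding \<C>_def using inc_sets mid_M by auto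
 have \<C>_space: "\<C> \<subseteq> Pow (space M)" using \<C>_M sets.sets_into_space by blast
 have inc_empty: "inc {} b = space M" for b by (simp add: inc_def)
 have Int: "Int_stable \<C>"
 proof (rule Int_stableI)
  fix X Y assume "X \<in> \<C>" "Y \<in> \<C>"
  then obtain S T b S' T' b' where XY: "X = S \<inter> inc T b" "Y = S' \<inter> inc T' b'" "S \<in> sets ?mid" "S' \<in> sets ?mid"
   "finite T" "finite T'" "T \<subseteq> {t<..}" "T' \<subseteq> {t<..}"
   unfolding \<C>_def by blast
  define b'' where "b'' v = (if v \<in> T then if v \<in> T' then min (b v) (b' v) else b v else b' v)" for v
  have "inc T b \<inter> inc T' b' = inc (T \<union> T') b''" unfolding inc_def b''_def by (auto split: if_splits)
  hence "X \<inter> Y = (S \<inter> S') \<inter> inc (T \<union> T') b''" using XY(1,2) by blast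
  moreover have "S \<inter> S' \<in> sets ?mid" using XY by blast
  ultimately show "X \<inter> Y \<in> \<C>" unfolding \<C>_def using XY by blast
 qed
 have \<C>_mid: "X \<inter> space M \<in> \<C>" if "X \<in> sets ?mid" for X
 proof -
  have "X \<inter> space M = X \<inter> inc {} (%_. 0)" by (simp add: inc_empty)
  thus ?thesis unfolding \<C>_def using that by blast
 qed
 have "sets (future a) \<subseteq> sets (sigma (space M) \<C>)"
 proof (rule sets_generated_le)
  fix s assume "s \<in> {a..}"
  have mid_meas: "B s \<in> borel_measurable (sigma (space M) \<C>)" if s: "s \<in> {a..t}" for s
  proof (rule measurableI)
   fix A :: "real set" assume A: "A \<in> sets borel"
   have "B s -` A \<inter> space M \<in> sets ?mid" using measurable_sets[OF measurable_generated[OF s, of B M] A] by simp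
   from \<C>_mid[OF this] show "B s -` A \<inter> space (sigma (space M) \<C>) \<in> sets (sigma (space M) \<C>)"
    using \<C>_space by (simp add: space_measure_of sets_measure_of)
  qed simp
  show "B s \<in> borel_measurable (sigma (space M) \<C>)"
  proof (cases "s <= t")
   case True
   thus ?thesis using mid_meas \<open>s \<in> {a..}\<close> by simp
  next
   case False
   have "(%w. B s w - B t w) \<in> borel_measurable (sigma (space M) \<C>)"
   proof (rule borel_measurableI_le)
    fix c
    have "inc {s} (%_. c) \<in> \<C>"
    proof -
     have "inc {s} (%_. c) = space M \<inter> inc {s} (%_. c)" by (auto simp: inc_def)
     moreover have "space M \<in> sets ?mid" using sets.top[of ?mid] by simp
     moreover have "finite {s}" "{s} \<subseteq> {t<..}" using False by auto
     ultimately show ?thesis unfolding \<C>_def by blast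
    qed
    thus "{w \<in> space (sigma (space M) \<C>). B s w - B t w <= c} \<in> sets (sigma (space M) \<C>)"
     using \<C>_space by (simp add: space_measure_of sets_measure_of inc_def)
   qed
   hence "(%w. (B s w - B t w) + B t w) \<in> borel_measurable (sigma (space M) \<C>)"
    using mid_meas[of t] a by (intro borel_measurable_add) auto
   thus ?thesis by simp
  qed
 qed (use \<C>_space in simp)
 hence S': "S \<in> sigma_sets (space M) \<C>" using S \<C>_space by (auto simp: sets_measure_of)
 have si: "set_integrable M X U" if "X \<in> sets M" for X
  unfolding set_integrable_def using integrable_mult_indicator[OF that U(1)] .
 have sub: "sigma_sets (space M) \<C> \<subseteq> sets M" by (rule sets.sigma_sets_subset[OF \<C>_M])
 have on_generator: "(LINT w:X|M. U w) = 0" if "X \<in> \<C>" for X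
 proof -
  from that obtain S T b where X: "X = S \<inter> inc T b" "S \<in> sets ?mid" "finite T" "T \<subseteq> {t<..}"
   unfolding \<C>_def by blast
  have SM: "S \<in> sets M" using mid_M X by blast
  have i: "integrable M (%w. indicator S w * U w)" using integrable_mult_indicator[OF SM U(1)] by simp
  have m: "(%w. indicator S w * U w) \<in> borel_measurable (F q)" if "t < q" for q
  proof -
   have "S \<in> sets (F q)" using midF[of q] that X(2) by auto
   thus ?thesis using U(2)[OF that] by simp
  qed
  have "(LINT w:X|M. U w) = (LINT w|M. (indicator S w * U w) * indicator (inc T b) w)"
   unfolding set_lebesgue_integral_def X(1) by (simp add: indicator_inter_arith mult_ac)
  also have "... = prob (inc T b) * (LINT w|M. indicator S w * U w)"
   by (rule increments_indep_right[OF t X(3,4) i m inc_def])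
  also have "(LINT w|M. indicator S w * U w) = 0"
   using zero[OF X(2)] by (simp add: set_lebesgue_integral_def)
  finally show ?thesis by simp
 qed
 have whole: "(LINT w|M. U w) = 0"
  using zero[OF sets.top] set_integral_space[OF U(1)] by simp
 from Int \<C>_space S' show ?thesis
 proof (induction rule: sigma_sets_induct_disjoint)
  case (basic X)
  thus ?case by (rule on_generator)
 next
  case empty
  show ?case by (simp add: set_lebesgue_integral_def)
 next
  case (compl X)
  hence X: "X \<in> sets M" using sub by blast
  have "(\<integral>w\<in>space M - X. U w \<partial>M) = (LINT w|M. U w - indicator X w *\<^sub>R U w)"
   unfolding set_lebesgue_integral_def by (rule Bochner_Integration.integral_cong) (auto simp: indicator_def)
  also have "... = (LINT w|M. U w) - (LINT w:X|M. U w)"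
   unfolding set_lebesgue_integral_def using U(1) integrable_mult_indicator[OF X U(1)] by (rule Bochner_Integration.integral_diff)
  finally show ?case using compl whole by simp
 next
  case (union A)
  hence A: "A i \<in> sets M" for i using sub by blast
  have "(\<integral>w\<in>(\<Union>i. A i). U w \<partial>M) = (\<Sum>i. \<integral>w\<in>A i. U w \<partial>M)"
  proof (rule lebesgue_integral_countable_add[OF A])
   show "A i \<inter> A j = {}" if "i \<noteq> j" for i j using union(1) that by (auto simp: disjoint_family_on_def)
   show "set_integrable M (\<Union> (range A)) U" by (rule si) (use A in auto)
  qed
  thus ?case using union by simp
 qed
qed

text \<open>By \<open>future_zero\<close>, conditioning on the whole future after \<open>a\<close>
  reduces to conditioning on the path over \<open>[a, t]\<close>. This makes conditional
  expectations given the future adapted, and it returns to \<open>F t\<close> what is known only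
  immediately after \<open>t\<close>, a form of right-continuity of the filtration.\<close>

lemma cond_exp_future_measurable:
 assumes a: "0 <= a" "a <= t" and X: "integrable M X" "!!q. t < q ==> X \<in> borel_measurable (F q)"
 shows "real_cond_exp M (future a) X \<in> borel_measurable (F t)"
proof -
 have t: "0 <= t" using a by simp
 let ?mid = "generated M B {a..t}"
 have BM: "B s \<in> borel_measurable M" if "a <= s" for s using that a by (intro B_measurable) simp
 interpret mid: finite_measure_subalgebra M ?mid by unfold_locales (rule subalgebra_generated, simp add: BM)
 interpret fut: finite_measure_subalgebra M "future a" by unfold_locales (rule subalgebra_future[OF a(1)])
 have midF: "sets ?mid \<subseteq> sets (F q)" if "t <= q" for q
 proof (rule sets_generated_le)
  show "space (F q) = space M" using that t by (simp add: space_F)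
  show "B s \<in> borel_measurable (F q)" if "s \<in> {a..t}" for s
   using that \<open>t <= q\<close> a by (intro measurable_F_mono[of s q] adapted) auto
 qed
 let ?Y = "real_cond_exp M ?mid X"
 have Ymid: "?Y \<in> borel_measurable ?mid" by simp
 have YF: "?Y \<in> borel_measurable (F q)" if "t <= q" for q
  by (rule measurable_from_subalg[OF _ Ymid]) (use midF[OF that] space_F[of q] that t in \<open>simp add: subalgebra_def\<close>)
 have Yi: "integrable M ?Y" by (rule mid.real_cond_exp_int(1)[OF X(1)])
 have Yfut: "?Y \<in> borel_measurable (future a)"
 proof (rule measurable_from_subalg[OF _ Ymid])
  have "sets ?mid \<subseteq> sets (future a)"
   by (rule sets_generated_le) (auto intro: measurable_generated)
  thus "subalgebra (future a) ?mid" by (simp add: subalgebra_def)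
 qed
 have z: "(LINT w:S|M. (X w - ?Y w)) = 0" if "S \<in> sets (future a)" for S
 proof (rule future_zero[OF a _ _ _ that])
  show "integrable M (%w. X w - ?Y w)" using X(1) Yi by simp
  show "(%w. X w - ?Y w) \<in> borel_measurable (F q)" if "t < q" for q
   using X(2)[OF that] YF[of q] that by simp
  show "(LINT w:S|M. (X w - ?Y w)) = 0" if S: "S \<in> sets ?mid" for S
  proof -
   have SM: "S \<in> sets M" using S mid.subalg by (auto simp: subalgebra_def)
   have "(LINT w:S|M. (X w - ?Y w)) = (LINT w:S|M. X w) - (LINT w:S|M. ?Y w)"
    by (rule set_integral_diff) (simp_all only: set_integrable_def integrable_mult_indicator[OF SM X(1)] integrable_mult_indicator[OF SM Yi])
   thus ?thesis using mid.real_cond_exp_intA[OF X(1) S] by simp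
  qed
 qed
 have "AE w in M. real_cond_exp M (future a) X w = ?Y w"
 proof (rule fut.real_cond_exp_charact[OF _ X(1) Yi Yfut])
  fix S assume S: "S \<in> sets (future a)"
  have SM: "S \<in> sets M" using S fut.subalg by (auto simp: subalgebra_def)
  have "(LINT w:S|M. (X w - ?Y w)) = (LINT w:S|M. X w) - (LINT w:S|M. ?Y w)"
   by (rule set_integral_diff) (simp_all only: set_integrable_def integrable_mult_indicator[OF SM X(1)] integrable_mult_indicator[OF SM Yi])
  thus "(LINT w:S|M. X w) = (LINT w:S|M. ?Y w)" using z[OF S] by simp
 qed
 hence "AE w in M. ?Y w = real_cond_exp M (future a) X w" by eventually_elim simp
 thus ?thesis by (rule measurable_F_AE[OF t YF[OF order_refl] borel_measurable_cond_exp2])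
qed

text \<open>The randomiser: \<open>2 B(a/2) - B(a)\<close> is the difference of two independent increments with the same variance,
 hence independent of their sum \<open>B(a)\<close>, and therefore of everything that happens from time \<open>a\<close> on.\<close>

lemma randomiser_exists:
 assumes a: "0 < a"
 obtains D where "D \<in> borel_measurable (F a)" "!!w. 0 < D w" "!!w. D w < (1::real)"
  "!!\<zeta>. \<zeta> \<in> borel_measurable (future a) ==> AE w in M. D w \<noteq> \<zeta> w"
proof -
 have a0: "0 <= a" "0 <= a/2" "0 < a/2" "a/2 < a" using a by auto
 define D where "D w = (B (a/2) w - B 0 w) - (B a w - B (a/2) w)" for w
 have [measurable]: "B 0 \<in> borel_measurable (F a)" "B (a/2) \<in> borel_measurable (F a)" "B a \<in> borel_measurable (F a)"
  "B 0 \<in> borel_measurable (F (a/2))" "B (a/2) \<in> borel_measurable (F (a/2))" "B 0 \<in> borel_measurable (F 0)"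
  using a0 by (auto intro: measurable_F_mono[OF _ _ adapted])
 have DF[measurable]: "D \<in> borel_measurable (F a)" unfolding D_def by measurable
 have DM[measurable]: "D \<in> borel_measurable M" by (rule measurable_F[OF a0(1) DF])
 have [measurable]: "B 0 \<in> borel_measurable M" "B (a/2) \<in> borel_measurable M" "B a \<in> borel_measurable M"
  using a0 by (auto intro: B_measurable)
 have law: "(nn_integral M (%w. \<Phi> (D w, B a w)))
  = (nn_integral \<N> (%x. \<integral>\<^sup>+y. \<Phi> (- (sqrt a * y), sqrt a * x) \<partial>\<N>))"
  if \<Phi>[measurable]: "\<Phi> \<in> borel_measurable borel" for \<Phi> :: "real \<times> real => ennreal"
 proof -
  note [measurable] = borel_prod[symmetric]
  define r where "r = sqrt (a/2)"
  have r: "sqrt (a - a/2) = r" "sqrt (a/2 - 0) = r" "0 < r" using a by (auto simp: r_def)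
  define \<Psi> where "\<Psi> z = \<Phi> (B (a/2) (fst z) - B 0 (fst z) - r * snd z, B (a/2) (fst z) - B 0 (fst z) + r * snd z)" for z
  have \<Psi>: "\<Psi> \<in> borel_measurable (F (a/2) \<Otimes>\<^sub>M borel)" unfolding \<Psi>_def by measurable
  define \<Theta> where "\<Theta> z = (nn_integral \<N> (%x. \<Phi> (r * snd z - r * x, r * snd z + r * x)))" for z :: "'a \<times> real"
  have \<Theta>: "\<Theta> \<in> borel_measurable (F 0 \<Otimes>\<^sub>M borel)"
   unfolding \<Theta>_def by (rule gauss.borel_measurable_nn_integral) measurable
  have "(nn_integral M (%w. \<Phi> (D w, B a w))) = (nn_integral M (%w. \<Psi> (w, (B a w - B (a/2) w)/sqrt (a - a/2))))"
  proof (rule nn_integral_cong_AE)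
   show "AE w in M. \<Phi> (D w, B a w) = \<Psi> (w, (B a w - B (a/2) w)/sqrt (a - a/2))"
    using start by eventually_elim (use r in \<open>simp add: \<Psi>_def D_def\<close>)
  qed
  also have "... = (nn_integral M (%w. \<integral>\<^sup>+x. \<Psi> (w, x) \<partial>\<N>))"
   by (rule nn_integral_increment[OF a0(2,4) \<Psi>])
  also have "... = (nn_integral M (%w. \<Theta> (w, (B (a/2) w - B 0 w)/sqrt (a/2 - 0))))"
   using r by (simp add: \<Psi>_def \<Theta>_def)
  also have "... = (nn_integral M (%w. \<integral>\<^sup>+x. \<Theta> (w, x) \<partial>\<N>))"
   by (rule nn_integral_increment[OF order_refl a0(3) \<Theta>])
  also have "... = (nn_integral \<N> (%x. \<integral>\<^sup>+y. \<Phi> (r * x - r * y, r * x + r * y) \<partial>\<N>))"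
   by (simp add: \<Theta>_def emeasure_space_1)
  \<comment> \<open>Rotation by 45 degrees separates sum and difference of the two equally
    distributed increments.\<close>
  also have "... = (nn_integral \<N> (%x. \<integral>\<^sup>+y. (%(p, q). \<Phi> (- (sqrt a * q), sqrt a * p)) (1/sqrt 2 * x + 1/sqrt 2 * y, 1/sqrt 2 * y - 1/sqrt 2 * x)
    \<partial>\<N>))"
  proof -
   have "sqrt a * (1/sqrt 2 * z) = r * z" for z by (simp add: r_def real_sqrt_divide)
   hence "- (sqrt a * (1/sqrt 2 * y - 1/sqrt 2 * x)) = r * x - r * y" "sqrt a * (1/sqrt 2 * x + 1/sqrt 2 * y) = r * x + r * y" for x y
    by (simp_all only: distrib_left right_diff_distrib minus_diff_eq)
   thus ?thesis by simp
  qed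
  also have "... = (nn_integral \<N> (%x. \<integral>\<^sup>+y. (%(p, q). \<Phi> (- (sqrt a * q), sqrt a * p)) (x, y) \<partial>\<N>))"
  proof (rule gauss_rotation)
   show "(1/sqrt 2)\<^sup>2 + (1/sqrt 2)^2 = (1::real)" by (simp add: power_divide)
   have "(%z. (- (sqrt a * snd z), sqrt a * fst z)) \<in> borel_measurable (borel :: (real \<times> real) measure)"
    by (intro borel_measurable_continuous_onI continuous_intros)
   from measurable_compose[OF this \<Phi>]
   show "(%(p, q). \<Phi> (- (sqrt a * q), sqrt a * p)) \<in> borel_measurable borel" by (simp add: case_prod_beta')
  qed simp
  finally show ?thesis by simp
 qed
 let ?\<delta> = "%C. \<integral>\<^sup>+y. indicator C (- (sqrt a * y)) \<partial>\<N>"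
 have joint: "emeasure M {w\<in>space M. D w \<in> C & B a w \<in> C'} = ?\<delta> C * (nn_integral \<N> (%x. indicator C' (sqrt a * x)))"
  if [measurable]: "C \<in> sets borel" "C' \<in> sets borel" for C C'
 proof -
  have "emeasure M {w\<in>space M. D w \<in> C & B a w \<in> C'} = (nn_integral M (%w. indicator {w\<in>space M. D w \<in> C & B a w \<in> C'} w))"
   by simp
  also have "... = (nn_integral M (%w. (%(p, q). indicator C p * indicator C' q) (D w, B a w)))"
   by (intro nn_integral_cong) (auto simp: indicator_def)
  also have "... = (nn_integral \<N> (%x. \<integral>\<^sup>+y. (%(p, q). indicator C p * indicator C' q) (- (sqrt a * y), sqrt a * x) \<partial>\<N>))"
   by (rule law) (unfold borel_prod[symmetric], measurable)
  also have "... = (nn_integral \<N> (%x. ?\<delta> C * indicator C' (sqrt a * x)))"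
   by (simp add: nn_integral_multc)
  also have "... = ?\<delta> C * (nn_integral \<N> (%x. indicator C' (sqrt a * x)))"
   by (rule nn_integral_cmult) measurable
  finally show ?thesis .
 qed
 have D_law: "emeasure M {w\<in>space M. D w \<in> C} = ?\<delta> C" if "C \<in> sets borel" for C
  using joint[OF that, of UNIV] gauss.emeasure_space_1 by simp
 \<comment> \<open>\<open>future_zero\<close> with \<open>t = a\<close> reduces independence of the
   whole future to independence of \<open>B a\<close>, which \<open>joint\<close> provides.\<close>
 have indep: "prob ({w\<in>space M. D w \<in> C} \<inter> S) = prob {w\<in>space M. D w \<in> C} * prob S" if [measurable]: "C \<in> sets borel" and S: "S \<in> sets (future a)" for C S
 proof -
  define G where "G = {w\<in>space M. D w \<in> C}"
  define U where "U w = indicator G w - prob G" for w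
  have GM[measurable]: "G \<in> sets M" unfolding G_def by measurable
  have int: "(LINT w:S|M. U w) = prob (G \<inter> S) - prob G * prob S" if [measurable]: "S \<in> sets M" for S
  proof -
   have "(LINT w:S|M. U w) = (LINT w|M. indicator (G \<inter> S) w - prob G * indicator S w)"
    unfolding set_lebesgue_integral_def by (rule Bochner_Integration.integral_cong) (auto simp: U_def indicator_def)
   also have "... = (LINT w|M. indicator (G \<inter> S) w) - (LINT w|M. prob G * indicator S w)"
    by (rule Bochner_Integration.integral_diff) (auto simp: emeasure_eq_measure)
   finally show ?thesis by simp
  qed
  have "(LINT w:S|M. U w) = 0"
  proof (rule future_zero[OF a0(1) order_refl _ _ _ S])
   show "integrable M U" unfolding U_def by (simp add: emeasure_eq_measure)
   show "U \<in> borel_measurable (F q)" if q: "a < q" for q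
   proof -
    have [measurable]: "D \<in> borel_measurable (F q)" by (rule measurable_F_mono[OF a0(1) _ DF]) (use q in simp)
    have "G = {w\<in>space (F q). D w \<in> C}" using space_F[of q] q a by (simp add: G_def)
    hence [measurable]: "G \<in> sets (F q)" by simp
    show ?thesis unfolding U_def by measurable
   qed
   fix S assume S: "S \<in> sets (generated M B {a..a})"
   have "\<exists>C'\<in>sets borel. S = {w\<in>space M. B a w \<in> C'}"
   proof -
    have "sets (generated M B {a..a}) = sets (vimage_algebra (space M) (B a) borel)"
     unfolding sets_generated sets_vimage_algebra by (auto intro!: arg_cong[where f="sigma_sets (space M)"])
    thus ?thesis using S by (auto simp: sets_vimage_algebra2)
   qed
   then obtain C' where C'[measurable]: "C' \<in> sets borel" and S_eq: "S = {w\<in>space M. B a w \<in> C'}" by blast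
   have "emeasure M (G \<inter> S) = emeasure M G * emeasure M S"
   proof -
    have e1: "G \<inter> S = {w\<in>space M. D w \<in> C & B a w \<in> C'}" by (auto simp: G_def S_eq)
    have e2: "S = {w\<in>space M. D w \<in> UNIV & B a w \<in> C'}" by (auto simp: S_eq)
    have e3: "emeasure M S = (nn_integral \<N> (%x. indicator C' (sqrt a * x)))"
     using joint[OF _ C', of UNIV] gauss.emeasure_space_1 unfolding e2 by simp
    have e4: "emeasure M G = ?\<delta> C" unfolding G_def by (rule D_law) simp
    show ?thesis unfolding e1 e3 e4 by (rule joint) simp_all
   qed
   hence "prob (G \<inter> S) = prob G * prob S"
    by (simp add: emeasure_eq_measure ennreal_mult'[symmetric])
   moreover have "S \<in> sets M" unfolding S_eq by measurable
   ultimately show "(LINT w:S|M. U w) = 0" using int by simp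
  qed
  moreover have "S \<in> sets M" using S subalgebra_future[OF a0(1)] by (auto simp: subalgebra_def)
  ultimately show ?thesis using int[of S] by (simp add: G_def)
 qed
 have no_atoms: "AE w in M. D w \<noteq> \<zeta> w" if \<zeta>: "\<zeta> \<in> borel_measurable (future a)" for \<zeta>
 proof -
  have \<zeta>M[measurable]: "\<zeta> \<in> borel_measurable M" by (rule measurable_from_subalg[OF subalgebra_future[OF a0(1)] \<zeta>])
  interpret D: prob_space "distr M borel D" by (rule prob_space_distr) simp
  interpret Z: prob_space "distr M borel \<zeta>" by (rule prob_space_distr) simp
  have eq: "distr M borel D \<Otimes>\<^sub>M distr M borel \<zeta> = distr M (borel \<Otimes>\<^sub>M borel) (%w. (D w, \<zeta> w))"
  proof (rule pair_measure_eqI)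
   fix A C assume "A \<in> sets (distr M borel D)" "C \<in> sets (distr M borel \<zeta>)"
   hence [measurable]: "A \<in> sets borel" "C \<in> sets borel" by auto
   have S: "\<zeta> -` C \<inter> space M \<in> sets (future a)" using measurable_sets[OF \<zeta>, of C] by simp
   have "(%w. (D w, \<zeta> w)) -` (A \<times> C) \<inter> space M = {w\<in>space M. D w \<in> A} \<inter> (\<zeta> -` C \<inter> space M)" by auto
   moreover have "D -` A \<inter> space M = {w\<in>space M. D w \<in> A}" by auto
   ultimately show "emeasure (distr M borel D) A * emeasure (distr M borel \<zeta>) C = emeasure (distr M (borel \<Otimes>\<^sub>M borel) (%w. (D w, \<zeta> w))) (A \<times> C)"
    using indep[OF _ S, of A] by (simp add: emeasure_distr emeasure_eq_measure ennreal_mult')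
  qed (rule D.sigma_finite_measure_axioms Z.sigma_finite_measure_axioms | simp cong: sets_pair_measure_cong)+
  have diag: "{z::real\<times>real. fst z = snd z} \<in> sets (borel \<Otimes>\<^sub>M borel)"
   unfolding borel_prod by (intro borel_closed closed_Collect_eq continuous_intros)
  have diag': "{z::real\<times>real. fst z = snd z} \<in> sets (distr M borel D \<Otimes>\<^sub>M distr M borel \<zeta>)"
   using diag by (simp cong: sets_pair_measure_cong)
  have single: "emeasure (distr M borel D) {z} = 0" for z
  proof -
   have "emeasure (distr M borel D) {z} = emeasure M {w\<in>space M. D w \<in> {z}}"
    by (simp add: emeasure_distr vimage_def Int_def conj_commute)
   also have "... = (nn_integral \<N> (%y. indicator {z} (- (sqrt a * y))))" by (rule D_law) simp
   also have "... = (nn_integral \<N> (%y. indicator {- z/sqrt a} y))"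
    by (intro nn_integral_cong) (use a in \<open>auto simp: indicator_def field_simps\<close>)
   also have "... = 0" by (simp add: emeasure_density)
   finally show ?thesis .
  qed
  have "emeasure M {w\<in>space M. D w = \<zeta> w} = emeasure (distr M (borel \<Otimes>\<^sub>M borel) (%w. (D w, \<zeta> w))) {z. fst z = snd z}"
   using diag by (simp add: emeasure_distr vimage_def Int_def conj_commute)
  also have "... = (\<integral>\<^sup>+ y. emeasure (distr M borel D) ((%x. (x, y)) -` {z. fst z = snd z}) \<partial>distr M borel \<zeta>)"
   unfolding eq[symmetric] by (rule pair_sigma_finite.emeasure_pair_measure_alt2) (unfold_locales, rule diag')
  also have "... = (\<integral>\<^sup>+ y. 0 \<partial>distr M borel \<zeta>)"
  proof (rule nn_integral_cong)
   fix y :: real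
   have "(%x. (x, y)) -` {z. fst z = snd z} = {y :: real}" by auto
   thus "emeasure (distr M borel D) ((%x. (x, y)) -` {z. fst z = snd z}) = 0" using single by simp
  qed
  finally have "{w\<in>space M. D w = \<zeta> w} \<in> null_sets M" by (intro null_setsI) simp_all
  thus ?thesis by (rule AE_I') auto
 qed
 \<comment> \<open>An injective rescaling into the unit interval; \<open>tan\<close> carries a
   competitor \<zeta> back to the scale of \<open>D\<close>.\<close>
 define D' where "D' w = 1/2 + arctan (D w)/pi" for w
 have arct: "- 1/2 < arctan x/pi" "arctan x/pi < 1/2" for x
  using arctan_bounded[of x] by (auto simp: field_simps)
 show ?thesis
 proof (rule that[of D'])
  show "D' \<in> borel_measurable (F a)" unfolding D'_def by measurable
  show "0 < D' w" "D' w < 1" for w using arct[of "D w"] unfolding D'_def by linarith+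
  fix \<zeta> :: "'a => real" assume \<zeta>: "\<zeta> \<in> borel_measurable (future a)"
  have [measurable]: "tan \<in> borel_measurable (borel :: real measure)" unfolding tan_def[abs_def] by measurable
  have "(%w. tan ((\<zeta> w - 1/2) * pi)) \<in> borel_measurable (future a)" using \<zeta> by measurable
  from no_atoms[OF this] show "AE w in M. D' w \<noteq> \<zeta> w"
  proof eventually_elim
   case (elim w)
   have "D w = tan ((D' w - 1/2) * pi)" by (simp add: D'_def tan_arctan)
   thus ?case using elim by metis
  qed
 qed
qed

end

section \<open>Randomised stopping\<close>

text \<open>\<open>A q\<close> is the probability, given the path, of having stopped by
  \<open>q\<close>. On paths calm up to \<open>tm i\<close> it is still zero at \<open>tm i\<close>,
  so the path before that time is available for randomisation. Each path is calm only up to a time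
  of its own, hence a sequence of times decreasing to 0, each with its own randomiser.\<close>

locale randomised_stopping = filtered_bm +
 fixes A :: "real => 'a => real" and r K :: real and tm :: "nat => real" and D :: "nat => 'a => real" and calm :: "real => 'a set"
 defines "calm \<equiv> %q. {w\<in>space M. \<forall>s\<in>\<rat>. 0 <= s --> s <= q --> \<bar>B s w\<bar> <= r}"
 assumes A_adapted: "!!q. q \<in> \<rat> ==> 0 <= q ==> A q \<in> borel_measurable (F q)"
  and A_range: "!!q w. 0 <= A q w" "!!q w. A q w <= 1"
  and A_mono: "!!q q'. q \<in> \<rat> ==> q' \<in> \<rat> ==> 0 <= q ==> q <= q' ==> AE w in M. A q w <= A q' w"
  and A_start: "AE w in M. A 0 w = 0" and A_end: "AE w in M. A K w = 1" and K: "K \<in> \<rat>" "0 < K" and r: "0 < r"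
  and tm: "!!i. tm i \<in> \<rat>" "!!i. 0 < tm i" "!!i. tm i <= K" "decseq tm" "tm \<longlonglongrightarrow> 0"
  and A_early: "!!i. AE w in M. w \<in> calm (tm i) --> A (tm i) w = 0"
  and D_adapted: "!!i. D i \<in> borel_measurable (F (tm i))" and D_range: "!!i w. 0 < D i w" "!!i w. D i w < 1"
  and D_no_atoms: "!!i \<zeta>. \<zeta> \<in> borel_measurable (generated M B {tm i..}) ==> AE w in M. D i w \<noteq> \<zeta> w"
begin

abbreviation "E i \<equiv> calm (tm i)"

text \<open>As \<open>tm\<close> decreases, the events \<open>E i\<close> increase; on
  \<open>P i\<close> the time \<open>tm i\<close> is the latest of the sequence up to which the path
  is calm.\<close>

definition "P i = E i - (\<Union>j<i. E j)"

text \<open>The stopping probability averaged over the path before \<open>tm i\<close>. The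
  randomness thus removed is supplied again by the comparison with \<open>V i\<close>, which is
  built from \<open>D i\<close>.\<close>

definition "cond_A i q = real_cond_exp M (future (tm i)) (%w. A q w * indicator (E i) w)"

definition "N i q w = max 0 (min 1 (cond_A i q w))"

definition "V i = cond_quantile.threshold M (future (tm i)) (E i) (D i)"

text \<open>The event of having stopped by \<open>q\<close>. A single threshold serves for all
  \<open>q\<close>, so these events increase with \<open>q\<close> as soon as the probabilities
  do.\<close>

definition "Z q = {w\<in>space M. \<exists>i. w \<in> P i & V i w <= N i q w}"

definition "\<tau> w = (INF q\<in>\<rat> \<inter> {0..K}. if w \<in> Z q then q else K)"

text \<open>The right limit of the probabilities at \<open>t\<close>: an infimum of times is at most
  \<open>t\<close> if stopping has occurred by every rational time after \<open>t\<close>.\<close>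

definition "Nbar i t w = (INF q\<in>\<rat> \<inter> {t<..K}. N i q w)"

lemma tm0: "0 <= tm i" using tm(2)[of i] by simp

lemma A_measurable: "q \<in> \<rat> ==> 0 <= q ==> A q \<in> borel_measurable M"
 using A_adapted measurable_F by blast

lemma rat_int: "countable (\<rat> \<inter> S :: real set)"
 by (auto intro: countable_subset[OF _ countable_rat])

lemma calm_alt: "calm q = (\<Inter>s\<in>\<rat> \<inter> {0..q}. {w\<in>space M. \<bar>B s w\<bar> <= r}) \<inter> space M"
 unfolding calm_def by auto

lemma countable_INT_sets:
 assumes "countable I" "!!i. i \<in> I ==> X i \<in> sets G"
 shows "(\<Inter>i\<in>I. X i) \<inter> space G \<in> sets G"
proof -
 have "(\<Inter>i\<in>I. X i) \<inter> space G = space G - (\<Union>i\<in>I. space G - X i)" by auto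
 also have "... \<in> sets G" using assms by (intro sets.Diff sets.countable_UN'' sets.top) auto
 finally show ?thesis .
qed

lemma calm_F: "0 <= q ==> calm q \<in> sets (F q)"
proof -
 assume q: "0 <= q"
 have "(\<Inter>s\<in>\<rat> \<inter> {0..q}. {w\<in>space M. \<bar>B s w\<bar> <= r}) \<inter> space (F q) \<in> sets (F q)"
 proof (rule countable_INT_sets[OF rat_int])
  fix s assume "s \<in> \<rat> \<inter> {0..q}"
  hence [measurable]: "B s \<in> borel_measurable (F q)" by (intro measurable_F_mono[of s q] adapted) auto
  have "{w\<in>space (F q). \<bar>B s w\<bar> <= r} \<in> sets (F q)" by measurable
  thus "{w\<in>space M. \<bar>B s w\<bar> <= r} \<in> sets (F q)" by (simp add: space_F[OF q])
 qed
 thus ?thesis by (simp add: calm_alt space_F[OF q])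
qed

lemma E_sets [measurable]: "E i \<in> sets M"
 by (rule sets_F[OF tm0 calm_F[OF tm0]])

lemma P_sets [measurable]: "P i \<in> sets M"
 unfolding P_def by measurable

lemma P_disjoint: "w \<in> P i ==> w \<in> P j ==> i = j"
 unfolding P_def by (cases i j rule: linorder_cases) auto

lemma P_E: "w \<in> P i ==> w \<in> E i"
 unfolding P_def by simp

lemma AE_P: "AE w in M. \<exists>i. w \<in> P i"
proof -
 have "AE w in M. \<exists>i. w \<in> E i"
  using start continuous_paths AE_space[of M]
 proof eventually_elim
  case (elim w)
  have "continuous (at 0 within {0..}) (%t. B t w)" using elim(2) by (auto simp: continuous_on_eq_continuous_within)
  then obtain d where d: "0 < d" "!!s. s \<in> {0..} ==> dist s 0 < d ==> dist (B s w) (B 0 w) < r"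
   using r unfolding continuous_within_eps_delta by blast
  obtain i where i: "tm i < d"
   using order_tendstoD(2)[OF tm(5) d(1)] by (auto simp: eventually_sequentially)
  have "\<bar>B s w\<bar> <= r" if "0 <= s" "s <= tm i" for s
   using d(2)[of s] that i elim(1) by (simp add: dist_real_def)
  thus ?case using elim(3) unfolding calm_def by blast
 qed
 thus ?thesis
 proof eventually_elim
  case (elim w)
  define i where "i = (LEAST i. w \<in> E i)"
  have "w \<in> E i" using elim unfolding i_def by (rule LeastI_ex)
  moreover have "w \<notin> E j" if "j < i" for j using not_less_Least that unfolding i_def by blast
  ultimately show ?case unfolding P_def by blast
 qed
qed

lemma fms: "finite_measure_subalgebra M (future (tm i))"
 by unfold_locales (rule subalgebra_future[OF tm0])

lemma D_measurable: "D i \<in> borel_measurable M"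
 by (rule measurable_F[OF tm0 D_adapted])

lemma cond_quantile: "cond_quantile M (future (tm i)) (E i) (D i)"
 by unfold_locales (simp_all add: subalgebra_future[OF tm0] D_measurable D_range D_no_atoms)

lemma AE_integrable:
 assumes "q \<in> \<rat>" "0 <= q"
 shows "integrable M (%w. A q w * indicator (E i) w)"
proof (rule integrable_const_bound[where B=1])
 show "AE w in M. norm (A q w * indicator (E i) w) <= 1"
  using A_range[of q] by (intro AE_I2) (simp add: indicator_def)
 show "(%w. A q w * indicator (E i) w) \<in> borel_measurable M" using A_measurable[OF assms] by measurable
qed

lemma N_range: "0 <= N i q w" "N i q w <= 1" by (auto simp: N_def)

lemma N_future: "N i q \<in> borel_measurable (future (tm i))"
 unfolding N_def cond_A_def by measurable

lemma N_measurable [measurable]: "N i q \<in> borel_measurable M"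
 unfolding N_def cond_A_def by measurable

lemma N_cond_A:
 assumes q: "q \<in> \<rat>" "0 <= q"
 shows "AE w in M. N i q w = cond_A i q w" "AE w in M. N i q w <= real_cond_exp M (future (tm i)) (indicator (E i)) w"
proof -
 interpret fms: finite_measure_subalgebra M "future (tm i)" by (rule fms)
 note int = AE_integrable[OF q, of i]
 have i1: "integrable M (indicat_real (E i))" by (simp add: emeasure_eq_measure)
 have 0: "AE w in M. cond_A i q w \<ge> 0"
  unfolding cond_A_def by (rule fms.real_cond_exp_ge_c[OF int]) (simp add: A_range indicator_def)
 have 1: "AE w in M. cond_A i q w <= real_cond_exp M (future (tm i)) (indicator (E i)) w"
  unfolding cond_A_def by (rule fms.real_cond_exp_mono[OF _ int i1]) (simp add: A_range indicator_def)
 have 2: "AE w in M. real_cond_exp M (future (tm i)) (indicator (E i)) w <= 1"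
  by (rule fms.real_cond_exp_le_c[OF i1]) (simp add: indicator_def)
 show "AE w in M. N i q w = cond_A i q w" using 0 1 2 by eventually_elim (simp add: N_def)
 show "AE w in M. N i q w <= real_cond_exp M (future (tm i)) (indicator (E i)) w" using 0 1 2 by eventually_elim (simp add: N_def)
qed

lemma N_mono: "AE w in M. \<forall>i. \<forall>q\<in>\<rat>. \<forall>q'\<in>\<rat>. 0 <= q --> q <= q' --> N i q w <= N i q' w"
proof -
 have 1: "AE w in M. 0 <= q --> q <= q' --> N i q w <= N i q' w" if q: "q \<in> \<rat>" "q' \<in> \<rat>" for i q q'
 proof (cases "0 <= q & q <= q'")
  case True
  interpret fms: finite_measure_subalgebra M "future (tm i)" by (rule fms)
  have "AE w in M. A q w * indicator (E i) w <= A q' w * indicator (E i) w"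
   using A_mono[OF q] True by (auto elim!: eventually_mono simp: indicator_def)
  hence "AE w in M. cond_A i q w <= cond_A i q' w"
   unfolding cond_A_def using q True by (intro fms.real_cond_exp_mono AE_integrable) auto
  thus ?thesis by eventually_elim (auto simp: N_def)
 qed auto
 have 2: "AE w in M. \<forall>q'\<in>\<rat>. 0 <= q --> q <= q' --> N i q w <= N i q' w" if "q \<in> \<rat>" for i q
  using 1[OF that] by (subst AE_ball_countable[OF countable_rat]) blast
 have "AE w in M. \<forall>q\<in>\<rat>. \<forall>q'\<in>\<rat>. 0 <= q --> q <= q' --> N i q w <= N i q' w" for i
  using 2 by (subst AE_ball_countable[OF countable_rat]) blast
 thus ?thesis by (subst AE_all_countable) blast
qed

lemma V_measurable [measurable]: "V i \<in> borel_measurable M"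
proof -
 interpret cond_quantile M "future (tm i)" "E i" "D i" by (rule cond_quantile)
 show ?thesis unfolding V_def by (rule threshold_measurable) (simp_all add: D_measurable)
qed

text \<open>Given the future after \<open>tm i\<close>, the conditional law of \<open>D i\<close> on
  \<open>E i\<close> depends on \<open>B (tm i)\<close> only, up to null sets. The threshold is
  therefore known at \<open>tm i\<close> although it is defined by conditioning on the
  future.\<close>

lemma V_F: "V i \<in> borel_measurable (F (tm i))"
proof -
 interpret cq: cond_quantile M "future (tm i)" "E i" "D i" by (rule cond_quantile)
 have "cq.cond_cdf q \<in> borel_measurable (F (tm i))" for q
  unfolding cq.cond_cdf_def
 proof (rule cond_exp_future_measurable[OF tm0 order_refl])
  have m: "E i \<inter> {w\<in>space M. D i w <= q} \<in> sets (F (tm i))"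
  proof -
   have "{w\<in>space (F (tm i)). D i w <= q} \<in> sets (F (tm i))" using D_adapted by measurable
   thus ?thesis using calm_F[OF tm0, of i] by (auto simp: space_F[OF tm0])
  qed
  show "integrable M (indicat_real (E i \<inter> {w\<in>space M. D i w <= q}))"
   using sets_F[OF tm0 m] by (simp add: emeasure_eq_measure)
  show "indicat_real (E i \<inter> {w\<in>space M. D i w <= q}) \<in> borel_measurable (F q')" if "tm i < q'" for q'
   using m F_mono[OF tm0, of i q'] that by (intro borel_measurable_indicator) auto
 qed
 hence "cq.clipped_cdf q \<in> borel_measurable (F (tm i))" for q
  unfolding cq.clipped_cdf_def by measurable
 thus ?thesis unfolding V_def by (rule cq.threshold_measurable[OF _ D_adapted])
qed

lemma N_F:
 assumes "q \<in> \<rat>" "tm i <= q"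
 shows "N i q \<in> borel_measurable (F q)"
proof -
 have q0: "0 <= q" using tm0[of i] assms by simp
 have m: "(%w. A q w * indicator (E i) w) \<in> borel_measurable (F q)"
 proof -
  have [measurable]: "A q \<in> borel_measurable (F q)" by (rule A_adapted[OF assms(1) q0])
  have [measurable]: "E i \<in> sets (F q)" using calm_F[OF tm0, of i] F_mono[OF tm0 assms(2)] by auto
  show ?thesis by measurable
 qed
 have "cond_A i q \<in> borel_measurable (F q)"
  unfolding cond_A_def
 proof (rule cond_exp_future_measurable[OF tm0 assms(2) AE_integrable[OF assms(1) q0]])
  show "(%w. A q w * indicator (E i) w) \<in> borel_measurable (F q')" if "q < q'" for q'
   using measurable_F_mono[OF q0 _ m, of q'] that by simp
 qed
 thus ?thesis unfolding N_def by measurable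
qed

text \<open>Quantities of the future after \<open>tm i\<close> cannot tell the randomised event from
  the stopping probability: on \<open>E i\<close> both have the conditional expectation
  \<open>N i q\<close>.\<close>

lemma key:
 assumes q: "q \<in> \<rat>" "0 <= q" and Y: "Y \<in> borel_measurable (future (tm i))" and c: "!!w. \<bar>Y w\<bar> <= c"
 shows "(LINT w|M. Y w * indicator (E i \<inter> {w\<in>space M. V i w <= N i q w}) w) = (LINT w|M. Y w * (A q w * indicator (E i) w))"
proof -
 interpret cq: cond_quantile M "future (tm i)" "E i" "D i" by (rule cond_quantile)
 have YM[measurable]: "Y \<in> borel_measurable M" by (rule cq.measurable_C[OF Y])
 have [measurable]: "A q \<in> borel_measurable M" by (rule A_measurable[OF q])
 let ?R = "E i \<inter> {w\<in>space M. V i w <= N i q w}"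
 have c0: "0 <= c" using c[of undefined] by simp
 have R: "AE w in M. real_cond_exp M (future (tm i)) (indicator ?R) w = N i q w"
  unfolding V_def
 proof (rule cq.cond_exp_threshold[OF N_future])
  show "AE w in M. 0 <= N i q w & N i q w <= real_cond_exp M (future (tm i)) (indicat_real (E i)) w"
   using N_cond_A(2)[OF q] by eventually_elim (simp add: N_range)
 qed
 have "(LINT w|M. Y w * indicator ?R w) = (LINT w|M. Y w * real_cond_exp M (future (tm i)) (indicator ?R) w)"
 proof (rule cq.real_cond_exp_intg(2)[symmetric])
  show "integrable M (%w. Y w * indicator ?R w)"
   by (rule integrable_const_bound[where B=c]) (use c c0 in \<open>auto simp: indicator_def\<close>)
 qed (use Y in simp_all)
 also have "... = (LINT w|M. Y w * cond_A i q w)"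
 proof (rule integral_cong_AE)
  show "AE w in M. Y w * real_cond_exp M (future (tm i)) (indicator ?R) w = Y w * cond_A i q w"
   using R N_cond_A(1)[OF q, of i] by eventually_elim simp
 qed (simp_all add: cond_A_def)
 also have "... = (LINT w|M. Y w * (A q w * indicator (E i) w))"
  unfolding cond_A_def
 proof (rule cq.real_cond_exp_intg(2))
  show "integrable M (%w. Y w * (A q w * indicator (E i) w))"
  proof (rule integrable_const_bound[where B=c])
   have "\<bar>Y w * (A q w * indicator (E i) w)\<bar> <= c * 1" for w
    unfolding abs_mult using c[of w] c0 A_range[of q w] by (intro mult_mono) (auto simp: indicator_def)
   thus "AE w in M. norm (Y w * (A q w * indicator (E i) w)) <= c" by simp
  qed measurable
 qed (use Y in simp_all)
 finally show ?thesis .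
qed

text \<open>\<open>E j\<close> is \<open>E i\<close> together with an event of the future after \<open>tm i\<close>.\<close>

definition "later i j = (\<Inter>s\<in>\<rat> \<inter> {tm i..tm j}. {w\<in>space M. \<bar>B s w\<bar> <= r}) \<inter> space M"

lemma later_future [measurable]: "later i j \<in> sets (future (tm i))"
proof -
 have "(\<Inter>s\<in>\<rat> \<inter> {tm i..tm j}. {w\<in>space M. \<bar>B s w\<bar> <= r}) \<inter> space (future (tm i)) \<in> sets (future (tm i))"
 proof (rule countable_INT_sets[OF rat_int])
  fix s assume "s \<in> \<rat> \<inter> {tm i..tm j}"
  hence [measurable]: "B s \<in> borel_measurable (future (tm i))" by (intro measurable_generated) auto
  have "{w\<in>space (future (tm i)). \<bar>B s w\<bar> <= r} \<in> sets (future (tm i))" by measurable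
  thus "{w\<in>space M. \<bar>B s w\<bar> <= r} \<in> sets (future (tm i))" by simp
 qed
 thus ?thesis by (simp add: later_def)
qed

lemma E_later: "j <= i ==> E j = E i \<inter> later i j"
proof -
 assume "j <= i"
 hence "tm i <= tm j" using tm(4) by (auto dest: decseqD)
 moreover have "0 <= s" if "tm i <= s" for s using tm0[of i] that by simp
 ultimately show ?thesis unfolding calm_def later_def by (auto intro: order_trans)
qed

text \<open>\<open>key\<close> is tested with the future event \<open>later i j\<close>. On
  \<open>E j\<close> the stopping probability at \<open>tm j\<close> is zero, so the randomised
  event there has probability zero.\<close>

lemma early_null: "AE w in M. \<forall>i j. j <= i --> w \<in> E j --> \<not> V i w <= N i (tm j) w"
proof -
 have "AE w in M. w \<in> E j --> \<not> V i w <= N i (tm j) w" if ji: "j <= i" for i j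
 proof -
  have [measurable]: "A (tm j) \<in> borel_measurable M" by (rule A_measurable[OF tm(1) tm0])
  let ?R = "E i \<inter> {w\<in>space M. V i w <= N i (tm j) w}"
  have LM[measurable]: "later i j \<in> sets M" using later_future[of i j] subalgebra_future[OF tm0, of i] by (auto simp: subalgebra_def)
  have "(LINT w|M. indicator (later i j) w * indicator ?R w) = (LINT w|M. indicator (later i j) w * (A (tm j) w * indicator (E i) w))"
   by (rule key[OF tm(1) tm0, where c=1]) (simp_all add: later_future indicator_def)
  also have "... = (LINT w|M. 0)"
  proof (rule integral_cong_AE)
   show "AE w in M. indicator (later i j) w * (A (tm j) w * indicator (E i) w) = 0"
    using A_early[of j] by eventually_elim (use E_later[OF ji] in \<open>auto simp: indicator_def\<close>)
  qed measurable
  finally have "prob (later i j \<inter> ?R) = 0" by (simp add: indicator_inter_arith[symmetric])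
  hence "later i j \<inter> ?R \<in> null_sets M" by (intro null_setsI) (simp_all add: emeasure_eq_measure)
  hence "AE w in M. w \<notin> later i j \<inter> ?R" by (rule AE_not_in)
  thus ?thesis using AE_space[of M] by eventually_elim (use E_later[OF ji] in auto)
 qed
 hence "AE w in M. j <= i --> w \<in> E j --> \<not> V i w <= N i (tm j) w" for i j by (cases "j <= i") auto
 thus ?thesis by (simp add: AE_all_countable)
qed

lemma Z_iff: "w \<in> P i ==> w \<in> Z q \<longleftrightarrow> V i w <= N i q w"
 unfolding Z_def using P_disjoint sets.sets_into_space[OF P_sets] by blast

lemma Z_sets [measurable]: "Z q \<in> sets M"
proof -
 have "Z q = (\<Union>i. P i \<inter> {w\<in>space M. V i w <= N i q w})" unfolding Z_def by auto
 also have "... \<in> sets M" by measurable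
 finally show ?thesis .
qed

lemma Z_mono: "AE w in M. \<forall>q\<in>\<rat>. \<forall>q'\<in>\<rat>. 0 <= q --> q <= q' --> w \<in> Z q --> w \<in> Z q'"
 using N_mono
proof eventually_elim
 case (elim w)
 thus ?case unfolding Z_def by (blast intro: order_trans)
qed

text \<open>Only values of the path at or after the level \<open>q\<close> are tested. If
  \<open>tm i <= q'\<close>, both \<open>B q'\<close> and the selection of \<open>P i\<close> within
  \<open>E i\<close> belong to the future after \<open>tm i\<close>, and \<open>key\<close> applies;
  if \<open>q' < tm i\<close>, both sides vanish on \<open>P i\<close>.\<close>

lemma Z_law:
 assumes q: "q \<in> \<rat>" "0 <= q" "q <= q'" and f[measurable]: "f \<in> borel_measurable borel" and c: "!!x. \<bar>f x\<bar> <= (c :: real)"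
 shows "(LINT w|M. f (B q' w) * indicator (Z q) w) = (LINT w|M. f (B q' w) * A q w)"
proof -
 have q': "0 <= q'" using q by simp
 have [measurable]: "B q' \<in> borel_measurable M" "A q \<in> borel_measurable M"
  using q' q by (auto intro: B_measurable A_measurable)
 have c0: "0 <= c" using c[of 0] by simp
 let ?f1 = "%w. f (B q' w) * indicator (Z q) w" and ?f2 = "%w. f (B q' w) * A q w"
 have int: "integrable M ?f1" "integrable M ?f2"
 proof -
  have "\<bar>?f2 w\<bar> <= c * 1" for w
   unfolding abs_mult using c[of "B q' w"] c0 A_range[of q w] by (intro mult_mono) auto
  thus "integrable M ?f2" by (intro integrable_const_bound[where B=c]) simp_all
  show "integrable M ?f1" by (rule integrable_const_bound[where B=c]) (use c c0 in \<open>auto simp: indicator_def\<close>)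
 qed
 have piece: "(\<integral>w\<in>P i. ?f1 w \<partial>M) = (\<integral>w\<in>P i. ?f2 w \<partial>M)" for i
 proof (cases "tm i <= q'")
  case True
  define G where "G = space M - (\<Union>j<i. later i j)"
  have "space (future (tm i)) - (\<Union>j<i. later i j) \<in> sets (future (tm i))" by measurable
  hence G: "G \<in> sets (future (tm i))" by (simp add: G_def)
  have PG: "P i = G \<inter> E i"
  proof -
   have "(\<Union>j<i. E j) = (\<Union>j<i. E i \<inter> later i j)" by (rule SUP_cong[OF refl]) (simp add: E_later)
   hence "(\<Union>j<i. E j) = E i \<inter> (\<Union>j<i. later i j)" by blast
   moreover have "E i \<subseteq> space M" using sets.sets_into_space[OF E_sets] .
   ultimately show ?thesis unfolding P_def G_def by blast
  qed
  define Y where "Y w = f (B q' w) * indicator G w" for w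
  have [measurable]: "B q' \<in> borel_measurable (future (tm i))" by (rule measurable_generated) (use True in simp)
  have Y: "Y \<in> borel_measurable (future (tm i))" unfolding Y_def using G by measurable
  have Yc: "\<bar>Y w\<bar> <= c" for w using c[of "B q' w"] c0 by (simp add: Y_def indicator_def)
  have "(\<integral>w\<in>P i. ?f1 w \<partial>M) = (LINT w|M. Y w * indicator (E i \<inter> {w\<in>space M. V i w <= N i q w}) w)"
   unfolding set_lebesgue_integral_def
  proof (rule Bochner_Integration.integral_cong[OF refl])
   fix w assume "w \<in> space M"
   thus "indicator (P i) w *\<^sub>R ?f1 w = Y w * indicator (E i \<inter> {w\<in>space M. V i w <= N i q w}) w"
    using Z_iff[of w i q] by (auto simp: indicator_def Y_def PG)
  qed
  also have "... = (LINT w|M. Y w * (A q w * indicator (E i) w))" by (rule key[OF q(1,2) Y Yc])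
  also have "... = (\<integral>w\<in>P i. ?f2 w \<partial>M)"
   unfolding set_lebesgue_integral_def by (rule Bochner_Integration.integral_cong[OF refl]) (auto simp: indicator_def Y_def PG)
  finally show ?thesis .
 next
  case False
  hence qi: "q <= tm i" using q by simp
  have "AE w in M. indicator (P i) w *\<^sub>R ?f1 w = indicator (P i) w *\<^sub>R ?f2 w"
   using early_null N_mono A_early[of i] A_mono[OF q(1) tm(1)[of i] q(2) qi]
  proof eventually_elim
   case (elim w)
   show ?case
   proof (cases "w \<in> P i")
    case True
    have "N i q w <= N i (tm i) w" using elim(2) q tm(1)[of i] False by auto
    hence "\<not> V i w <= N i q w" using elim(1) P_E[OF True] by (meson order_refl order_trans)
    hence "w \<notin> Z q" using Z_iff[OF True] by simp
    moreover have "A q w = 0" using elim(3,4) P_E[OF True] A_range(1)[of q w] False q by auto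
    ultimately show ?thesis by simp
   qed simp
  qed
  thus ?thesis unfolding set_lebesgue_integral_def by (intro integral_cong_AE) simp_all
 qed
 have total: "(LINT w|M. g w) = (\<Sum>i. \<integral>w\<in>P i. g w \<partial>M)" if g: "integrable M g" for g :: "'a => real"
 proof -
  have "(LINT w|M. g w) = (\<integral>w\<in>(\<Union>i. P i). g w \<partial>M)"
   unfolding set_lebesgue_integral_def
  proof (rule integral_cong_AE)
   show "AE w in M. g w = indicator (\<Union>i. P i) w *\<^sub>R g w" using AE_P by eventually_elim simp
  qed (use g in simp_all)
  also have "... = (\<Sum>i. \<integral>w\<in>P i. g w \<partial>M)"
  proof (rule lebesgue_integral_countable_add[OF P_sets])
   show "P i \<inter> P j = {}" if "i \<noteq> j" for i j using P_disjoint that by blast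
   show "set_integrable M (\<Union> (range P)) g"
    unfolding set_integrable_def by (rule integrable_mult_indicator[OF _ g]) simp
  qed
  finally show ?thesis .
 qed
 show ?thesis unfolding total[OF int(1)] total[OF int(2)] piece by (rule refl)
qed

lemma Z_prob: "q \<in> \<rat> ==> 0 <= q ==> prob (Z q) = (LINT w|M. A q w)"
 using Z_law[of q q "%_. 1" 1] by simp

lemma Z_0: "AE w in M. w \<notin> Z 0"
proof -
 have "(LINT w|M. A 0 w) = (LINT w|M. 0)"
  using A_start A_measurable[of 0] by (intro integral_cong_AE) auto
 hence "prob (Z 0) = 0" using Z_prob[of 0] by simp
 hence "Z 0 \<in> null_sets M" by (intro null_setsI) (simp_all add: emeasure_eq_measure)
 thus ?thesis by (rule AE_not_in)
qed

lemma Z_K: "AE w in M. w \<in> Z K"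
proof -
 have "(LINT w|M. A K w) = (LINT w|M. 1)"
  using A_end A_measurable[of K] K by (intro integral_cong_AE) auto
 hence "prob (Z K) = 1" using Z_prob[of K] K by (simp add: prob_space)
 thus ?thesis by (simp add: prob_eq_1)
qed

lemma Nbar_le: "q \<in> \<rat> ==> t < q ==> q <= K ==> Nbar i t w <= N i q w"
 unfolding Nbar_def by (rule cINF_lower) (auto intro!: bdd_belowI2[where m=0] simp: N_range)

lemma Nbar_future:
 assumes "t < K"
 shows "Nbar i t \<in> borel_measurable (future (tm i))"
proof -
 have ne: "\<rat> \<inter> {t<..K} \<noteq> {}" using K assms by auto
 have "(%w. INF q\<in>\<rat> \<inter> {t<..K}. N i q w) \<in> borel_measurable (future (tm i))"
 proof (rule borel_measurable_cINF[OF rat_int])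
  show "bdd_below ((%q. N i q w) ` (\<rat> \<inter> {t<..K}))" for w by (rule bdd_belowI2[where m=0]) (rule N_range)
 qed (rule N_future)
 thus ?thesis by (simp add: Nbar_def[abs_def])
qed

text \<open>The infimum over rationals after \<open>t\<close> is known only immediately after
  \<open>t\<close>. It is also measurable for the future after \<open>tm i\<close>, hence equal to
  its own conditional expectation, which \<open>cond_exp_future_measurable\<close> places in
  \<open>F t\<close>.\<close>

lemma Nbar_F:
 assumes t: "tm i <= t" "t < K"
 shows "Nbar i t \<in> borel_measurable (F t)"
proof -
 have t0: "0 <= t" using tm0[of i] t by simp
 interpret fms: finite_measure_subalgebra M "future (tm i)" by (rule fms)
 have fut: "Nbar i t \<in> borel_measurable (future (tm i))" by (rule Nbar_future[OF t(2)])
 have meas: "Nbar i t \<in> borel_measurable M" by (rule measurable_from_subalg[OF fms.subalg fut])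
 have "0 <= Nbar i t w" "Nbar i t w <= 1" for w
 proof -
  show "0 <= Nbar i t w" unfolding Nbar_def by (rule cINF_greatest) (use K t in \<open>auto simp: N_range\<close>)
  show "Nbar i t w <= 1" using Nbar_le[OF K(1) t(2) order_refl] N_range(2) by (rule order_trans)
 qed
 hence int: "integrable M (Nbar i t)" by (intro integrable_const_bound[where B=1] meas AE_I2) simp
 have "Nbar i t \<in> borel_measurable (F q)" if q: "t < q" for q
 proof (rule measurable_F_AE[OF _ _ meas])
  show q0: "0 <= q" using q t0 by simp
  have m: "t < min q K" using q t by simp
  have "(%w. INF q'\<in>\<rat> \<inter> {t<..min q K}. N i q' w) \<in> borel_measurable (F q)"
  proof (rule borel_measurable_cINF[OF rat_int])
   fix q' assume "q' \<in> \<rat> \<inter> {t<..min q K}"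
   thus "N i q' \<in> borel_measurable (F q)" using t t0 by (intro measurable_F_mono[OF _ _ N_F]) auto
  next
   show "bdd_below ((%q. N i q w) ` (\<rat> \<inter> {t<..min q K}))" for w by (rule bdd_belowI2[where m=0]) (rule N_range)
  qed
  thus "(%w. INF q'\<in>\<rat> \<inter> {t<..min q K}. N i q' w) \<in> borel_measurable (F q)" .
  obtain p where p: "p \<in> \<rat>" "t < p" "p < min q K" using Rats_dense_in_real[OF m] by blast
  show "AE w in M. (INF q'\<in>\<rat> \<inter> {t<..min q K}. N i q' w) = Nbar i t w"
   using N_mono
  proof eventually_elim
   case (elim w)
   have bdd: "bdd_below ((%q. N i q w) ` (\<rat> \<inter> {t<..u}))" for u by (rule bdd_belowI2[where m=0]) (rule N_range)
   show ?case
   proof (rule antisym)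
    show "(INF q'\<in>\<rat> \<inter> {t<..min q K}. N i q' w) <= Nbar i t w"
     unfolding Nbar_def
    proof (rule cINF_greatest)
     show "\<rat> \<inter> {t<..K} \<noteq> {}" using p by auto
     fix u assume u: "u \<in> \<rat> \<inter> {t<..K}"
     have v: "min u p \<in> \<rat> \<inter> {t<..min q K}" using u p by (auto simp: min_def)
     have "(INF q'\<in>\<rat> \<inter> {t<..min q K}. N i q' w) <= N i (min u p) w" by (rule cINF_lower[OF bdd v])
     also have "... <= N i u w" using elim u v t0 by auto
     finally show "(INF q'\<in>\<rat> \<inter> {t<..min q K}. N i q' w) <= N i u w" .
    qed
    show "Nbar i t w <= (INF q'\<in>\<rat> \<inter> {t<..min q K}. N i q' w)"
     unfolding Nbar_def by (rule cINF_superset_mono[OF _ bdd]) (use p in auto)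
   qed
  qed
 qed
 from cond_exp_future_measurable[OF tm0 t(1) int this]
 have "real_cond_exp M (future (tm i)) (Nbar i t) \<in> borel_measurable (F t)" by simp
 thus ?thesis
  using fms.real_cond_exp_F_meas[OF int fut] by (rule measurable_F_AE[OF t0 _ meas])
qed

lemma \<tau>_le: "q \<in> \<rat> ==> 0 <= q ==> q <= K ==> \<tau> w <= (if w \<in> Z q then q else K)"
 unfolding \<tau>_def using K by (intro cINF_lower) (auto intro!: bdd_belowI2[where m=0])

lemma \<tau>_range: "0 <= \<tau> w" "\<tau> w <= K"
proof -
 show "0 <= \<tau> w" unfolding \<tau>_def by (rule cINF_greatest) (use K in auto)
 show "\<tau> w <= K" using \<tau>_le[of K w] K by (simp split: if_splits)
qed

lemma \<tau>_measurable [measurable]: "\<tau> \<in> borel_measurable M"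
proof -
 have "(%w. INF q\<in>\<rat> \<inter> {0..K}. if w \<in> Z q then q else K) \<in> borel_measurable M"
 proof (rule borel_measurable_cINF[OF rat_int])
  show "(%w. if w \<in> Z q then q else K) \<in> borel_measurable M" for q by measurable
  show "bdd_below ((%q. if w \<in> Z q then q else K) ` (\<rat> \<inter> {0..K}))" for w
   by (rule bdd_belowI2[where m=0]) (use K in auto)
 qed
 thus ?thesis by (simp add: \<tau>_def[abs_def])
qed

lemma \<tau>_less: "\<tau> w < u ==> u <= K ==> \<exists>q\<in>\<rat>. 0 <= q & q < u & w \<in> Z q"
proof -
 assume u: "\<tau> w < u" "u <= K"
 have ne: "\<rat> \<inter> {0..K} \<noteq> {}" and bdd: "bdd_below ((%q. if w \<in> Z q then q else K) ` (\<rat> \<inter> {0..K}))"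
  using K by (auto intro!: bdd_belowI2[where m=0])
 have "\<exists>q\<in>\<rat> \<inter> {0..K}. (if w \<in> Z q then q else K) < u"
  using u(1) unfolding \<tau>_def by (rule cINF_less_iff[OF ne bdd, THEN iffD1])
 then obtain q where q: "q \<in> \<rat> \<inter> {0..K}" "(if w \<in> Z q then q else K) < u" ..
 hence "w \<in> Z q" using u(2) by (cases "w \<in> Z q") simp_all
 thus ?thesis using q by (intro bexI[of _ q]) simp_all
qed

text \<open>At time \<open>t\<close> it may be open whether the path will stay calm up to some
  \<open>tm j > t\<close>, so the index of its piece \<open>P\<close> is not yet known.
  \<open>R i\<close> disregards such \<open>j\<close>; on the paths concerned
  \<open>early_null\<close> excludes \<open>V i <= Nbar i t\<close> anyway.\<close>

lemma \<tau>_stop: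
 assumes t: "0 <= t"
 shows "{w\<in>space M. \<tau> w <= t} \<in> sets (F t)"
proof (cases "K <= t")
 case True
 hence "\<tau> w <= t" for w using \<tau>_range(2)[of w] by simp
 thus ?thesis using space_in_F[OF t] by simp
next
 case False
 hence tK: "t < K" by simp
 define R where "R i = (if tm i <= t then (E i \<inter> {w\<in>space M. V i w <= Nbar i t w}) - (\<Union>j\<in>{j. j < i & tm j <= t}. E j) else {})" for i
 have E: "E j \<in> sets (F t)" if "tm j <= t" for j using calm_F[OF tm0, of j] F_mono[OF tm0 that] by auto
 have RF: "R i \<in> sets (F t)" for i
 proof (cases "tm i <= t")
  case True
  have [measurable]: "V i \<in> borel_measurable (F t)" "Nbar i t \<in> borel_measurable (F t)"
   by (rule measurable_F_mono[OF tm0 True V_F]) (rule Nbar_F[OF True tK])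
  have "{w\<in>space (F t). V i w <= Nbar i t w} \<in> sets (F t)" by measurable
  hence "{w\<in>space M. V i w <= Nbar i t w} \<in> sets (F t)" by (simp add: space_F[OF t])
  moreover have "(\<Union>j\<in>{j. j < i & tm j <= t}. E j) \<in> sets (F t)" by (rule sets.finite_UN) (auto intro: E)
  ultimately show ?thesis using E[OF True] True by (simp add: R_def sets.Diff sets.Int)
 qed (simp add: R_def)
 show ?thesis
 proof (rule sets_F_AE[OF t])
  show "(\<Union>i. R i) \<in> sets (F t)" using RF by auto
  show "{w\<in>space M. \<tau> w <= t} \<in> sets M" by measurable
  show "AE w in M. w \<in> (\<Union>i. R i) \<longleftrightarrow> w \<in> {w\<in>space M. \<tau> w <= t}"
   using N_mono early_null AE_P AE_space[of M]
  proof eventually_elim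
   case (elim w)
   have early: "\<not> V i w <= Nbar i t w" if "j <= i" "w \<in> E j" "t < tm j" for i j
    using elim(2) that Nbar_le[OF tm(1) that(3) tm(3), of i w] by (meson order_trans)
   obtain i where i: "w \<in> P i" using elim(3) by blast
   have nE: "w \<notin> E j" if "j < i" for j using i that unfolding P_def by blast
   have "(\<exists>k. w \<in> R k) \<longleftrightarrow> V i w <= Nbar i t w"
   proof
    assume "V i w <= Nbar i t w"
    moreover from this have "tm i <= t" using early[OF order_refl P_E[OF i]] by force
    ultimately have "w \<in> R i" using P_E[OF i] nE elim(4) by (auto simp: R_def)
    thus "\<exists>k. w \<in> R k" by blast
   next
    assume "\<exists>k. w \<in> R k"
    then obtain k where k: "w \<in> R k" by blast
    hence kt: "tm k <= t" and kE: "w \<in> E k" and kV: "V k w <= Nbar k t w" and kn: "!!j. j < k ==> tm j <= t ==> w \<notin> E j"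
     by (auto simp: R_def split: if_splits)
    have "w \<notin> E j" if "j < k" for j
    proof (cases "tm j <= t")
     case False
     thus ?thesis using early[of j k] kV that by force
    qed (use kn that in blast)
    hence "w \<in> P k" using kE unfolding P_def by blast
    hence "k = i" using i P_disjoint by blast
    thus "V i w <= Nbar i t w" using kV by simp
   qed
   also have "... \<longleftrightarrow> \<tau> w <= t"
   proof
    assume le: "V i w <= Nbar i t w"
    show "\<tau> w <= t"
    proof (rule ccontr)
     assume "\<not> \<tau> w <= t"
     then obtain q where q: "q \<in> \<rat>" "t < q" "q < \<tau> w" using Rats_dense_in_real[of t "\<tau> w"] by (meson not_le)
     have qK: "q <= K" using q \<tau>_range(2)[of w] by simp
     have "V i w <= N i q w" using le Nbar_le[OF q(1,2) qK] by (rule order_trans)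
     hence "w \<in> Z q" using Z_iff[OF i] by simp
     hence "\<tau> w <= q" using \<tau>_le[OF q(1) _ qK, of w] q t by simp
     thus False using q by simp
    qed
   next
    assume \<tau>: "\<tau> w <= t"
    show "V i w <= Nbar i t w"
     unfolding Nbar_def
    proof (rule cINF_greatest)
     show "\<rat> \<inter> {t<..K} \<noteq> {}" using K tK by auto
     fix u assume u: "u \<in> \<rat> \<inter> {t<..K}"
     obtain q where q: "q \<in> \<rat>" "0 <= q" "q < u" "w \<in> Z q" using \<tau>_less[of w u] \<tau> u by auto
     have "V i w <= N i q w" using Z_iff[OF i] q(4) by simp
     also have "... <= N i u w" using elim(1) q u by auto
     finally show "V i w <= N i u w" .
    qed
   qed
   finally show ?case using elim(4) by auto
  qed
 qed
qed

end

section \<open>Calculus of mixtures and the time grid\<close>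

lemma mix_tendsto:
 assumes wt: "!!k. tail_weights k (wt k)" and a: "a \<longlonglongrightarrow> l"
 shows "(%k. mix (wt k) a) \<longlonglongrightarrow> l"
proof (rule LIMSEQ_I)
 fix e :: real assume e: "0 < e"
 then obtain k0 where k0: "!!m. k0 <= m ==> norm (a m - l) < e/2"
  using LIMSEQ_D[OF a, of "e/2"] by auto
 have "norm (mix (wt k) a - l) < e" if "k0 <= k" for k
 proof -
  have "l - e/2 <= a m" "a m <= l + e/2" if "k <= m" for m
   using k0[of m] that \<open>k0 <= k\<close> unfolding real_norm_def by linarith+
  hence "mix (wt k) (%_. l - e/2) <= mix (wt k) a" "mix (wt k) a <= mix (wt k) (%_. l + e/2)"
   by (auto intro: mix_mono[OF wt])
  hence "l - e/2 <= mix (wt k) a" "mix (wt k) a <= l + e/2" unfolding mix_const[OF wt] .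
  thus ?thesis using e by (auto simp: abs_less_iff)
 qed
 thus "\<exists>k0. \<forall>k\<ge>k0. norm (mix (wt k) a - l) < e" by blast
qed

lemma integral_mix:
 assumes "!!m. integrable M (f m)"
 shows "integrable M (%x. mix wt (%m. f m x))" "(LINT x|M. mix wt (%m. f m x)) = mix wt (%m. \<integral>x. f m x \<partial>M)"
 unfolding mix_def using assms by (auto simp: Bochner_Integration.integral_sum)

lemma mix_diff: "mix wt (%m. a m - b m) = mix wt a - mix wt b"
 by (simp add: mix_def algebra_simps sum_subtractf)

lemma mix_cmult: "mix wt (%m. c * a m) = c * mix wt a"
 by (simp add: mix_def sum_distrib_left algebra_simps)

lemma mix_sum: "mix wt (%m. \<Sum>i\<in>I. a i m) = (\<Sum>i\<in>I. mix wt (a i))"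
 unfolding mix_def by (simp add: sum_distrib_left) (rule sum.swap)

text \<open>Instead of a diagonal argument, the index \<open>n\<close> becomes a coordinate of a
  product with a geometric law; as this law charges every index, almost sure convergence on the
  product is convergence for all \<open>n\<close>.\<close>

lemma (in prob_space) convex_combinations_converge_countable:
 fixes f :: "nat => nat => 'a => real"
 assumes f[measurable]: "!!m n. f m n \<in> borel_measurable M" and f01: "!!m n x. 0 <= f m n x" "!!m n x. f m n x <= 1"
 obtains wt where "!!k. tail_weights k (wt k)" "AE x in M. \<forall>n. convergent (%k. mix (wt k) (%m. f m n x))"
proof -
 let ?Q = "measure_pmf (geometric_pmf (1/2))"
 interpret P: pair_prob_space M ?Q by unfold_locales
 have [measurable]: "(%z. f m (snd z) (fst z)) \<in> borel_measurable (M \<Otimes>\<^sub>M ?Q)" for m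
 proof (rule measurable_compose_countable[where g=snd])
  show "(%z. f m n (fst z)) \<in> borel_measurable (M \<Otimes>\<^sub>M ?Q)" for n by measurable
 qed measurable
 obtain wt where wt: "!!k. tail_weights k (wt k)" "AE z in M \<Otimes>\<^sub>M ?Q. convergent (%k. mix (wt k) (%m. f m (snd z) (fst z)))"
  using P.convex_combinations_converge[of "%m z. f m (snd z) (fst z)"] f01 by auto
 have "AE x in M. AE n in ?Q. convergent (%k. mix (wt k) (%m. f m (snd (x, n)) (fst (x, n))))"
  by (rule P.AE_pair[OF wt(2)])
 hence "AE x in M. \<forall>n. convergent (%k. mix (wt k) (%m. f m n x))"
  by (simp add: AE_measure_pmf_iff set_pmf_geometric)
 thus ?thesis using that wt(1) by blast
qed

text \<open>A switch that never turns off turns on exactly once, and the sum of its increments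
  evaluates \<open>x\<close> there. Both the approximating times and the family \<open>Z\<close> are
  discretised in this way.\<close>

lemma telescope_pick:
 assumes "\<not> z 0" "z n" "!!i. i < n ==> z i ==> z (Suc i)"
 obtains j where "j < n" "\<not> z j" "z (Suc j)" "!!x. (\<Sum>k<n. x k * (of_bool (z (Suc k)) - of_bool (z k))) = (x j :: real)"
proof -
 have "0 < n" using assms by (cases n) auto
 hence ex: "\<exists>j. z (Suc j)" using assms(2) by (intro exI[of _ "n - 1"]) simp
 define j where "j = (LEAST j. z (Suc j))"
 have zj: "z (Suc j)" using ex unfolding j_def by (rule LeastI_ex)
 have jn: "j < n"
 proof -
  have "j <= n - 1" unfolding j_def by (rule Least_le) (use \<open>0 < n\<close> assms(2) in simp)
  thus ?thesis using \<open>0 < n\<close> by simp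
 qed
 have below: "\<not> z i" if "i <= j" for i
 proof (cases i)
  case (Suc l)
  hence "l < j" using that by simp
  thus ?thesis using not_less_Least[of l "%j. z (Suc j)"] Suc by (simp add: j_def)
 qed (use assms in simp)
 have above: "z i" if "Suc j <= i" "i <= n" for i
  using that(1,2)
 proof (induction i rule: dec_induct)
  case base
  show ?case by (rule zj)
 next
  case (step i)
  thus ?case using assms(3)[of i] by simp
 qed
 have "(\<Sum>k<n. x k * (of_bool (z (Suc k)) - of_bool (z k))) = x j" for x :: "nat => real"
 proof -
  have "(\<Sum>k<n. x k * (of_bool (z (Suc k)) - of_bool (z k))) = (\<Sum>k<n. if k = j then x k else 0)"
  proof (rule sum.cong[OF refl])
   fix k assume k: "k \<in> {..<n}"
   thus "x k * (of_bool (z (Suc k)) - of_bool (z k)) = (if k = j then x k else 0)"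
    using below[of k] below[of "Suc k"] above[of k] above[of "Suc k"] by (cases k j rule: linorder_cases) auto
  qed
  thus ?thesis using jn by simp
 qed
 thus ?thesis using that jn zj below by blast
qed

context randomised_stopping
begin

definition grid :: "nat => nat => real" where "grid n k = real k * K/real n"

lemma grid: "grid n k \<in> \<rat>" "0 <= grid n k" "0 < n ==> k <= n ==> grid n k <= K" "grid n 0 = 0" "0 < n ==> grid n n = K"
 "k <= l ==> grid n k <= grid n l" "grid n (Suc k) - grid n k = K/n"
proof -
 show "grid n k \<in> \<rat>" "0 <= grid n k" "grid n 0 = 0" using K by (auto simp: grid_def)
 show "0 < n ==> grid n n = K" by (simp add: grid_def)
 show mono: "k <= l ==> grid n k <= grid n l" for k l
  unfolding grid_def using K by (intro divide_right_mono mult_right_mono) auto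
 show "0 < n ==> k <= n ==> grid n k <= K" using mono[of k n] by (simp add: grid_def)
 show "grid n (Suc k) - grid n k = K/n" by (simp add: grid_def diff_divide_distrib[symmetric] distrib_right)
qed

end

section \<open>The law of the path at the randomised time\<close>

locale embedding_law = randomised_stopping +
 fixes \<delta> :: "real => real" and \<sigma> :: "nat => 'a => real" and wt :: "nat => nat => real"
 assumes \<delta>_continuous: "continuous_on UNIV \<delta>"
  and wt: "!!k. tail_weights k (wt k)"
  and A_limit: "!!q. q \<in> \<rat> ==> 0 <= q ==> AE w in M. (%k. mix (wt k) (%m. indicator {w. \<sigma> m w <= q} w)) \<longlonglongrightarrow> A q w"
  and \<sigma>_measurable [measurable]: "!!m. \<sigma> m \<in> borel_measurable M"
  and B\<sigma>_measurable: "!!m. (%w. B (\<sigma> m w) w) \<in> borel_measurable M"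
  and \<sigma>_range: "!!m w. w \<in> space M ==> \<sigma> m w \<in> \<rat>" "!!m w. w \<in> space M ==> 0 < \<sigma> m w" "!!m w. w \<in> space M ==> \<sigma> m w <= K"
begin

definition \<Gamma> :: "real => 'a => real" where "\<Gamma> t w = \<delta> t + B t w"

text \<open>Modulus of continuity at the mesh width, truncated at 1 so that it tends to zero in mean
  without any moment bound on the path; rational times make the supremum measurable.\<close>

definition osc :: "nat => 'a => real" where
 "osc n w = (SUP (s, s')\<in>{(s, s'). s \<in> \<rat> \<inter> {0..K} & s' \<in> \<rat> \<inter> {0..K} & \<bar>s - s'\<bar> <= K/n}. min 1 \<bar>\<Gamma> s w - \<Gamma> s' w\<bar>)"

text \<open>The path at the grid time where \<open>Z\<close> switches on, within one mesh width of
  \<tau>. The sum form is linear in the indicators of \<open>Z\<close>, as \<open>Z_law\<close>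
  requires.\<close>

definition GZ :: "nat => 'a => real" where
 "GZ n w = (\<Sum>k<n. \<Gamma> (grid n (Suc k)) w * (of_bool (w \<in> Z (grid n (Suc k))) - of_bool (w \<in> Z (grid n k))))"

lemma \<delta>_measurable [measurable]: "\<delta> \<in> borel_measurable borel"
 using \<delta>_continuous by (rule borel_measurable_continuous_onI)

lemma \<Gamma>_measurable: "0 <= t ==> \<Gamma> t \<in> borel_measurable M"
 unfolding \<Gamma>_def using B_measurable[of t] by measurable

lemma \<Gamma>_continuous: "AE w in M. continuous_on {0..} (%t. \<Gamma> t w)"
 using continuous_paths
 by eventually_elim (auto simp: \<Gamma>_def intro!: continuous_on_add continuous_on_subset[OF \<delta>_continuous])

lemma osc_bounds: "0 <= osc n w" "osc n w <= 1"
 and osc_upper: "s \<in> \<rat> ==> s' \<in> \<rat> ==> s \<in> {0..K} ==> s' \<in> {0..K} ==> \<bar>s - s'\<bar> <= K/n ==> min 1 \<bar>\<Gamma> s w - \<Gamma> s' w\<bar> <= osc n w"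
 and osc_measurable [measurable]: "osc n \<in> borel_measurable M"
proof -
 define I where "I = {(s, s'). s \<in> \<rat> \<inter> {0..K} & s' \<in> \<rat> \<inter> {0..K} & \<bar>s - s'\<bar> <= K/n}"
 define f where "f p w = (case p of (s, s') => min 1 \<bar>\<Gamma> s w - \<Gamma> s' w\<bar>)" for p and w
 have osc: "osc n w = (SUP p\<in>I. f p w)" for w by (simp add: osc_def I_def f_def)
 have bdd: "bdd_above ((%p. f p w) ` I)" for w by (rule bdd_aboveI2[where M=1]) (auto simp: f_def)
 have "I \<subseteq> \<rat> \<times> \<rat>" by (auto simp: I_def)
 hence cI: "countable I" by (rule countable_subset) (intro countable_SIGMA countable_rat)
 have 0: "(0, 0) \<in> I" using K by (auto simp: I_def)
 show "min 1 \<bar>\<Gamma> s w - \<Gamma> s' w\<bar> <= osc n w" if "s \<in> \<rat>" "s' \<in> \<rat>" "s \<in> {0..K}" "s' \<in> {0..K}" "\<bar>s - s'\<bar> <= K/n" for s s' w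
 proof -
  have "(s, s') \<in> I" using that by (simp add: I_def)
  hence "f (s, s') w <= osc n w" unfolding osc by (rule cSUP_upper[OF _ bdd])
  thus ?thesis by (simp add: f_def)
 qed
 show "0 <= osc n w" for w
 proof -
  have "f (0, 0) w <= osc n w" unfolding osc by (rule cSUP_upper[OF 0 bdd])
  thus ?thesis by (simp add: f_def)
 qed
 show "osc n w <= 1" for w unfolding osc by (rule cSUP_least) (use 0 in \<open>auto simp: f_def\<close>)
 have "(%w. SUP p\<in>I. f p w) \<in> borel_measurable M"
 proof (rule borel_measurable_cSUP[OF cI])
  fix p assume p: "p \<in> I"
  hence [measurable]: "\<Gamma> (fst p) \<in> borel_measurable M" "\<Gamma> (snd p) \<in> borel_measurable M"
   by (auto simp: I_def intro: \<Gamma>_measurable)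
  show "f p \<in> borel_measurable M" unfolding f_def case_prod_beta by measurable
 qed (rule bdd)
 thus "osc n \<in> borel_measurable M" using osc by (simp add: fun_eq_iff[symmetric] cong: measurable_cong)
qed

lemma osc_tendsto: "AE w in M. (%n. osc (Suc n) w) \<longlonglongrightarrow> 0"
 using \<Gamma>_continuous
proof eventually_elim
 case (elim w)
 have "continuous_on {0..K} (%t. \<Gamma> t w)" using elim by (rule continuous_on_subset) auto
 hence uc: "uniformly_continuous_on {0..K} (%t. \<Gamma> t w)" by (rule compact_uniformly_continuous) simp
 show ?case
 proof (rule LIMSEQ_I)
  fix e :: real assume e: "0 < e"
  then obtain d where d: "0 < d" "!!s s'. s \<in> {0..K} ==> s' \<in> {0..K} ==> dist s' s < d ==> dist (\<Gamma> s' w) (\<Gamma> s w) < e/2"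
   using uc unfolding uniformly_continuous_on_def by (meson half_gt_zero)
  obtain n0 where n0: "K/d < real n0" using reals_Archimedean2 by blast
  have "osc (Suc n) w < e" if "n0 <= n" for n
  proof -
   have "K/d < real (Suc n)" using n0 that by simp
   hence Kn: "K/real (Suc n) < d" using d(1) by (simp add: divide_less_eq mult.commute)
   have "osc (Suc n) w <= e/2"
    unfolding osc_def
   proof (rule cSUP_least)
    show "{(s, s'). s \<in> \<rat> \<inter> {0..K} & s' \<in> \<rat> \<inter> {0..K} & \<bar>s - s'\<bar> <= K/real (Suc n)} \<noteq> {}"
     using K by (auto intro!: exI[of _ 0])
    fix p assume "p \<in> {(s, s'). s \<in> \<rat> \<inter> {0..K} & s' \<in> \<rat> \<inter> {0..K} & \<bar>s - s'\<bar> <= K/real (Suc n)}"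
    then obtain s s' where p: "p = (s, s')" "s \<in> {0..K}" "s' \<in> {0..K}" "\<bar>s - s'\<bar> <= K/real (Suc n)" by blast
    have "dist (\<Gamma> s w) (\<Gamma> s' w) < e/2" using d(2)[of s' s] p Kn by (simp add: dist_real_def)
    thus "(case p of (s, s') => min 1 \<bar>\<Gamma> s w - \<Gamma> s' w\<bar>) <= e/2"
     using min.cobounded2[of 1 "\<bar>\<Gamma> s w - \<Gamma> s' w\<bar>"] unfolding p(1) dist_real_def prod.case by linarith
   qed
   thus ?thesis using e by simp
  qed
  thus "\<exists>n0. \<forall>n\<ge>n0. norm (osc (Suc n) w - 0) < e" using osc_bounds(1) by auto
 qed
qed

lemma osc_integral_tendsto: "(%n. \<integral>w. osc (Suc n) w \<partial>M) \<longlonglongrightarrow> 0"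
proof -
 have "(%n. \<integral>w. osc (Suc n) w \<partial>M) \<longlonglongrightarrow> (LINT w|M. 0)"
  by (rule integral_dominated_convergence[where w="%_. 1"]) (use osc_tendsto osc_bounds in simp_all)
 thus ?thesis by simp
qed

lemma Z_pick:
 "AE w in M. \<forall>n>0. \<exists>j<n. w \<notin> Z (grid n j) & w \<in> Z (grid n (Suc j)) &
  (\<forall>x. (\<Sum>k<n. x k * (of_bool (w \<in> Z (grid n (Suc k))) - of_bool (w \<in> Z (grid n k)))) = (x j :: real))"
 using Z_mono Z_0 Z_K
proof eventually_elim
 case (elim w)
 show ?case
 proof (intro allI impI)
  fix n :: nat assume n: "0 < n"
  obtain j where "j < n" "w \<notin> Z (grid n j)" "w \<in> Z (grid n (Suc j))"
   "!!x. (\<Sum>k<n. x k * (of_bool (w \<in> Z (grid n (Suc k))) - of_bool (w \<in> Z (grid n k)))) = (x j :: real)"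
  proof (rule telescope_pick[of "%k. w \<in> Z (grid n k)" n])
   show "w \<notin> Z (grid n 0)" using elim(2) by (simp add: grid)
   show "w \<in> Z (grid n n)" using elim(3) n by (simp add: grid)
   show "w \<in> Z (grid n (Suc i))" if "w \<in> Z (grid n i)" for i
   proof -
    have "grid n i <= grid n (Suc i)" by (rule grid(6)) simp
    thus ?thesis using elim(1) grid(1,2) that by meson
   qed
  next
   fix j assume "j < n" "w \<notin> Z (grid n j)" "w \<in> Z (grid n (Suc j))"
    "!!x. (\<Sum>k<n. x k * (of_bool (w \<in> Z (grid n (Suc k))) - of_bool (w \<in> Z (grid n k)))) = (x j :: real)"
   thus thesis by (rule that)
  qed
  thus "\<exists>j<n. w \<notin> Z (grid n j) & w \<in> Z (grid n (Suc j)) &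
   (\<forall>x. (\<Sum>k<n. x k * (of_bool (w \<in> Z (grid n (Suc k))) - of_bool (w \<in> Z (grid n k)))) = (x j :: real))"
   by (intro exI[of _ j] conjI allI) simp_all
 qed
qed

lemma GZ_tendsto: "AE w in M. (%n. GZ (Suc n) w) \<longlonglongrightarrow> \<Gamma> (\<tau> w) w"
 using \<Gamma>_continuous Z_pick Z_mono
proof eventually_elim
 case (elim w)
 have "\<exists>s. GZ (Suc n) w = \<Gamma> s w & 0 <= s & \<bar>s - \<tau> w\<bar> <= K/Suc n" for n
 proof -
  from elim(2)[THEN spec, THEN mp, OF zero_less_Suc, of n] obtain j where j: "j < Suc n" "w \<notin> Z (grid (Suc n) j)" "w \<in> Z (grid (Suc n) (Suc j))"
   and sum: "\<forall>x. (\<Sum>k<Suc n. x k * (of_bool (w \<in> Z (grid (Suc n) (Suc k))) - of_bool (w \<in> Z (grid (Suc n) k)))) = (x j :: real)"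
   by (elim exE conjE)
  let ?s = "grid (Suc n) (Suc j)"
  have le: "grid (Suc n) (Suc j) <= K" "grid (Suc n) j <= K" using grid(3)[of "Suc n" "Suc j"] grid(3)[of "Suc n" j] j(1) by simp_all
  have "\<tau> w <= ?s" using \<tau>_le[OF grid(1,2) le(1), of w] j(3) by simp
  moreover have "grid (Suc n) j <= \<tau> w"
  proof (rule ccontr)
   assume "\<not> ?thesis"
   then obtain q where "q \<in> \<rat>" "0 <= q" "q < grid (Suc n) j" "w \<in> Z q" using \<tau>_less[of w "grid (Suc n) j"] le by auto
   hence "w \<in> Z (grid (Suc n) j)" using elim(3) grid(1)[of "Suc n" j] by (meson less_imp_le)
   thus False using j(2) by simp
  qed
  ultimately have "\<bar>?s - \<tau> w\<bar> <= K/Suc n" using grid(7)[of "Suc n" j] by simp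
  moreover have "GZ (Suc n) w = \<Gamma> ?s w" unfolding GZ_def by (rule sum[THEN spec])
  ultimately show ?thesis using grid(2)[of "Suc n" "Suc j"] by (intro exI[of _ ?s] conjI)
 qed
 then obtain s where s: "!!n. GZ (Suc n) w = \<Gamma> (s n) w" "!!n. 0 <= s n" "!!n. \<bar>s n - \<tau> w\<bar> <= K/Suc n"
  using choice[of "%n s. GZ (Suc n) w = \<Gamma> s w & 0 <= s & \<bar>s - \<tau> w\<bar> <= K/Suc n"] by blast
 have "(%n. K/Suc n) \<longlonglongrightarrow> 0"
  using tendsto_mult[OF tendsto_const LIMSEQ_Suc[OF lim_1_over_n], of K] by simp
 hence "(%n. \<bar>s n - \<tau> w\<bar>) \<longlonglongrightarrow> 0"
  by (rule tendsto_sandwich[OF _ _ tendsto_const, rotated 2]) (use s(3) in auto)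
 hence "(%n. s n - \<tau> w) \<longlonglongrightarrow> 0" by (rule tendsto_rabs_zero_cancel)
 hence "s \<longlonglongrightarrow> \<tau> w" by (rule LIM_zero_cancel)
 hence "(%n. \<Gamma> (s n) w) \<longlonglongrightarrow> \<Gamma> (\<tau> w) w"
  by (rule continuous_on_tendsto_compose[OF elim(1)]) (use s(2) \<tau>_range(1) in simp_all)
 thus ?case unfolding s(1) .
qed

lemma GZ_measurable [measurable]: "GZ n \<in> borel_measurable M"
proof -
 have [measurable]: "\<Gamma> (grid n k) \<in> borel_measurable M" for k by (rule \<Gamma>_measurable[OF grid(2)])
 show ?thesis unfolding GZ_def by measurable
qed

text \<open>\<open>R n m\<close> discretises the law at \<open>\<sigma> m\<close> and
  \<open>S n\<close> the law at \<tau>. For fixed \<open>n\<close> the former is linear in the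
  indicators of \<open>\<sigma> m <= q\<close>, so its mixtures converge to \<open>S n\<close>. The
  discretisation error is at most \<open>C\<close> times the mean of \<open>osc n\<close>, uniformly
  in \<open>m\<close>, and mixing preserves the limit \<open>I\<close>.\<close>

lemma law_limit:
 fixes h :: "real => real"
 assumes h1: "!!x. \<bar>h x\<bar> <= 1" and hC: "!!x y. \<bar>h x - h y\<bar> <= C * min 1 \<bar>x - y\<bar>" and C: "0 <= C"
  and lim: "(%m. \<integral>w. h (\<Gamma> (\<sigma> m w) w) \<partial>M) \<longlonglongrightarrow> I"
 shows "(%n. \<integral>w. h (GZ (Suc n) w) \<partial>M) \<longlonglongrightarrow> I"
proof -
 let ?g = "%n k w. h (\<Gamma> (grid n (Suc k)) w)"
  and ?h = "%m w. h (\<Gamma> (\<sigma> m w) w)"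
  and ?s = "%m q. indicat_real {w. \<sigma> m w <= q}"
  and ?z = "%n k w. indicat_real (Z (grid n (Suc k))) w - indicator (Z (grid n k)) w"
 let ?d = "%n m k w. ?s m (grid n (Suc k)) w - ?s m (grid n k) w"
 have "continuous_on UNIV h"
 proof (rule continuous_onI)
  fix x :: real and e :: real assume e: "0 < e"
  show "\<exists>d>0. \<forall>x'\<in>UNIV. dist x' x < d --> dist (h x') (h x) <= e"
  proof (intro exI[of _ "e/(C + 1)"] conjI ballI impI)
   fix x' assume "dist x' x < e/(C + 1)"
   hence "(C + 1) * \<bar>x' - x\<bar> <= e" using C by (simp add: dist_real_def less_divide_eq mult.commute)
   moreover have "C * min 1 \<bar>x' - x\<bar> <= (C + 1) * \<bar>x' - x\<bar>" using C by (intro mult_mono) auto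
   ultimately show "dist (h x') (h x) <= e" using hC[of x' x] by (simp add: dist_real_def)
  qed (use e C in simp)
 qed
 hence [measurable]: "h \<in> borel_measurable borel" by (rule borel_measurable_continuous_onI)
 have [measurable]: "\<Gamma> (grid n k) \<in> borel_measurable M" for n k by (rule \<Gamma>_measurable[OF grid(2)])
 have [measurable]: "A (grid n k) \<in> borel_measurable M" for n k by (rule A_measurable[OF grid(1,2)])
 have [measurable]: "(%w. \<Gamma> (\<sigma> m w) w) \<in> borel_measurable M" for m
  unfolding \<Gamma>_def using B\<sigma>_measurable by measurable
 have hi: "integrable M (%w. h (X w) * Y w)" if [measurable]: "X \<in> borel_measurable M" "Y \<in> borel_measurable M" and Y: "!!w. \<bar>Y w\<bar> <= 1" for X Y
 proof (rule integrable_const_bound[where B=1])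
  have "\<bar>h (X w) * Y w\<bar> <= 1 * 1" for w unfolding abs_mult using h1 Y by (intro mult_mono) auto
  thus "AE w in M. norm (h (X w) * Y w) <= 1" by simp
 qed measurable
 have hi1: "integrable M (%w. h (X w))" if "X \<in> borel_measurable M" for X
  using hi[OF that, of "%_. 1"] by simp
 define S where "S n = (\<Sum>k<n. (LINT w|M. ?g n k w * A (grid n (Suc k)) w) - (LINT w|M. ?g n k w * A (grid n k) w))" for n
 have ind: "of_bool (w \<in> X) = indicat_real X w" for w X by (simp add: indicator_def)
 have GZ_S: "(LINT w|M. h (GZ n w)) = S n" if n: "0 < n" for n
 proof -
  have e1: "(LINT w|M. h (GZ n w)) = (LINT w|M. (\<Sum>k<n. ?g n k w * ?z n k w))"
  proof (rule integral_cong_AE)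
   show "AE w in M. h (GZ n w) = (\<Sum>k<n. ?g n k w * ?z n k w)"
    using Z_pick
   proof eventually_elim
    case (elim w)
    from elim[rule_format, OF n] obtain j where
     "\<forall>x. (\<Sum>k<n. x k * (of_bool (w \<in> Z (grid n (Suc k))) - of_bool (w \<in> Z (grid n k)))) = (x j :: real)"
     by (elim exE conjE)
    hence j: "(\<Sum>k<n. x k * (indicat_real (Z (grid n (Suc k))) w - indicator (Z (grid n k)) w)) = x j" for x
     by (simp only: ind)
    show ?case unfolding GZ_def ind j by (rule refl)
   qed
  qed measurable
  have e2: "(LINT w|M. (\<Sum>k<n. ?g n k w * ?z n k w)) = (\<Sum>k<n. \<integral>w. ?g n k w * ?z n k w \<partial>M)"
   by (rule Bochner_Integration.integral_sum) (rule hi, measurable, simp add: indicator_def)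
  have e3: "(\<Sum>k<n. \<integral>w. ?g n k w * ?z n k w \<partial>M) = S n"
   unfolding S_def
  proof (rule sum.cong[OF refl])
   fix k assume k: "k \<in> {..<n}"
   let ?q = "grid n (Suc k)"
   \<comment> \<open>The path is evaluated at the right end of the grid interval, so that both
     levels \<open>grid n k\<close> and \<open>grid n (Suc k)\<close> are at most the evaluation
     time, as \<open>Z_law\<close> demands.\<close>
   have law: "(LINT w|M. h (\<Gamma> ?q w) * indicator (Z q) w) = (LINT w|M. h (\<Gamma> ?q w) * A q w)" if q: "q \<in> \<rat>" "0 <= q" "q <= ?q" for q
    unfolding \<Gamma>_def by (rule Z_law[OF q, of "%x. h (\<delta> ?q + x)" 1]) (measurable, simp add: h1)
   have d1: "(LINT w|M. h (\<Gamma> ?q w) * (indicator (Z ?q) w - indicator (Z (grid n k)) w))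
    = (LINT w|M. h (\<Gamma> ?q w) * indicator (Z ?q) w - h (\<Gamma> ?q w) * indicator (Z (grid n k)) w)"
    by (simp add: right_diff_distrib)
   have d2: "(LINT w|M. h (\<Gamma> ?q w) * indicator (Z ?q) w - h (\<Gamma> ?q w) * indicator (Z (grid n k)) w) = (LINT w|M. h (\<Gamma> ?q w) * indicator (Z ?q) w) - (LINT w|M. h (\<Gamma> ?q w) * indicator (Z (grid n k)) w)"
    by (rule Bochner_Integration.integral_diff; rule hi; (measurable; fail)?; simp add: indicator_def)
   have d3: "grid n k <= ?q" by (rule grid(6)) simp
   show "(LINT w|M. h (\<Gamma> ?q w) * (indicator (Z ?q) w - indicator (Z (grid n k)) w))
    = (LINT w|M. h (\<Gamma> ?q w) * A ?q w) - (LINT w|M. h (\<Gamma> ?q w) * A (grid n k) w)"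
    unfolding d1 d2 law[OF grid(1,2) order_refl] law[OF grid(1,2) d3] by (rule refl)
  qed
  show ?thesis unfolding e1 e2 e3 by (rule refl)
 qed
 define R where "R n m = (\<Sum>k<n. (LINT w|M. ?g n k w * ?s m (grid n (Suc k)) w)
   - (LINT w|M. ?g n k w * ?s m (grid n k) w))" for n m
 have im: "(%w. ?s m q w) \<in> borel_measurable M" for m q
 proof -
  have "(%w. if \<sigma> m w <= q then 1 else 0 :: real) \<in> borel_measurable M" by measurable
  thus ?thesis by (simp add: indicator_def)
 qed
 have R_near: "\<bar>R n m - (LINT w|M. ?h m w)\<bar> <= C * (LINT w|M. osc n w)" if n: "0 < n" for n m
 proof -
  define T where "T w = (\<Sum>k<n. ?g n k w * ?d n m k w)" for w
  have Ti: "integrable M T" unfolding T_def by (intro Bochner_Integration.integrable_sum hi borel_measurable_diff im) (auto simp: indicator_def)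
  have "(LINT w|M. T w) = R n m"
  proof -
   have "(LINT w|M. T w) = (\<Sum>k<n. \<integral>w. ?g n k w * ?d n m k w \<partial>M)"
    unfolding T_def by (intro Bochner_Integration.integral_sum hi borel_measurable_diff im) (auto simp: indicator_def)
   also have "... = R n m"
    unfolding R_def
   proof (rule sum.cong[OF refl])
    fix k
    show "(LINT w|M. ?g n k w * ?d n m k w)
     = (LINT w|M. ?g n k w * ?s m (grid n (Suc k)) w)
      - (LINT w|M. ?g n k w * ?s m (grid n k) w)"
     unfolding right_diff_distrib by (intro Bochner_Integration.integral_diff hi im) (auto simp: indicator_def)
   qed
   finally show ?thesis .
  qed
  moreover have "\<bar>T w - ?h m w\<bar> <= C * osc n w" if w: "w \<in> space M" for w
  proof -
   obtain j where j: "j < n" "\<not> \<sigma> m w <= grid n j" "\<sigma> m w <= grid n (Suc j)"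
    "!!x. (\<Sum>k<n. x k * (of_bool (\<sigma> m w <= grid n (Suc k)) - of_bool (\<sigma> m w <= grid n k))) = (x j :: real)"
   proof (rule telescope_pick[of "%k. \<sigma> m w <= grid n k" n])
    show "\<not> \<sigma> m w <= grid n 0" using \<sigma>_range(2)[OF w, of m] by (simp add: grid)
    show "\<sigma> m w <= grid n n" using \<sigma>_range(3)[OF w, of m] n by (simp add: grid)
    show "\<sigma> m w <= grid n (Suc i)" if "\<sigma> m w <= grid n i" for i
     using that grid(6)[of i "Suc i" n] by simp
   next
    fix j assume "j < n" "\<not> \<sigma> m w <= grid n j" "\<sigma> m w <= grid n (Suc j)"
     "!!x. (\<Sum>k<n. x k * (of_bool (\<sigma> m w <= grid n (Suc k)) - of_bool (\<sigma> m w <= grid n k))) = (x j :: real)"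
    thus thesis by (rule that)
   qed
   have "T w = (\<Sum>k<n. ?g n k w * (of_bool (\<sigma> m w <= grid n (Suc k)) - of_bool (\<sigma> m w <= grid n k)))"
    by (simp add: T_def indicator_def)
   hence T: "T w = h (\<Gamma> (grid n (Suc j)) w)" using j(4) by simp
   have "min 1 \<bar>\<Gamma> (grid n (Suc j)) w - \<Gamma> (\<sigma> m w) w\<bar> <= osc n w"
   proof (rule osc_upper[OF grid(1) \<sigma>_range(1)[OF w]])
    show "grid n (Suc j) \<in> {0..K}" using grid(2) grid(3)[of n "Suc j"] j(1) by simp
    show "\<sigma> m w \<in> {0..K}" using \<sigma>_range(2,3)[OF w, of m] by simp
    show "\<bar>grid n (Suc j) - \<sigma> m w\<bar> <= K/n" using j(2,3) grid(7)[of n j] by simp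
   qed
   thus ?thesis unfolding T using hC[of "\<Gamma> (grid n (Suc j)) w" "\<Gamma> (\<sigma> m w) w"] C by (meson mult_left_mono order_trans)
  qed
  moreover have oi: "integrable M (%w. C * osc n w)"
   using osc_bounds by (intro integrable_mult_right integrable_const_bound[where B=1]) auto
  moreover have "integrable M (%w. ?h m w)" by (rule hi1) measurable
  ultimately have 1: "\<bar>R n m - (LINT w|M. ?h m w)\<bar> = \<bar>\<integral>w. T w - ?h m w \<partial>M\<bar>"
   and 2: "(LINT w|M. \<bar>T w - ?h m w\<bar>) <= (LINT w|M. C * osc n w)"
   using Ti by (simp, intro integral_mono Bochner_Integration.integrable_abs Bochner_Integration.integrable_diff) auto
  have 3: "(LINT w|M. C * osc n w) = C * (LINT w|M. osc n w)" by (rule integral_mult_right_zero)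
  show ?thesis
   unfolding 1 3[symmetric] by (rule order_trans[OF integral_abs_bound 2])
 qed
 have R_limit: "(%k. mix (wt k) (R n)) \<longlonglongrightarrow> S n" for n
 proof -
  have A_lim: "(%k. mix (wt k) (%m. \<integral>w. h (\<Gamma> p w) * ?s m q w \<partial>M)) \<longlonglongrightarrow> (LINT w|M. h (\<Gamma> p w) * A q w)"
   if q: "q \<in> \<rat>" "0 <= q" and p: "0 <= p" for p q
  proof -
   have [measurable]: "\<Gamma> p \<in> borel_measurable M" "A q \<in> borel_measurable M" by (rule \<Gamma>_measurable[OF p], rule A_measurable[OF q])
   have ii: "integrable M (%w. h (\<Gamma> p w) * ?s m q w)" for m
    by (intro hi im) (auto simp: indicator_def)
   have eq: "mix (wt k) (%m. \<integral>w. h (\<Gamma> p w) * ?s m q w \<partial>M)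
    = (LINT w|M. h (\<Gamma> p w) * mix (wt k) (%m. ?s m q w))" for k
    unfolding integral_mix(2)[OF ii, symmetric] mix_cmult by (rule refl)
   have mm: "(%w. mix (wt k) (%m. ?s m q w)) \<in> borel_measurable M" for k
    unfolding mix_def by (intro borel_measurable_sum borel_measurable_times im) simp
   have mb: "0 <= mix (wt k) (%m. ?s m q w)" "mix (wt k) (%m. ?s m q w) <= 1" for k w
    by (rule mix_bounds[OF wt]; simp add: indicator_def)+
   show ?thesis
    unfolding eq
   proof (rule integral_dominated_convergence[where w="%_. 1"])
    show "AE w in M. (%k. h (\<Gamma> p w) * mix (wt k) (%m. ?s m q w)) \<longlonglongrightarrow> h (\<Gamma> p w) * A q w"
     using A_limit[OF q] by eventually_elim (intro tendsto_mult tendsto_const)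
    show "AE w in M. norm (h (\<Gamma> p w) * mix (wt k) (%m. ?s m q w)) <= 1" for k
    proof (rule AE_I2)
     fix w
     have "\<bar>h (\<Gamma> p w) * mix (wt k) (%m. ?s m q w)\<bar> <= 1 * 1"
      unfolding abs_mult using h1 mb[of k w] by (intro mult_mono) auto
     thus "norm (h (\<Gamma> p w) * mix (wt k) (%m. ?s m q w)) <= 1" by simp
    qed
    show "(%w. h (\<Gamma> p w) * A q w) \<in> borel_measurable M" by measurable
    show "(%w. h (\<Gamma> p w) * mix (wt k) (%m. ?s m q w)) \<in> borel_measurable M" for k
     by (intro borel_measurable_times mm) measurable
   qed simp
  qed
  show ?thesis
   unfolding R_def S_def mix_sum mix_diff by (intro tendsto_sum tendsto_diff A_lim grid)
 qed
 have I_mix: "(%k. mix (wt k) (%m. \<integral>w. ?h m w \<partial>M)) \<longlonglongrightarrow> I" by (rule mix_tendsto[OF wt lim])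
 have close: "\<bar>S n - I\<bar> <= C * (LINT w|M. osc n w)" if n: "0 < n" for n
 proof (rule LIMSEQ_le_const2)
  show "(%k. \<bar>mix (wt k) (R n) - mix (wt k) (%m. \<integral>w. ?h m w \<partial>M)\<bar>) \<longlonglongrightarrow> \<bar>S n - I\<bar>"
   by (intro tendsto_rabs tendsto_diff R_limit I_mix)
  have "\<bar>mix (wt k) (%m. R n m - (LINT w|M. ?h m w))\<bar> <= C * (LINT w|M. osc n w)" for k
  proof (rule abs_leI)
   show "mix (wt k) (%m. R n m - (LINT w|M. ?h m w)) <= C * (LINT w|M. osc n w)"
    by (rule order_trans[OF mix_mono[OF wt abs_le_D1[OF R_near[OF n]]]]) (simp only: mix_const[OF wt] order_refl)
   have "mix (wt k) (%m. - (R n m - (LINT w|M. ?h m w))) <= C * (LINT w|M. osc n w)"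
    by (rule order_trans[OF mix_mono[OF wt abs_le_D2[OF R_near[OF n]]]]) (simp only: mix_const[OF wt] order_refl)
   thus "- mix (wt k) (%m. R n m - (LINT w|M. ?h m w)) <= C * (LINT w|M. osc n w)"
    unfolding mix_def by (simp only: mult_minus_right sum_negf)
  qed
  thus "\<exists>k0. \<forall>k\<ge>k0. \<bar>mix (wt k) (R n) - mix (wt k) (%m. \<integral>w. ?h m w \<partial>M)\<bar> <= C * (LINT w|M. osc n w)"
   unfolding mix_diff by (intro exI[of _ 0] allI impI)
 qed
 have C0: "(%n. C * (LINT w|M. osc (Suc n) w)) \<longlonglongrightarrow> 0"
  using tendsto_mult[OF tendsto_const osc_integral_tendsto, of C] unfolding mult_zero_right .
 have "(%n. \<bar>S (Suc n) - I\<bar>) \<longlonglongrightarrow> 0"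
 proof (rule tendsto_sandwich[OF _ _ tendsto_const C0])
  show "eventually (%n. \<bar>S (Suc n) - I\<bar> <= C * (LINT w|M. osc (Suc n) w)) sequentially"
   by (rule always_eventually, rule allI, rule close) simp
  show "eventually (%n. 0 <= \<bar>S (Suc n) - I\<bar>) sequentially" by (rule always_eventually) simp
 qed
 hence "(%n. S (Suc n) - I) \<longlonglongrightarrow> 0" by (rule tendsto_rabs_zero_cancel)
 hence "(%n. S (Suc n)) \<longlonglongrightarrow> I" by (rule LIM_zero_cancel)
 moreover have "(%n. \<integral>w. h (GZ (Suc n) w) \<partial>M) = (%n. S (Suc n))" by (rule ext, rule GZ_S) simp
 ultimately show ?thesis by (simp only:)
qed

end

section \<open>Embedding\<close>

lemma trig_difference:
 fixes f :: "real => real"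
 assumes "f = sin \<or> f = cos"
 shows "\<bar>f x\<bar> <= 1" "\<bar>f x - f y\<bar> <= \<bar>x - y\<bar>"
proof -
 show "\<bar>f x\<bar> <= 1" using assms by auto
 have half: "\<bar>sin ((a - b)/2)\<bar> <= \<bar>a - b\<bar>/2" for a b :: real
  using abs_sin_x_le_abs_x[of "(a - b)/2"] by simp
 have prod: "2 * (s * t) <= \<bar>a - b\<bar>" if "0 <= s" "0 <= t" "s <= \<bar>a - b\<bar>/2" "t <= 1" for s t a b :: real
  using mult_mono[OF that(3,4)] that(1,2) by simp
 from assms show "\<bar>f x - f y\<bar> <= \<bar>x - y\<bar>"
 proof
  assume f: "f = sin"
  show ?thesis unfolding f sin_diff_sin abs_mult mult.assoc
   using prod[OF _ _ half[of x y], of "\<bar>cos ((x + y)/2)\<bar>"] by simp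
 next
  assume f: "f = cos"
  show ?thesis unfolding f cos_diff_cos abs_mult mult.assoc
   using prod[OF _ _ half[of y x], of "\<bar>sin ((x + y)/2)\<bar>"] by (simp add: mult.commute abs_minus_commute)
 qed
qed

text \<open>These moments are the real and imaginary parts of the characteristic function, so every
  limit can be taken for bounded real Lipschitz functions.\<close>

lemma trig_moments_unique:
 assumes M1: "real_distribution M1" and M2: "real_distribution M2"
  and eq: "!!f v. f = sin \<or> f = cos ==> (\<integral>x. f (v * x) \<partial>M1) = (\<integral>x. f (v * x) \<partial>M2)"
 shows "M1 = M2"
proof (rule Levy_uniqueness[OF M1 M2], rule ext)
 fix v
 have char: "char N v = Complex (LINT x|N. cos (v * x)) (LINT x|N. sin (v * x))" if "real_distribution N" for N
 proof -
  interpret N: real_distribution N by fact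
  have i: "complex_integrable N (%x. iexp (v * x))"
   by (rule N.integrable_const_bound[where B=1]) auto
  have "Re (char N v) = (LINT x|N. Re (iexp (v * x)))" "Im (char N v) = (LINT x|N. Im (iexp (v * x)))"
   unfolding char_def by (rule integral_Re[OF i, symmetric], rule integral_Im[OF i, symmetric])
  thus ?thesis by (intro complex_eqI) (simp_all add: Re_exp Im_exp)
 qed
 show "char M1 v = char M2 v"
  unfolding char[OF M1] char[OF M2] using eq[of cos v] eq[of sin v] by simp
qed

context filtered_bm
begin

theorem exact_embedding:
 assumes L: "0 < L" and \<Lambda>: "0 < \<Lambda>"
  and g_lipschitz: "!!x x'. \<bar>g x - g x'\<bar> <= L * \<bar>x - x'\<bar>"
  and \<delta>_lipschitz: "!!y y'. \<bar>\<delta> y - \<delta> y'\<bar> <= \<Lambda> * \<bar>y - y'\<bar>"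
  and g_mono: "mono g"
  and \<kappa>0: "0 < \<kappa>0" and ab: "u < v"
  and g_slope: "!!x x'. x <= x' ==> (\<integral>\<^sup>+t\<in>{x..x'}. ennreal (\<kappa>0 * indicator {u..v} t) \<partial>lborel) <= ennreal (g x' - g x)"
 obtains \<tau> Y K c where "!!t. 0 <= t ==> {w\<in>space M. \<tau> w <= t} \<in> sets (F t)" "!!w. 0 <= \<tau> w" "!!w. \<tau> w <= K"
  "Y \<in> borel_measurable M" "AE w in M. Y w = c + (\<delta> (\<tau> w) + B (\<tau> w) w)"
  "distr M borel Y = distr \<N> borel g"
proof -
 have [measurable]: "g \<in> borel_measurable borel" by (rule borel_measurable_mono[OF g_mono])
 have \<delta>_cont: "continuous_on UNIV \<delta>"
 proof (rule lipschitz_on_continuous_on[where L=\<Lambda>], rule lipschitz_onI)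
  show "dist (\<delta> x) (\<delta> y) <= \<Lambda> * dist x y" for x y using \<delta>_lipschitz by (simp add: dist_real_def)
 qed (use \<Lambda> in simp)
 have [measurable]: "\<delta> \<in> borel_measurable borel" using \<delta>_cont by (rule borel_measurable_continuous_onI)
 obtain C r t0 where r: "0 < r" and t0: "0 < t0" and ex: "!!\<eta>. 0 < \<eta> ==> \<exists>\<sigma> a. approximates (L^2 + 1) C r t0 g \<delta> \<eta> \<sigma> a"
  using approximate_embedding[OF assms] by metis
 have "\<forall>m. \<exists>p. approximates (L^2 + 1) C r t0 g \<delta> (1/real (Suc m)) (fst p) (snd p)"
  using ex by auto
 from choice[OF this] obtain p0 where p0: "!!m. approximates (L^2 + 1) C r t0 g \<delta> (1/real (Suc m)) (fst (p0 m)) (snd (p0 m))"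
  by blast
 have "snd (p0 m) \<in> {-C..C}" for m using p0[of m] by (auto simp: approximates_def abs_le_iff)
 hence in_C: "\<forall>m. (snd \<circ> p0) m \<in> {-C..C}" by simp
 \<comment> \<open>The additive constants lie in a compact interval; along a subsequence they
   converge to the constant of the exact embedding.\<close>
 obtain c \<rho> where \<rho>: "strict_mono \<rho>" and c: "(snd \<circ> p0 \<circ> \<rho>) \<longlonglongrightarrow> c"
  by (rule seq_compactE[OF compact_imp_seq_compact[OF compact_Icc] in_C])
 define \<sigma> where "\<sigma> m = fst (p0 (\<rho> m))" for m
 define a where "a m = snd (p0 (\<rho> m))" for m
 define \<eta> where "\<eta> m = 1/real (Suc (\<rho> m))" for m
 have ac: "a \<longlonglongrightarrow> c" using c by (simp add: a_def[abs_def] comp_def)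
 have \<eta>0: "\<eta> \<longlonglongrightarrow> 0"
  using LIMSEQ_subseq_LIMSEQ[OF LIMSEQ_Suc[OF lim_1_over_n] \<rho>] by (simp add: \<eta>_def[abs_def] comp_def)
 have approx: "approximates (L^2 + 1) C r t0 g \<delta> (\<eta> m) (\<sigma> m) (a m)" for m
  unfolding \<sigma>_def a_def \<eta>_def by (rule p0)
 have \<sigma>_stop: "{w\<in>space M. \<sigma> m w <= t} \<in> sets (F t)" if "0 <= t" for m t
  using approx[of m] that unfolding approximates_def by blast
 \<comment> \<open>The bound is rounded up to an integer, so that the end of the time range is
   itself a rational level.\<close>
 define K where "K = real (nat \<lceil>L\<^sup>2 + 1\<rceil>)"
 have K: "K \<in> \<rat>" "0 < K" "L\<^sup>2 + 1 <= K"
 proof -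
  show "K \<in> \<rat>" by (simp add: K_def)
  show le: "L\<^sup>2 + 1 <= K" unfolding K_def by linarith
  show "0 < K" using le zero_le_power2[of L] by linarith
 qed
 have \<sigma>_rat: "\<sigma> m w \<in> \<rat>" and \<sigma>_pos: "0 < \<sigma> m w" and \<sigma>_le: "\<sigma> m w <= K" if "w \<in> space M" for m w
  using approx[of m] that K(3) unfolding approximates_def by auto
 have \<sigma>_meas[measurable]: "\<sigma> m \<in> borel_measurable M" for m
 proof (rule borel_measurableI_le)
  fix t show "{w \<in> space M. \<sigma> m w <= t} \<in> sets M"
  proof (cases "0 <= t")
   case True
   show ?thesis by (rule sets_F[OF True \<sigma>_stop[OF True]])
  next
   case False
   hence e: "{w \<in> space M. \<sigma> m w <= t} = {}" using \<sigma>_pos[of _ m] by force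
   show ?thesis unfolding e by (rule sets.empty_sets)
  qed
 qed
 have B\<sigma>[measurable]: "(%w. B (\<sigma> m w) w) \<in> borel_measurable M" for m
  using approx[of m] unfolding approximates_def by blast
 define ind where "ind m q w = indicat_real {w. \<sigma> m w <= q} w" for m q w
 have ind01: "0 <= ind m q w" "ind m q w <= 1" for m q w by (auto simp: ind_def indicator_def)
 have ind_eq: "ind m q = (%w. if \<sigma> m w <= q then 1 else 0)" for m q by (auto simp: ind_def indicator_def)
 have ind_M[measurable]: "ind m q \<in> borel_measurable M" for m q unfolding ind_eq by measurable
 have ind_F: "ind m q \<in> borel_measurable (F q)" if q: "0 <= q" for m q
  unfolding ind_eq
 proof (rule measurable_If)
  show "{w \<in> space (F q). \<sigma> m w <= q} \<in> sets (F q)" using \<sigma>_stop[OF q, of m] by (simp add: space_F[OF q])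
 qed simp_all
 obtain wt where wt: "!!k. tail_weights k (wt k)" and w_conv: "AE w in M. \<forall>n. convergent (%k. mix (wt k) (%m. ind m (from_nat_into \<rat> n) w))"
  using convex_combinations_converge_countable[of "%m n. ind m (from_nat_into \<rat> n)"] ind01 ind_M by metis
 have conv: "AE w in M. convergent (%k. mix (wt k) (%m. ind m q w))" if q: "q \<in> \<rat>" for q
  using w_conv
 proof eventually_elim
  case (elim w)
  obtain n where "from_nat_into \<rat> n = q" using from_nat_into_surj[OF countable_rat q] by blast
  thus ?case using elim by blast
 qed
 have mb: "0 <= mix (wt k) (%m. ind m q w)" "mix (wt k) (%m. ind m q w) <= 1" for k q w
  by (rule mix_bounds[OF wt]; rule ind01)+
 \<comment> \<open>A limit of \<open>F q\<close>-measurable mixtures with one sequence of weights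
   for all levels. Clipping enforces the range also where the limit fails to exist.\<close>
 define A where "A q w = max 0 (min 1 (lim (%k. mix (wt k) (%m. ind m q w))))" for q w
 have A01: "0 <= A q w" "A q w <= 1" for q w by (auto simp: A_def)
 have A_lim: "AE w in M. (%k. mix (wt k) (%m. ind m q w)) \<longlonglongrightarrow> A q w" if "q \<in> \<rat>" for q
  using conv[OF that]
 proof eventually_elim
  case (elim w)
  have l: "(%k. mix (wt k) (%m. ind m q w)) \<longlonglongrightarrow> lim (%k. mix (wt k) (%m. ind m q w))"
   using elim by (simp add: convergent_LIMSEQ_iff)
  have "0 <= lim (%k. mix (wt k) (%m. ind m q w))" by (rule LIMSEQ_le_const[OF l]) (use mb in blast)
  moreover have "lim (%k. mix (wt k) (%m. ind m q w)) <= 1" by (rule LIMSEQ_le_const2[OF l]) (use mb in blast)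
  ultimately show ?case using l by (simp add: A_def)
 qed
 have A_F: "A q \<in> borel_measurable (F q)" if q: "0 <= q" for q
 proof -
  have [measurable]: "(%w. mix (wt k) (%m. ind m q w)) \<in> borel_measurable (F q)" for k
   unfolding mix_def by (intro borel_measurable_sum borel_measurable_times ind_F q) simp
  have "(%w. lim (%k. mix (wt k) (%m. ind m q w))) \<in> borel_measurable (F q)" by measurable
  thus ?thesis unfolding A_def by measurable
 qed
 have A_M: "A q \<in> borel_measurable M" if "0 <= q" for q by (rule measurable_F[OF that A_F[OF that]])
 define n0 where "n0 = nat \<lceil>max (1/t0) (1/K)\<rceil>"
 define tm where "tm i = 1/real (Suc (n0 + i))" for i
 have tm_le: "tm i <= t0" "tm i <= K" for i
 proof -
  have "max (1/t0) (1/K) <= real n0" unfolding n0_def by linarith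
  hence "1/t0 <= real (Suc (n0 + i))" "1/K <= real (Suc (n0 + i))" by simp_all
  thus "tm i <= t0" "tm i <= K" using t0 K(2) by (simp_all add: tm_def divide_le_eq mult.commute)
 qed
 have tm_pos: "0 < tm i" for i by (simp add: tm_def)
 have "\<forall>i. \<exists>D. D \<in> borel_measurable (F (tm i)) & (\<forall>w. 0 < D w) & (\<forall>w. D w < (1::real)) &
  (\<forall>\<zeta>\<in>borel_measurable (future (tm i)). AE w in M. D w \<noteq> \<zeta> w)"
 proof
  fix i
  obtain D where "D \<in> borel_measurable (F (tm i))" "!!w. 0 < D w" "!!w. D w < (1::real)"
   "!!\<zeta>. \<zeta> \<in> borel_measurable (future (tm i)) ==> AE w in M. D w \<noteq> \<zeta> w"
   using randomiser_exists[OF tm_pos] by metis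
  thus "\<exists>D. D \<in> borel_measurable (F (tm i)) & (\<forall>w. 0 < D w) & (\<forall>w. D w < (1::real)) &
   (\<forall>\<zeta>\<in>borel_measurable (future (tm i)). AE w in M. D w \<noteq> \<zeta> w)" by (intro exI[of _ D] conjI ballI allI)
 qed
 from choice[OF this] obtain D where D_all: "\<forall>i. D i \<in> borel_measurable (F (tm i)) & (\<forall>w. 0 < D i w) & (\<forall>w. D i w < (1::real)) &
  (\<forall>\<zeta>\<in>borel_measurable (future (tm i)). AE w in M. D i w \<noteq> \<zeta> w)" ..
 have D: "D i \<in> borel_measurable (F (tm i))" "0 < D i w" "D i w < 1" for i w
  using D_all by simp_all
 have D_no_atoms: "AE w in M. D i w \<noteq> \<zeta> w" if "\<zeta> \<in> borel_measurable (future (tm i))" for i \<zeta>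
  using D_all[rule_format, of i] that by blast
 define calm where "calm q = {w\<in>space M. \<forall>s\<in>\<rat>. 0 <= s --> s <= q --> \<bar>B s w\<bar> <= r}" for q
 have calm_sets: "calm q \<in> sets M" if "0 <= q" for q
 proof -
  have "calm q = space M - (\<Union>s\<in>{s\<in>\<rat>. 0 <= s & s <= q}. {w\<in>space M. \<not> \<bar>B s w\<bar> <= r})" by (auto simp: calm_def)
  also have "... \<in> sets M"
  proof (intro sets.Diff sets.countable_UN'' sets.top)
   show "countable {s\<in>\<rat>. 0 <= s & s <= q}" by (rule countable_subset[OF _ countable_rat]) auto
   fix s assume "s \<in> {s\<in>\<rat>. 0 <= s & s <= q}"
   hence [measurable]: "B s \<in> borel_measurable M" by (intro B_measurable) simp
   show "{w\<in>space M. \<not> \<bar>B s w\<bar> <= r} \<in> sets M" by measurable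
  qed
  finally show ?thesis .
 qed
 \<comment> \<open>Stopping by \<open>q\<close> on calm paths has probability at most
   \<open>\<eta> m\<close> along the sequence. Mixing preserves the limit 0, and a nonnegative
   function with integral zero over the calm paths vanishes there almost surely.\<close>
 have A_early: "AE w in M. w \<in> calm (tm i) --> A (tm i) w = 0" for i
 proof -
  define q where "q = tm i"
  have q: "q \<in> \<rat>" "0 <= q" "q <= t0" using tm_pos[of i] tm_le(1)[of i] by (simp_all add: q_def tm_def)
  have [measurable]: "calm q \<in> sets M" by (rule calm_sets[OF q(2)])
  have [measurable]: "A q \<in> borel_measurable M" by (rule A_M[OF q(2)])
  let ?f = "%m w. indicator (calm q) w * ind m q w"
  have fi: "integrable M (?f m)" for m
   by (rule integrable_const_bound[where B=1]) (auto simp: indicator_def ind_def)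
  have f_le: "(LINT w|M. ?f m w) <= \<eta> m" and f_ge: "0 <= (LINT w|M. ?f m w)" for m
  proof -
   have "?f m w = indicator (calm q \<inter> {w\<in>space M. \<sigma> m w <= q}) w" if "w \<in> space M" for w
    using that by (simp add: ind_def indicator_def)
   hence "(LINT w|M. ?f m w) = (LINT w|M. indicator (calm q \<inter> {w\<in>space M. \<sigma> m w <= q}) w)"
    by (intro Bochner_Integration.integral_cong) auto
   hence e: "(LINT w|M. ?f m w) = prob (calm q \<inter> {w\<in>space M. \<sigma> m w <= q})" by simp
   have ev: "calm q \<inter> {w\<in>space M. \<sigma> m w <= q} \<in> sets M" by measurable
   have "\<forall>w\<in>calm q \<inter> {w\<in>space M. \<sigma> m w <= q}. \<sigma> m w <= q & (\<forall>s\<in>\<rat>. 0 <= s --> s <= q --> \<bar>B s w\<bar> <= r)"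
    by (auto simp: calm_def)
   hence "prob (calm q \<inter> {w\<in>space M. \<sigma> m w <= q}) <= \<eta> m"
    using approx[of m] ev q(3) unfolding approximates_def by blast
   thus "(LINT w|M. ?f m w) <= \<eta> m" "0 <= (LINT w|M. ?f m w)" unfolding e by simp_all
  qed
  have f0: "(%m. \<integral>w. ?f m w \<partial>M) \<longlonglongrightarrow> 0"
   by (rule tendsto_sandwich[OF _ _ tendsto_const \<eta>0]) (simp_all add: f_le f_ge)
  have "(%k. mix (wt k) (%m. \<integral>w. ?f m w \<partial>M)) \<longlonglongrightarrow> 0" by (rule mix_tendsto[OF wt f0])
  hence 1: "(%k. \<integral>w. indicator (calm q) w * mix (wt k) (%m. ind m q w) \<partial>M) \<longlonglongrightarrow> 0"
   unfolding integral_mix(2)[OF fi, symmetric] mix_cmult .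
  have 2: "(%k. \<integral>w. indicator (calm q) w * mix (wt k) (%m. ind m q w) \<partial>M) \<longlonglongrightarrow> (LINT w|M. indicator (calm q) w * A q w)"
  proof (rule integral_dominated_convergence[where w="%_. 1"])
   show "AE w in M. (%k. indicator (calm q) w * mix (wt k) (%m. ind m q w)) \<longlonglongrightarrow> indicator (calm q) w * A q w"
    using A_lim[OF q(1)] by eventually_elim (intro tendsto_mult tendsto_const)
   show "AE w in M. norm (indicator (calm q) w * mix (wt k) (%m. ind m q w)) <= 1" for k
    using mb by (intro AE_I2) (simp add: indicator_def)
   show "(%w. indicator (calm q) w * mix (wt k) (%m. ind m q w)) \<in> borel_measurable M" for k
    unfolding mix_def by measurable
  qed simp_all
  have 3: "(LINT w|M. indicator (calm q) w * A q w) = 0" by (rule LIMSEQ_unique[OF 2 1])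
  have "AE w in M. indicator (calm q) w * A q w = 0"
  proof (subst integral_nonneg_eq_0_iff_AE[symmetric])
   show "integrable M (%w. indicator (calm q) w * A q w)"
    by (rule integrable_const_bound[where B=1]) (use A01 in \<open>auto simp: indicator_def\<close>)
  qed (use 3 A01 in simp_all)
  thus ?thesis by (auto simp: q_def elim: eventually_mono)
 qed
 have A_const: "AE w in M. A q w = b" if q: "q \<in> \<rat>" and b: "!!m w. w \<in> space M ==> ind m q w = b" for q b
  using A_lim[OF q] AE_space[of M]
 proof eventually_elim
  case (elim w)
  have "(%k. mix (wt k) (%m. ind m q w)) = (%k. b)" unfolding b[OF elim(2)] mix_const[OF wt] by (rule refl)
  hence "(%k::nat. b) \<longlonglongrightarrow> A q w" using elim(1) by (simp only:)
  thus ?case by (simp add: LIMSEQ_const_iff)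
 qed
 interpret law: embedding_law M F B A r K tm D calm \<delta> \<sigma> wt
 proof unfold_locales
  show "calm \<equiv> %q. {w\<in>space M. \<forall>s\<in>\<rat>. 0 <= s --> s <= q --> \<bar>B s w\<bar> <= r}" by (rule eq_reflection) (auto simp: calm_def fun_eq_iff)
  show "A q \<in> borel_measurable (F q)" if "q \<in> \<rat>" "0 <= q" for q by (rule A_F[OF that(2)])
  show "AE w in M. A q w <= A q' w" if "q \<in> \<rat>" "q' \<in> \<rat>" "0 <= q" "q <= q'" for q q'
   using A_lim[OF that(1)] A_lim[OF that(2)]
  proof eventually_elim
   case (elim w)
   have "mix (wt k) (%m. ind m q w) <= mix (wt k) (%m. ind m q' w)" for k
    by (rule mix_mono[OF wt]) (use that(4) in \<open>simp add: ind_eq\<close>)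
   thus ?case by (intro LIMSEQ_le[OF elim]) blast
  qed
  show "AE w in M. A 0 w = 0" by (rule A_const) (use \<sigma>_pos in \<open>auto simp: ind_eq not_le\<close>)
  show "AE w in M. A K w = 1" by (rule A_const[OF K(1)]) (use \<sigma>_le in \<open>auto simp: ind_eq\<close>)
  show "tm i \<in> \<rat>" for i by (simp add: tm_def)
  show "decseq tm" by (rule decseq_SucI) (simp add: tm_def frac_le)
  show "tm \<longlonglongrightarrow> 0"
   using LIMSEQ_ignore_initial_segment[OF LIMSEQ_Suc[OF lim_1_over_n], of n0] unfolding tm_def[abs_def] by (simp add: add.commute)
  show "AE w in M. (%k. mix (wt k) (%m. indicator {w. \<sigma> m w <= q} w)) \<longlonglongrightarrow> A q w" if "q \<in> \<rat>" "0 <= q" for q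
   using A_lim[OF that(1)] by (simp add: ind_def)
 qed (fact A01 r K tm_pos tm_le A_early[unfolded calm_def] D D_no_atoms \<delta>_cont wt \<sigma>_meas B\<sigma> \<sigma>_rat \<sigma>_pos \<sigma>_le)+
 let ?\<Gamma> = "%t w. \<delta> t + B t w"
 \<comment> \<open>The stopped value itself may fail to be measurable when the paths are continuous
   only almost surely; the limit of its discretisations is measurable and almost surely equal to
   it.\<close>
 define Y where "Y w = c + lim (%n. law.GZ (Suc n) w)" for w
 have Y[measurable]: "Y \<in> borel_measurable M" unfolding Y_def by measurable
 have Y_AE: "AE w in M. Y w = c + (\<delta> (law.\<tau> w) + B (law.\<tau> w) w)"
  using law.GZ_tendsto by eventually_elim (simp add: Y_def limI law.\<Gamma>_def)
 interpret Yd: real_distribution "distr M borel Y" by (rule real_distribution_distr) simp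
 have gd: "real_distribution (distr \<N> borel g)"
  by (rule gauss.real_distribution_distr) simp
 have "distr M borel Y = distr \<N> borel g"
 proof (rule trig_moments_unique[OF Yd.real_distribution_axioms gd])
  fix f :: "real => real" and x :: real assume f: "f = sin \<or> f = cos"
  have f_cont: "continuous_on UNIV f" using f by (auto intro: continuous_intros)
  have [measurable]: "f \<in> borel_measurable borel" by (rule borel_measurable_continuous_onI[OF f_cont])
  define h where "h y = f (x * (c + y))" for y
  have h1: "\<bar>h y\<bar> <= 1" for y unfolding h_def by (rule trig_difference(1)[OF f])
  have h2: "\<bar>h y - h z\<bar> <= (\<bar>x\<bar> + 2) * min 1 \<bar>y - z\<bar>" for y z
  proof (cases "\<bar>y - z\<bar> <= 1")
   case True
   have "\<bar>h y - h z\<bar> <= \<bar>x * (c + y) - x * (c + z)\<bar>" unfolding h_def by (rule trig_difference(2)[OF f])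
   also have "x * (c + y) - x * (c + z) = x * (y - z)" by (simp add: algebra_simps)
   also have "\<bar>x * (y - z)\<bar> <= (\<bar>x\<bar> + 2) * \<bar>y - z\<bar>" unfolding abs_mult by (rule mult_right_mono) simp_all
   finally show ?thesis using True by simp
  next
   case False
   thus ?thesis using h1[of y] h1[of z] by simp
  qed
  have [measurable]: "h \<in> borel_measurable borel" unfolding h_def by measurable
  define I where "I = (LINT y|\<N>. f (x * g y))"
  \<comment> \<open>On the scale \<open>x\<close> the trigonometric functions are
    \<open>|x|\<close>-Lipschitz, so the mean error of the approximate embedding carries over to the
    moments. \<open>X\<close> enters through its law only.\<close>
  have near: "\<bar>(LINT w|M. h (?\<Gamma> (\<sigma> m w) w)) - I\<bar> <= \<bar>x\<bar> * (\<bar>c - a m\<bar> + \<eta> m)" for m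
  proof -
   have "\<exists>X. distr M borel X = \<N> & X \<in> borel_measurable M &
    (nn_integral M (%w. ennreal \<bar>a m + \<delta> (\<sigma> m w) + B (\<sigma> m w) w - g (X w)\<bar>)) <= ennreal (\<eta> m)"
    using approx[of m] unfolding approximates_def by blast
   then obtain X where Xd: "distr M borel X = \<N>" and X[measurable]: "X \<in> borel_measurable M"
    and Xn: "(nn_integral M (%w. ennreal \<bar>a m + \<delta> (\<sigma> m w) + B (\<sigma> m w) w - g (X w)\<bar>)) <= ennreal (\<eta> m)" by blast
   define R where "R w = \<bar>a m + \<delta> (\<sigma> m w) + B (\<sigma> m w) w - g (X w)\<bar>" for w
   have [measurable]: "R \<in> borel_measurable M" unfolding R_def by measurable
   have Rn: "(nn_integral M (%w. ennreal (R w))) <= ennreal (\<eta> m)" using Xn by (simp add: R_def)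
   have R0: "0 <= R w" for w by (simp add: R_def)
   have Ri: "integrable M R"
    by (rule integrableI_nonneg) (use Rn R0 in \<open>auto simp: less_top[symmetric] top_unique\<close>)
   have RI: "(LINT w|M. R w) <= \<eta> m"
   proof -
    have "ennreal (LINT w|M. R w) <= ennreal (\<eta> m)"
     using Rn nn_integral_eq_integral[OF Ri] R0 by simp
    thus ?thesis by (simp add: ennreal_le_iff \<eta>_def)
   qed
   have I: "I = (LINT w|M. f (x * g (X w)))"
    unfolding I_def Xd[symmetric] by (rule integral_distr) measurable
   have bi: "integrable M (%w. f (U w))" if "U \<in> borel_measurable M" for U
    by (rule integrable_const_bound[where B=1]) (use that trig_difference(1)[OF f] in auto)
   have i1: "integrable M (%w. h (?\<Gamma> (\<sigma> m w) w))" unfolding h_def by (rule bi) measurable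
   have i2: "integrable M (%w. f (x * g (X w)))" by (rule bi) measurable
   have e: "(LINT w|M. h (?\<Gamma> (\<sigma> m w) w)) - I = (LINT w|M. h (?\<Gamma> (\<sigma> m w) w) - f (x * g (X w)))"
    unfolding I by (rule Bochner_Integration.integral_diff[OF i1 i2, symmetric])
   have pt: "\<bar>h (?\<Gamma> (\<sigma> m w) w) - f (x * g (X w))\<bar> <= \<bar>x\<bar> * (\<bar>c - a m\<bar> + R w)" for w
   proof -
    have "\<bar>h (?\<Gamma> (\<sigma> m w) w) - f (x * g (X w))\<bar> <= \<bar>x * (c + ?\<Gamma> (\<sigma> m w) w) - x * g (X w)\<bar>"
     unfolding h_def by (rule trig_difference(2)[OF f])
    also have "x * (c + ?\<Gamma> (\<sigma> m w) w) - x * g (X w) = x * ((c - a m) + (a m + \<delta> (\<sigma> m w) + B (\<sigma> m w) w - g (X w)))"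
     by (simp add: algebra_simps)
    also have "\<bar>...\<bar> <= \<bar>x\<bar> * (\<bar>c - a m\<bar> + R w)"
     unfolding abs_mult R_def by (intro mult_left_mono abs_triangle_ineq) simp
    finally show ?thesis .
   qed
   have i3: "integrable M (%w. \<bar>x\<bar> * (\<bar>c - a m\<bar> + R w))" using Ri by simp
   have c1: "\<bar>\<integral>w. h (?\<Gamma> (\<sigma> m w) w) - f (x * g (X w)) \<partial>M\<bar> <= (LINT w|M. \<bar>h (?\<Gamma> (\<sigma> m w) w) - f (x * g (X w))\<bar>)"
    by (rule integral_abs_bound)
   have c2: "(LINT w|M. \<bar>h (?\<Gamma> (\<sigma> m w) w) - f (x * g (X w))\<bar>) <= (LINT w|M. \<bar>x\<bar> * (\<bar>c - a m\<bar> + R w))"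
    by (rule integral_mono[OF _ i3 pt]) (intro Bochner_Integration.integrable_abs Bochner_Integration.integrable_diff i1 i2)
   have c3: "(LINT w|M. \<bar>x\<bar> * (\<bar>c - a m\<bar> + R w)) = \<bar>x\<bar> * (\<bar>c - a m\<bar> + (LINT w|M. R w))"
    using Ri by (simp add: prob_space)
   have c4: "\<bar>x\<bar> * (\<bar>c - a m\<bar> + (LINT w|M. R w)) <= \<bar>x\<bar> * (\<bar>c - a m\<bar> + \<eta> m)"
    using RI by (intro mult_left_mono add_left_mono) auto
   show ?thesis unfolding e by (rule order_trans[OF c1 order_trans[OF c2[unfolded c3] c4]])
  qed
  have "(%m. \<bar>x\<bar> * (\<bar>c - a m\<bar> + \<eta> m)) \<longlonglongrightarrow> \<bar>x\<bar> * (\<bar>c - c\<bar> + 0)"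
   by (intro tendsto_mult tendsto_add tendsto_rabs tendsto_diff tendsto_const ac \<eta>0)
  hence lim0: "(%m. \<bar>x\<bar> * (\<bar>c - a m\<bar> + \<eta> m)) \<longlonglongrightarrow> 0" by simp
  have "(%m. \<bar>(LINT w|M. h (?\<Gamma> (\<sigma> m w) w)) - I\<bar>) \<longlonglongrightarrow> 0"
  proof (rule tendsto_sandwich[OF _ _ tendsto_const lim0])
   show "eventually (%m. \<bar>(LINT w|M. h (?\<Gamma> (\<sigma> m w) w)) - I\<bar> <= \<bar>x\<bar> * (\<bar>c - a m\<bar> + \<eta> m)) sequentially"
    by (rule always_eventually, rule allI, rule near)
   show "eventually (%m. 0 <= \<bar>(LINT w|M. h (?\<Gamma> (\<sigma> m w) w)) - I\<bar>) sequentially"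
    by (rule always_eventually, rule allI, rule abs_ge_zero)
  qed
  hence "(%m. (LINT w|M. h (?\<Gamma> (\<sigma> m w) w)) - I) \<longlonglongrightarrow> 0" by (rule tendsto_rabs_zero_cancel)
  hence "(%m. \<integral>w. h (?\<Gamma> (\<sigma> m w) w) \<partial>M) \<longlonglongrightarrow> I" by (rule LIM_zero_cancel)
  hence "(%m. \<integral>w. h (law.\<Gamma> (\<sigma> m w) w) \<partial>M) \<longlonglongrightarrow> I" by (simp only: law.\<Gamma>_def)
  from law.law_limit[OF h1 h2 _ this]
  have l1: "(%n. \<integral>w. h (law.GZ (Suc n) w) \<partial>M) \<longlonglongrightarrow> I" by simp
  have l2: "(%n. \<integral>w. h (law.GZ (Suc n) w) \<partial>M) \<longlonglongrightarrow> (LINT w|M. f (x * Y w))"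
  proof (rule integral_dominated_convergence[where w="%_. 1"])
   show "AE w in M. (%n. h (law.GZ (Suc n) w)) \<longlonglongrightarrow> f (x * Y w)"
    using law.GZ_tendsto Y_AE
   proof eventually_elim
    case (elim w)
    have "continuous_on UNIV h" unfolding h_def
     by (rule continuous_on_compose2[OF f_cont]) (auto intro!: continuous_intros)
    hence "(%n. h (law.GZ (Suc n) w)) \<longlonglongrightarrow> h (law.\<Gamma> (law.\<tau> w) w)"
     by (rule continuous_on_tendsto_compose[OF _ elim(1)]) simp_all
    moreover have "h (law.\<Gamma> (law.\<tau> w) w) = f (x * Y w)" unfolding h_def law.\<Gamma>_def elim(2) ..
    ultimately show ?case by (simp only:)
   qed
   show "AE w in M. norm (h (law.GZ (Suc n) w)) <= 1" for n using h1 by simp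
  qed simp_all
  have "(LINT w|M. f (x * Y w)) = I" by (rule LIMSEQ_unique[OF l2 l1])
  moreover have "(\<integral>y. f (x * y) \<partial>distr M borel Y) = (LINT w|M. f (x * Y w))" by (rule integral_distr) measurable
  moreover have "(\<integral>y. f (x * y) \<partial>distr \<N> borel g) = I" unfolding I_def by (rule integral_distr) measurable
  ultimately show "(\<integral>y. f (x * y) \<partial>distr M borel Y) = (\<integral>y. f (x * y) \<partial>distr \<N> borel g)" by (simp only:)
 qed
 thus ?thesis
  using that[of law.\<tau> K Y c] law.\<tau>_stop law.\<tau>_range Y Y_AE by blast
qed

end

section \<open>The augmented Brownian filtration\<close>

lemma space_brownian_filtration [simp]: "space (brownian_filtration M W t) = space M"
 unfolding brownian_filtration_def by (rule space_measure_of) (auto dest: sets.sets_into_space simp: null_sets_def)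

lemma sets_brownian_filtration:
 "sets (brownian_filtration M W t) = sigma_sets (space M) ({W s -` A \<inter> space M | s A. 0 <= s & s <= t & A \<in> sets borel} \<union> null_sets M)"
 unfolding brownian_filtration_def by (rule sets_measure_of) (auto dest: sets.sets_into_space simp: null_sets_def)

context brownian_motion
begin

lemma scaled_increment:
 assumes "0 <= s" "s < t" and C[measurable]: "C \<in> sets borel"
 shows "prob {w\<in>space M. W t w - W s w \<in> C} = measure \<N> {x. sqrt (t - s) * x \<in> C}"
proof -
 have [measurable]: "W t \<in> borel_measurable M" "W s \<in> borel_measurable M" using assms by (auto intro: W_measurable)
 have "distributed \<N> lborel (%x. x) (normal_density 0 1)"
  unfolding distributed_def by (simp add: distr_id2)
 from gauss.normal_density_affine[OF this, of "sqrt (t - s)" 0]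
 have "distributed \<N> lborel (%x. sqrt (t - s) * x) (normal_density 0 (sqrt (t - s)))"
  using assms by simp
 hence "distr \<N> lborel (%x. sqrt (t - s) * x) = distr M lborel (%w. W t w - W s w)"
  using W_increments[OF assms(1,2)] by (simp add: distributed_def)
 hence "measure (distr \<N> lborel (%x. sqrt (t - s) * x)) C = measure (distr M lborel (%w. W t w - W s w)) C"
  by simp
 hence "measure \<N> ((%x. sqrt (t - s) * x) -` C \<inter> UNIV) = prob ((%w. W t w - W s w) -` C \<inter> space M)"
  by (subst (asm) measure_distr, simp, simp, subst (asm) measure_distr) simp_all
 moreover have "(%w. W t w - W s w) -` C \<inter> space M = {w\<in>space M. W t w - W s w \<in> C}" by auto
 ultimately show ?thesis by (simp add: vimage_def)
qed

text \<open>The times in \<open>U\<close> are completed by 0 and \<open>s\<close>, sorted, and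
  followed by \<open>t\<close>. As \<open>W 0 = 0\<close> almost surely, the values on
  \<open>U\<close> are partial sums of the first \<open>n - 1\<close> increments, while the last
  increment is the one from \<open>s\<close> to \<open>t\<close>.\<close>

lemma past_event_indep:
 assumes st: "0 <= s" "s < t" and U: "finite U" "U \<subseteq> {0..s}" and A: "!!u. A u \<in> sets borel" and C: "C \<in> sets borel"
 shows "prob ({w\<in>space M. \<forall>u\<in>U. W u w \<in> A u} \<inter> {w\<in>space M. W t w - W s w \<in> C})
  = prob {w\<in>space M. \<forall>u\<in>U. W u w \<in> A u} * prob {w\<in>space M. W t w - W s w \<in> C}"
proof -
 define xs where "xs = sorted_list_of_set (insert 0 (insert s U))"
 have fin: "finite (insert 0 (insert s U))" using U by simp
 have xs: "sorted xs" "distinct xs" "set xs = insert 0 (insert s U)"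
  unfolding xs_def by (rule sorted_sorted_list_of_set distinct_sorted_list_of_set set_sorted_list_of_set[OF fin])+
 define n where "n = length xs"
 have n: "0 < n" using xs(3) by (auto simp: n_def)
 have range: "0 <= xs ! i" "xs ! i <= s" if "i < n" for i
 proof -
  have "xs ! i \<in> set xs" using that by (simp add: n_def)
  thus "0 <= xs ! i" "xs ! i <= s" using U(2) st xs(3) by auto
 qed
 have first: "xs ! 0 = 0"
 proof -
  obtain i where i: "i < n" "xs ! i = 0" using xs(3) by (metis in_set_conv_nth insertI1 n_def)
  hence "xs ! 0 <= 0" using sorted_nth_mono[OF xs(1), of 0 i] by (simp add: n_def)
  thus ?thesis using range(1)[OF n] by simp
 qed
 have last: "xs ! (n - 1) = s"
 proof -
  obtain i where i: "i < n" "xs ! i = s" using xs(3) by (metis in_set_conv_nth insertI1 insertI2 n_def)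
  hence "s <= xs ! (n - 1)" using sorted_nth_mono[OF xs(1), of i "n - 1"] by (simp add: n_def)
  thus ?thesis using range(2)[of "n - 1"] n by simp
 qed
 define p where "p i = (if i < n then xs ! i else t)" for i
 have p0: "p 0 = 0" using n first by (simp add: p_def)
 have p_mono: "p i <= p (Suc i)" if "i < n" for i
  using that range(2)[OF that] st sorted_nth_mono[OF xs(1), of i "Suc i"] by (auto simp: p_def n_def)
 define X where "X i w = W (p (Suc i)) w - W (p i) w" for i and w
 have ind: "indep_vars (%_. borel) X {..<n}"
  unfolding X_def using W_indep_increments[of p n] p0 p_mono by auto
 have top: "X (n - 1) w = W t w - W s w" for w using n last by (simp add: X_def p_def)
 let ?I = "{..<n - 1}" and ?J = "{n - 1}"
 have ind2: "indep_var (PiM ?I (%_. borel)) (%w. restrict (%i. X i w) ?I) (PiM ?J (%_. borel)) (%w. restrict (%i. X i w) ?J)"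
  by (rule indep_var_restrict[OF ind]) (use n in auto)
 define R where "R = {x \<in> space (PiM ?I (%_. borel)). \<forall>j\<in>{j. j < n & xs ! j \<in> U}. (\<Sum>i<j. x i) \<in> A (xs ! j)}"
 have R: "R \<in> sets (PiM ?I (%_. borel :: real measure))"
 proof -
  have [measurable]: "(%x. \<Sum>i<j. x i) \<in> borel_measurable (PiM ?I (%_. borel :: real measure))" if "j \<in> {j. j < n & xs ! j \<in> U}" for j
   using that by (intro borel_measurable_sum measurable_component_singleton) auto
  note A[measurable]
  show ?thesis unfolding R_def by measurable
 qed
 define Q where "Q = {x \<in> space (PiM ?J (%_. borel)). x (n - 1) \<in> C}"
 have Q: "Q \<in> sets (PiM ?J (%_. borel :: real measure))"
 proof -
  have [measurable]: "(%x. x (n - 1)) \<in> borel_measurable (PiM ?J (%_. borel :: real measure))"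
   by (rule measurable_component_singleton) simp
  note C[measurable]
  show ?thesis unfolding Q_def by measurable
 qed
 have WM[measurable]: "W u \<in> borel_measurable M" if "u \<in> U" for u using that U by (intro W_measurable) auto
 have [measurable]: "W t \<in> borel_measurable M" "W s \<in> borel_measurable M" using st by (auto intro: W_measurable)
 have XM: "X i \<in> borel_measurable M" if "i < n" for i
 proof -
  have "0 <= p i" for i using range(1) st by (simp add: p_def)
  hence [measurable]: "W (p i) \<in> borel_measurable M" for i by (rule W_measurable)
  show ?thesis unfolding X_def by measurable
 qed
 have R_eq: "AE w in M. (\<forall>u\<in>U. W u w \<in> A u) \<longleftrightarrow> restrict (%i. X i w) ?I \<in> R"
  using W_start
 proof eventually_elim
  case (elim w)
  have sum: "(\<Sum>i<j. restrict (%i. X i w) ?I i) = W (xs ! j) w" if "j < n" for j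
  proof -
   have "(\<Sum>i<j. restrict (%i. X i w) ?I i) = (\<Sum>i<j. W (p (Suc i)) w - W (p i) w)"
    using that by (intro sum.cong) (auto simp: X_def)
   also have "... = W (p j) w - W (p 0) w" by (rule sum_lessThan_telescope)
   also have "... = W (xs ! j) w" using that p0 elim by (simp add: p_def)
   finally show ?thesis .
  qed
  have "(\<forall>u\<in>U. W u w \<in> A u) \<longleftrightarrow> (\<forall>j\<in>{j. j < n & xs ! j \<in> U}. W (xs ! j) w \<in> A (xs ! j))"
  proof
   assume r: "\<forall>j\<in>{j. j < n & xs ! j \<in> U}. W (xs ! j) w \<in> A (xs ! j)"
   show "\<forall>u\<in>U. W u w \<in> A u"
   proof
    fix u assume u: "u \<in> U"
    then obtain j where "j < n" "xs ! j = u" using xs(3) by (metis in_set_conv_nth insertI2 n_def)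
    thus "W u w \<in> A u" using r u by blast
   qed
  qed blast
  also have "... \<longleftrightarrow> restrict (%i. X i w) ?I \<in> R"
   unfolding R_def using sum by (auto simp: space_PiM)
  finally show ?case .
 qed
 have Q_eq: "restrict (%i. X i w) ?J \<in> Q \<longleftrightarrow> W t w - W s w \<in> C" for w
  unfolding Q_def by (auto simp: space_PiM top[unfolded One_nat_def])
 let ?a = "%w. restrict (%i. X i w) ?I" and ?b = "%w. restrict (%i. X i w) ?J"
 have aM: "?a \<in> measurable M (PiM ?I (%_. borel))" by (rule measurable_restrict) (use XM in auto)
 have aR: "?a -` R \<inter> space M \<in> sets M" by (rule measurable_sets[OF aM R])
 have past: "{w\<in>space M. \<forall>u\<in>U. W u w \<in> A u} \<in> sets M" using U(1) A by measurable
 have Cm: "{w\<in>space M. W t w - W s w \<in> C} \<in> sets M" using C by measurable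
 have "prob ({w\<in>space M. \<forall>u\<in>U. W u w \<in> A u} \<inter> {w\<in>space M. W t w - W s w \<in> C})
  = prob ((%w. (?a w, ?b w)) -` (R \<times> Q) \<inter> space M)"
 proof (rule finite_measure_eq_AE)
  show "AE w in M. w \<in> {w\<in>space M. \<forall>u\<in>U. W u w \<in> A u} \<inter> {w\<in>space M. W t w - W s w \<in> C}
   \<longleftrightarrow> w \<in> (%w. (?a w, ?b w)) -` (R \<times> Q) \<inter> space M"
   using R_eq by eventually_elim (use Q_eq in auto)
  show "{w\<in>space M. \<forall>u\<in>U. W u w \<in> A u} \<inter> {w\<in>space M. W t w - W s w \<in> C} \<in> sets M" using past Cm by blast
  have "(%w. (?a w, ?b w)) -` (R \<times> Q) \<inter> space M = (?a -` R \<inter> space M) \<inter> {w\<in>space M. W t w - W s w \<in> C}"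
   using Q_eq by auto
  thus "(%w. (?a w, ?b w)) -` (R \<times> Q) \<inter> space M \<in> sets M" using aR Cm by auto
 qed
 also have "... = prob (?a -` R \<inter> space M) * prob (?b -` Q \<inter> space M)"
  by (rule indep_varD[OF ind2 R Q])
 also have "prob (?a -` R \<inter> space M) = prob {w\<in>space M. \<forall>u\<in>U. W u w \<in> A u}"
  by (rule finite_measure_eq_AE[OF _ aR past]) (use R_eq AE_space[of M] in eventually_elim, auto)
 also have "?b -` Q \<inter> space M = {w\<in>space M. W t w - W s w \<in> C}" using Q_eq by auto
 finally show ?thesis .
qed

text \<open>Finite dimensional events together with the null sets are intersection stable and
  generate the augmented filtration. Null sets satisfy the product formula trivially, so Dynkin's
  argument includes the augmentation.\<close>

lemma filtration_indep:
 assumes st: "0 <= s" "s < t" and E: "E \<in> sets (brownian_filtration M W s)" and C: "C \<in> sets borel"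
 shows "E \<in> sets M" "prob (E \<inter> {w\<in>space M. W t w - W s w \<in> C}) = prob E * prob {w\<in>space M. W t w - W s w \<in> C}"
proof -
 let ?C = "{w\<in>space M. W t w - W s w \<in> C}"
 define cyl where "cyl U A = {w\<in>space M. \<forall>u\<in>U. W u w \<in> A u}" for U and A :: "real => real set"
 define \<C> where "\<C> = {cyl U A | U A. finite U & U \<subseteq> {0..s} & (\<forall>u. A u \<in> sets borel)} \<union> null_sets M"
 have WM[measurable]: "W u \<in> borel_measurable M" if "0 <= u" for u using that by (rule W_measurable)
 have Cm: "?C \<in> sets M"
 proof -
  have [measurable]: "W t \<in> borel_measurable M" "W s \<in> borel_measurable M" using st by (auto intro: W_measurable)
  show ?thesis using C by measurable
 qed
 have cyl_M: "cyl U A \<in> sets M" if "finite U" "U \<subseteq> {0..s}" "!!u. A u \<in> sets borel" for U A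
 proof -
  have [measurable]: "W u \<in> borel_measurable M" if "u \<in> U" for u using that \<open>U \<subseteq> {0..s}\<close> by (intro W_measurable) auto
  show ?thesis unfolding cyl_def using that by measurable
 qed
 have \<C>_M: "\<C> \<subseteq> sets M" unfolding \<C>_def using cyl_M by (auto simp: null_sets_def)
 have \<C>_space: "\<C> \<subseteq> Pow (space M)" using \<C>_M sets.sets_into_space by blast
 have Int: "Int_stable \<C>"
 proof (rule Int_stableI)
  fix a b assume ab: "a \<in> \<C>" "b \<in> \<C>"
  hence m: "a \<in> sets M" "b \<in> sets M" using \<C>_M by auto
  show "a \<inter> b \<in> \<C>"
  proof (cases "a \<in> null_sets M \<or> b \<in> null_sets M")
   case True
   hence "a \<inter> b \<in> null_sets M" using m null_set_Int1 null_set_Int2 by blast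
   thus ?thesis by (simp add: \<C>_def)
  next
   case False
   then obtain U A U' A' where e: "a = cyl U A" "b = cyl U' A'" "finite U" "finite U'" "U \<subseteq> {0..s}" "U' \<subseteq> {0..s}"
    "\<forall>u. A u \<in> sets borel" "\<forall>u. A' u \<in> sets borel"
    using ab unfolding \<C>_def by blast
   define A'' where "A'' u = (if u \<in> U then A u else UNIV) \<inter> (if u \<in> U' then A' u else UNIV)" for u
   have "a \<inter> b = cyl (U \<union> U') A''" unfolding e cyl_def A''_def by (auto split: if_splits)
   moreover have "\<forall>u. A'' u \<in> sets borel" using e by (auto simp: A''_def)
   ultimately show ?thesis unfolding \<C>_def using e by blast
  qed
 qed
 have gen: "sets (brownian_filtration M W s) \<subseteq> sigma_sets (space M) \<C>"
  unfolding sets_brownian_filtration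
 proof (rule sigma_sets_mono, rule subsetI)
  fix a assume "a \<in> {W u -` A \<inter> space M | u A. 0 <= u & u <= s & A \<in> sets borel} \<union> null_sets M"
  hence "a \<in> \<C>"
  proof
   assume "a \<in> {W u -` A \<inter> space M | u A. 0 <= u & u <= s & A \<in> sets borel}"
   then obtain u A where uA: "a = W u -` A \<inter> space M" "0 <= u" "u <= s" "A \<in> sets borel" by blast
   hence "a = cyl {u} (%_. A)" by (auto simp: cyl_def)
   moreover have "finite {u}" "{u} \<subseteq> {0..s}" using uA by auto
   ultimately show ?thesis unfolding \<C>_def using uA(4) by blast
  qed (simp add: \<C>_def)
  thus "a \<in> sigma_sets (space M) \<C>" by (rule sigma_sets.Basic)
 qed
 have sub: "sigma_sets (space M) \<C> \<subseteq> sets M" by (rule sets.sigma_sets_subset[OF \<C>_M])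
 show "E \<in> sets M" using E gen sub by blast
 have E': "E \<in> sigma_sets (space M) \<C>" using E gen by blast
 from Int \<C>_space E' show "prob (E \<inter> ?C) = prob E * prob ?C"
 proof (induction rule: sigma_sets_induct_disjoint)
  case (basic a)
  show ?case
  proof (cases "a \<in> null_sets M")
   case True
   hence "a \<inter> ?C \<in> null_sets M" using Cm by (rule null_set_Int2)
   thus ?thesis using True by (simp add: measure_eq_0_null_sets)
  next
   case False
   then obtain U A where "a = cyl U A" "finite U" "U \<subseteq> {0..s}" "!!u. A u \<in> sets borel" using basic unfolding \<C>_def by blast
   thus ?thesis using past_event_indep[OF st _ _ _ C, of U A] by (simp add: cyl_def)
  qed
 next
  case empty
  show ?case by simp
 next
  case (compl a)
  hence a: "a \<in> sets M" using sub by blast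
  have "(space M - a) \<inter> ?C = ?C - a \<inter> ?C" by auto
  hence "prob ((space M - a) \<inter> ?C) = prob ?C - prob (a \<inter> ?C)"
   using a Cm by (simp add: finite_measure_Diff)
  thus ?case using compl a by (simp add: prob_compl algebra_simps)
 next
  case (union a)
  hence a: "range a \<subseteq> sets M" using sub by blast
  have "(%i. prob (a i \<inter> ?C)) sums prob (\<Union>i. a i \<inter> ?C)"
   by (rule finite_measure_UNION) (use a Cm union(1) in \<open>auto simp: disjoint_family_on_def\<close>)
  hence 1: "(%i. prob (a i) * prob ?C) sums prob ((\<Union>i. a i) \<inter> ?C)" using union by (simp add: Int_UN_distrib2)
  have 2: "(%i. prob (a i) * prob ?C) sums (prob (\<Union>i. a i) * prob ?C)"
   by (rule sums_mult2[OF finite_measure_UNION[OF a union(1)]])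
  show ?case by (rule sums_unique2[OF 1 2])
 qed
qed

lemma W_filtered: "filtered_bm M (brownian_filtration M W) W"
proof
 fix t :: real assume t: "0 <= t"
 have "sets (brownian_filtration M W t) \<subseteq> sets M"
  using filtration_indep(1)[OF t, of "t + 1" _ UNIV] by auto
 thus "subalgebra M (brownian_filtration M W t)" by (simp add: subalgebra_def)
 show "null_sets M \<subseteq> sets (brownian_filtration M W t)"
  unfolding sets_brownian_filtration by auto
 show "W t \<in> borel_measurable (brownian_filtration M W t)"
 proof (rule measurableI)
  fix A :: "real set" assume "A \<in> sets borel"
  thus "W t -` A \<inter> space (brownian_filtration M W t) \<in> sets (brownian_filtration M W t)"
   unfolding sets_brownian_filtration using t by (auto intro!: sigma_sets.Basic)
 qed simp
next
 fix s t :: real assume "0 <= s" "s <= t"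
 thus "sets (brownian_filtration M W s) \<subseteq> sets (brownian_filtration M W t)"
  unfolding sets_brownian_filtration by (intro sigma_sets_mono') fastforce
next
 fix s t E C assume *: "0 <= s" "s < t" "E \<in> sets (brownian_filtration M W s)" "C \<in> sets (borel :: real measure)"
 show "prob (E \<inter> {w\<in>space M. W t w - W s w \<in> C}) = prob E * measure \<N> {x. sqrt (t - s) * x \<in> C}"
  using filtration_indep(2)[OF *] scaled_increment[OF *(1,2,4)] by simp
qed (fact W_start W_continuous)+

end

section \<open>Wiener integrals\<close>

lemma gauss_scale_abs:
 fixes h :: "real => ennreal"
 assumes [measurable]: "h \<in> borel_measurable borel"
 shows "(nn_integral \<N> (%x. h (y + c * x))) = (nn_integral \<N> (%x. h (y + \<bar>c\<bar> * x)))"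
proof (cases "0 <= c")
 case False
 have "(\<integral>\<^sup>+x. h (y + \<bar>c\<bar> * x) \<partial>distr \<N> borel uminus) = (nn_integral \<N> (%x. h (y + \<bar>c\<bar> * (- x))))"
  by (rule nn_integral_distr) measurable
 thus ?thesis using False by (simp add: gauss_uminus)
qed simp

context filtered_bm
begin

text \<open>The intervals may overlap and the index type is free: the difference of two step
  integrals over unrelated partitions is again of this form, indexed by a disjoint sum.\<close>

definition weighted_increments :: "'i set => ('i => real) => ('i => real) => ('i => real) => 'a => real" where
 "weighted_increments J c a b w = (\<Sum>j\<in>J. c j * (B (b j) w - B (a j) w))"

lemma increment_square:
 assumes "0 <= s" "s <= t"
 shows "integrable M (%w. (B t w - B s w)^2)" "(LINT w|M. (B t w - B s w)^2) = t - s"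
proof -
 have [measurable]: "B t \<in> borel_measurable M" "B s \<in> borel_measurable M" using assms by (auto intro: B_measurable)
 have "(nn_integral M (%w. ennreal ((B t w - B s w)^2))) = ennreal (t - s)"
 proof (cases "s = t")
  case False
  hence st: "s < t" using assms by simp
  have "(nn_integral M (%w. ennreal ((B t w - B s w)^2)))
   = (nn_integral M (%w. (%(w, x). ennreal ((t - s) * x^2)) (w, (B t w - B s w)/sqrt (t - s))))"
   using st by (simp add: power_divide)
  also have "... = (nn_integral M (%w. (nn_integral \<N> (%x. (%(w, x). ennreal ((t - s) * x^2)) (w, x)))))"
   by (rule nn_integral_increment[OF assms(1) st]) measurable
  also have "... = (nn_integral \<N> (%x. ennreal ((t - s) * x^2)))" by (simp add: emeasure_space_1)
  also have "... = ennreal (LINT x|\<N>. (t - s) * x^2)"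
   using st by (intro nn_integral_eq_integral) auto
  finally show ?thesis by simp
 qed simp
 thus "integrable M (%w. (B t w - B s w)^2)" "(LINT w|M. (B t w - B s w)^2) = t - s"
  using assms by (auto intro!: integrableI_nonneg simp: integral_eq_nn_integral)
qed

lemma covariance:
 assumes "0 <= s" "0 <= t"
 shows "integrable M (%w. B s w * B t w)" "(LINT w|M. B s w * B t w) = min s t"
proof -
 have m[measurable]: "B t \<in> borel_measurable M" if "0 <= t" for t using that by (rule B_measurable)
 have [measurable]: "B t \<in> borel_measurable M" "B s \<in> borel_measurable M" using assms by (auto intro: m)
 have sq: "integrable M (%w. (B t w)^2)" "(LINT w|M. (B t w)^2) = t" if t: "0 <= t" for t
 proof -
  have [measurable]: "B t \<in> borel_measurable M" "B 0 \<in> borel_measurable M" using t by (auto intro: m)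
  have e: "AE w in M. (B t w - B 0 w)^2 = (B t w)\<^sup>2" using start by eventually_elim simp
  show "integrable M (%w. (B t w)^2)"
   by (rule integrable_cong_AE_imp[OF increment_square(1)[OF order_refl t] _ e]) measurable
  have "(LINT w|M. (B t w - B 0 w)^2) = (LINT w|M. (B t w)^2)" by (rule integral_cong_AE[OF _ _ e]) measurable
  thus "(LINT w|M. (B t w)^2) = t" using increment_square(2)[OF order_refl t] by simp
 qed
 show int: "integrable M (%w. B s w * B t w)"
 proof (rule Bochner_Integration.integrable_bound)
  show "integrable M (%w. (B s w)^2 + (B t w)^2)" using sq assms by simp
  show "AE w in M. norm (B s w * B t w) <= norm ((B s w)^2 + (B t w)^2)"
  proof (rule AE_I2)
   fix w
   have "2 * \<bar>B s w * B t w\<bar> <= (B s w)^2 + (B t w)\<^sup>2"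
    using sum_squares_bound[of "\<bar>B s w\<bar>" "\<bar>B t w\<bar>"] by (simp add: abs_mult)
   thus "norm (B s w * B t w) <= norm ((B s w)^2 + (B t w)^2)" by simp
  qed
 qed measurable
 define u v where "u = min s t" and "v = max s t"
 have uv: "0 <= u" "u <= v" "0 <= v" using assms by (auto simp: u_def v_def)
 have comm: "B s w * B t w = B u w * B v w" for w
  by (cases "s <= t") (simp_all add: u_def v_def min_def max_def)
 have int': "integrable M (%w. B u w * B v w)" using int by (simp add: comm)
 have "v - u = (LINT w|M. (B v w)^2 + (B u w)^2 - 2 * (B u w * B v w))"
  unfolding increment_square(2)[OF uv(1,2), symmetric] by (simp add: power2_diff mult_ac)
 also have "... = v + u - 2 * (LINT w|M. B u w * B v w)"
  using sq[OF uv(1)] sq[OF uv(3)] int' by simp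
 finally have "(LINT w|M. B u w * B v w) = u" by simp
 thus "(LINT w|M. B s w * B t w) = min s t" by (simp add: comm u_def)
qed

lemma increments_covariance:
 assumes "0 <= a" "a <= b" "0 <= c" "c <= d"
 shows "integrable M (%w. (B b w - B a w) * (B d w - B c w))"
  "(LINT w|M. (B b w - B a w) * (B d w - B c w)) = measure lborel ({a<..b} \<inter> {c<..d})"
proof -
 have nn: "0 <= b" "0 <= d" using assms by auto
 note cov = covariance[OF nn(1) nn(2)] covariance[OF nn(1) assms(3)] covariance[OF assms(1) nn(2)] covariance[OF assms(1,3)]
 have e: "(B b w - B a w) * (B d w - B c w) = B b w * B d w - B b w * B c w - B a w * B d w + B a w * B c w" for w
  by (simp add: algebra_simps)
 show "integrable M (%w. (B b w - B a w) * (B d w - B c w))" unfolding e using cov by simp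
 have "(LINT w|M. (B b w - B a w) * (B d w - B c w)) = min b d - min b c - min a d + min a c"
  unfolding e using cov by simp
 also have "... = max 0 (min b d - max a c)" using assms by (auto simp: min_def max_def)
 also have "... = measure lborel {max a c<..min b d}" by (auto simp: max_def)
 also have "{max a c<..min b d} = {a<..b} \<inter> {c<..d}" by auto
 finally show "(LINT w|M. (B b w - B a w) * (B d w - B c w)) = measure lborel ({a<..b} \<inter> {c<..d})" .
qed

text \<open>The covariance of two increments is the length of the intersection of their intervals.
  Both sides are therefore the same quadratic form in the coefficients, overlapping or not.\<close>

lemma isometry:
 assumes J: "finite J" and ab: "!!j. j \<in> J ==> 0 <= a j" "!!j. j \<in> J ==> a j <= b j"
 shows "(nn_integral M (%w. ennreal ((weighted_increments J c a b w)^2)))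
  = (nn_integral lborel (%x. ennreal ((\<Sum>j\<in>J. c j * indicator {a j<..b j} x)^2)))"
proof -
 define m where "m i j = measure lborel ({a i<..b i} \<inter> {a j<..b j})" for i j
 have e1: "(weighted_increments J c a b w)\<^sup>2 = (\<Sum>i\<in>J. \<Sum>j\<in>J. c i * c j * ((B (b i) w - B (a i) w) * (B (b j) w - B (a j) w)))" for w
  unfolding weighted_increments_def power2_eq_square sum_product by (simp add: mult_ac)
 have i1: "integrable M (%w. c i * c j * ((B (b i) w - B (a i) w) * (B (b j) w - B (a j) w)))"
  and v1: "(LINT w|M. c i * c j * ((B (b i) w - B (a i) w) * (B (b j) w - B (a j) w))) = c i * c j * m i j" if "i \<in> J" "j \<in> J" for i j
  using increments_covariance[OF ab(1)[OF that(1)] ab(2)[OF that(1)] ab(1)[OF that(2)] ab(2)[OF that(2)]] by (simp_all add: m_def)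
 have I1: "integrable M (%w. (weighted_increments J c a b w)^2)"
  unfolding e1 by (intro Bochner_Integration.integrable_sum i1)
 have V1: "(LINT w|M. (weighted_increments J c a b w)^2) = (\<Sum>i\<in>J. \<Sum>j\<in>J. c i * c j * m i j)"
 proof -
  have "(LINT w|M. (weighted_increments J c a b w)^2)
   = (\<Sum>i\<in>J. \<integral>w. (\<Sum>j\<in>J. c i * c j * ((B (b i) w - B (a i) w) * (B (b j) w - B (a j) w))) \<partial>M)"
   unfolding e1 by (rule Bochner_Integration.integral_sum) (intro Bochner_Integration.integrable_sum i1)
  also have "... = (\<Sum>i\<in>J. \<Sum>j\<in>J. c i * c j * m i j)"
  proof (rule sum.cong[OF refl])
   fix i assume i: "i \<in> J"
   have "(LINT w|M. (\<Sum>j\<in>J. c i * c j * ((B (b i) w - B (a i) w) * (B (b j) w - B (a j) w))))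
    = (\<Sum>j\<in>J. \<integral>w. c i * c j * ((B (b i) w - B (a i) w) * (B (b j) w - B (a j) w)) \<partial>M)"
    by (rule Bochner_Integration.integral_sum) (rule i1[OF i])
   thus "(LINT w|M. (\<Sum>j\<in>J. c i * c j * ((B (b i) w - B (a i) w) * (B (b j) w - B (a j) w)))) = (\<Sum>j\<in>J. c i * c j * m i j)"
    using v1[OF i] by (simp only: cong: sum.cong)
  qed
  finally show ?thesis .
 qed
 have e2: "(\<Sum>j\<in>J. c j * indicator {a j<..b j} x)\<^sup>2 = (\<Sum>i\<in>J. \<Sum>j\<in>J. c i * c j * indicator ({a i<..b i} \<inter> {a j<..b j}) x)" for x :: real
  unfolding power2_eq_square sum_product indicator_inter_arith by (simp add: mult_ac)
 have fin: "emeasure lborel ({a i<..b i} \<inter> {a j<..b j}) < \<infinity>" for i j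
 proof -
  have "emeasure lborel ({a i<..b i} \<inter> {a j<..b j}) <= emeasure lborel {a i..b i}" by (rule emeasure_mono) auto
  also have "... < \<infinity>" by (cases "a i <= b i") auto
  finally show ?thesis .
 qed
 have i2: "integrable lborel (%x. c i * c j * indicator ({a i<..b i} \<inter> {a j<..b j}) x)" for i j
  using fin[of i j] by (intro integrable_mult_right integrable_real_indicator) auto
 have v2: "(LINT x|lborel. c i * c j * indicator ({a i<..b i} \<inter> {a j<..b j}) x) = c i * c j * m i j" for i j
  by (simp add: m_def)
 have I2: "integrable lborel (%x. (\<Sum>j\<in>J. c j * indicator {a j<..b j} x)^2)"
  unfolding e2 by (intro Bochner_Integration.integrable_sum i2)
 have V2: "(LINT x|lborel. (\<Sum>j\<in>J. c j * indicator {a j<..b j} x)^2) = (\<Sum>i\<in>J. \<Sum>j\<in>J. c i * c j * m i j)"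
  unfolding e2 by (subst Bochner_Integration.integral_sum, intro Bochner_Integration.integrable_sum i2,
   subst Bochner_Integration.integral_sum, rule i2, simp only: v2)
 show ?thesis
  unfolding nn_integral_eq_integral[OF I1 AE_I2[OF zero_le_power2]] nn_integral_eq_integral[OF I2 AE_I2[OF zero_le_power2]] V1 V2 ..
qed

text \<open>Averaging out the last increment given \<open>F (q n)\<close> convolves \<open>h\<close>
  with a centred normal law, and by \<open>gauss_convolution\<close> the variances add up. Negative
  coefficients are handled by the symmetry of \<open>\<N>\<close>.\<close>

lemma step_law:
 fixes c q :: "nat => real"
 assumes s: "0 <= s" and q: "s <= q 0" "!!i. i < n ==> q i <= q (Suc i)" and A: "A \<in> sets (F s)"
  and h: "h \<in> borel_measurable borel"
 shows "(nn_integral M (%w. h (weighted_increments {..<n} c q (%i. q (Suc i)) w) * indicator A w))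
  = emeasure M A * (nn_integral \<N> (%x. h (sqrt (\<Sum>i<n. (c i)^2 * (q (Suc i) - q i)) * x)))"
 using q(2) h
proof (induction n arbitrary: h)
 case 0
 thus ?case using gauss.emeasure_space_1 sets_F[OF s A]
  by (simp add: weighted_increments_def nn_integral_cmult mult.commute)
next
 case (Suc n)
 note h[measurable] = Suc.prems(2)
 let ?X = "weighted_increments {..<n} c q (%i. q (Suc i))"
 let ?V = "\<Sum>i<n. (c i)^2 * (q (Suc i) - q i)"
 have qn: "q n <= q (Suc n)" using Suc.prems(1) by simp
 have q_ge: "s <= q i" if "i <= n" for i
  using that
 proof (induction i)
  case (Suc i)
  thus ?case using Suc.prems(1) \<open>!!i. i < Suc n ==> q i <= q (Suc i)\<close>[of i] by simp
 qed (use q(1) in simp)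
 have q_mono: "q i <= q n" if "i <= n" for i
  using that
 proof (induction i rule: inc_induct)
  case (step i)
  thus ?case using Suc.prems(1)[of i] by simp
 qed simp
 have V0: "0 <= ?V" by (rule sum_nonneg) (use Suc.prems(1) in auto)
 have qn0: "0 <= q n" using q_ge[of n] s by simp
 have split: "weighted_increments {..<Suc n} c q (%i. q (Suc i)) w = ?X w + c n * (B (q (Suc n)) w - B (q n) w)" for w
  by (simp add: weighted_increments_def)
 define \<Delta> where "\<Delta> = c n * sqrt (q (Suc n) - q n)"
 define h' where "h' y = (nn_integral \<N> (%x. h (y + \<Delta> * x)))" for y
 have h'[measurable]: "h' \<in> borel_measurable borel"
  unfolding h'_def by (rule gauss.borel_measurable_nn_integral) measurable
 have XF: "?X \<in> borel_measurable (F (q n))"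
  unfolding weighted_increments_def
 proof (intro borel_measurable_sum borel_measurable_times borel_measurable_diff)
  fix i assume i: "i \<in> {..<n}"
  have le: "q i <= q n" "q (Suc i) <= q n" "0 <= q i" "0 <= q (Suc i)"
   using q_mono[of i] q_mono[of "Suc i"] q_ge[of i] q_ge[of "Suc i"] i s by auto
  show "B (q (Suc i)) \<in> borel_measurable (F (q n))" by (rule measurable_F_mono[OF le(4,2) adapted[OF le(4)]])
  show "B (q i) \<in> borel_measurable (F (q n))" by (rule measurable_F_mono[OF le(3,1) adapted[OF le(3)]])
 qed simp
 have AF: "A \<in> sets (F (q n))" using F_mono[OF s q_ge[OF order_refl]] A by blast
 have step: "(nn_integral M (%w. h (weighted_increments {..<Suc n} c q (%i. q (Suc i)) w) * indicator A w))
  = (nn_integral M (%w. h' (?X w) * indicator A w))"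
 proof (cases "q n = q (Suc n)")
  case True
  hence "\<Delta> = 0" by (simp add: \<Delta>_def)
  hence "h' = h" using gauss.emeasure_space_1 by (simp add: h'_def fun_eq_iff)
  thus ?thesis unfolding split using True by simp
 next
  case False
  hence lt: "q n < q (Suc n)" using qn by simp
  define \<Psi> where "\<Psi> z = h (?X (fst z) + \<Delta> * snd z) * indicator A (fst z)" for z
  note XF[measurable] AF[measurable]
  have \<Psi>: "\<Psi> \<in> borel_measurable (F (q n) \<Otimes>\<^sub>M borel)" unfolding \<Psi>_def by measurable
  have "(nn_integral M (%w. h (weighted_increments {..<Suc n} c q (%i. q (Suc i)) w) * indicator A w))
   = (nn_integral M (%w. \<Psi> (w, (B (q (Suc n)) w - B (q n) w)/sqrt (q (Suc n) - q n))))"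
   unfolding split \<Psi>_def \<Delta>_def using lt by simp
  also have "... = (nn_integral M (%w. \<integral>\<^sup>+x. \<Psi> (w, x) \<partial>\<N>))"
   by (rule nn_integral_increment[OF qn0 lt \<Psi>])
  also have "... = (nn_integral M (%w. h' (?X w) * indicator A w))"
   unfolding \<Psi>_def h'_def fst_conv snd_conv by (intro nn_integral_cong nn_integral_multc) measurable
  finally show ?thesis .
 qed
 have d2: "\<Delta>\<^sup>2 = (c n)^2 * (q (Suc n) - q n)" using qn by (simp add: \<Delta>_def power_mult_distrib)
 have "(nn_integral \<N> (%x. h' (sqrt ?V * x)))
  = (nn_integral \<N> (%x. \<integral>\<^sup>+y. h (sqrt ?V * x + \<bar>\<Delta>\<bar> * y) \<partial>\<N>))"
  unfolding h'_def by (intro nn_integral_cong gauss_scale_abs) measurable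
 also have "... = (nn_integral \<N> (%x. h (sqrt ((sqrt ?V)^2 + \<bar>\<Delta>\<bar>\<^sup>2) * x)))"
  by (rule gauss_convolution[OF h]) (use V0 in simp_all)
 also have "(sqrt ?V)\<^sup>2 + \<bar>\<Delta>\<bar>\<^sup>2 = (\<Sum>i<Suc n. (c i)^2 * (q (Suc i) - q i))"
  using V0 by (simp add: d2)
 finally have conv: "(nn_integral \<N> (%x. h' (sqrt ?V * x)))
  = (nn_integral \<N> (%x. h (sqrt (\<Sum>i<Suc n. (c i)^2 * (q (Suc i) - q i)) * x)))" .
 show ?case
  unfolding step conv[symmetric] by (rule Suc.IH[OF _ h']) (use Suc.prems(1) in simp)
qed

end

lemma L2_AE_subseq:
 fixes X :: "nat => 'a => real"
 assumes [measurable]: "!!k. X k \<in> borel_measurable M" "Y \<in> borel_measurable M"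
  and lim: "(%k. \<integral>\<^sup>+w. ennreal ((X k w - Y w)^2) \<partial>M) \<longlonglongrightarrow> 0"
 obtains r :: "nat => nat" where "strict_mono r" "AE w in M. (%k. X (r k) w) \<longlonglongrightarrow> Y w"
proof -
 have "eventually (%k. (nn_integral M (%w. ennreal ((X k w - Y w)^2))) < 1) sequentially"
  using order_tendstoD(2)[OF lim, of 1] by simp
 then obtain k0 where k0: "!!k. k0 <= k ==> (nn_integral M (%w. ennreal ((X k w - Y w)^2))) < 1"
  by (auto simp: eventually_sequentially)
 \<comment> \<open>The first terms may be at infinite distance from \<open>Y\<close>; from
   \<open>k0\<close> on the squared differences are integrable.\<close>
 define u where "u k w = (X (k + k0) w - Y w)\<^sup>2" for k w
 have nn: "(nn_integral M (%w. ennreal (u k w))) < 1" for k unfolding u_def by (rule k0) simp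
 have ui: "integrable M (u k)" for k
 proof (rule integrableI_nonneg)
  show "u k \<in> borel_measurable M" unfolding u_def by measurable
  show "(nn_integral M (%w. ennreal (u k w))) < \<infinity>" using nn[of k] by (rule less_trans) simp
 qed (simp add: u_def)
 have "ennreal (LINT w|M. norm (u k w)) = (nn_integral M (%w. ennreal ((X (k + k0) w - Y w)^2)))" for k
  using nn_integral_eq_integral[OF ui[of k]] by (simp add: u_def[abs_def])
 hence "(%k. ennreal (LINT w|M. norm (u k w))) \<longlonglongrightarrow> ennreal 0"
  using LIMSEQ_ignore_initial_segment[OF lim, of k0] by simp
 hence "(%k. \<integral>w. norm (u k w) \<partial>M) \<longlonglongrightarrow> 0"
  by (rule tendsto_ennrealD) simp_all
 from tendsto_L1_AE_subseq[OF ui this] obtain r where r: "strict_mono r" "AE w in M. (%n. u (r n) w) \<longlonglongrightarrow> 0" by blast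
 show ?thesis
 proof (rule that[of "%k. r k + k0"])
  show "strict_mono (%k. r k + k0)" using r(1) by (simp add: strict_mono_def)
  show "AE w in M. (%k. X (r k + k0) w) \<longlonglongrightarrow> Y w"
   using r(2)
  proof eventually_elim
   case (elim w)
   have "(%k. sqrt (u (r k) w)) \<longlonglongrightarrow> sqrt 0" by (rule tendsto_real_sqrt[OF elim])
   hence "(%k. \<bar>X (r k + k0) w - Y w\<bar>) \<longlonglongrightarrow> 0" by (simp add: u_def)
   hence "(%k. X (r k + k0) w - Y w) \<longlonglongrightarrow> 0" by (rule tendsto_rabs_zero_cancel)
   thus ?case by (rule LIM_zero_cancel)
  qed
 qed
qed

text \<open>Convergence in \<open>L\<^sup>2\<close> implies convergence of the norms, through
 \<open>\<bar>x\<^sup>2 - y\<^sup>2\<bar> <= (1 + 1 / e) (x - y)\<^sup>2 + e y\<^sup>2\<close>.\<close>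

lemma L2_norm_tendsto:
 fixes X :: "nat => 'a => real"
 assumes [measurable]: "!!k. X k \<in> borel_measurable M" "Y \<in> borel_measurable M"
  and lim: "(%k. \<integral>\<^sup>+w. ennreal ((X k w - Y w)^2) \<partial>M) \<longlonglongrightarrow> 0" and Y: "integrable M (%w. (Y w)^2)"
  and X: "!!k. integrable M (%w. (X k w)^2)"
 shows "(%k. \<integral>w. (X k w)^2 \<partial>M) \<longlonglongrightarrow> (LINT w|M. (Y w)^2)"
proof -
 have D: "integrable M (%w. (X k w - Y w)^2)" for k
 proof (rule Bochner_Integration.integrable_bound)
  show "integrable M (%w. 2 * (X k w)^2 + 2 * (Y w)^2)" using X Y by simp
  have "(X k w - Y w)\<^sup>2 <= 2 * (X k w)^2 + 2 * (Y w)\<^sup>2" for w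
   using zero_le_power2[of "X k w + Y w"] by (simp add: power2_sum power2_diff)
  thus "AE w in M. norm ((X k w - Y w)^2) <= norm (2 * (X k w)^2 + 2 * (Y w)^2)" by simp
 qed measurable
 define a where "a k = (LINT w|M. (X k w - Y w)^2)" for k
 define b where "b = (LINT w|M. (Y w)^2)"
 have b0: "0 <= b" unfolding b_def by simp
 have "ennreal (a k) = (nn_integral M (%w. ennreal ((X k w - Y w)^2)))" for k
  unfolding a_def by (rule nn_integral_eq_integral[OF D, symmetric]) simp
 hence "(%k. ennreal (a k)) \<longlonglongrightarrow> ennreal 0" using lim by simp
 hence a0: "a \<longlonglongrightarrow> 0" by (rule tendsto_ennrealD) (simp_all add: a_def)
 have near: "\<bar>(LINT w|M. (X k w)^2) - b\<bar> <= (1 + 1/e) * a k + e * b" if e: "0 < e" for k e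
 proof -
  have pt: "\<bar>x\<^sup>2 - y\<^sup>2\<bar> <= (1 + 1/e) * (x - y)^2 + e * y\<^sup>2" for x y :: real
  proof -
   have "2 * \<bar>y * (x - y)\<bar> <= 1/e * (x - y)^2 + e * y\<^sup>2"
   proof -
    have "2 * ((sqrt e * \<bar>y\<bar>) * (1/sqrt e * \<bar>x - y\<bar>)) <= (sqrt e * \<bar>y\<bar>)^2 + (1/sqrt e * \<bar>x - y\<bar>)\<^sup>2"
     using sum_squares_bound[of "sqrt e * \<bar>y\<bar>" "1/sqrt e * \<bar>x - y\<bar>"] by (simp only: mult.assoc)
    moreover have "(sqrt e * \<bar>y\<bar>) * (1/sqrt e * \<bar>x - y\<bar>) = \<bar>y * (x - y)\<bar>" using e by (simp add: abs_mult)
    moreover have "(sqrt e * \<bar>y\<bar>)\<^sup>2 = e * y\<^sup>2" "(1/sqrt e * \<bar>x - y\<bar>)\<^sup>2 = 1/e * (x - y)\<^sup>2"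
     using e by (simp_all add: power_mult_distrib power_divide)
    ultimately show ?thesis by (simp only: add.commute)
   qed
   moreover have "x\<^sup>2 - y\<^sup>2 = (x - y)^2 + 2 * (y * (x - y))" by (simp add: power2_eq_square algebra_simps)
   hence "\<bar>x\<^sup>2 - y\<^sup>2\<bar> <= (x - y)^2 + 2 * \<bar>y * (x - y)\<bar>"
    using abs_triangle_ineq[of "(x - y)\<^sup>2" "2 * (y * (x - y))"] by (simp add: abs_mult)
   ultimately show ?thesis by (simp add: distrib_right)
  qed
  have "\<bar>(LINT w|M. (X k w)^2) - b\<bar> = \<bar>\<integral>w. (X k w)^2 - (Y w)\<^sup>2 \<partial>M\<bar>" unfolding b_def using X Y by simp
  also have "... <= (LINT w|M. \<bar>(X k w)\<^sup>2 - (Y w)\<^sup>2\<bar>)" by (rule integral_abs_bound)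
  also have "... <= (LINT w|M. (1 + 1/e) * (X k w - Y w)^2 + e * (Y w)^2)"
   by (rule integral_mono[OF _ _ pt]) (use X Y D in simp_all)
  also have "... = (1 + 1/e) * a k + e * b" unfolding a_def b_def using D Y by simp
  finally show ?thesis .
 qed
 show ?thesis
  unfolding b_def[symmetric]
 proof (rule LIMSEQ_I)
  fix \<epsilon> :: real assume \<epsilon>: "0 < \<epsilon>"
  define e where "e = \<epsilon>/(2 * (b + 1))"
  have e: "0 < e" "e * b < \<epsilon>/2" using \<epsilon> b0 by (simp_all add: e_def field_simps)
  have lim0: "(%k. (1 + 1/e) * a k) \<longlonglongrightarrow> 0" by (rule tendsto_mult_right_zero[OF a0])
  have "eventually (%k. (1 + 1/e) * a k < \<epsilon>/2) sequentially"
   by (rule order_tendstoD(2)[OF lim0]) (use \<epsilon> in simp)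
  then obtain k0 where k0: "!!k. k0 <= k ==> (1 + 1/e) * a k < \<epsilon>/2" by (auto simp: eventually_sequentially)
  have "norm ((LINT w|M. (X k w)^2) - b) < \<epsilon>" if "k0 <= k" for k
   unfolding real_norm_def by (rule le_less_trans[OF near[OF e(1)]]) (use add_strict_mono[OF k0[OF that] e(2)] in simp)
  thus "\<exists>k0. \<forall>k\<ge>k0. norm ((LINT w|M. (X k w)^2) - b) < \<epsilon>" by blast
 qed
qed

lemma partition_upto_bounds:
 assumes "partition_upto t n p" "i <= n"
 shows "0 <= p i" "p i <= t" "i < n ==> p i <= p (Suc i)"
proof -
 have p: "p 0 = 0" "p n = t" "!!i. i < n ==> p i <= p (Suc i)" using assms(1) by (auto simp: partition_upto_def)
 have "p 0 <= p j" if "j <= n" for j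
  using that
 proof (induction j)
  case (Suc j)
  thus ?case using p(3)[of j] by simp
 qed simp
 thus "0 <= p i" using assms(2) p(1) by simp
 have "p j <= p n" if "j <= n" for j
  using that
 proof (induction j rule: inc_induct)
  case (step j)
  thus ?case using p(3)[of j] by simp
 qed simp
 thus "p i <= t" using assms(2) p(2) by simp
 show "i < n ==> p i <= p (Suc i)" by (rule p(3))
qed

lemma step_fun_zero:
 assumes "partition_upto t n p" "x <= 0 \<or> t < x"
 shows "step_fun n p c x = 0"
proof -
 have "c i * indicator {p i<..p (Suc i)} x = 0" if "i < n" for i
  using partition_upto_bounds(1)[OF assms(1), of i] partition_upto_bounds(2)[OF assms(1), of "Suc i"] that assms(2)
  by (auto simp: indicator_def)
 thus ?thesis unfolding step_fun_def by (intro sum.neutral) auto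
qed

lemma step_fun_measurable [measurable]: "step_fun n p c \<in> borel_measurable borel"
 unfolding step_fun_def by measurable

section \<open>Adaptedness and increments of the Wiener integral\<close>

locale wiener_integral = filtered_bm +
 fixes \<beta> :: "real => real" and I :: "real => 'a => real"
 assumes \<beta>_measurable [measurable]: "\<beta> \<in> borel_measurable borel"
  and \<beta>_square: "!!t. 0 <= t ==> (\<integral>\<^sup>+s\<in>{0..t}. ennreal ((\<beta> s)^2) \<partial>lborel) < \<infinity>"
  and integral: "stochastic_integral M B \<beta> I"
begin

lemma I_measurable: "0 <= t ==> I t \<in> borel_measurable M"
 using integral unfolding stochastic_integral_def by blast

lemma I_approximation:
 assumes "0 <= t"
 obtains n p c where "\<forall>k::nat. partition_upto t (n k) (p k)"
  "(%k. \<integral>\<^sup>+s\<in>{0..t}. ennreal ((step_fun (n k) (p k) (c k) s - \<beta> s)^2) \<partial>lborel) \<longlonglongrightarrow> 0"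
  "(%k. \<integral>\<^sup>+w. ennreal ((step_integral B (n k) (p k) (c k) w - I t w)^2) \<partial>M) \<longlonglongrightarrow> 0"
proof -
 have "\<exists>n p c. (\<forall>k::nat. partition_upto t (n k) (p k)) &
  (%k. \<integral>\<^sup>+s\<in>{0..t}. ennreal ((step_fun (n k) (p k) (c k) s - \<beta> s)^2) \<partial>lborel) \<longlonglongrightarrow> 0 &
  (%k. \<integral>\<^sup>+w. ennreal ((step_integral B (n k) (p k) (c k) w - I t w)^2) \<partial>M) \<longlonglongrightarrow> 0"
  using integral assms unfolding stochastic_integral_def by blast
 thus ?thesis using that by blast
qed

lemma step_integral_F:
 assumes "partition_upto t n p" "0 <= t"
 shows "step_integral B n p c \<in> borel_measurable (F t)"
 unfolding step_integral_def
proof (intro borel_measurable_sum borel_measurable_times borel_measurable_diff)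
 fix i assume i: "i \<in> {..<n}"
 have "B (p j) \<in> borel_measurable (F t)" if "j <= n" for j
  using partition_upto_bounds(1,2)[OF assms(1) that] by (intro measurable_F_mono[OF _ _ adapted])
 thus "B (p (Suc i)) \<in> borel_measurable (F t)" "B (p i) \<in> borel_measurable (F t)" using i by auto
qed simp

lemma I_adapted:
 assumes t: "0 <= t"
 shows "I t \<in> borel_measurable (F t)"
proof -
 obtain n p c where part_all: "\<forall>k::nat. partition_upto t (n k) (p k)"
  and "(%k. \<integral>\<^sup>+x\<in>{0..t}. ennreal ((step_fun (n k) (p k) (c k) x - \<beta> x)^2) \<partial>lborel) \<longlonglongrightarrow> 0"
  and lim: "(%k. \<integral>\<^sup>+w. ennreal ((step_integral B (n k) (p k) (c k) w - I t w)^2) \<partial>M) \<longlonglongrightarrow> 0"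
  by (rule I_approximation[OF t])
 note part = part_all[rule_format]
 let ?S = "%k. step_integral B (n k) (p k) (c k)"
 have SF: "?S k \<in> borel_measurable (F t)" for k by (rule step_integral_F[OF part t])
 have SM: "?S k \<in> borel_measurable M" for k by (rule measurable_F[OF t SF])
 obtain r :: "nat => nat" where r: "AE w in M. (%k. ?S (r k) w) \<longlonglongrightarrow> I t w"
  by (rule L2_AE_subseq[OF SM I_measurable[OF t] lim])
 have "(%w. lim (%k. ?S (r k) w)) \<in> borel_measurable (F t)" using SF by measurable
 thus ?thesis
  by (rule measurable_F_AE[OF t _ I_measurable[OF t]]) (use r in \<open>auto elim!: eventually_mono simp: limI\<close>)
qed

lemma I_start: "AE w in M. I 0 w = 0"
proof -
 obtain n p c where part_all: "\<forall>k::nat. partition_upto 0 (n k) (p k)"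
  and "(%k. \<integral>\<^sup>+x\<in>{0..0}. ennreal ((step_fun (n k) (p k) (c k) x - \<beta> x)^2) \<partial>lborel) \<longlonglongrightarrow> 0"
  and lim: "(%k. \<integral>\<^sup>+w. ennreal ((step_integral B (n k) (p k) (c k) w - I 0 w)^2) \<partial>M) \<longlonglongrightarrow> 0"
  by (rule I_approximation[OF order_refl])
 note part = part_all[rule_format]
 have [measurable]: "I 0 \<in> borel_measurable M" by (rule I_measurable) simp
 have "p k i = 0" if "i <= n k" for k i
  using partition_upto_bounds(1,2)[OF part that] by simp
 hence "step_integral B (n k) (p k) (c k) w = 0" for k w
  unfolding step_integral_def by (intro sum.neutral ballI) simp
 hence "(%k::nat. \<integral>\<^sup>+w. ennreal ((I 0 w)^2) \<partial>M) \<longlonglongrightarrow> 0" using lim by simp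
 hence "(nn_integral M (%w. ennreal ((I 0 w)^2))) = 0" by (simp add: LIMSEQ_const_iff)
 hence "AE w in M. ennreal ((I 0 w)^2) = 0" by (subst (asm) nn_integral_0_iff_AE) simp_all
 thus ?thesis by eventually_elim (simp add: ennreal_eq_0_iff)
qed

definition var :: "real => real => real" where
 "var s t = (LINT x|lborel. (indicator {s<..t} x * \<beta> x)^2)"

lemma \<beta>_integrable:
 assumes "0 <= s"
 shows "integrable lborel (%x. (indicator {s<..t} x * \<beta> x)^2)"
proof (rule integrableI_nonneg)
 have "(nn_integral lborel (%x. ennreal ((indicator {s<..t} x * \<beta> x)^2))) <= (\<integral>\<^sup>+x\<in>{0..max 0 t}. ennreal ((\<beta> x)^2) \<partial>lborel)"
  by (rule nn_integral_mono) (use assms in \<open>auto simp: indicator_def\<close>)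
 also have "... < \<infinity>" by (rule \<beta>_square) simp
 finally show "(nn_integral lborel (%x. ennreal ((indicator {s<..t} x * \<beta> x)^2))) < \<infinity>" .
qed simp_all

text \<open>The approximations of \<open>I t\<close> restricted to the time after \<open>s\<close> approximate \<open>I t - I s\<close>, because, by the isometry,
 their restrictions to \<open>[0, s]\<close> are close to the approximations of \<open>I s\<close>.\<close>

lemma increment_approximation:
 assumes s: "0 <= s" and st: "s <= t"
 obtains n :: "nat => nat" and q c where
  "\<forall>k. s <= q k 0" "\<forall>k. \<forall>i<n k. q k i <= q k (Suc i)"
  "(%k. \<integral>\<^sup>+w. ennreal ((weighted_increments {..<n k} (c k) (q k) (%i. q k (Suc i)) w - (I t w - I s w))^2) \<partial>M) \<longlonglongrightarrow> 0"
  "(%k. \<Sum>i<n k. (c k i)^2 * (q k (Suc i) - q k i)) \<longlonglongrightarrow> var s t"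
proof -
 have t: "0 <= t" using s st by simp
 obtain n p c where part_all: "\<forall>k::nat. partition_upto t (n k) (p k)"
  and f_lim: "(%k. \<integral>\<^sup>+x\<in>{0..t}. ennreal ((step_fun (n k) (p k) (c k) x - \<beta> x)^2) \<partial>lborel) \<longlonglongrightarrow> 0"
  and S_lim: "(%k. \<integral>\<^sup>+w. ennreal ((step_integral B (n k) (p k) (c k) w - I t w)^2) \<partial>M) \<longlonglongrightarrow> 0"
  by (rule I_approximation[OF t])
 obtain n' p' c' where part'_all: "\<forall>k::nat. partition_upto s (n' k) (p' k)"
  and f'_lim: "(%k. \<integral>\<^sup>+x\<in>{0..s}. ennreal ((step_fun (n' k) (p' k) (c' k) x - \<beta> x)^2) \<partial>lborel) \<longlonglongrightarrow> 0"
  and S'_lim: "(%k. \<integral>\<^sup>+w. ennreal ((step_integral B (n' k) (p' k) (c' k) w - I s w)^2) \<partial>M) \<longlonglongrightarrow> 0"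
  by (rule I_approximation[OF s])
 note part = part_all[rule_format] and part' = part'_all[rule_format]
 define f where "f k = step_fun (n k) (p k) (c k)" for k
 define f' where "f' k = step_fun (n' k) (p' k) (c' k)" for k
 define S where "S k = step_integral B (n k) (p k) (c k)" for k
 define S' where "S' k = step_integral B (n' k) (p' k) (c' k)" for k
 \<comment> \<open>Every partition interval is cut at \<open>s\<close>: \<open>max\<close> keeps the
   part after \<open>s\<close>, \<open>min\<close> the part before. Intervals on the wrong side
   collapse to a point and contribute nothing.\<close>
 define q where "q k i = max (p k i) s" for k i
 define X where "X k = weighted_increments {..<n k} (c k) (q k) (%i. q k (Suc i))" for k
 define Y where "Y k = weighted_increments {..<n k} (c k) (%i. min (p k i) s) (%i. min (p k (Suc i)) s)" for k
 have [measurable]: "f k \<in> borel_measurable borel" "f' k \<in> borel_measurable borel" for k by (simp_all add: f_def f'_def)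
 have SM[measurable]: "S k \<in> borel_measurable M" for k
  unfolding S_def by (rule measurable_F[OF t step_integral_F[OF part t]])
 have S'M[measurable]: "S' k \<in> borel_measurable M" for k
  unfolding S'_def by (rule measurable_F[OF s step_integral_F[OF part' s]])
 have [measurable]: "I t \<in> borel_measurable M" "I s \<in> borel_measurable M" by (rule I_measurable, fact)+
 have q_s: "s <= q k i" and q_mono: "i < n k ==> q k i <= q k (Suc i)" for k i
  using partition_upto_bounds(3)[OF part, of i k] by (auto simp: q_def)
 have q0: "0 <= q k i" for k i using q_s[of k i] s by simp
 have XM[measurable]: "X k \<in> borel_measurable M" for k
  unfolding X_def weighted_increments_def using B_measurable q0 by (intro borel_measurable_sum) simp
 have SXY: "S k w = X k w + Y k w" for k w
 proof -
  have "B (max u s) w + B (min u s) w = B u w + B s w" for u by (cases "u <= s") (simp_all add: max_def min_def)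
  hence "c k i * (B (p k (Suc i)) w - B (p k i) w) = c k i * (B (q k (Suc i)) w - B (q k i) w)
   + c k i * (B (min (p k (Suc i)) s) w - B (min (p k i) s) w)" for i
   unfolding q_def by (simp add: distrib_left[symmetric] algebra_simps)
  thus ?thesis by (simp add: S_def X_def Y_def step_integral_def weighted_increments_def sum.distrib)
 qed
 let ?e = "%k. (\<integral>\<^sup>+x\<in>{0..t}. ennreal ((f k x - \<beta> x)^2) \<partial>lborel) + (\<integral>\<^sup>+x\<in>{0..s}. ennreal ((f' k x - \<beta> x)^2) \<partial>lborel)"
  and ?d = "%U V :: 'a => real. (nn_integral M (%w. ennreal ((U w - V w)^2)))"
 have YS': "?d (Y k) (S' k)
  <= 2 * ?e k" for k
 proof -
  \<comment> \<open>Both sums are merged over a disjoint union of index sets, with negative sign for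
    the second, so that the isometry applies to their difference without a common
    refinement.\<close>
  let ?J = "{..<n k} <+> {..<n' k}" and ?c = "case_sum (c k) (%i. - c' k i)"
   and ?a = "case_sum (%i. min (p k i) s) (p' k)" and ?b = "case_sum (%i. min (p k (Suc i)) s) (%i. p' k (Suc i))"
  have "Y k w - S' k w = weighted_increments ?J ?c ?a ?b w" for w
   by (simp add: Y_def S'_def step_integral_def weighted_increments_def sum.Plus comp_def sum_negf)
  hence "?d (Y k) (S' k) = (nn_integral M (%w. ennreal ((weighted_increments ?J ?c ?a ?b w)^2)))"
   by simp
  also have "... = (nn_integral lborel (%x. ennreal ((\<Sum>j\<in>?J. ?c j * indicator {?a j<..?b j} x)^2)))"
  proof (rule isometry)
   fix j assume "j \<in> ?J"
   thus "0 <= ?a j" "?a j <= ?b j"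
    using partition_upto_bounds(1,3)[OF part, of _ k] partition_upto_bounds(1,3)[OF part', of _ k] s
    by (auto simp: min_le_iff_disj)
  qed simp
  also have "... = (nn_integral lborel (%x. ennreal ((indicator {0..s} x * (f k x - f' k x))^2)))"
  proof -
   have "(\<Sum>j\<in>?J. ?c j * indicator {?a j<..?b j} x) = indicator {0..s} x * (f k x - f' k x)" for x
   proof -
    have "(\<Sum>j\<in>?J. ?c j * indicator {?a j<..?b j} x) = (\<Sum>i<n k. c k i * indicator {min (p k i) s<..min (p k (Suc i)) s} x) - f' k x"
     by (simp only: sum.Plus[OF finite_lessThan finite_lessThan] comp_def sum.case mult_minus_left sum_negf f'_def step_fun_def diff_conv_add_uminus)
    also have "(\<Sum>i<n k. c k i * indicator {min (p k i) s<..min (p k (Suc i)) s} x) = indicator {..s} x * f k x"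
     unfolding f_def step_fun_def sum_distrib_left by (rule sum.cong[OF refl]) (auto simp: indicator_def)
    also have "indicator {..s} x * f k x - f' k x = indicator {0..s} x * (f k x - f' k x)"
     using step_fun_zero[OF part, of x k "c k"] step_fun_zero[OF part', of x k "c' k"] s
     by (cases "x < 0"; cases "x <= s") (auto simp: f_def f'_def indicator_def)
    finally show ?thesis .
   qed
   thus ?thesis by simp
  qed
  also have "... <= (nn_integral lborel (%x. 2 * (ennreal ((f k x - \<beta> x)^2) * indicator {0..t} x + ennreal ((f' k x - \<beta> x)^2) * indicator {0..s} x)))"
  proof (rule nn_integral_mono)
   fix x :: real
   have "(f k x - f' k x)\<^sup>2 <= 2 * ((f k x - \<beta> x)^2 + (f' k x - \<beta> x)^2)"
    using zero_le_power2[of "(f k x - \<beta> x) + (f' k x - \<beta> x)"] by (simp add: power2_eq_square algebra_simps)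
   hence "ennreal ((f k x - f' k x)^2) <= ennreal (2 * ((f k x - \<beta> x)^2 + (f' k x - \<beta> x)^2))" by (rule ennreal_leI)
   also have "... = 2 * (ennreal ((f k x - \<beta> x)^2) + ennreal ((f' k x - \<beta> x)^2))" by (simp add: ennreal_mult)
   finally show "ennreal ((indicator {0..s} x * (f k x - f' k x))^2)
    <= 2 * (ennreal ((f k x - \<beta> x)^2) * indicator {0..t} x + ennreal ((f' k x - \<beta> x)^2) * indicator {0..s} x)"
    using st by (auto simp: indicator_def)
  qed
  also have "... = 2 * ?e k"
   by (simp add: nn_integral_cmult nn_integral_add)
  finally show ?thesis .
 qed
 have X_bound: "(nn_integral M (%w. ennreal ((X k w - (I t w - I s w))^2)))
  <= 3 * (?d (S k) (I t) + ?d (S' k) (I s)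
   + 2 * ?e k)" for k
 proof -
  have YM[measurable]: "Y k \<in> borel_measurable M"
  proof -
   have "Y k = (%w. S k w - X k w)" by (simp add: SXY fun_eq_iff)
   thus ?thesis by simp
  qed
  have "(nn_integral M (%w. ennreal ((X k w - (I t w - I s w))^2)))
   <= (nn_integral M (%w. 3 * (ennreal ((S k w - I t w)^2) + ennreal ((S' k w - I s w)^2) + ennreal ((Y k w - S' k w)^2))))"
  proof (rule nn_integral_mono)
   fix w
   have sq: "(x - y - z)\<^sup>2 <= 3 * (x^2 + y^2 + z^2)" for x y z :: real
    using zero_le_power2[of "x + y"] zero_le_power2[of "x + z"] zero_le_power2[of "y - z"]
    by (simp add: power2_eq_square algebra_simps)
   have "X k w - (I t w - I s w) = (S k w - I t w) - (S' k w - I s w) - (Y k w - S' k w)" by (simp add: SXY)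
   hence "(X k w - (I t w - I s w))\<^sup>2 <= 3 * ((S k w - I t w)^2 + (S' k w - I s w)^2 + (Y k w - S' k w)^2)"
    by (simp only: sq)
   hence "ennreal ((X k w - (I t w - I s w))^2) <= ennreal (3 * ((S k w - I t w)^2 + (S' k w - I s w)^2 + (Y k w - S' k w)^2))"
    by (rule ennreal_leI)
   thus "ennreal ((X k w - (I t w - I s w))^2)
    <= 3 * (ennreal ((S k w - I t w)^2) + ennreal ((S' k w - I s w)^2) + ennreal ((Y k w - S' k w)^2))"
    by (simp add: ennreal_mult)
  qed
  also have "... = 3 * (?d (S k) (I t) + ?d (S' k) (I s)
   + ?d (Y k) (S' k))"
   by (simp add: nn_integral_cmult nn_integral_add)
  also have "... <= 3 * (?d (S k) (I t) + ?d (S' k) (I s)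
   + 2 * ?e k)"
   by (intro mult_left_mono add_left_mono YS') simp
  finally show ?thesis .
 qed
 have bound_lim: "(%k. 3 * (?d (S k) (I t) + ?d (S' k) (I s)
   + 2 * ?e k)) \<longlonglongrightarrow> 3 * (0 + 0 + 2 * (0 + 0))"
  unfolding S_def S'_def f_def f'_def
  by (intro ennreal_tendsto_cmult tendsto_add S_lim S'_lim f_lim f'_lim) simp_all
 have X_lim: "(%k. \<integral>\<^sup>+w. ennreal ((X k w - (I t w - I s w))^2) \<partial>M) \<longlonglongrightarrow> 0"
  by (rule tendsto_sandwich[OF _ _ tendsto_const bound_lim[unfolded add_0_left mult_zero_right]];
   rule always_eventually, rule allI, rule zero_le X_bound)
 define \<phi> where "\<phi> k x = (\<Sum>i<n k. c k i * indicator {q k i<..q k (Suc i)} x)" for k x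
 define \<psi> where "\<psi> x = indicator {s<..t} x * \<beta> x" for x
 have \<phi>: "\<phi> k x = indicator {s<..} x * f k x" for k x
  unfolding \<phi>_def f_def step_fun_def q_def sum_distrib_left by (rule sum.cong[OF refl]) (auto simp: indicator_def)
 have [measurable]: "\<phi> k \<in> borel_measurable borel" "\<psi> \<in> borel_measurable borel" for k unfolding \<phi>_def \<psi>_def by measurable
 define V where "V k = (\<Sum>i<n k. (c k i)^2 * (q k (Suc i) - q k i))" for k
 have V0: "0 <= V k" for k unfolding V_def by (rule sum_nonneg) (use q_mono in auto)
 \<comment> \<open>The norm of \<phi> is read off through the isometry as the second moment of
   \<open>X k\<close>, which \<open>step_law\<close> evaluates.\<close>
 have \<phi>_V: "(nn_integral lborel (%x. ennreal ((\<phi> k x)^2))) = ennreal (V k)" for k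
 proof -
  have "(nn_integral lborel (%x. ennreal ((\<phi> k x)^2))) = (nn_integral M (%w. ennreal ((X k w)^2)))"
   unfolding \<phi>_def X_def by (rule isometry[symmetric]) (use q0 q_mono in auto)
  also have "... = (nn_integral M (%w. ennreal ((X k w)^2) * indicator (space M) w))" by (intro nn_integral_cong) simp
  also have "... = emeasure M (space M) * (nn_integral \<N> (%x. ennreal ((sqrt (V k) * x)^2)))"
   unfolding X_def V_def by (rule step_law[where h="%x. ennreal (x^2)" and q="q k" and s=s, OF s q_s q_mono space_in_F[OF s]]) simp_all
  also have "(nn_integral \<N> (%x. ennreal ((sqrt (V k) * x)^2))) = ennreal (LINT x|\<N>. V k * x^2)"
   using V0[of k] by (subst nn_integral_eq_integral[symmetric]) (simp_all add: power_mult_distrib)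
  finally show ?thesis by (simp add: emeasure_space_1)
 qed
 have \<phi>i: "integrable lborel (%x. (\<phi> k x)^2)" for k
  by (rule integrableI_nonneg) (simp_all add: \<phi>_V)
 have \<phi>I: "(LINT x|lborel. (\<phi> k x)^2) = V k" for k
  using \<phi>_V[of k] V0[of k] by (simp add: integral_eq_nn_integral)
 have "(%k. \<integral>\<^sup>+x. ennreal ((\<phi> k x - \<psi> x)^2) \<partial>lborel) \<longlonglongrightarrow> 0"
 proof (rule tendsto_sandwich[OF _ _ tendsto_const f_lim])
  have "(nn_integral lborel (%x. ennreal ((\<phi> k x - \<psi> x)^2))) <= (\<integral>\<^sup>+x\<in>{0..t}. ennreal ((step_fun (n k) (p k) (c k) x - \<beta> x)^2) \<partial>lborel)" for k
  proof (rule nn_integral_mono)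
   fix x :: real
   show "ennreal ((\<phi> k x - \<psi> x)^2) <= ennreal ((step_fun (n k) (p k) (c k) x - \<beta> x)^2) * indicator {0..t} x"
    using step_fun_zero[OF part, of x k "c k"] s unfolding \<phi> \<psi>_def f_def
    by (cases "x <= s"; cases "x <= t") (auto simp: indicator_def)
  qed
  thus "eventually (%k. (nn_integral lborel (%x. ennreal ((\<phi> k x - \<psi> x)^2))) <= (\<integral>\<^sup>+x\<in>{0..t}. ennreal ((step_fun (n k) (p k) (c k) x - \<beta> x)^2) \<partial>lborel)) sequentially"
   by simp
 qed simp
 from L2_norm_tendsto[OF _ _ this _ \<phi>i]
 have "(%k. \<integral>x. (\<phi> k x)^2 \<partial>lborel) \<longlonglongrightarrow> (LINT x|lborel. (\<psi> x)^2)"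
  using \<beta>_integrable[OF s, of t] by (simp add: \<psi>_def)
 hence V_lim: "V \<longlonglongrightarrow> var s t" unfolding \<phi>I var_def \<psi>_def .
 show ?thesis
  by (rule that[of q n c]) (use q_s q_mono X_lim V_lim in \<open>simp_all add: X_def V_def[abs_def]\<close>)
qed

text \<open>The step integrals after \<open>s\<close> are centred normal given \<open>F s\<close>,
  with variances tending to \<open>var s t\<close>. Along an almost surely convergent subsequence
  their bounded moments on \<open>A\<close> pass to the limit.\<close>

lemma trig_increment:
 fixes f :: "real => real"
 assumes s: "0 <= s" and st: "s <= t" and A: "A \<in> sets (F s)" and f: "f = sin \<or> f = cos"
 shows "(LINT w|M. f (v * (I t w - I s w)) * indicator A w)
  = prob A * (LINT x|\<N>. f (v * (sqrt (var s t) * x)))"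
proof -
 have t: "0 <= t" using s st by simp
 have [measurable]: "A \<in> sets M" by (rule sets_F[OF s A])
 have f_cont: "continuous_on UNIV f" using f by (auto intro: continuous_intros)
 have [measurable]: "f \<in> borel_measurable borel" by (rule borel_measurable_continuous_onI[OF f_cont])
 have f1: "\<bar>f x\<bar> <= 1" for x by (rule trig_difference(1)[OF f])
 obtain n :: "nat => nat" and q c where q_all: "\<forall>k. s <= q k 0" "\<forall>k. \<forall>i<n k. q k i <= q k (Suc i)"
  and X_lim: "(%k. \<integral>\<^sup>+w. ennreal ((weighted_increments {..<n k} (c k) (q k) (%i. q k (Suc i)) w - (I t w - I s w))^2) \<partial>M) \<longlonglongrightarrow> 0"
  and V_lim: "(%k. \<Sum>i<n k. (c k i)^2 * (q k (Suc i) - q k i)) \<longlonglongrightarrow> var s t"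
  by (rule increment_approximation[OF s st])
 have q: "s <= q k 0" "i < n k ==> q k i <= q k (Suc i)" for k i using q_all by simp_all
 define X where "X k = weighted_increments {..<n k} (c k) (q k) (%i. q k (Suc i))" for k
 define V where "V k = (\<Sum>i<n k. (c k i)^2 * (q k (Suc i) - q k i))" for k
 have [measurable]: "I t \<in> borel_measurable M" "I s \<in> borel_measurable M" by (rule I_measurable, fact)+
 have q_ge: "s <= q k i" if "i <= n k" for k i
  using that
 proof (induction i)
  case (Suc i)
  thus ?case using q(2)[of i k] by simp
 qed (use q(1) in simp)
 have XM[measurable]: "X k \<in> borel_measurable M" for k
  unfolding X_def weighted_increments_def
 proof (intro borel_measurable_sum borel_measurable_times borel_measurable_diff)
  fix i assume i: "i \<in> {..<n k}"
  have "0 <= q k (Suc i)" "0 <= q k i" using q_ge[of i k] q_ge[of "Suc i" k] i s by auto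
  thus "B (q k (Suc i)) \<in> borel_measurable M" "B (q k i) \<in> borel_measurable M" by (auto intro: B_measurable)
 qed simp
 have fi: "integrable M (%w. f (U w) * indicator A w)" if [measurable]: "U \<in> borel_measurable M" for U
  by (rule integrable_const_bound[where B=1]) (use f1 in \<open>auto simp: indicator_def\<close>)
 have step: "(LINT w|M. f (v * X k w) * indicator A w) = prob A * (LINT x|\<N>. f (v * (sqrt (V k) * x)))" for k
 proof -
  \<comment> \<open>Adding 1 makes the integrand nonnegative, since \<open>step_law\<close> concerns
    \<open>ennreal\<close> integrals; the constant is subtracted at the end.\<close>
  let ?h = "%y. 1 + f (v * y)"
  have h0: "0 <= ?h y" for y using f1[of "v * y"] by (simp add: abs_le_iff)
  have gi: "integrable \<N> (%x. f (v * (sqrt (V k) * x)))"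
   by (rule gauss.integrable_const_bound[where B=1]) (use f1 in auto)
  have iA: "integrable M (%w. ?h (X k w) * indicator A w)"
   unfolding distrib_right mult_1 by (intro Bochner_Integration.integrable_add fi) (simp_all add: emeasure_eq_measure)
  have "ennreal (LINT w|M. ?h (X k w) * indicator A w) = (nn_integral M (%w. ennreal (?h (X k w) * indicator A w)))"
   by (rule nn_integral_eq_integral[OF iA, symmetric]) (use h0 in \<open>simp add: indicator_def\<close>)
  also have "... = (nn_integral M (%w. ennreal (?h (X k w)) * indicator A w))"
   by (intro nn_integral_cong) (simp add: indicator_def)
  also have "... = emeasure M A * (nn_integral \<N> (%x. ennreal (?h (sqrt (V k) * x))))"
   unfolding X_def V_def
   by (rule step_law[where h="%y. ennreal (?h y)" and q="q k" and s=s, OF s q(1) q(2) A]) simp_all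
  also have "(nn_integral \<N> (%x. ennreal (?h (sqrt (V k) * x)))) = ennreal (LINT x|\<N>. ?h (sqrt (V k) * x))"
   by (rule nn_integral_eq_integral) (use gi h0 in simp_all)
  also have "emeasure M A * ... = ennreal (prob A * (LINT x|\<N>. ?h (sqrt (V k) * x)))"
   by (simp add: emeasure_eq_measure ennreal_mult')
  finally have 1: "(LINT w|M. ?h (X k w) * indicator A w) = prob A * (LINT x|\<N>. ?h (sqrt (V k) * x))"
   by (rule ennreal_inj[THEN iffD1, rotated 2]) (simp_all add: h0 integral_nonneg_AE)
  have 2: "(LINT w|M. ?h (X k w) * indicator A w) = prob A + (LINT w|M. f (v * X k w) * indicator A w)"
   unfolding distrib_right mult_1 by (subst Bochner_Integration.integral_add) (simp_all add: fi emeasure_eq_measure)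
  have 3: "(LINT x|\<N>. ?h (sqrt (V k) * x)) = 1 + (LINT x|\<N>. f (v * (sqrt (V k) * x)))"
   using gi gauss.prob_space by (subst Bochner_Integration.integral_add) simp_all
  show ?thesis using 1 unfolding 2 3 by (simp add: distrib_left)
 qed
 obtain r :: "nat => nat" where r: "strict_mono r" "AE w in M. (%k. X (r k) w) \<longlonglongrightarrow> I t w - I s w"
  by (rule L2_AE_subseq[OF XM _ X_lim[folded X_def]]) measurable
 have "(%k. \<integral>w. f (v * X (r k) w) * indicator A w \<partial>M) \<longlonglongrightarrow> (LINT w|M. f (v * (I t w - I s w)) * indicator A w)"
 proof (rule integral_dominated_convergence[where w="%_. 1"])
  show "AE w in M. (%k. f (v * X (r k) w) * indicator A w) \<longlonglongrightarrow> f (v * (I t w - I s w)) * indicator A w"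
   using r(2)
  proof eventually_elim
   case (elim w)
   have "(%k. v * X (r k) w) \<longlonglongrightarrow> v * (I t w - I s w)" by (intro tendsto_mult tendsto_const elim)
   hence "(%k. f (v * X (r k) w)) \<longlonglongrightarrow> f (v * (I t w - I s w))"
    by (rule continuous_on_tendsto_compose[OF f_cont]) simp_all
   thus ?case by (intro tendsto_mult tendsto_const)
  qed
  show "AE w in M. norm (f (v * X (r k) w) * indicator A w) <= 1" for k
   using f1 by (intro AE_I2) (simp add: indicator_def)
 qed simp_all
 moreover have "(%k. prob A * (LINT x|\<N>. f (v * (sqrt (V (r k)) * x))))
  \<longlonglongrightarrow> prob A * (LINT x|\<N>. f (v * (sqrt (var s t) * x)))"
 proof (intro tendsto_mult tendsto_const)
  have V_r: "(%k. V (r k)) \<longlonglongrightarrow> var s t"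
   using LIMSEQ_subseq_LIMSEQ[OF V_lim r(1)] by (simp add: V_def comp_def)
  show "(%k. \<integral>x. f (v * (sqrt (V (r k)) * x)) \<partial>\<N>) \<longlonglongrightarrow> (LINT x|\<N>. f (v * (sqrt (var s t) * x)))"
  proof (rule integral_dominated_convergence[where w="%_. 1"])
   show "AE x in \<N>. (%k. f (v * (sqrt (V (r k)) * x))) \<longlonglongrightarrow> f (v * (sqrt (var s t) * x))"
   proof (rule AE_I2)
    fix x :: real
    have "(%k. v * (sqrt (V (r k)) * x)) \<longlonglongrightarrow> v * (sqrt (var s t) * x)"
     by (intro tendsto_mult tendsto_const tendsto_real_sqrt V_r)
    thus "(%k. f (v * (sqrt (V (r k)) * x))) \<longlonglongrightarrow> f (v * (sqrt (var s t) * x))"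
     by (rule continuous_on_tendsto_compose[OF f_cont]) simp_all
   qed
   show "AE x in \<N>. norm (f (v * (sqrt (V (r k)) * x))) <= 1" for k
    using f1 by (intro AE_I2) simp
  qed simp_all
 qed
 ultimately show ?thesis unfolding step by (rule LIMSEQ_unique)
qed

text \<open>Under the conditional probability given \<open>A\<close> the trigonometric moments of
  the increment are those of a normal variable that does not depend on \<open>A\<close>; uniqueness
  turns this into the product formula.\<close>

lemma integral_increment:
 assumes s: "0 <= s" and st: "s <= t" and A: "A \<in> sets (F s)" and C: "C \<in> sets borel"
 shows "prob (A \<inter> {w\<in>space M. I t w - I s w \<in> C}) = prob A * measure \<N> {x. sqrt (var s t) * x \<in> C}"
proof -
 have t: "0 <= t" using s st by simp
 have AM[measurable]: "A \<in> sets M" by (rule sets_F[OF s A])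
 note C[measurable]
 have [measurable]: "I t \<in> borel_measurable M" "I s \<in> borel_measurable M" by (rule I_measurable, fact)+
 let ?X = "%w. I t w - I s w"
 have XC: "{w\<in>space M. ?X w \<in> C} \<in> sets M" by measurable
 show ?thesis
 proof (cases "prob A = 0")
  case True
  have "prob (A \<inter> {w\<in>space M. ?X w \<in> C}) <= prob A" by (rule finite_measure_mono) auto
  thus ?thesis using True by (simp add: measure_le_0_iff)
 next
  case False
  hence pA: "0 < prob A" by (simp add: zero_less_measure_iff)
  define MA where "MA = density M (%w. ennreal (indicator A w/prob A))"
  have MA_int: "(LINT w|MA. g w) = (LINT w|M. g w * indicator A w)/prob A" if [measurable]: "g \<in> borel_measurable M" for g :: "'a => real"
  proof -
   have "(LINT w|MA. g w) = (LINT w|M. (indicator A w/prob A) *\<^sub>R g w)"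
    unfolding MA_def by (rule integral_density) (use pA in auto)
   also have "... = (LINT w|M. g w * indicator A w/prob A)" by (simp add: mult.commute)
   finally show ?thesis by simp
  qed
  have MA_em: "emeasure MA E = ennreal (prob (A \<inter> E)/prob A)" if [measurable]: "E \<in> sets M" for E
  proof -
   have "emeasure MA E = (nn_integral M (%w. ennreal (indicator A w/prob A) * indicator E w))"
    unfolding MA_def by (rule emeasure_density) auto
   also have "... = (nn_integral M (%w. ennreal (1/prob A) * indicator (A \<inter> E) w))"
    by (intro nn_integral_cong) (auto simp: indicator_def)
   also have "... = ennreal (1/prob A) * emeasure M (A \<inter> E)" by (rule nn_integral_cmult_indicator) simp
   also have "... = ennreal (prob (A \<inter> E)/prob A)"
    using pA by (simp add: emeasure_eq_measure ennreal_mult'[symmetric])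
   finally show ?thesis .
  qed
  have [simp]: "sets MA = sets M" "space MA = space M" by (simp_all add: MA_def)
  have "emeasure MA (space MA) = 1"
   using MA_em[OF sets.top] pA sets.sets_into_space[OF AM] by (simp add: Int_absorb2)
  then interpret MA: prob_space MA by (rule prob_spaceI)
  have [measurable]: "?X \<in> borel_measurable MA" by (simp add: measurable_def)
  let ?D1 = "distr MA borel ?X" and ?D2 = "distr \<N> borel (%x. sqrt (var s t) * x)"
  have "?D1 = ?D2"
  proof (rule trig_moments_unique)
   show "real_distribution ?D1" by (rule MA.real_distribution_distr) simp
   show "real_distribution ?D2" by (rule gauss.real_distribution_distr) simp
   fix f :: "real => real" and v :: real assume f: "f = sin \<or> f = cos"
   have [measurable]: "f \<in> borel_measurable borel"
    by (rule borel_measurable_continuous_onI) (use f in \<open>auto intro: continuous_intros\<close>)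
   have "(\<integral>x. f (v * x) \<partial>?D1) = (LINT w|MA. f (v * ?X w))" by (rule integral_distr) measurable
   also have "... = (LINT w|M. f (v * ?X w) * indicator A w)/prob A" by (rule MA_int) measurable
   also have "... = (LINT x|\<N>. f (v * (sqrt (var s t) * x)))"
    unfolding trig_increment[OF s st A f] using pA by simp
   also have "... = (\<integral>x. f (v * x) \<partial>?D2)" by (rule integral_distr[symmetric]) measurable
   finally show "(\<integral>x. f (v * x) \<partial>?D1) = (\<integral>x. f (v * x) \<partial>?D2)" .
  qed
  hence "emeasure ?D1 C = emeasure ?D2 C" by simp
  hence "emeasure MA (?X -` C \<inter> space M) = emeasure \<N> ((%x. sqrt (var s t) * x) -` C \<inter> UNIV)"
   by (simp add: emeasure_distr)
  moreover have "?X -` C \<inter> space M = {w\<in>space M. ?X w \<in> C}" by auto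
  ultimately have "ennreal (prob (A \<inter> {w\<in>space M. ?X w \<in> C})/prob A) = ennreal (measure \<N> {x. sqrt (var s t) * x \<in> C})"
   using MA_em[OF XC] by (simp add: gauss.emeasure_eq_measure vimage_def)
  hence "prob (A \<inter> {w\<in>space M. ?X w \<in> C})/prob A = measure \<N> {x. sqrt (var s t) * x \<in> C}"
   by (subst (asm) ennreal_inj) simp_all
  thus ?thesis using pA by (simp add: field_simps)
 qed
qed

end

section \<open>Time change\<close>

text \<open>The normal distribution function is continuous and strictly increasing with values
  strictly between 0 and 1, so its value at a normal variable is uniform. The rest is the Galois
  relation between quantile and distribution function.\<close>

lemma quantile_law:
 assumes \<nu>: "real_distribution \<nu>" and g: "g_fun \<nu> \<in> borel_measurable borel"
 shows "distr \<N> borel (g_fun \<nu>) = \<nu>"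
proof -
 interpret nu: cdf_distribution \<nu> unfolding cdf_distribution_def by (rule \<nu>)
 interpret N: real_distribution \<N> by unfold_locales simp_all
 define \<Phi> where "\<Phi> = cdf \<N>"
 have pos: "0 < measure \<N> S" if S: "S \<in> sets borel" "emeasure lborel S \<noteq> 0" for S
 proof -
  have "emeasure \<N> S \<noteq> 0"
  proof
   assume "emeasure \<N> S = 0"
   hence "S \<in> null_sets (density lborel (%x. ennreal (std_normal_density x)))" using S(1) by (auto intro: null_setsI)
   hence "AE x in lborel. x \<in> S --> ennreal (std_normal_density x) = 0" by (simp add: null_sets_density_iff)
   hence "AE x in lborel. x \<notin> S"
   proof eventually_elim
    case (elim x)
    have "0 < std_normal_density x" by (simp add: normal_density_pos)
    thus ?case using elim by (simp add: ennreal_eq_0_iff)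
   qed
   hence "S \<in> null_sets lborel" using S(1) by (simp add: AE_iff_null_sets)
   thus False using S(2) by auto
  qed
  thus ?thesis by (simp add: gauss.emeasure_eq_measure zero_less_measure_iff)
 qed
 have \<Phi>_mono: "\<Phi> a < \<Phi> b" if "a < b" for a b
 proof -
  have "0 < measure \<N> {a<..b}" by (rule pos) (use that in auto)
  thus ?thesis unfolding \<Phi>_def by (simp add: N.cdf_diff_eq[OF that, symmetric])
 qed
 have \<Phi>01: "0 < \<Phi> z" "\<Phi> z < 1" for z
 proof -
  show "0 < \<Phi> z" using \<Phi>_mono[of "z - 1" z] N.cdf_nonneg[of "z - 1"] by (simp add: \<Phi>_def)
  show "\<Phi> z < 1" using \<Phi>_mono[of z "z + 1"] N.cdf_bounded_prob[of "z + 1"] by (simp add: \<Phi>_def)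
 qed
 have \<Phi>_cont: "isCont \<Phi> z" for z
  unfolding \<Phi>_def N.isCont_cdf by (simp add: gauss.emeasure_eq_measure[symmetric] measure_def emeasure_density)
 have uniform: "measure \<N> {z. \<Phi> z <= p} = p" if p: "0 <= p" "p <= 1" for p
 proof -
  consider "p = 0" | "p = 1" | "0 < p" "p < 1" using p by force
  thus ?thesis
  proof cases
   case 1
   hence "{z. \<Phi> z <= p} = {}" using \<Phi>01(1) by (auto simp: not_le)
   thus ?thesis using 1 by simp
  next
   case 2
   hence "{z. \<Phi> z <= p} = UNIV" using \<Phi>01(2) by (auto simp: less_imp_le)
   thus ?thesis using 2 gauss.prob_space by simp
  next
   case 3
   obtain a where a: "\<Phi> a < p"
    using order_tendstoD(2)[OF N.cdf_lim_at_bot 3(1)] eventually_happens'[OF trivial_limit_at_bot_linorder] unfolding \<Phi>_def by blast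
   obtain b where b: "p < \<Phi> b"
    using order_tendstoD(1)[OF N.cdf_lim_at_top_prob 3(2)] eventually_happens'[OF trivial_limit_at_top_linorder] unfolding \<Phi>_def by blast
   have "a <= b" using a b \<Phi>_mono[of b a] by (cases "a <= b") auto
   then obtain z where z: "\<Phi> z = p" using IVT[of \<Phi> a p b] a b \<Phi>_cont by (auto simp: less_imp_le)
   have "{y. \<Phi> y <= p} = {..z}"
   proof (rule set_eqI)
    fix y show "y \<in> {y. \<Phi> y <= p} \<longleftrightarrow> y \<in> {..z}"
     unfolding z[symmetric] using \<Phi>_mono[of y z] \<Phi>_mono[of z y] by (cases y z rule: linorder_cases) auto
   qed
   thus ?thesis using z by (simp add: \<Phi>_def cdf_def)
  qed
 qed
 show ?thesis
 proof (rule cdf_unique[OF _ \<nu>])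
  show "real_distribution (distr \<N> borel (g_fun \<nu>))"
   by (rule gauss.real_distribution_distr) (use g in simp)
  show "cdf (distr \<N> borel (g_fun \<nu>)) = cdf \<nu>"
  proof
   fix x
   have "g_fun \<nu> z <= x \<longleftrightarrow> \<Phi> z <= cdf \<nu> x" for z
    using nu.pseudoinverse[OF \<Phi>01[of z], of x] by (simp add: g_fun_def quantile_def \<Phi>_def)
   hence "g_fun \<nu> -` {..x} \<inter> UNIV = {z. \<Phi> z <= cdf \<nu> x}" by auto
   hence "cdf (distr \<N> borel (g_fun \<nu>)) x = measure \<N> {z. \<Phi> z <= cdf \<nu> x}"
    unfolding cdf_def using g by (subst measure_distr) simp_all
   thus "cdf (distr \<N> borel (g_fun \<nu>)) x = cdf \<nu> x"
    using uniform nu.cdf_nonneg nu.cdf_bounded_prob by simp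
  qed
 qed
qed

text \<open>Being nonconstant, \<open>g\<close> has a point with nonzero derivative; it is positive
  by monotonicity and stays above half its value nearby by continuity. The integral form of the
  conclusion is the one that the scheme propagates.\<close>

lemma increasing_slope:
 fixes g g' :: "real => real"
 assumes deriv: "!!x. (g has_real_derivative g' x) (at x)" and cont: "continuous_on UNIV g'"
  and mono: "mono g" and nonconst: "\<not> (\<exists>a. \<forall>x. g x = a)"
 obtains \<kappa> u v where "0 < \<kappa>" "u < v"
  "!!x x'. x <= x' ==> (\<integral>\<^sup>+t\<in>{x..x'}. ennreal (\<kappa> * indicator {u..v} t) \<partial>lborel) <= ennreal (g x' - g x)"
proof -
 have "\<exists>x. g' x \<noteq> 0"
 proof (rule ccontr)
  assume "\<not> ?thesis"
  hence "DERIV g x :> 0" for x using deriv[of x] by simp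
  hence "g x = g 0" for x using DERIV_isconst_all by blast
  thus False using nonconst by blast
 qed
 then obtain u where u: "g' u \<noteq> 0" by blast
 have "0 <= g' u" by (rule mono_on_imp_deriv_nonneg[of UNIV g, OF _ deriv]) (use mono in \<open>auto simp: mono_on_def mono_def\<close>)
 hence u0: "0 < g' u" using u by simp
 define \<kappa> where "\<kappa> = g' u/2"
 have \<kappa>: "0 < \<kappa>" "\<kappa> < g' u" using u0 by (auto simp: \<kappa>_def)
 have "isCont g' u" using cont by (simp add: continuous_on_eq_continuous_at)
 hence "eventually (%x. \<kappa> < g' x) (at u)" using \<kappa>(2) by (intro order_tendstoD(1)) (auto simp: isCont_def)
 then obtain d where d: "0 < d" "!!x. x \<noteq> u ==> dist x u < d ==> \<kappa> < g' x"
  unfolding eventually_at by blast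
 define v where "v = u + d/2"
 have big: "\<kappa> <= g' x" if "x \<in> {u..v}" for x
  using d(2)[of x] \<kappa>(2) that d(1) by (cases "x = u") (auto simp: v_def dist_real_def)
 have slope: "(\<integral>\<^sup>+t\<in>{x..x'}. ennreal (\<kappa> * indicator {u..v} t) \<partial>lborel) <= ennreal (g x' - g x)" if "x <= x'" for x x'
 proof -
  define a b where "a = max x u" and "b = min x' v"
  have "(\<integral>\<^sup>+t\<in>{x..x'}. ennreal (\<kappa> * indicator {u..v} t) \<partial>lborel) = (nn_integral lborel (%t. ennreal \<kappa> * indicator {a..b} t))"
   by (rule nn_integral_cong) (auto simp: indicator_def a_def b_def)
  also have "... = ennreal \<kappa> * emeasure lborel {a..b}" by (rule nn_integral_cmult_indicator) simp
  also have "... <= ennreal (g x' - g x)"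
  proof (cases "a < b")
   case True
   obtain z where z: "a < z" "z < b" "g b - g a = (b - a) * g' z" using MVT2[OF True, of g g'] deriv by blast
   have "\<kappa> <= g' z" by (rule big) (use z in \<open>auto simp: a_def b_def\<close>)
   hence "\<kappa> * (b - a) <= g b - g a" using True z(3) by (simp add: mult.commute)
   also have "... <= g x' - g x"
    using monoD[OF mono, of x a] monoD[OF mono, of b x'] by (simp add: a_def b_def)
   finally show ?thesis using True \<kappa>(1) by (simp add: ennreal_mult[symmetric] ennreal_leI)
  next
   case False
   hence "emeasure lborel {a..b} = 0" by (cases "a = b") auto
   thus ?thesis by simp
  qed
  finally show ?thesis .
 qed
 show ?thesis by (rule that[OF \<kappa>(1) _ slope]) (use d(1) in \<open>simp add: v_def\<close>)
qed

lemma distr_completion_AE: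
 assumes Y: "Y \<in> borel_measurable M" and eq: "AE w in M. X w = Y w"
 shows "distr (completion M) borel X = distr M borel Y"
proof -
 have X: "X \<in> borel_measurable (completion M)"
 proof (rule measurableI)
  fix A :: "'b set" assume A: "A \<in> sets borel"
  obtain Z where Z: "Z \<in> null_sets M" "{w\<in>space M. X w \<noteq> Y w} \<subseteq> Z" using eq by (auto elim!: AE_E simp: null_sets_def)
  have "X -` A \<inter> space M = (Y -` A \<inter> space M - Z) \<union> (X -` A \<inter> space M \<inter> Z)" using Z(2) by auto
  moreover have "Y -` A \<inter> space M - Z \<in> sets (completion M)" using measurable_sets[OF Y A] Z(1) by auto
  moreover have "X -` A \<inter> space M \<inter> Z \<in> sets (completion M)"
   using null_sets_completion[of _ M, OF Z(1)] by auto
  ultimately have "X -` A \<inter> space M \<in> sets (completion M)" by (metis sets.Un)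
  thus "X -` A \<inter> space (completion M) \<in> sets (completion M)" by simp
 qed simp
 have "distr (completion M) borel X = distr (completion M) borel Y"
  by (rule distr_cong_AE[OF refl refl AE_completion[OF eq] X measurable_completion[OF Y]])
 thus ?thesis by (simp add: distr_completion[OF Y])
qed

text \<open>The time change: \<open>T\<close> is the inverse of the quadratic variation \<open>H\<close> of the integral.\<close>

locale elliptic_integral = wiener_integral +
 fixes b0 :: real
 assumes b0: "0 < b0" and elliptic: "!!s. 0 <= s ==> b0 <= \<bar>\<beta> s\<bar>"
begin

abbreviation "H \<equiv> H_fun \<beta>"

definition "T = inv_into {0..} H"

lemma \<beta>_set_integrable: "0 <= t ==> set_integrable lborel {0..t} (%s. (\<beta> s)^2)"
 unfolding set_integrable_def
proof (rule integrableI_nonneg)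
 assume "0 <= t"
 have "(nn_integral lborel (%x. ennreal (indicator {0..t} x *\<^sub>R (\<beta> x)\<^sup>2))) = (\<integral>\<^sup>+x\<in>{0..t}. ennreal ((\<beta> x)^2) \<partial>lborel)"
  by (rule nn_integral_cong) (simp add: indicator_def)
 thus "(nn_integral lborel (%x. ennreal (indicator {0..t} x *\<^sub>R (\<beta> x)\<^sup>2))) < \<infinity>" using \<beta>_square[OF \<open>0 <= t\<close>] by simp
qed (simp_all add: indicator_def)

lemma H_0: "H 0 = 0"
proof -
 have "(LBINT s:{0..0}. (\<beta> s)^2) = 0"
  unfolding set_lebesgue_integral_def
 proof (rule integral_eq_zero_AE)
  show "AE s in lborel. indicat_real {0..0} s *\<^sub>R (\<beta> s)\<^sup>2 = 0"
   using AE_lborel_singleton[of 0] by eventually_elim (simp add: indicator_def)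
 qed
 thus ?thesis by (simp add: H_fun_def)
qed

lemma H_diff:
 assumes "0 <= s" "s <= t"
 shows "H t - H s = var s t"
proof -
 have t: "0 <= t" using assms by simp
 note i = \<beta>_set_integrable[OF assms(1)] \<beta>_set_integrable[OF t]
 have "H t - H s = (LINT x|lborel. indicator {0..t} x *\<^sub>R (\<beta> x)\<^sup>2 - indicator {0..s} x *\<^sub>R (\<beta> x)\<^sup>2)"
  unfolding H_fun_def set_lebesgue_integral_def using i unfolding set_integrable_def
  by (intro Bochner_Integration.integral_diff[symmetric])
 also have "... = var s t"
  unfolding var_def by (rule Bochner_Integration.integral_cong[OF refl]) (use assms in \<open>auto simp: indicator_def\<close>)
 finally show ?thesis .
qed

lemma var_lower:
 assumes "0 <= s" "s <= t"
 shows "b0\<^sup>2 * (t - s) <= var s t"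
proof -
 have "(LINT x|lborel. b0\<^sup>2 * indicator {s<..t} x) <= var s t"
  unfolding var_def
 proof (rule integral_mono)
  show "integrable lborel (%x. b0\<^sup>2 * indicator {s<..t} x)" using assms by (intro integrable_mult_right integrable_real_indicator) auto
  show "integrable lborel (%x. (indicator {s<..t} x * \<beta> x)^2)" by (rule \<beta>_integrable[OF assms(1)])
  fix x :: real
  show "b0\<^sup>2 * indicator {s<..t} x <= (indicator {s<..t} x * \<beta> x)\<^sup>2"
  proof (cases "x \<in> {s<..t}")
   case True
   have "b0\<^sup>2 <= \<bar>\<beta> x\<bar>\<^sup>2" by (rule power_mono[OF elliptic]) (use True assms b0 in auto)
   thus ?thesis using True by simp
  qed simp
 qed
 thus ?thesis using assms by simp
qed

lemma H_strict: "0 <= s ==> s < t ==> H s < H t"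
proof -
 assume st: "0 <= s" "s < t"
 have "0 < b0\<^sup>2 * (t - s)" using b0 st by simp
 thus ?thesis using H_diff[of s t] var_lower[of s t] st by simp
qed

lemma H_surj:
 assumes "0 <= y"
 shows "\<exists>t\<ge>0. H t = y"
proof -
 define t where "t = y/b0\<^sup>2"
 have t: "0 <= t" using assms b0 by (simp add: t_def)
 have "y <= H t" using var_lower[OF order_refl t] H_diff[OF order_refl t] H_0 b0 by (simp add: t_def)
 moreover have "continuous_on {0..t} H"
 proof -
  have c: "continuous_on {0..t} (%x. integral {0..x} (%s. (\<beta> s)^2))"
   by (rule indefinite_integral_continuous_1[OF set_borel_integral_eq_integral(1)[OF \<beta>_set_integrable[OF t]]])
  have "integral {0..x} (%s. (\<beta> s)^2) = H x" if "x \<in> {0..t}" for x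
   unfolding H_fun_def by (rule set_borel_integral_eq_integral(2)[OF \<beta>_set_integrable, symmetric]) (use that in simp)
  thus ?thesis by (rule continuous_on_eq[OF c])
 qed
 ultimately show ?thesis using IVT'[of H 0 y t] assms t H_0 by auto
qed

lemma T: "0 <= y ==> 0 <= T y" "0 <= y ==> H (T y) = y"
proof -
 assume "0 <= y"
 hence "y \<in> H ` {0..}" using H_surj by force
 thus "0 <= T y" "H (T y) = y" unfolding T_def using inv_into_into[of y H "{0..}"] f_inv_into_f[of y H "{0..}"] by auto
qed

lemma T_le_iff: "0 <= y ==> 0 <= t ==> T y <= t \<longleftrightarrow> y <= H t"
 using T[of y] H_strict[of "T y" t] H_strict[of t "T y"] by (cases "T y" t rule: linorder_cases) auto

lemma T_H: "0 <= t ==> T (H t) = t"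
proof -
 assume t: "0 <= t"
 have "0 <= H t" using H_strict[of 0 t] H_0 t by (cases "t = 0") auto
 thus ?thesis using T[of "H t"] H_strict[of t "T (H t)"] H_strict[of "T (H t)" t] t by (cases "T (H t)" t rule: linorder_cases) auto
qed

lemma H_nonneg: "0 <= t ==> 0 <= H t"
 using H_strict[of 0 t] H_0 by (cases "t = 0") auto

lemma T_mono: "0 <= x ==> x <= y ==> T x <= T y"
 using T_le_iff[of x "T y"] T[of y] by simp

lemma T_0: "T 0 = 0"
 using T_H[of 0] H_0 by simp

lemma T_lipschitz:
 assumes "0 <= x" "x <= y"
 shows "T y - T x <= (y - x)/b0\<^sup>2"
proof -
 have y: "0 <= y" using assms by simp
 have "b0\<^sup>2 * (T y - T x) <= y - x"
  using var_lower[OF T(1)[OF assms(1)] T_mono[OF assms]] H_diff[OF T(1)[OF assms(1)] T_mono[OF assms]] T(2)[OF assms(1)] T(2)[OF y] by simp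
 thus ?thesis using b0 by (simp add: le_divide_eq mult.commute)
qed

lemma T_continuous: "continuous_on {0..} T"
proof (rule lipschitz_on_continuous_on[where L="1/b0\<^sup>2"], rule lipschitz_onI)
 fix x y :: real assume xy: "x \<in> {0..}" "y \<in> {0..}"
 show "dist (T x) (T y) <= 1/b0\<^sup>2 * dist x y"
 proof (cases "x <= y")
  case True
  thus ?thesis using T_lipschitz[of x y] T_mono[of x y] xy by (simp add: dist_real_def abs_if)
 next
  case False
  thus ?thesis using T_lipschitz[of y x] T_mono[of y x] xy by (simp add: dist_real_def abs_if)
 qed
qed simp

text \<open>\<open>H (T y) = y\<close> makes the variance between \<open>T s\<close> and
  \<open>T t\<close> equal to \<open>t - s\<close>. Ellipticity makes \<open>T\<close> Lipschitz, so
  continuous paths stay continuous.\<close>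

lemma time_changed: "filtered_bm M (%t. F (T t)) (%t. I (T t))"
proof
 fix t :: real assume t: "0 <= t"
 show "subalgebra M (F (T t))" "null_sets M \<subseteq> sets (F (T t))" "I (T t) \<in> borel_measurable (F (T t))"
  by (rule subalgebra_F null_F I_adapted; rule T(1)[OF t])+
next
 fix s t :: real assume "0 <= s" "s <= t"
 thus "sets (F (T s)) \<subseteq> sets (F (T t))" by (intro F_mono T T_mono)
next
 fix s t E C assume *: "0 <= s" "s < t" "E \<in> sets (F (T s))" "C \<in> sets (borel :: real measure)"
 have le: "0 <= T s" "T s <= T t" "0 <= t" using * by (auto intro: T T_mono)
 have "var (T s) (T t) = t - s" using H_diff[OF le(1,2)] T(2)[OF *(1)] T(2)[OF le(3)] by simp
 thus "prob (E \<inter> {w\<in>space M. I (T t) w - I (T s) w \<in> C}) = prob E * measure \<N> {x. sqrt (t - s) * x \<in> C}"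
  using integral_increment[OF le(1,2) *(3,4)] by simp
next
 show "AE w in M. I (T 0) w = 0" using I_start by (simp add: T_0)
 have "AE w in M. continuous_on {0..} (%t. I t w)" using integral unfolding stochastic_integral_def by blast
 thus "AE w in M. continuous_on {0..} (%t. I (T t) w)"
  by eventually_elim (rule continuous_on_compose2[OF _ T_continuous], assumption, use T(1) in auto)
qed

end

theorem corollary4p11:
  fixes M :: "'a measure" and W I G :: "real \<Rightarrow> 'a \<Rightarrow> real"
    and G0 :: real and \<alpha> \<beta> :: "real \<Rightarrow> real" and \<nu> :: "real measure"
  assumes "brownian_motion M W"
    and "\<alpha> \<in> borel_measurable (restrict_space borel {0..})"
    and "\<beta> \<in> borel_measurable (restrict_space borel {0..})"
    and "\<And>t. 0 \<le> t \<Longrightarrow> (\<integral>\<^sup>+ s \<in> {0..t}. ennreal \<bar>\<alpha> s\<bar> \<partial>lborel)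
                       + (\<integral>\<^sup>+ s \<in> {0..t}. ennreal ((\<beta> s)\<^sup>2) \<partial>lborel) < \<infinity>"
    and "(INF s\<in>{0..}. \<bar>\<beta> s\<bar>) > 0"
    and "stochastic_integral M W \<beta> I"
    and "\<And>t \<omega>. 0 \<le> t \<Longrightarrow> \<omega> \<in> space M \<Longrightarrow> G t \<omega> = G0 + (LBINT s:{0..t}. \<alpha> s) + I t \<omega>"
    and "real_distribution \<nu>"
    and "lipschitz_upto_second_deriv UNIV (g_fun \<nu>)"
    and "lipschitz_upto_second_deriv {0..} (delta_fun G0 \<alpha> \<beta>)"
    and "mono (g_fun \<nu>)"
    and "\<not> (\<exists>a. \<forall>x. g_fun \<nu> x = a)"
  shows "\<exists>\<tau> :: 'a \<Rightarrow> real. \<exists>K c :: real.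
           stopping_time (brownian_filtration M W) \<tau> \<and>
           (\<forall>\<omega>\<in>space M. 0 \<le> \<tau> \<omega> \<and> \<tau> \<omega> \<le> K) \<and>
           has_law M (\<lambda>\<omega>. c + G (\<tau> \<omega>) \<omega>) \<nu>"
proof -
 interpret bm: brownian_motion M W by (rule assms(1))
 interpret W: filtered_bm M "brownian_filtration M W" W by (rule bm.W_filtered)
 \<comment> \<open>Extension by zero gives a Borel function on the whole line; all integrals
   involved see nonnegative times only.\<close>
 define \<beta>' where "\<beta>' s = indicator {0..} s * \<beta> s" for s
 have \<beta>': "\<beta>' s = \<beta> s" if "0 <= s" for s using that by (simp add: \<beta>'_def)
 have [measurable]: "\<beta>' \<in> borel_measurable borel"
  using assms(3) by (simp add: borel_measurable_restrict_space_iff \<beta>'_def[abs_def])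
 define b0 where "b0 = (INF s\<in>{0..}. \<bar>\<beta> s\<bar>)"
 have b0: "0 < b0" using assms(5) by (simp add: b0_def)
 have b0_le: "b0 <= \<bar>\<beta> s\<bar>" if "0 <= s" for s
  unfolding b0_def by (rule cINF_lower) (use that in \<open>auto intro!: bdd_belowI2[where m=0]\<close>)
 have square: "(\<integral>\<^sup>+s\<in>{0..t}. ennreal ((\<beta>' s)^2) \<partial>lborel) < \<infinity>" if "0 <= t" for t
 proof -
  have "(\<integral>\<^sup>+s\<in>{0..t}. ennreal ((\<beta>' s)^2) \<partial>lborel) = (\<integral>\<^sup>+s\<in>{0..t}. ennreal ((\<beta> s)^2) \<partial>lborel)"
   by (rule nn_integral_cong) (simp add: indicator_def \<beta>')
  also have "... <= (\<integral>\<^sup>+s\<in>{0..t}. ennreal \<bar>\<alpha> s\<bar> \<partial>lborel) + (\<integral>\<^sup>+s\<in>{0..t}. ennreal ((\<beta> s)^2) \<partial>lborel)" by simp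
  also have "... < \<infinity>" by (rule assms(4)[OF that])
  finally show ?thesis .
 qed
 have si: "stochastic_integral M W \<beta>' I"
 proof -
  have "(\<integral>\<^sup>+s\<in>{0..t}. ennreal ((step_fun n p c s - \<beta>' s)^2) \<partial>lborel) = (\<integral>\<^sup>+s\<in>{0..t}. ennreal ((step_fun n p c s - \<beta> s)^2) \<partial>lborel)" for n p c t
   by (rule nn_integral_cong) (simp add: indicator_def \<beta>')
  thus ?thesis using assms(6) unfolding stochastic_integral_def by simp
 qed
 interpret E: elliptic_integral M "brownian_filtration M W" W \<beta>' I b0
  by unfold_locales (use square si b0 b0_le \<beta>' in simp_all)
 interpret B: filtered_bm M "%t. brownian_filtration M W (E.T t)" "%t. I (E.T t)" by (rule E.time_changed)
 have H_eq: "H_fun \<beta>' = H_fun \<beta>"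
  unfolding H_fun_def set_lebesgue_integral_def
  by (intro ext Bochner_Integration.integral_cong refl) (simp add: indicator_def \<beta>')
 have delta_T: "delta_fun G0 \<alpha> \<beta> y = G0 + (LBINT s:{0..E.T y}. \<alpha> s)" for y
  by (simp add: delta_fun_def delta_hat_def E.T_def H_eq)
 obtain g' g'' Lg where g': "!!x. (g_fun \<nu> has_real_derivative g' x) (at x)" "!!x. (g' has_real_derivative g'' x) (at x)"
  and Lg: "Lg-lipschitz_on UNIV (g_fun \<nu>)"
  using assms(9) unfolding lipschitz_upto_second_deriv_def by auto
 obtain L\<delta> where L\<delta>: "L\<delta>-lipschitz_on {0..} (delta_fun G0 \<alpha> \<beta>)"
  using assms(10) unfolding lipschitz_upto_second_deriv_def by auto
 have "continuous_on UNIV g'"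
  using DERIV_isCont[OF g'(2)] by (simp add: continuous_at_imp_continuous_on)
 from increasing_slope[OF g'(1) this assms(11,12)]
 obtain \<kappa> u v where slope: "0 < \<kappa>" "u < v"
  "!!x x'. x <= x' ==> (\<integral>\<^sup>+t\<in>{x..x'}. ennreal (\<kappa> * indicator {u..v} t) \<partial>lborel) <= ennreal (g_fun \<nu> x' - g_fun \<nu> x)"
  by blast
 \<comment> \<open>Extended to negative times by its value at 0; \<open>max 0\<close> is a
   contraction, so the Lipschitz constant is kept.\<close>
 define \<delta> where "\<delta> y = delta_fun G0 \<alpha> \<beta> (max 0 y)" for y
 \<comment> \<open>A Lipschitz constant may be 0, whereas the embedding is stated for positive
   constants; hence the maximum with 1, here and for \<delta>.\<close>
 have g_lip: "\<bar>g_fun \<nu> x - g_fun \<nu> x'\<bar> <= max 1 Lg * \<bar>x - x'\<bar>" for x x'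
 proof -
  have "\<bar>g_fun \<nu> x - g_fun \<nu> x'\<bar> <= Lg * \<bar>x - x'\<bar>" using lipschitz_onD[OF Lg, of x x'] by (simp add: dist_real_def)
  also have "... <= max 1 Lg * \<bar>x - x'\<bar>" by (rule mult_right_mono) simp_all
  finally show ?thesis .
 qed
 have \<delta>_lip: "\<bar>\<delta> y - \<delta> y'\<bar> <= max 1 L\<delta> * \<bar>y - y'\<bar>" for y y'
 proof -
  have "\<bar>\<delta> y - \<delta> y'\<bar> <= L\<delta> * \<bar>max 0 y - max 0 y'\<bar>"
   using lipschitz_onD[OF L\<delta>, of "max 0 y" "max 0 y'"] by (simp add: dist_real_def \<delta>_def)
  also have "... <= max 1 L\<delta> * \<bar>y - y'\<bar>"
   by (rule mult_mono) auto
  finally show ?thesis .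
 qed
 obtain \<tau> Y K c where stop: "!!t. 0 <= t ==> {w\<in>space M. \<tau> w <= t} \<in> sets (brownian_filtration M W (E.T t))"
  and \<tau>: "!!w. 0 <= \<tau> w" "!!w. \<tau> w <= K" and Y: "Y \<in> borel_measurable M"
  and Y_eq: "AE w in M. Y w = c + (\<delta> (\<tau> w) + I (E.T (\<tau> w)) w)"
  and Y_law: "distr M borel Y = distr \<N> borel (g_fun \<nu>)"
  by (rule B.exact_embedding[OF _ _ g_lip \<delta>_lip assms(11) slope]) auto
 define S where "S w = E.T (\<tau> w)" for w
 have S: "0 <= S w" "S w <= E.T K" for w
  unfolding S_def using \<tau> by (auto intro: E.T E.T_mono)
 have "stopping_time (brownian_filtration M W) S"
  unfolding stopping_time_def pred_def
 proof
  fix t :: real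
  show "{w \<in> space (brownian_filtration M W t). S w <= t} \<in> sets (brownian_filtration M W t)"
  proof (cases "0 <= t")
   case True
   \<comment> \<open>The time change is undone: \<open>T (\<tau> w) <= t\<close> amounts to
     \<open>\<tau> w <= H t\<close>, an event known at \<open>T (H t) = t\<close>.\<close>
   have "{w \<in> space (brownian_filtration M W t). S w <= t} = {w \<in> space M. \<tau> w <= H_fun \<beta>' t}"
    unfolding S_def using E.T_le_iff[OF \<tau>(1) True] by simp
   thus ?thesis using stop[OF E.H_nonneg[OF True]] by (simp add: E.T_H[OF True])
  next
   case False
   hence "S w <= t \<longleftrightarrow> False" for w using S(1)[of w] by (auto dest: order_trans)
   thus ?thesis by simp
  qed
 qed
 moreover have "has_law M (%w. c + G (S w) w) \<nu>"
 proof -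
  have "AE w in M. c + G (S w) w = Y w"
   using Y_eq AE_space[of M]
  proof eventually_elim
   case (elim w)
   have "G (S w) w = \<delta> (\<tau> w) + I (E.T (\<tau> w)) w"
    using assms(7)[OF S(1) elim(2)] \<tau>(1)[of w] by (simp add: \<delta>_def delta_T S_def)
   thus ?case using elim(1) by simp
  qed
  from distr_completion_AE[OF Y this] show ?thesis
   unfolding has_law_def Y_law
   using quantile_law[OF assms(8) borel_measurable_mono[OF assms(11)]] by simp
 qed
 ultimately show ?thesis using S by blast
qed

end
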